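(* Let $\nu_0$ be a probability measure on $\mathbb{R}$, let $R$ have distribution $\nu_0$, and let $(N,C,A_1,A_2,\ldots)$ be a random vector with values in $\{0,1,2,\ldots\}\times\mathbb{R}\times(0,\infty)^{\mathbb{N}}$ such that (i) $\int_{1-\varepsilon}^1 \frac{\mathrm{d}s}{s-\mathbb{E}[s^N]}=\infty$ for all sufficiently small $\varepsilon>0$; (ii) $\mathbb{P}[A_1>0,\ldots,A_m>0\mid N=m]=1$ for every $m\in\mathbb{N}$; (iii) for some $m$ with $\mathbb{P}[N=m]>0$ one has $\mathbb{P}[A_1=1,\ldots,A_m=1\mid N=m]<1$; (iv) $\mathbb{E}[N]\in(1,\infty]$. With the notation of the context ($W_t$, $\Phi$, $\mu$, $\mathcal{D}$, $M_\infty(1)$, $C_\infty$), let $\phi_t(\xi)=\mathbb{E}[e^{i\xi W_t}]$. Then, as $t\to\infty$ and for every $\xi\in\mathbb{R}$: 1. If $\mathbb{E}[C]\ne0$, $\mathbb{E}|C|^p<\infty$ for some $p>1$, $1\in\mathrm{int}(\mathcal{D})$, $\mu'(1)<0$, $\Phi(1)>0$, and further $\mathbb{E}[R]=0$ and $\mathbb{E}[|R|^{1+\delta}]<\infty$ for some $\delta>0$, then $$e^{-\mu(1)t}W_t\overset{\mathbb{P}}{\to}\frac{\mathbb{E}[C]}{\Phi(1)}M_\infty(1)\quad\text{and}\quad\phi_t(e^{-\mu(1)t}\xi)\to\mathbb{E}\exp\big(i\xi\,\mathbb{E}[C]\,M_\infty(1)/\Phi(1)\big).$$ 2. If $\mathbb{E}[C]\ne0$,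 $\mathbb{E}|C|^p<\infty$ for some $p>1$, $1\in\mathrm{int}(\mathcal{D})$, $\mu'(1)<0$, $\Phi(1)=0$, and further either (b) $\lim_{x\to+\infty}x\nu_0(x,+\infty)=\lim_{x\to-\infty}|x|\nu_0(-\infty,x)=c_0\in(0,\infty)$ and $\lim_{T\to+\infty}\int_{[-T,T]}x\,\nu_0(\mathrm{d}x)=m_0\in(-\infty,\infty)$, or $\mathbb{E}[R]=0$ and $\mathbb{E}[|R|^{1+\delta}]<\infty$ for some $\delta>0$, then $$\frac1tW_t\overset{\mathbb{P}}{\to}\mathbb{E}[C]\,M_\infty(1)\quad\text{and}\quad\phi_t(t^{-1}\xi)\to\mathbb{E}\exp\big(i\xi\,\mathbb{E}[C]\,M_\infty(1)\big).$$ 3. If $\mathbb{E}[C]\ne0$, $\mathbb{E}|C|^p<\infty$ for some $p>1$, $1\in\mathrm{int}(\mathcal{D})$, $\mu'(1)<0$, $\Phi(1)<0$, and further there exists $\gamma\in(0,1)$ such that $\Phi(\gamma)<0$ and $\mathbb{E}[|R|^\gamma]<\infty$, then $$W_t\overset{\mathbb{P}}{\to}C_\infty\quad\text{and}\quad\phi_t(\xi)\to\mathbb{E}\exp(i\xi C_\infty).$$ 4. If $\mathbb{E}[C]=0$, $\mu'(1)<0$, for some $p\in(1,2]$ both $\mathbb{E}[|C|^p]<\infty$ and $\Phi(p)<0$, and further there exists $\gamma\in(0,p)$ such that $\Phi(\gamma)<0$, $\mathbb{E}|R|^\gamma<\infty$, and $\mathbb{E}[R]=0$ if $\gamma>1$,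 then $$W_t\overset{\mathbb{P}}{\to}C_\infty\quad\text{and}\quad\phi_t(\xi)\to\mathbb{E}\exp(i\xi C_\infty).$$
   Context: Notation: $\Phi(s)=\mathbb{E}\big[\sum_{k=1}^N A_k^s\big]-1$ for $s\ge0$; $\mathcal{D}=\{s>0:\mathbb{E}[\sum_{k=1}^N A_k^s]<\infty\}$; $\mu(s)=\Phi(s)/s$ for $s\in\mathcal{D}$. Writing $\mu'(s)<0$ presupposes that $s\in\mathcal{D}$ and that this derivative exists. $\overset{\mathbb{P}}{\to}$ is convergence in probability. Marked continuous-time branching random walk. Let $E$ be a unit mean exponential random variable such that $E$, $R$ and $(N,C,A_1,A_2,\ldots)$ are independent. Let $\bigcup_{n\ge0}\mathbb{N}^n$ ($\mathbb{N}^0=\{\varnothing\}$) be the set of Ulam-Harris labels and equip the vertices $x$ with independent copies $(E(x),R(x),N(x),C(x),A_1(x),A_2(x),\ldots)$ of $(E,R,N,C,A_1,A_2,\ldots)$. The full Galton-Watson tree $\mathcal{T}_\infty$ contains $\varnothing$, and for each $x\in\mathcal{T}_\infty$ the children of $x$ in $\mathcal{T}_\infty$ are $xi$, $1\le i\le N(x)$. Birth times $B$, death times $D$ and positions $V$ are defined by $B(\varnothing)=0$, $D(x)=B(x)+E(x)$, $B(xi)=D(x)$, $V(\varnothing)=0$, $V(xi)=V(x)+\log A_i(x)$. For $t\ge0$ let $\partial\mathcal{T}_t=\{x\in\mathcal{T}_\infty: B(x)\le t<D(x)\}$ and $\mathcal{T}_t^o=\{x\in\mathcal{T}_\infty: D(x)\le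 t\}$. Put $$W_t=\sum_{x\in\partial\mathcal{T}_t}e^{V(x)}R(x)+C_t,\qquad C_t=\sum_{x\in\mathcal{T}_t^o}e^{V(x)}C(x),\qquad M_t(\gamma)=e^{-\Phi(\gamma)t}\sum_{x\in\partial\mathcal{T}_t}e^{\gamma V(x)},\quad\gamma\in\mathcal{D}.$$ ($\phi_t$ is then the unique solution of $\partial_t\phi_t=\widehat{\mathcal{Q}}\phi_t-\phi_t$, $\widehat{\mathcal{Q}}\psi(\xi)=\mathbb{E}[e^{i\xi C}\prod_{k=1}^N\psi(A_k\xi)]$, with $\phi_0$ the characteristic function of $\nu_0$.) $(M_t(\gamma))_{t\ge0}$ is a nonnegative martingale and $M_\infty(\gamma)$ denotes its a.s. limit as $t\to\infty$. $C_\infty=\sum_{x\in\mathcal{T}_\infty}e^{V(x)}C(x)$, understood (when not absolutely convergent) as the limit in probability of $C_t$ as $t\to\infty$. *)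

theory Defs
  imports "HOL-Probability.Probability"
begin

text \<open>
  A mark is a tuple \<open>(E, R, N, C, (A\<^sub>1, A\<^sub>2, \<dots>))\<close>.  The weights are indexed from 0, so that
  \<open>A k\<close> stands for the mathematical \<open>A\<^sub>k\<^sub>+\<^sub>1\<close>, and \<open>A\<^sub>1, \<dots>, A\<^sub>N\<close> are the \<open>A k\<close> with \<open>k < N\<close>.
\<close>

type_synonym offspring = "nat \<times> real \<times> (nat \<Rightarrow> real)"
type_synonym mark = "real \<times> real \<times> offspring"

abbreviation vec_space :: "offspring measure" where
  "vec_space \<equiv> count_space UNIV \<Otimes>\<^sub>M borel \<Otimes>\<^sub>M (\<Pi>\<^sub>M k\<in>UNIV. borel)"

abbreviation mark_space :: "mark measure" where
  "mark_space \<equiv> borel \<Otimes>\<^sub>M borel \<Otimes>\<^sub>M vec_space"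

fun mE :: "mark \<Rightarrow> real" where "mE (e, r, n, c, a) = e"
fun mR :: "mark \<Rightarrow> real" where "mR (e, r, n, c, a) = r"
fun mN :: "mark \<Rightarrow> nat"  where "mN (e, r, n, c, a) = n"
fun mC :: "mark \<Rightarrow> real" where "mC (e, r, n, c, a) = c"
fun mA :: "mark \<Rightarrow> nat \<Rightarrow> real" where "mA (e, r, n, c, a) = a"


section \<open>The generic vector\<close>

text \<open>\<open>indep_var\<close> and \<open>indep_vars\<close> need a common codomain, so joint independence of the three
  differently typed variables is stated for the \<open>\<sigma>\<close>-algebras they generate.\<close>

definition indep3 ::
    "'b measure \<Rightarrow> 'x measure \<Rightarrow> ('b \<Rightarrow> 'x) \<Rightarrow> 'y measure \<Rightarrow> ('b \<Rightarrow> 'y) \<Rightarrow> 'z measure \<Rightarrow> ('b \<Rightarrow> 'z) \<Rightarrow> bool"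
  where
  "indep3 P S X T Y U Z \<longleftrightarrow>
     X \<in> measurable P S \<and> Y \<in> measurable P T \<and> Z \<in> measurable P U \<and>
     prob_space.indep_sets P
       (\<lambda>i. [sets (vimage_algebra (space P) X S),
             sets (vimage_algebra (space P) Y T),
             sets (vimage_algebra (space P) Z U)] ! i) {..<3}"

text \<open>\<open>Phi\<close> is extended-real valued: it is \<open>\<infinity>\<close> where the expectation diverges, so that
  \<open>Phi P N A s < 0\<close> entails finiteness.\<close>

definition weight_moment :: "'b measure \<Rightarrow> ('b \<Rightarrow> nat) \<Rightarrow> (nat \<Rightarrow> 'b \<Rightarrow> real) \<Rightarrow> real \<Rightarrow> ennreal" where
  "weight_moment P N A s = (\<integral>\<^sup>+\<omega>. (\<Sum>k<N \<omega>. ennreal (A k \<omega> powr s)) \<partial>P)"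

definition Phi :: "'b measure \<Rightarrow> ('b \<Rightarrow> nat) \<Rightarrow> (nat \<Rightarrow> 'b \<Rightarrow> real) \<Rightarrow> real \<Rightarrow> ereal" where
  "Phi P N A s = enn2ereal (weight_moment P N A s) - 1"

definition Dom :: "'b measure \<Rightarrow> ('b \<Rightarrow> nat) \<Rightarrow> (nat \<Rightarrow> 'b \<Rightarrow> real) \<Rightarrow> real set" where
  "Dom P N A = {s. 0 < s \<and> weight_moment P N A s < \<infinity>}"

text \<open>\<open>mu\<close> is meaningful only on \<open>Dom P N A\<close>, hence \<open>\<mu>'\<close> is the derivative within that set
  (the ordinary derivative at interior points).\<close>

definition mu :: "'b measure \<Rightarrow> ('b \<Rightarrow> nat) \<Rightarrow> (nat \<Rightarrow> 'b \<Rightarrow> real) \<Rightarrow> real \<Rightarrow> real" where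
  "mu P N A s = real_of_ereal (Phi P N A s) / s"

definition mu_deriv_neg :: "'b measure \<Rightarrow> ('b \<Rightarrow> nat) \<Rightarrow> (nat \<Rightarrow> 'b \<Rightarrow> real) \<Rightarrow> real \<Rightarrow> bool" where
  "mu_deriv_neg P N A s \<longleftrightarrow>
     s \<in> Dom P N A \<and>
     (\<exists>d<0. (mu P N A has_real_derivative d) (at s within Dom P N A))"


section \<open>The marked branching random walk\<close>

text \<open>\<open>X\<close> is the family of marks of the Ulam--Harris labels.  Labels are stored in reverse order:
  \<open>i # x\<close> is the \<open>(i+1)\<close>-st child of \<open>x\<close>, and \<open>[]\<close> is the root.\<close>

definition iid_marks :: "'a measure \<Rightarrow> (nat list \<Rightarrow> 'a \<Rightarrow> mark) \<Rightarrow> mark measure \<Rightarrow> bool" where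
  "iid_marks M X L \<longleftrightarrow>
     prob_space.indep_vars M (\<lambda>_. mark_space) X UNIV \<and>
     (\<forall>x. distr M mark_space (X x) = L)"

primrec birth :: "(nat list \<Rightarrow> 'a \<Rightarrow> mark) \<Rightarrow> 'a \<Rightarrow> nat list \<Rightarrow> real" where
  "birth X \<omega> [] = 0"
| "birth X \<omega> (i # x) = birth X \<omega> x + mE (X x \<omega>)"

definition death :: "(nat list \<Rightarrow> 'a \<Rightarrow> mark) \<Rightarrow> 'a \<Rightarrow> nat list \<Rightarrow> real" where
  "death X \<omega> x = birth X \<omega> x + mE (X x \<omega>)"

primrec pos :: "(nat list \<Rightarrow> 'a \<Rightarrow> mark) \<Rightarrow> 'a \<Rightarrow> nat list \<Rightarrow> real" where
  "pos X \<omega> [] = 0"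
| "pos X \<omega> (i # x) = pos X \<omega> x + ln (mA (X x \<omega>) i)"

inductive_set tree :: "(nat list \<Rightarrow> 'a \<Rightarrow> mark) \<Rightarrow> 'a \<Rightarrow> nat list set" for X \<omega> where
  root: "[] \<in> tree X \<omega>"
| child: "x \<in> tree X \<omega> \<Longrightarrow> i < mN (X x \<omega>) \<Longrightarrow> i # x \<in> tree X \<omega>"

definition alive :: "(nat list \<Rightarrow> 'a \<Rightarrow> mark) \<Rightarrow> 'a \<Rightarrow> real \<Rightarrow> nat list set" where
  "alive X \<omega> t = {x \<in> tree X \<omega>. birth X \<omega> x \<le> t \<and> t < death X \<omega> x}"

definition dead :: "(nat list \<Rightarrow> 'a \<Rightarrow> mark) \<Rightarrow> 'a \<Rightarrow> real \<Rightarrow> nat list set" where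
  "dead X \<omega> t = {x \<in> tree X \<omega>. death X \<omega> x \<le> t}"

text \<open>The sets \<open>alive X \<omega> t\<close> and \<open>dead X \<omega> t\<close> are almost surely finite for all \<open>t\<close> when the
  process does not explode.\<close>

definition Cproc :: "(nat list \<Rightarrow> 'a \<Rightarrow> mark) \<Rightarrow> real \<Rightarrow> 'a \<Rightarrow> real" where
  "Cproc X t \<omega> = (\<Sum>\<^sub>\<infinity>x\<in>dead X \<omega> t. exp (pos X \<omega> x) * mC (X x \<omega>))"

definition Wproc :: "(nat list \<Rightarrow> 'a \<Rightarrow> mark) \<Rightarrow> real \<Rightarrow> 'a \<Rightarrow> real" where
  "Wproc X t \<omega> = (\<Sum>\<^sub>\<infinity>x\<in>alive X \<omega> t. exp (pos X \<omega> x) * mR (X x \<omega>)) + Cproc X t \<omega>"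

text \<open>The argument \<open>\<Phi>\<close> below is the real number \<open>\<Phi>(\<gamma>)\<close>.\<close>

definition Mart :: "(nat list \<Rightarrow> 'a \<Rightarrow> mark) \<Rightarrow> real \<Rightarrow> real \<Rightarrow> real \<Rightarrow> 'a \<Rightarrow> real" where
  "Mart X \<Phi> \<gamma> t \<omega> = exp (- \<Phi> * t) * (\<Sum>\<^sub>\<infinity>x\<in>alive X \<omega> t. exp (\<gamma> * pos X \<omega> x))"

definition conv_in_prob :: "'a measure \<Rightarrow> (real \<Rightarrow> 'a \<Rightarrow> real) \<Rightarrow> ('a \<Rightarrow> real) \<Rightarrow> bool" where
  "conv_in_prob M Y Z \<longleftrightarrow>
     (\<forall>\<epsilon>>0. ((\<lambda>t. \<P>(\<omega> in M. \<epsilon> < \<bar>Y t \<omega> - Z \<omega>\<bar>)) \<longlongrightarrow> 0) at_top)"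

text \<open>The limits \<open>M\<^sub>\<infinity>(\<gamma>)\<close> and \<open>C\<^sub>\<infinity>\<close> are random variables determined up to null sets, hence
  predicates.\<close>

definition is_M_inf ::
    "'a measure \<Rightarrow> (nat list \<Rightarrow> 'a \<Rightarrow> mark) \<Rightarrow> real \<Rightarrow> real \<Rightarrow> ('a \<Rightarrow> real) \<Rightarrow> bool" where
  "is_M_inf M X \<Phi> \<gamma> Z \<longleftrightarrow>
     Z \<in> borel_measurable M \<and> (AE \<omega> in M. ((\<lambda>t. Mart X \<Phi> \<gamma> t \<omega>) \<longlongrightarrow> Z \<omega>) at_top)"

definition is_C_inf :: "'a measure \<Rightarrow> (nat list \<Rightarrow> 'a \<Rightarrow> mark) \<Rightarrow> ('a \<Rightarrow> real) \<Rightarrow> bool" where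
  "is_C_inf M X Z \<longleftrightarrow>
     Z \<in> borel_measurable M \<and>
     conv_in_prob M (Cproc X) Z \<and>
     (AE \<omega> in M. (\<lambda>x. \<bar>exp (pos X \<omega> x) * mC (X x \<omega>)\<bar>) summable_on tree X \<omega> \<longrightarrow>
        Z \<omega> = (\<Sum>\<^sub>\<infinity>x\<in>tree X \<omega>. exp (pos X \<omega> x) * mC (X x \<omega>)))"

definition char_fun :: "'a measure \<Rightarrow> ('a \<Rightarrow> real) \<Rightarrow> real \<Rightarrow> complex" where
  "char_fun M Y \<xi> = (CLINT \<omega>|M. iexp (\<xi> * Y \<omega>))"

end

theory Submission
  imports Defs "HOL-Library.Nat_Bijection" "HOL-Real_Asymp.Real_Asymp"
begin

text \<open>The law of the whole population is the product \<open>Q\<close> of the laws of the marks, indexed by the labels, and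
  every process of the statement is an unconditional sum over all labels \<open>x\<close> of a functional of the
  mark, the birth time and the weight of \<open>x\<close>, the weight being \<open>e\<^bsup>V(x)\<^esup>\<close> on the tree and \<open>0\<close> off
  it.  The birth time and the weight of \<open>x\<close> do not involve the mark of \<open>x\<close>.  Conditioning can
  therefore be replaced throughout by integrating out one coordinate of the product.

  Revealing the marks parents first, one coordinate at a time, a sum of centred vertex functionals
  satisfies the inequality of von Bahr and Esseen for every \<open>0 < p \<le> 2\<close>: its \<open>p\<close>-th absolute
  moment is at most a constant times the sum of the \<open>p\<close>-th moments of the summands
  (\<open>nn_integral_vsum_powr_le_treesum\<close>).  The latter are weighted sums over the tree with weights
  \<open>e\<^bsup>p V(x)\<^esup>\<close>.  A vertex is either still alive at time \<open>t\<close> or has been replaced by its children;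
  this one-step balance, summed over the generations, shows that the sum of \<open>e\<^bsup>\<theta> V(x)\<^esup>\<close> over the
  alive vertices grows in mean, also given the past, at most like \<open>e\<^bsup>\<Phi>(\<theta>) t\<^esup>\<close>
  (\<open>alive_sum_supermartingale\<close>).

  Three consequences give the theorem.  The additive martingale \<open>M\<^sub>t(1)\<close> converges almost surely,
  because its upcrossings of an interval are bounded in mean (\<open>mart_converges\<close>).  If the relevant
  exponent is negative, the increments of \<open>C\<^sub>t\<close> over unit intervals are exponentially small in mean,
  so \<open>C\<^sub>t\<close> converges (\<open>additive_part_converges\<close>).  If \<open>\<Phi>(1) \<ge> 0\<close>, let \<open>J\<^sub>t\<close> be the time integral
  of the alive weights up to \<open>t\<close>.  Since a unit exponential lifetime has hazard rate \<open>1\<close>, the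
  difference \<open>C\<^sub>t - E[C] J\<^sub>t\<close> is again a sum of centred vertex functionals.  The inequality
  \<open>\<mu>'(1) < 0\<close> supplies an exponent \<open>p > 1\<close> with \<open>\<Phi>(p) < p \<Phi>(1)\<close>, for which this difference is
  negligible (\<open>additive_part_law\<close>), while \<open>J\<^sub>t\<close>, suitably normalised, is a weighted
  average of the convergent \<open>M\<^sub>s(1)\<close>.

  The terminal values \<open>R\<close> contribute a negligible sum over the alive vertices, by the moment
  inequality when \<open>R\<close> has the corresponding moment (\<open>Rsum_converges\<close>) and by truncating every summand at level
  \<open>t\<close> when the tails are of order \<open>1/x\<close> (\<open>Rsum_heavy_tails\<close>).  Convergence in probability and the
  statement on characteristic functions then carry over from \<open>Q\<close> to any family of independent marks,
  as all processes are functions of the configuration of the marks.\<close>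

section \<open>Elementary inequalities for powers\<close>

text \<open>After scaling to \<open>x + y = 1\<close> this is \<open>u \<le> u powr p\<close> on the unit interval.\<close>

lemma powr_add_le_add_powr:
  fixes x y :: real
  assumes "0 \<le> x" "0 \<le> y" "0 < p" "p \<le> 1"
  shows "(x + y) powr p \<le> x powr p + y powr p"
proof (cases "x + y = 0")
  case True
  then show ?thesis using assms by auto
next
  case False
  define z where "z = x + y"
  have z: "0 < z" using False assms by (auto simp: z_def)
  have frac: "u / z \<le> (u / z) powr p" if "0 \<le> u" "u \<le> z" for u
  proof (cases "u = 0")
    case False
    then have "(u / z) powr 1 \<le> (u / z) powr p"
      using that z assms by (intro powr_mono') auto
    then show ?thesis using that z False by simp
  qed auto
  have "1 = x / z + y / z" using z by (simp add: z_def add_divide_distrib [symmetric])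
  also have "\<dots> \<le> (x / z) powr p + (y / z) powr p"
    using assms by (intro add_mono frac) (auto simp: z_def)
  also have "\<dots> = (x powr p + y powr p) / z powr p"
    using assms z by (simp add: powr_divide add_divide_distrib)
  finally show ?thesis using z by (simp add: z_def field_simps)
qed

lemma abs_add_powr_le:
  fixes a h :: real
  assumes "0 < p" "p \<le> 1"
  shows "\<bar>a + h\<bar> powr p \<le> \<bar>a\<bar> powr p + \<bar>h\<bar> powr p"
  using powr_add_le_add_powr[of "\<bar>a\<bar>" "\<bar>h\<bar>" p] assms
    powr_mono2[of p "\<bar>a + h\<bar>" "\<bar>a\<bar> + \<bar>h\<bar>"] by linarith

lemma abs_powr_diff_le:
  fixes x y :: real
  assumes "0 \<le> x" "0 \<le> y" "0 < q" "q \<le> 1"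
  shows "\<bar>x powr q - y powr q\<bar> \<le> \<bar>x - y\<bar> powr q"
  using powr_add_le_add_powr[of "x - y" y q] powr_add_le_add_powr[of "y - x" x q] assms
    powr_mono2[of q x y] powr_mono2[of q y x]
  by (cases x y rule: le_cases) (auto simp: abs_if)

text \<open>The second-order remainder of the power function is controlled by the power of the increment,
  because its derivative is Hoelder continuous of order \<open>p - 1\<close>.  The linear term integrates to
  zero against a centred increment, which is what makes the inequality useful.\<close>

lemma abs_add_powr_le_linear_pos:
  fixes a h :: real
  assumes p: "1 < p" "p \<le> 2" and a: "0 < a"
  shows "\<bar>a + h\<bar> powr p \<le> a powr p + p * a powr (p - 1) * h + 4 * \<bar>h\<bar> powr p"
proof (cases "a + h < 0")
  case True
  then have ha: "a < \<bar>h\<bar>" "h < 0" using a by auto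
  have "\<bar>a + h\<bar> powr p \<le> \<bar>h\<bar> powr p"
    using True a p by (intro powr_mono2) auto
  moreover have "a powr (p - 1) \<le> \<bar>h\<bar> powr (p - 1)"
    using ha a p by (intro powr_mono2) auto
  then have "a powr (p - 1) * \<bar>h\<bar> \<le> \<bar>h\<bar> powr (p - 1) * \<bar>h\<bar>"
    by (intro mult_right_mono) auto
  then have "a powr (p - 1) * \<bar>h\<bar> \<le> \<bar>h\<bar> powr p"
    using ha powr_add[of "\<bar>h\<bar>" "p - 1" 1] by simp
  then have "p * (a powr (p - 1) * \<bar>h\<bar>) \<le> 2 * \<bar>h\<bar> powr p"
    using p by (intro mult_mono) auto
  moreover have "p * (a powr (p - 1) * \<bar>h\<bar>) = - (p * a powr (p - 1) * h)"
    using ha by (simp add: abs_if)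
  ultimately show ?thesis
    using powr_ge_zero[of a p] powr_ge_zero[of "\<bar>h\<bar>" p] by linarith
next
  case False
  show ?thesis
  proof (cases "h = 0")
    case True
    then show ?thesis using a by simp
  next
    case hne: False
    define l u where "l = min a (a + h)" and "u = max a (a + h)"
    have lu: "l < u" "0 \<le> l" using hne False a by (auto simp: l_def u_def)
    have "\<exists>l' z. l < z \<and> z < u \<and> ((\<lambda>x. x powr p) has_real_derivative l') (at z) \<and>
        u powr p - l powr p = (u - l) * l'"
      using lu p
      by (intro MVT continuous_on_powr' continuous_intros)
        (auto simp: real_differentiable_def intro!: exI has_real_derivative_powr)
    then obtain l' z where z: "l < z" "z < u" "((\<lambda>x. x powr p) has_real_derivative l') (at z)"
      "u powr p - l powr p = (u - l) * l'" by blast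
    have "l' = p * z powr (p - 1)"
      using z(3) has_real_derivative_powr[of z p] z(1) lu DERIV_unique by force
    then have eq: "\<bar>a + h\<bar> powr p - a powr p = h * (p * z powr (p - 1))"
      using z(4) False by (auto simp: l_def u_def min_def max_def split: if_splits)
    have "\<bar>z powr (p - 1) - a powr (p - 1)\<bar> \<le> \<bar>z - a\<bar> powr (p - 1)"
      using z lu a p by (intro abs_powr_diff_le) auto
    also have "\<dots> \<le> \<bar>h\<bar> powr (p - 1)"
      using z p by (intro powr_mono2) (auto simp: l_def u_def min_def max_def split: if_splits)
    finally have "p * (\<bar>h\<bar> * \<bar>z powr (p - 1) - a powr (p - 1)\<bar>) \<le> 2 * (\<bar>h\<bar> * \<bar>h\<bar> powr (p - 1))"
      using p by (intro mult_mono) auto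
    also have "\<bar>h\<bar> * \<bar>h\<bar> powr (p - 1) = \<bar>h\<bar> powr p"
      using hne powr_add[of "\<bar>h\<bar>" "p - 1" 1] by simp
    finally have "p * (h * (z powr (p - 1) - a powr (p - 1))) \<le> 2 * \<bar>h\<bar> powr p"
      using p mult_left_mono[OF abs_ge_self[of "h * (z powr (p - 1) - a powr (p - 1))"], of p]
      unfolding abs_mult by linarith
    moreover have "p * (h * (z powr (p - 1) - a powr (p - 1)))
        = h * (p * z powr (p - 1)) - p * a powr (p - 1) * h" by (simp add: algebra_simps)
    ultimately show ?thesis using eq powr_ge_zero[of "\<bar>h\<bar>" p] by linarith
  qed
qed

lemma abs_add_powr_le_linear:
  fixes a h :: real
  assumes p: "1 < p" "p \<le> 2"
  shows "\<bar>a + h\<bar> powr p \<le> \<bar>a\<bar> powr p + p * sgn a * \<bar>a\<bar> powr (p - 1) * h + 4 * \<bar>h\<bar> powr p"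
proof -
  consider "a = 0" | "a > 0" | "a < 0" by linarith
  then show ?thesis
  proof cases
    case 3
    have "\<bar>a + h\<bar> = \<bar>(-a) + (-h)\<bar>" by linarith
    then show ?thesis using abs_add_powr_le_linear_pos[OF p, of "-a" "-h"] 3 by simp
  qed (use abs_add_powr_le_linear_pos[OF p, of a h] p in auto)
qed

text \<open>Either \<open>y\<close> is below the threshold \<open>\<eta>\<close>, or \<open>(y / \<eta>) powr (p - 1)\<close> exceeds \<open>1\<close>.  The inequality turns a
  bound on a \<open>p\<close>-th moment into one on the first moment at any prescribed scale.\<close>

lemma le_add_scaled_powr:
  fixes y \<eta> p :: real
  assumes "0 < \<eta>" "1 \<le> p" "0 \<le> y"
  shows "y \<le> \<eta> + \<eta> powr (1 - p) * y powr p"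
proof (cases "y \<le> \<eta>")
  case False
  then have "y powr (1 - p) \<le> \<eta> powr (1 - p)"
    using assms by (intro powr_mono2') auto
  then have "y powr (1 - p) * y powr p \<le> \<eta> powr (1 - p) * y powr p"
    by (intro mult_right_mono) auto
  moreover have "y = y powr (1 - p) * y powr p"
    using assms False powr_add[of y "1 - p" p] by simp
  ultimately show ?thesis using assms by linarith
qed (use assms in \<open>auto intro: add_increasing2\<close>)

section \<open>Upcrossings\<close>

text \<open>\<open>hold a b f k\<close> says that the strategy "buy below \<open>a\<close>, sell above \<open>b\<close>" owns the asset after
  seeing the price \<open>f k\<close>; \<open>ups a b f k\<close> counts the sales up to then.\<close>

primrec hold :: "real \<Rightarrow> real \<Rightarrow> (nat \<Rightarrow> real) \<Rightarrow> nat \<Rightarrow> bool" where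
  "hold a b f 0 \<longleftrightarrow> f 0 < a"
| "hold a b f (Suc k) \<longleftrightarrow> (if hold a b f k then f (Suc k) \<le> b else f (Suc k) < a)"

primrec ups :: "real \<Rightarrow> real \<Rightarrow> (nat \<Rightarrow> real) \<Rightarrow> nat \<Rightarrow> nat" where
  "ups a b f 0 = 0"
| "ups a b f (Suc k) = ups a b f k + (if hold a b f k \<and> b < f (Suc k) then 1 else 0)"

lemma hold_cong: "(\<And>i. i \<le> k \<Longrightarrow> f i = g i) \<Longrightarrow> hold a b f k = hold a b g k"
  by (induction k) auto

lemma hold_below: "a < b \<Longrightarrow> f k < a \<Longrightarrow> hold a b f k"
  by (cases k) auto

lemma ups_mono: "k \<le> l \<Longrightarrow> ups a b f k \<le> ups a b f l"
  by (rule lift_Suc_mono_le) auto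

lemma ups_sale:
  assumes "hold a b f k" "k < l" "b < f l"
  shows "ups a b f k + 1 \<le> ups a b f l"
proof (rule ccontr)
  assume "\<not> ?thesis"
  then have less: "ups a b f j \<le> ups a b f k" if "j \<le> l" for j
    using ups_mono[OF that, of a b f] by linarith
  have "j \<le> l \<Longrightarrow> hold a b f j" if "k \<le> j" for j
    using that
  proof (induction j rule: dec_induct)
    case (step j)
    then have h: "hold a b f j" by auto
    have "ups a b f (Suc j) \<le> ups a b f k" using step by (intro less) auto
    moreover have "ups a b f k \<le> ups a b f j" using step by (intro ups_mono) auto
    ultimately have "ups a b f (Suc j) \<le> ups a b f j" by linarith
    then show ?case using h by (auto split: if_splits)
  qed (use assms in auto)
  then have h: "hold a b f (l - 1)" using assms by auto
  have "ups a b f l \<le> ups a b f k" by (intro less) auto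
  moreover have "ups a b f k \<le> ups a b f (l - 1)" using assms by (intro ups_mono) auto
  moreover have "ups a b f l = ups a b f (l - 1) + 1" using h assms by (cases l) auto
  ultimately show False by linarith
qed

text \<open>Each completed sale earns at least \<open>b - a\<close>; an open position at the end loses at most \<open>a\<close>
  because prices are nonnegative.\<close>

lemma ups_gain:
  assumes "a < b" and "\<And>k. 0 \<le> f k" "0 \<le> a"
  shows "(b - a) * ups a b f n \<le> a + (\<Sum>k<n. of_bool (hold a b f k) * (f (Suc k) - f k))"
proof -
  have "(b - a) * ups a b f n + (if hold a b f n then f n - a else 0)
      \<le> (\<Sum>k<n. of_bool (hold a b f k) * (f (Suc k) - f k))"
  proof (induction n)
    case (Suc n)
    then show ?case using assms(1)
      by (cases "hold a b f n"; cases "b < f (Suc n)"; cases "f (Suc n) < a") (auto simp: algebra_simps)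
  qed (use assms in auto)
  then show ?thesis using assms(2)[of n] assms(3) by (auto split: if_splits)
qed

text \<open>No filtration enters: the supermartingale property is tested only against the strategy \<open>hold\<close> of the
  process itself, whose expected gain is then at most \<open>0\<close>.\<close>

lemma (in prob_space) upcrossing_inequality:
  fixes f :: "nat \<Rightarrow> 'a \<Rightarrow> real"
  assumes ab: "0 \<le> a" "a < b" and nn: "\<And>k \<omega>. 0 \<le> f k \<omega>"
    and [measurable]: "\<And>k. f k \<in> borel_measurable M"
    and fin: "\<And>k. (\<integral>\<^sup>+\<omega>. f k \<omega> \<partial>M) < \<infinity>"
    and super: "\<And>k. (\<integral>\<^sup>+\<omega>. of_bool (hold a b (\<lambda>i. f i \<omega>) k) * ennreal (f (Suc k) \<omega>) \<partial>M)
      \<le> (\<integral>\<^sup>+\<omega>. of_bool (hold a b (\<lambda>i. f i \<omega>) k) * ennreal (f k \<omega>) \<partial>M)"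
  shows "(\<integral>\<^sup>+\<omega>. ups a b (\<lambda>i. f i \<omega>) n \<partial>M) \<le> ennreal (a / (b - a))"
proof -
  have meas_hold[measurable]: "Measurable.pred M (\<lambda>\<omega>. hold a b (\<lambda>i. f i \<omega>) k)" for k
    by (induction k) auto
  have meas_ups[measurable]: "(\<lambda>\<omega>. ups a b (\<lambda>i. f i \<omega>) k) \<in> measurable M (count_space UNIV)" for k
    by (induction k) auto
  let ?h = "\<lambda>k \<omega>. of_bool (hold a b (\<lambda>i. f i \<omega>) k) :: real"
  have int: "integrable M (f k)" for k
    using fin[of k] nn by (intro integrableI_nonneg) auto
  have inth: "integrable M (\<lambda>\<omega>. ?h k \<omega> * f j \<omega>)" for k j
    by (rule Bochner_Integration.integrable_bound[OF int[of j]]) (auto simp: nn)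
  have step: "(LINT \<omega>|M. ?h k \<omega> * (f (Suc k) \<omega> - f k \<omega>)) \<le> 0" for k
  proof -
    have e: "ennreal (LINT \<omega>|M. ?h k \<omega> * f j \<omega>)
        = (\<integral>\<^sup>+\<omega>. of_bool (hold a b (\<lambda>i. f i \<omega>) k) * ennreal (f j \<omega>) \<partial>M)" for j
      using inth nn by (subst nn_integral_eq_integral[symmetric])
        (auto simp: ennreal_mult' intro!: nn_integral_cong)
    have "(LINT \<omega>|M. ?h k \<omega> * f (Suc k) \<omega>) \<le> (LINT \<omega>|M. ?h k \<omega> * f k \<omega>)"
      using super[of k] unfolding e[symmetric]
      by (subst (asm) ennreal_le_iff) (auto intro!: Bochner_Integration.integral_nonneg simp: nn)
    then show ?thesis using inth by (simp add: right_diff_distrib Bochner_Integration.integral_diff)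
  qed
  have ups_le: "ups a b (\<lambda>i. f i \<omega>) k \<le> k" for k \<omega>
    by (induction k) auto
  have intu: "integrable M (\<lambda>\<omega>. real (ups a b (\<lambda>i. f i \<omega>) n))"
    by (rule integrable_const_bound[where B = n]) (auto simp: ups_le)
  have "(LINT \<omega>|M. (b - a) * ups a b (\<lambda>i. f i \<omega>) n)
      \<le> (LINT \<omega>|M. a + (\<Sum>k<n. ?h k \<omega> * (f (Suc k) \<omega> - f k \<omega>)))"
    using intu inth ab nn
    by (intro integral_mono ups_gain) (auto simp: right_diff_distrib)
  also have "\<dots> = a + (\<Sum>k<n. LINT \<omega>|M. ?h k \<omega> * (f (Suc k) \<omega> - f k \<omega>))"
    using inth by (subst Bochner_Integration.integral_add)
      (auto simp: right_diff_distrib Bochner_Integration.integral_sum prob_space)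
  also have "\<dots> \<le> a" using step by (simp add: sum_nonpos)
  finally have "(b - a) * (LINT \<omega>|M. ups a b (\<lambda>i. f i \<omega>) n) \<le> a" by simp
  then have "(LINT \<omega>|M. ups a b (\<lambda>i. f i \<omega>) n) \<le> a / (b - a)"
    using ab by (simp add: field_simps)
  moreover have "(\<integral>\<^sup>+\<omega>. ups a b (\<lambda>i. f i \<omega>) n \<partial>M) = ennreal (LINT \<omega>|M. ups a b (\<lambda>i. f i \<omega>) n)"
    using intu by (subst nn_integral_eq_integral[symmetric]) (auto simp: ennreal_of_nat_eq_real_of_nat)
  ultimately show ?thesis by (auto intro: ennreal_leI)
qed

text \<open>A right-continuous path is sampled faithfully by the points \<open>\<lceil>s j\<rceil> / j\<close>, which decrease to
  \<open>s\<close>; a path that oscillates across \<open>[a, b]\<close> for ever therefore shows arbitrarily many upcrossings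
  on fine grids.\<close>

lemma nat_ceiling_le_add_one: "0 \<le> x \<Longrightarrow> real (nat \<lceil>x\<rceil>) \<le> x + 1"
  by linarith

lemma grid_tendsto:
  fixes f :: "real \<Rightarrow> real"
  assumes "continuous (at_right s) f" "0 \<le> s"
  shows "(\<lambda>j. f (real (nat \<lceil>s * real (Suc j)\<rceil>) / real (Suc j))) \<longlonglongrightarrow> f s"
proof -
  let ?s = "\<lambda>j. real (nat \<lceil>s * real (Suc j)\<rceil>) / real (Suc j)"
  have ge: "s \<le> ?s j" for j
    using assms(2) by (simp add: pos_le_divide_eq)
  have le: "?s j \<le> s + 1 / real (Suc j)" for j
  proof -
    have "0 \<le> s * real (Suc j)" using assms(2) by simp
    then have "real (nat \<lceil>s * real (Suc j)\<rceil>) \<le> s * real (Suc j) + 1"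
      by (rule nat_ceiling_le_add_one)
    then have "?s j \<le> (s * real (Suc j) + 1) / real (Suc j)" by (intro divide_right_mono) auto
    then show ?thesis by (simp only: add_divide_distrib) simp
  qed
  have "?s \<longlonglongrightarrow> s"
    using LIMSEQ_Suc[OF tendsto_add[OF tendsto_const[of s] lim_1_over_n]]
    by (intro tendsto_sandwich[of "\<lambda>_. s" ?s _ "\<lambda>j. s + 1 / real (Suc j)"]) (use ge le in auto)
  moreover have "continuous (at s within {s..}) f"
    using assms(1) by (simp add: continuous_within at_within_Ici_at_right)
  ultimately show ?thesis
    using continuous_within_tendsto_compose[of s "{s..}" f ?s sequentially] ge by auto
qed

lemma oscillation_imp_many_upcrossings:
  fixes f :: "real \<Rightarrow> real"
  assumes rc: "\<And>s. 0 \<le> s \<Longrightarrow> continuous (at_right s) f" and "a < b"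
    and low: "\<And>T. \<exists>s\<ge>T. f s < a" and high: "\<And>T. \<exists>s\<ge>T. b < f s"
  shows "\<forall>\<^sub>F j in sequentially.
    m \<le> ups a b (\<lambda>k. f (real k / real (Suc j))) (Suc j * Suc j)"
proof -
  have "\<exists>T\<ge>0. \<forall>\<^sub>F j in sequentially.
      m \<le> ups a b (\<lambda>k. f (real k / real (Suc j))) (nat \<lceil>T * real (Suc j)\<rceil>)"
  proof (induction m)
    case (Suc m)
    then obtain T where T: "0 \<le> T" "\<forall>\<^sub>F j in sequentially.
      m \<le> ups a b (\<lambda>k. f (real k / real (Suc j))) (nat \<lceil>T * real (Suc j)\<rceil>)" by auto
    obtain s where s: "T + 1 \<le> s" "f s < a" using low by auto
    obtain u where u: "s + 1 \<le> u" "b < f u" using high by auto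
    have 1: "\<forall>\<^sub>F j in sequentially. f (real (nat \<lceil>s * real (Suc j)\<rceil>) / real (Suc j)) < a"
      using grid_tendsto[of s f] rc[of s] s T by (intro order_tendstoD(2)) auto
    have 2: "\<forall>\<^sub>F j in sequentially. b < f (real (nat \<lceil>u * real (Suc j)\<rceil>) / real (Suc j))"
      using grid_tendsto[of u f] rc[of u] s u T by (intro order_tendstoD(1)) auto
    have "\<forall>\<^sub>F j in sequentially.
      Suc m \<le> ups a b (\<lambda>k. f (real k / real (Suc j))) (nat \<lceil>u * real (Suc j)\<rceil>)"
      using 1 2 T(2)
    proof eventually_elim
      case (elim j)
      let ?F = "\<lambda>k. f (real k / real (Suc j))"
      have "T * real (Suc j) \<le> s * real (Suc j)" using s by (intro mult_right_mono) auto
      moreover have "s * real (Suc j) + 1 \<le> s * real (Suc j) + real (Suc j)" by simp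
      then have "s * real (Suc j) + 1 \<le> (s + 1) * real (Suc j)" by (simp only: distrib_right mult_1)
      then have "s * real (Suc j) + 1 \<le> u * real (Suc j)"
        using mult_right_mono[OF u(1), of "real (Suc j)"] by linarith
      ultimately have st: "T * real (Suc j) \<le> s * real (Suc j)" "s * real (Suc j) + 1 \<le> u * real (Suc j)" .
      have ord: "nat \<lceil>T * real (Suc j)\<rceil> \<le> nat \<lceil>s * real (Suc j)\<rceil>"
        by (intro nat_mono ceiling_mono st)
      have "\<lceil>s * real (Suc j)\<rceil> + 1 = \<lceil>s * real (Suc j) + 1\<rceil>" by simp
      also have "\<dots> \<le> \<lceil>u * real (Suc j)\<rceil>" by (intro ceiling_mono st)
      finally have "\<lceil>s * real (Suc j)\<rceil> < \<lceil>u * real (Suc j)\<rceil>" by simp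
      moreover have "0 < u * real (Suc j)" using s u T by (intro mult_pos_pos) auto
      then have "0 < \<lceil>u * real (Suc j)\<rceil>" by simp
      ultimately have ord': "nat \<lceil>s * real (Suc j)\<rceil> < nat \<lceil>u * real (Suc j)\<rceil>"
        by (simp only: zless_nat_conj)
      have "hold a b ?F (nat \<lceil>s * real (Suc j)\<rceil>)"
        using elim(1) assms(2) by (intro hold_below) auto
      then have "ups a b ?F (nat \<lceil>s * real (Suc j)\<rceil>) + 1 \<le> ups a b ?F (nat \<lceil>u * real (Suc j)\<rceil>)"
        using ord' elim(2) by (intro ups_sale) auto
      moreover have "ups a b ?F (nat \<lceil>T * real (Suc j)\<rceil>) \<le> ups a b ?F (nat \<lceil>s * real (Suc j)\<rceil>)"
        using ord by (intro ups_mono)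
      ultimately show ?case using elim(3) by linarith
    qed
    then show ?case using s u T by (intro exI[of _ u]) auto
  qed auto
  then obtain T where T: "0 \<le> T" "\<forall>\<^sub>F j in sequentially.
      m \<le> ups a b (\<lambda>k. f (real k / real (Suc j))) (nat \<lceil>T * real (Suc j)\<rceil>)" by auto
  have "\<forall>\<^sub>F j in sequentially. nat \<lceil>T\<rceil> \<le> j" by (rule eventually_ge_at_top)
  with T(2) show ?thesis
  proof eventually_elim
    case (elim j)
    have "T * real (Suc j) \<le> real (Suc j) * real (Suc j)"
      using elim(2) real_nat_ceiling_ge[of T] by (intro mult_right_mono) auto
    then have "nat \<lceil>T * real (Suc j)\<rceil> \<le> Suc j * Suc j"
      by (simp only: nat_le_iff ceiling_le_iff of_int_of_nat_eq) (simp only: of_nat_mult)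
    from ups_mono[OF this] elim(1) show ?case by (rule order_trans[rotated])
  qed
qed

text \<open>A nonnegative path that crosses no rational interval infinitely often converges, unless it
  tends to infinity.\<close>

lemma convergent_if_no_oscillation:
  fixes f :: "real \<Rightarrow> real"
  assumes nn: "\<And>t. 0 \<le> f t"
    and osc: "\<And>a b. a \<in> \<rat> \<Longrightarrow> b \<in> \<rat> \<Longrightarrow> 0 \<le> a \<Longrightarrow> a < b \<Longrightarrow>
      \<not> ((\<forall>T. \<exists>s\<ge>T. f s < a) \<and> (\<forall>T. \<exists>s\<ge>T. b < f s))"
    and bdd: "\<exists>K. \<forall>T. \<exists>s\<ge>T. f s \<le> K"
  shows "\<exists>l. (f \<longlongrightarrow> l) at_top"
proof -
  let ?F = "\<lambda>t. ereal (f t)"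
  have "Liminf at_top ?F = Limsup at_top ?F"
  proof (rule ccontr)
    assume "\<not> ?thesis"
    moreover have "Liminf at_top ?F \<le> Limsup at_top ?F" by (intro Liminf_le_Limsup) auto
    ultimately have "Liminf at_top ?F < Limsup at_top ?F" by simp
    then obtain x where x: "Liminf at_top ?F < ereal x" "ereal x < Limsup at_top ?F"
      using ereal_dense2 by blast
    obtain y where y: "ereal x < ereal y" "ereal y < Limsup at_top ?F"
      using x(2) ereal_dense2 by blast
    obtain z where z: "ereal y < ereal z" "ereal z < Limsup at_top ?F"
      using y(2) ereal_dense2 by blast
    obtain a where a: "a \<in> \<rat>" "x < a" "a < y" using Rats_dense_in_real[of x y] y by auto
    obtain b where b: "b \<in> \<rat>" "y < b" "b < z" using Rats_dense_in_real[of y z] z by auto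
    have lo: "\<exists>s\<ge>T. f s < a" for T
    proof (rule ccontr)
      assume "\<not> ?thesis"
      then have "\<forall>\<^sub>F t in at_top. ereal a \<le> ?F t"
        by (intro eventually_at_top_linorderI[of T]) (auto simp: not_less)
      then have "ereal a \<le> Liminf at_top ?F" by (rule Liminf_bounded)
      with x(1) a show False by (metis ereal_less_eq(3) linorder_not_less order_less_imp_le order_le_less_trans)
    qed
    have hi: "\<exists>s\<ge>T. b < f s" for T
    proof (rule ccontr)
      assume "\<not> ?thesis"
      then have "\<forall>\<^sub>F t in at_top. ?F t \<le> ereal b"
        by (intro eventually_at_top_linorderI[of T]) (auto simp: not_less)
      then have "Limsup at_top ?F \<le> ereal b" by (rule Limsup_bounded)
      with z(2) b show False by (metis ereal_less_eq(3) linorder_not_less order_less_imp_le order_less_le_trans)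
    qed
    have "0 \<le> a"
      using lo[of 0] nn by (meson le_less_trans less_imp_le)
    then show False using osc[of a b] a b lo hi by auto
  qed
  then have lim: "(?F \<longlongrightarrow> Liminf at_top ?F) at_top"
    by (intro Liminf_eq_Limsup) auto
  obtain K where K: "\<And>T. \<exists>s\<ge>T. f s \<le> K" using bdd by auto
  have "Liminf at_top ?F \<noteq> \<infinity>"
  proof
    assume "Liminf at_top ?F = \<infinity>"
    then have "\<forall>\<^sub>F t in at_top. ereal K < ?F t" using lim by (intro order_tendstoD(1)) auto
    then show False using K by (auto simp: eventually_at_top_linorder) (meson not_less)
  qed
  moreover have "0 \<le> Liminf at_top ?F" by (rule Liminf_bounded) (simp add: nn)
  ultimately obtain l where "Liminf at_top ?F = ereal l" by (cases "Liminf at_top ?F") auto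
  then show ?thesis using lim by auto
qed

section \<open>Marks, birth times and weights\<close>

type_synonym configuration = "nat list \<Rightarrow> mark"

abbreviation vec_of :: "mark \<Rightarrow> offspring" where
  "vec_of m \<equiv> snd (snd m)"

lemma mark_projections: "mE m = fst m" "mR m = fst (snd m)" "mN m = fst (vec_of m)"
  "mC m = fst (snd (vec_of m))" "mA m = snd (snd (vec_of m))"
  by (cases m; simp)+

lemma measurable_mark_projections [measurable]:
  "mE \<in> borel_measurable mark_space" "mR \<in> borel_measurable mark_space"
  "mN \<in> measurable mark_space (count_space UNIV)" "mC \<in> borel_measurable mark_space"
  "(\<lambda>m. mA m k) \<in> borel_measurable mark_space"
proof -
  have eqs: "mE = fst" "mR = (\<lambda>m. fst (snd m))" "mN = (\<lambda>m. fst (vec_of m))"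
    "mC = (\<lambda>m. fst (snd (vec_of m)))" "(\<lambda>m. mA m k) = (\<lambda>m. snd (snd (vec_of m)) k)"
    by (auto simp: mark_projections)
  show "mE \<in> borel_measurable mark_space" "mR \<in> borel_measurable mark_space"
    "mN \<in> measurable mark_space (count_space UNIV)" "mC \<in> borel_measurable mark_space"
    "(\<lambda>m. mA m k) \<in> borel_measurable mark_space"
    unfolding eqs by measurable
qed

primrec bt :: "configuration \<Rightarrow> nat list \<Rightarrow> real" where
  "bt \<kappa> [] = 0"
| "bt \<kappa> (i # x) = bt \<kappa> x + mE (\<kappa> x)"

text \<open>\<open>wt \<kappa> x\<close> is \<open>e\<^bsup>V(x)\<^esup>\<close> on the Galton--Watson tree and \<open>0\<close> off it, so that sums over the tree
  become sums over all labels.\<close>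

primrec wt :: "configuration \<Rightarrow> nat list \<Rightarrow> real" where
  "wt \<kappa> [] = 1"
| "wt \<kappa> (i # x) = wt \<kappa> x * (if i < mN (\<kappa> x) then mA (\<kappa> x) i else 0)"

definition ev :: "(mark \<Rightarrow> real \<Rightarrow> real \<Rightarrow> 'c) \<Rightarrow> configuration \<Rightarrow> nat list \<Rightarrow> 'c" where
  "ev H \<kappa> x = H (\<kappa> x) (bt \<kappa> x) (wt \<kappa> x)"

text \<open>The code \<open>list_encode\<close> of a label exceeds the codes of its ancestors, so the birth time and the
  weight of a vertex do not depend on the marks of vertices with the same or a larger code.\<close>

lemma list_encode_less_Cons: "list_encode x < list_encode (i # x)"
  using le_prod_encode_2[of "list_encode x" i] by simp

lemma bt_upd: "list_encode x \<le> list_encode y \<Longrightarrow> bt (\<kappa>(y := m)) x = bt \<kappa> x"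
proof (induction x)
  case (Cons i x)
  then show ?case using list_encode_less_Cons[of x i] by auto
qed auto

lemma wt_upd: "list_encode x \<le> list_encode y \<Longrightarrow> wt (\<kappa>(y := m)) x = wt \<kappa> x"
proof (induction x)
  case (Cons i x)
  then show ?case using list_encode_less_Cons[of x i] by auto
qed auto

lemma ev_upd_same: "ev H (\<kappa>(x := m)) x = H m (bt \<kappa> x) (wt \<kappa> x)"
  by (simp add: ev_def bt_upd wt_upd)

lemma ev_upd_later: "list_encode x < list_encode y \<Longrightarrow> ev H (\<kappa>(y := m)) x = ev H \<kappa> x"
  by (auto simp: ev_def bt_upd wt_upd)

abbreviation cfg_space :: "configuration measure" where
  "cfg_space \<equiv> \<Pi>\<^sub>M x\<in>UNIV. mark_space"

lemma measurable_mark_at [measurable]: "(\<lambda>\<kappa>. \<kappa> x) \<in> measurable cfg_space mark_space"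
  by (rule measurable_component_singleton) auto

lemma measurable_bt [measurable]: "(\<lambda>\<kappa>. bt \<kappa> x) \<in> borel_measurable cfg_space"
  by (induction x) auto

lemma measurable_wt [measurable]: "(\<lambda>\<kappa>. wt \<kappa> x) \<in> borel_measurable cfg_space"
  by (induction x) auto

text \<open>A vertex functional sees the mark, the birth time and the weight of a vertex.\<close>

definition meas_fun :: "(mark \<Rightarrow> real \<Rightarrow> real \<Rightarrow> 'c::topological_space) \<Rightarrow> bool" where
  "meas_fun H \<longleftrightarrow> (\<lambda>(m, b, w). H m b w) \<in> borel_measurable (mark_space \<Otimes>\<^sub>M borel \<Otimes>\<^sub>M borel)"

lemma meas_fun_compose:
  assumes "meas_fun H" "f \<in> measurable M mark_space" "g \<in> borel_measurable M" "h \<in> borel_measurable M"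
  shows "(\<lambda>x. H (f x) (g x) (h x)) \<in> borel_measurable M"
proof -
  have "(\<lambda>x. (\<lambda>(m, b, w). H m b w) (f x, g x, h x)) \<in> borel_measurable M"
    using assms unfolding meas_fun_def by measurable
  then show ?thesis by simp
qed

lemma measurable_ev: "meas_fun H \<Longrightarrow> (\<lambda>\<kappa>. ev H \<kappa> x) \<in> borel_measurable cfg_space"
  unfolding ev_def by (rule meas_fun_compose) auto

section \<open>Sums over the vertices\<close>

lemma infsum_eq_lebesgue_integral:
  fixes f :: "'i \<Rightarrow> real"
  shows "(\<Sum>\<^sub>\<infinity>i. f i) = (LINT i|count_space UNIV. f i)"
proof (cases "Infinite_Sum.abs_summable_on f UNIV")
  case True
  then have "infsetsum f UNIV = (\<Sum>\<^sub>\<infinity>i. f i)"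
    by (intro infsetsum_infsum iffD1[OF abs_summable_equivalent])
  then show ?thesis unfolding infsetsum_def by (rule sym)
next
  case False
  then have "\<not> f summable_on UNIV"
    by (subst summable_on_iff_abs_summable_on_real)
  moreover have "\<not> integrable (count_space UNIV) f"
    using False unfolding abs_summable_equivalent abs_summable_on_def .
  ultimately show ?thesis by (simp add: infsum_not_exists not_integrable_integral_eq)
qed

lemma borel_measurable_infsum:
  fixes f :: "'i::countable \<Rightarrow> 'a \<Rightarrow> real"
  assumes "\<And>i. f i \<in> borel_measurable M"
  shows "(\<lambda>\<omega>. \<Sum>\<^sub>\<infinity>i. f i \<omega>) \<in> borel_measurable M"
proof -
  interpret sigma_finite_measure "count_space (UNIV :: 'i set)"
    by (intro sigma_finite_measure_count_space_countable) auto
  have "(\<lambda>(i, \<omega>). f i \<omega>) \<in> borel_measurable (count_space UNIV \<Otimes>\<^sub>M M)"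
    by (rule measurable_pair_measure_countable1) (use assms in auto)
  from measurable_compose[OF measurable_pair_swap' this]
  have "(\<lambda>(\<omega>, i). f i \<omega>) \<in> borel_measurable (M \<Otimes>\<^sub>M count_space UNIV)"
    by (simp add: case_prod_unfold)
  then show ?thesis unfolding infsum_eq_lebesgue_integral by (rule borel_measurable_lebesgue_integral)
qed

definition vsum :: "(mark \<Rightarrow> real \<Rightarrow> real \<Rightarrow> real) \<Rightarrow> configuration \<Rightarrow> real" where
  "vsum H \<kappa> = (\<Sum>\<^sub>\<infinity>x. ev H \<kappa> x)"

definition psum :: "(mark \<Rightarrow> real \<Rightarrow> real \<Rightarrow> real) \<Rightarrow> nat \<Rightarrow> configuration \<Rightarrow> real" where
  "psum H k \<kappa> = (\<Sum>j<k. ev H \<kappa> (list_decode j))"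

lemma measurable_psum: "meas_fun H \<Longrightarrow> psum H k \<in> borel_measurable cfg_space"
  unfolding psum_def[abs_def] by (intro borel_measurable_sum measurable_ev)

lemma measurable_vsum: "meas_fun H \<Longrightarrow> vsum H \<in> borel_measurable cfg_space"
  unfolding vsum_def[abs_def] by (intro borel_measurable_infsum measurable_ev)

text \<open>Where the unconditional sum does not exist it has the default value \<open>0\<close>.  Bounds on the partial sums
  therefore pass to \<open>vsum\<close> by Fatou's lemma without any summability.\<close>

lemma vsum_cases:
  obtains "vsum H \<kappa> = 0" | "(\<lambda>k. psum H k \<kappa>) \<longlonglongrightarrow> vsum H \<kappa>"
proof (cases "(\<lambda>x. ev H \<kappa> x) summable_on UNIV")
  case True
  then have "((\<lambda>x. ev H \<kappa> x) has_sum vsum H \<kappa>) UNIV" unfolding vsum_def by simp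
  then have "((\<lambda>j. ev H \<kappa> (list_decode j)) has_sum vsum H \<kappa>) UNIV"
    using has_sum_reindex_bij_betw[OF bij_list_decode, of "\<lambda>x. ev H \<kappa> x" "vsum H \<kappa>"] by simp
  then have "(\<lambda>k. psum H k \<kappa>) \<longlonglongrightarrow> vsum H \<kappa>"
    using has_sum_imp_sums by (auto simp: sums_def psum_def)
  then show ?thesis by (rule that)
qed (auto simp: vsum_def infsum_not_exists intro: that)

lemma ennreal_vsum_le_liminf:
  assumes "0 < p"
  shows "ennreal (\<bar>vsum H \<kappa>\<bar> powr p) \<le> liminf (\<lambda>k. ennreal (\<bar>psum H k \<kappa>\<bar> powr p))"
proof (cases rule: vsum_cases[of H \<kappa>])
  case 2
  then have "(\<lambda>k. ennreal (\<bar>psum H k \<kappa>\<bar> powr p)) \<longlonglongrightarrow> ennreal (\<bar>vsum H \<kappa>\<bar> powr p)"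
    using assms by (intro tendsto_ennrealI tendsto_powr' tendsto_rabs) auto
  then have "liminf (\<lambda>k. ennreal (\<bar>psum H k \<kappa>\<bar> powr p)) = ennreal (\<bar>vsum H \<kappa>\<bar> powr p)"
    by (rule lim_imp_Liminf[OF sequentially_bot])
  then show ?thesis by simp
qed (use assms in auto)

section \<open>Independence by resampling one mark\<close>

text \<open>Independence is recorded in the form in which it is applied: as the product formulas with which the
  lifetime is integrated out.\<close>

locale mark_law = prob_space L for L :: "mark measure" +
  assumes sets_L [measurable_cong]: "sets L = sets mark_space"
    and mA_pos: "AE m in L. \<forall>k. 0 < mA m k"
    and mE_exponential: "distr L borel mE = density lborel (exponential_density 1)"
    and indep_vec: "\<And>f g. f \<in> borel_measurable borel \<Longrightarrow> g \<in> borel_measurable vec_space \<Longrightarrow>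
      (\<integral>\<^sup>+m. f (mE m) * g (vec_of m) \<partial>L) = (\<integral>\<^sup>+m. f (mE m) \<partial>L) * (\<integral>\<^sup>+m. g (vec_of m) \<partial>L)"
    and indep_R: "\<And>f g. f \<in> borel_measurable borel \<Longrightarrow> g \<in> borel_measurable borel \<Longrightarrow>
      (\<integral>\<^sup>+m. f (mE m) * g (mR m) \<partial>L) = (\<integral>\<^sup>+m. f (mE m) \<partial>L) * (\<integral>\<^sup>+m. g (mR m) \<partial>L)"
begin

lemma measurable_L: "f \<in> measurable mark_space N \<Longrightarrow> f \<in> measurable L N"
  using measurable_cong_sets[OF sets_L refl] by blast

abbreviation Q :: "configuration measure" where
  "Q \<equiv> \<Pi>\<^sub>M x\<in>UNIV. L"

lemma sets_Q [measurable_cong]: "sets Q = sets cfg_space"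
  by (intro sets_PiM_cong refl sets_L)

sublocale Q: prob_space Q
  by (intro prob_space_PiM) unfold_locales

lemma space_Q [simp]: "space Q = UNIV"
proof -
  have "space L = UNIV" using sets_eq_imp_space_eq[OF sets_L] by (auto simp: space_pair_measure space_PiM)
  then show ?thesis by (auto simp: space_PiM)
qed

text \<open>The product measure is invariant under replacing one coordinate by an independent copy.\<close>

lemma nn_integral_resample:
  assumes [measurable]: "F \<in> borel_measurable cfg_space"
  shows "(\<integral>\<^sup>+\<kappa>. F \<kappa> \<partial>Q) = (\<integral>\<^sup>+\<kappa>. \<integral>\<^sup>+m. F (\<kappa>(x := m)) \<partial>L \<partial>Q)"
proof -
  interpret pair_sigma_finite L Q ..
  have upd: "(\<lambda>(m, \<kappa>). \<kappa>(x := m)) \<in> measurable (L \<Otimes>\<^sub>M Q) Q"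
    using measurable_fun_upd[of UNIV UNIV x "\<lambda>z. snd z" "L \<Otimes>\<^sub>M Q" "\<lambda>_. L" "\<lambda>z. fst z"]
    by (simp add: case_prod_unfold)
  have "Q = distr (L \<Otimes>\<^sub>M Q) Q (\<lambda>(m, \<kappa>). \<kappa>(x := m))"
    using distr_pair_PiM_eq_PiM[of UNIV "\<lambda>_. L" x] prob_space_axioms by simp
  then have "(\<integral>\<^sup>+\<kappa>. F \<kappa> \<partial>Q) = (\<integral>\<^sup>+\<kappa>. F \<kappa> \<partial>distr (L \<Otimes>\<^sub>M Q) Q (\<lambda>(m, \<kappa>). \<kappa>(x := m)))" by simp
  also have "\<dots> = (\<integral>\<^sup>+z. F ((snd z)(x := fst z)) \<partial>(L \<Otimes>\<^sub>M Q))"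
    using upd by (subst nn_integral_distr) (auto simp: case_prod_unfold)
  also have "\<dots> = (\<integral>\<^sup>+\<kappa>. \<integral>\<^sup>+m. F (\<kappa>(x := m)) \<partial>L \<partial>Q)"
    using measurable_compose[OF upd, of F borel]
    by (subst nn_integral_snd[symmetric]) (auto simp: case_prod_unfold)
  finally show ?thesis .
qed

lemma AE_all_marks:
  assumes [measurable]: "Measurable.pred mark_space P" and "AE m in L. P m"
  shows "AE \<kappa> in Q. \<forall>x. P (\<kappa> x)"
proof -
  have "AE \<kappa> in Q. P (\<kappa> x)" for x
  proof -
    have "distr Q L (\<lambda>\<kappa>. \<kappa> x) = L"
      using prob_space_axioms by (intro distr_PiM_component[of UNIV "\<lambda>_. L" x]) auto
    then have "AE m in distr Q L (\<lambda>\<kappa>. \<kappa> x). P m" using assms(2) by (simp only:)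
    then show ?thesis by (rule AE_distrD[rotated]) (rule measurable_component_singleton, simp)
  qed
  then show ?thesis by (simp add: AE_all_countable)
qed

lemma nn_integral_mE:
  assumes [measurable]: "f \<in> borel_measurable borel"
  shows "(\<integral>\<^sup>+m. f (mE m) \<partial>L) = (\<integral>\<^sup>+e. ennreal (exp (- e)) * indicator {0..} e * f e \<partial>lborel)"
proof -
  have "(\<integral>\<^sup>+m. f (mE m) \<partial>L) = (\<integral>\<^sup>+e. f e \<partial>distr L borel mE)"
    by (subst nn_integral_distr) (auto simp: measurable_L[OF measurable_mark_projections(1)])
  also have "\<dots> = (\<integral>\<^sup>+e. ennreal (exponential_density 1 e) * f e \<partial>lborel)"
    unfolding mE_exponential by (subst nn_integral_density) auto
  finally show ?thesis
    by (simp add: exponential_density_def) (auto intro!: nn_integral_cong split: split_indicator)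
qed

lemma mE_pos: "AE m in L. 0 < mE m"
proof -
  have "(\<integral>\<^sup>+m. indicator {..0} (mE m) \<partial>L) = (\<integral>\<^sup>+e. ennreal (exp (- e)) * indicator {0..} e * indicator {..0} e \<partial>lborel)"
    by (rule nn_integral_mE) auto
  also have "\<dots> = 0"
    using AE_lborel_singleton[of 0]
    by (subst nn_integral_0_iff_AE) (auto split: split_indicator elim!: eventually_mono)
  finally have "(\<integral>\<^sup>+m. indicator {..0} (mE m) \<partial>L) = 0" .
  then have "AE m in L. indicator {..0} (mE m) = (0::ennreal)"
    by (subst (asm) nn_integral_0_iff_AE) (auto intro!: measurable_L)
  then show ?thesis by eventually_elim (auto split: split_indicator_asm)
qed

lemma AE_good: "AE \<kappa> in Q. \<forall>x. 0 < mE (\<kappa> x) \<and> (\<forall>k. 0 < mA (\<kappa> x) k)"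
  using mE_pos mA_pos by (intro AE_all_marks) auto

lemma wt_nonneg: "\<forall>x k. 0 < mA (\<kappa> x) k \<Longrightarrow> 0 \<le> wt \<kappa> x"
  by (induction x) (simp_all add: less_imp_le)

lemma bt_nonneg: "\<forall>x. 0 < mE (\<kappa> x) \<Longrightarrow> 0 \<le> bt \<kappa> x"
  by (induction x) (simp_all add: less_imp_le add_nonneg_nonneg)

section \<open>Moment bounds for sums over the vertices\<close>

lemma nn_integral_ev:
  fixes H :: "mark \<Rightarrow> real \<Rightarrow> real \<Rightarrow> ennreal"
  assumes "meas_fun H"
  shows "(\<integral>\<^sup>+\<kappa>. ev H \<kappa> x \<partial>Q) = (\<integral>\<^sup>+\<kappa>. \<integral>\<^sup>+m. H m (bt \<kappa> x) (wt \<kappa> x) \<partial>L \<partial>Q)"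
  using measurable_ev[OF assms] by (subst nn_integral_resample[where x = x]) (auto simp: ev_upd_same)

text \<open>Integrating the second-order inequality for the power removes its linear term, because \<open>h\<close> is
  centred; for \<open>p \<le> 1\<close> the power is subadditive.\<close>

lemma nn_integral_powr_add_le:
  fixes h :: "mark \<Rightarrow> real"
  assumes p: "0 < p" "p \<le> 2" and [measurable]: "h \<in> borel_measurable mark_space"
    and centred: "p \<le> 1 \<or> integrable L h \<and> (LINT m|L. h m) = 0"
  shows "(\<integral>\<^sup>+m. ennreal (\<bar>a + h m\<bar> powr p) \<partial>L)
    \<le> ennreal (\<bar>a\<bar> powr p) + 4 * (\<integral>\<^sup>+m. ennreal (\<bar>h m\<bar> powr p) \<partial>L)"
proof (cases "p \<le> 1")
  case True
  have "(\<integral>\<^sup>+m. ennreal (\<bar>a + h m\<bar> powr p) \<partial>L) \<le> (\<integral>\<^sup>+m. ennreal (\<bar>a\<bar> powr p) + ennreal (\<bar>h m\<bar> powr p) \<partial>L)"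
    using abs_add_powr_le[OF p(1) True]
    by (intro nn_integral_mono) (auto simp: ennreal_plus[symmetric] intro!: ennreal_leI simp del: ennreal_plus)
  also have "\<dots> = ennreal (\<bar>a\<bar> powr p) + 1 * (\<integral>\<^sup>+m. ennreal (\<bar>h m\<bar> powr p) \<partial>L)"
    by (subst nn_integral_add) (auto simp: emeasure_space_1 intro!: measurable_L)
  also have "\<dots> \<le> ennreal (\<bar>a\<bar> powr p) + 4 * (\<integral>\<^sup>+m. ennreal (\<bar>h m\<bar> powr p) \<partial>L)"
    by (intro add_left_mono mult_right_mono) auto
  finally show ?thesis .
next
  case False
  then have h: "integrable L h" "(LINT m|L. h m) = 0" and p1: "1 < p" using centred by auto
  show ?thesis
  proof (cases "(\<integral>\<^sup>+m. ennreal (\<bar>h m\<bar> powr p) \<partial>L) = \<infinity>")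
    case True
    then show ?thesis by (simp add: ennreal_mult_top)
  next
    case False
    then have "(\<integral>\<^sup>+m. ennreal (\<bar>h m\<bar> powr p) \<partial>L) < \<infinity>"
      by (simp add: less_top)
    moreover have "(\<lambda>m. \<bar>h m\<bar> powr p) \<in> borel_measurable mark_space"
      by measurable
    ultimately have hp: "integrable L (\<lambda>m. \<bar>h m\<bar> powr p)"
      by (intro integrableI_nonneg[OF measurable_L]) auto
    let ?r = "\<lambda>m. \<bar>a\<bar> powr p + p * sgn a * \<bar>a\<bar> powr (p - 1) * h m + 4 * \<bar>h m\<bar> powr p"
    have le: "\<bar>a + h m\<bar> powr p \<le> ?r m" for m
      by (rule abs_add_powr_le_linear[OF p1 p(2)])
    then have "(\<integral>\<^sup>+m. ennreal (\<bar>a + h m\<bar> powr p) \<partial>L) \<le> (\<integral>\<^sup>+m. ennreal (?r m) \<partial>L)"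
      by (intro nn_integral_mono ennreal_leI)
    also have "\<dots> = ennreal (LINT m|L. ?r m)"
    proof (rule nn_integral_eq_integral)
      show "integrable L ?r"
        by (intro Bochner_Integration.integrable_add integrable_mult_right integrable_const h(1) hp)
      show "AE m in L. 0 \<le> ?r m"
        using order_trans[OF powr_ge_zero le] by (intro AE_I2)
    qed
    also have "(LINT m|L. ?r m) = \<bar>a\<bar> powr p + 4 * (LINT m|L. \<bar>h m\<bar> powr p)"
      using h hp by (simp add: prob_space)
    also have "ennreal \<dots> = ennreal (\<bar>a\<bar> powr p) + 4 * (\<integral>\<^sup>+m. ennreal (\<bar>h m\<bar> powr p) \<partial>L)"
      using nn_integral_eq_integral[OF hp] by (simp add: ennreal_plus ennreal_mult')
    finally show ?thesis .
  qed
qed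

text \<open>Revealing the marks in the order of their codes, each new summand is centred given the previous
  ones, because only its own mark is fresh.  This is the von Bahr--Esseen inequality, and for
  \<open>p \<le> 1\<close> plain subadditivity.\<close>

lemma nn_integral_psum_powr_le:
  assumes p: "0 < p" "p \<le> 2" and H: "meas_fun H"
    and centred: "p \<le> 1 \<or> (\<forall>b w. integrable L (\<lambda>m. H m b w) \<and> (LINT m|L. H m b w) = 0)"
  shows "(\<integral>\<^sup>+\<kappa>. ennreal (\<bar>psum H k \<kappa>\<bar> powr p) \<partial>Q)
    \<le> 4 * (\<integral>\<^sup>+\<kappa>. (\<integral>\<^sup>+x. ev (\<lambda>m b w. ennreal (\<bar>H m b w\<bar> powr p)) \<kappa> x \<partial>count_space UNIV) \<partial>Q)"
proof -
  let ?g = "\<lambda>m b w. ennreal (\<bar>H m b w\<bar> powr p)"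
  have mH [measurable]: "(\<lambda>m. H m b w) \<in> borel_measurable mark_space" for b w
    by (rule meas_fun_compose[OF H]) auto
  have mg: "meas_fun ?g"
    using H unfolding meas_fun_def case_prod_unfold by measurable
  note [measurable] = measurable_ev[OF H] measurable_psum[OF H] measurable_ev[OF mg]
  have "(\<integral>\<^sup>+\<kappa>. ennreal (\<bar>psum H k \<kappa>\<bar> powr p) \<partial>Q) \<le> 4 * (\<Sum>j<k. \<integral>\<^sup>+\<kappa>. ev ?g \<kappa> (list_decode j) \<partial>Q)"
  proof (induction k)
    case (Suc k)
    let ?x = "list_decode k"
    have psum_upd: "psum H (Suc k) (\<kappa>(?x := m)) = psum H k \<kappa> + H m (bt \<kappa> ?x) (wt \<kappa> ?x)" for \<kappa> m
    proof -
      have "psum H k (\<kappa>(?x := m)) = psum H k \<kappa>"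
        unfolding psum_def by (intro sum.cong refl ev_upd_later) auto
      then show ?thesis by (simp add: psum_def ev_upd_same)
    qed
    have "(\<integral>\<^sup>+\<kappa>. ennreal (\<bar>psum H (Suc k) \<kappa>\<bar> powr p) \<partial>Q)
        = (\<integral>\<^sup>+\<kappa>. \<integral>\<^sup>+m. ennreal (\<bar>psum H k \<kappa> + H m (bt \<kappa> ?x) (wt \<kappa> ?x)\<bar> powr p) \<partial>L \<partial>Q)"
      by (subst nn_integral_resample[where x = ?x]) (auto simp: psum_upd)
    also have "\<dots> \<le> (\<integral>\<^sup>+\<kappa>. ennreal (\<bar>psum H k \<kappa>\<bar> powr p)
        + 4 * (\<integral>\<^sup>+m. ?g m (bt \<kappa> ?x) (wt \<kappa> ?x) \<partial>L) \<partial>Q)"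
      using centred by (intro nn_integral_mono nn_integral_powr_add_le p mH) auto
    also have "\<dots> = (\<integral>\<^sup>+\<kappa>. ennreal (\<bar>psum H k \<kappa>\<bar> powr p) \<partial>Q)
        + 4 * (\<integral>\<^sup>+\<kappa>. \<integral>\<^sup>+m. ?g m (bt \<kappa> ?x) (wt \<kappa> ?x) \<partial>L \<partial>Q)"
    proof -
      have "(\<lambda>z. ?g (snd z) (bt (fst z) ?x) (wt (fst z) ?x)) \<in> borel_measurable (Q \<Otimes>\<^sub>M L)"
        by (rule meas_fun_compose[OF mg]) measurable
      then have "(\<lambda>\<kappa>. \<integral>\<^sup>+m. ?g m (bt \<kappa> ?x) (wt \<kappa> ?x) \<partial>L) \<in> borel_measurable Q"
        using borel_measurable_nn_integral[of "\<lambda>\<kappa> m. ?g m (bt \<kappa> ?x) (wt \<kappa> ?x)" Q]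
        by (simp add: case_prod_unfold)
      then show ?thesis by (subst nn_integral_add) (auto simp: nn_integral_cmult)
    qed
    also have "(\<integral>\<^sup>+\<kappa>. \<integral>\<^sup>+m. ?g m (bt \<kappa> ?x) (wt \<kappa> ?x) \<partial>L \<partial>Q) = (\<integral>\<^sup>+\<kappa>. ev ?g \<kappa> ?x \<partial>Q)"
      by (rule nn_integral_ev[OF mg, symmetric])
    finally show ?case using Suc.IH by (simp add: distrib_left add.commute order_trans[OF _ add_left_mono])
  qed (use p in \<open>simp add: psum_def\<close>)
  also have "\<dots> \<le> 4 * (\<Sum>j. \<integral>\<^sup>+\<kappa>. ev ?g \<kappa> (list_decode j) \<partial>Q)"
    by (intro mult_left_mono sum_le_suminf) auto
  also have "(\<Sum>j. \<integral>\<^sup>+\<kappa>. ev ?g \<kappa> (list_decode j) \<partial>Q) = (\<integral>\<^sup>+x. \<integral>\<^sup>+\<kappa>. ev ?g \<kappa> x \<partial>Q \<partial>count_space UNIV)"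
    by (subst nn_integral_count_space_nat[symmetric]) (rule nn_integral_bij_count_space[OF bij_list_decode])
  also have "\<dots> = (\<integral>\<^sup>+\<kappa>. (\<integral>\<^sup>+x. ev ?g \<kappa> x \<partial>count_space UNIV) \<partial>Q)"
    by (rule nn_integral_count_space_nn_integral[symmetric]) auto
  finally show ?thesis .
qed

text \<open>Only weights and birth times remain, since the mark of the vertex itself has been integrated out.\<close>

definition treesum :: "real \<Rightarrow> (real \<Rightarrow> ennreal) \<Rightarrow> ennreal" where
  "treesum \<theta> g = (\<integral>\<^sup>+\<kappa>. \<integral>\<^sup>+x. ennreal (wt \<kappa> x powr \<theta>) * g (bt \<kappa> x) \<partial>count_space UNIV \<partial>Q)"

lemma nn_integral_sum_ev_le_treesum:
  fixes H :: "mark \<Rightarrow> real \<Rightarrow> real \<Rightarrow> ennreal"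
  assumes H: "meas_fun H" and [measurable]: "g \<in> borel_measurable borel"
    and le: "\<And>b w. 0 \<le> b \<Longrightarrow> 0 \<le> w \<Longrightarrow> (\<integral>\<^sup>+m. H m b w \<partial>L) \<le> ennreal (w powr \<theta>) * g b"
  shows "(\<integral>\<^sup>+\<kappa>. (\<integral>\<^sup>+x. ev H \<kappa> x \<partial>count_space UNIV) \<partial>Q) \<le> treesum \<theta> g"
proof -
  note [measurable] = measurable_ev[OF H]
  have "(\<integral>\<^sup>+\<kappa>. (\<integral>\<^sup>+x. ev H \<kappa> x \<partial>count_space UNIV) \<partial>Q)
      = (\<integral>\<^sup>+x. \<integral>\<^sup>+\<kappa>. \<integral>\<^sup>+m. H m (bt \<kappa> x) (wt \<kappa> x) \<partial>L \<partial>Q \<partial>count_space UNIV)"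
    by (subst nn_integral_count_space_nn_integral) (auto simp: nn_integral_ev[OF H])
  also have "\<dots> \<le> (\<integral>\<^sup>+x. \<integral>\<^sup>+\<kappa>. ennreal (wt \<kappa> x powr \<theta>) * g (bt \<kappa> x) \<partial>Q \<partial>count_space UNIV)"
  proof (rule nn_integral_mono, rule nn_integral_mono_AE)
    fix x
    show "AE \<kappa> in Q. (\<integral>\<^sup>+m. H m (bt \<kappa> x) (wt \<kappa> x) \<partial>L) \<le> ennreal (wt \<kappa> x powr \<theta>) * g (bt \<kappa> x)"
      using AE_good by eventually_elim (auto intro!: le bt_nonneg wt_nonneg)
  qed
  also have "\<dots> = treesum \<theta> g"
    unfolding treesum_def by (subst nn_integral_count_space_nn_integral) auto
  finally show ?thesis .
qed

lemma nn_integral_psum_powr_le_treesum: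
  assumes p: "0 < p" "p \<le> 2" and H: "meas_fun H" and [measurable]: "g \<in> borel_measurable borel"
    and centred: "p \<le> 1 \<or> (\<forall>b w. integrable L (\<lambda>m. H m b w) \<and> (LINT m|L. H m b w) = 0)"
    and le: "\<And>b w. 0 \<le> b \<Longrightarrow> 0 \<le> w \<Longrightarrow>
      (\<integral>\<^sup>+m. ennreal (\<bar>H m b w\<bar> powr p) \<partial>L) \<le> ennreal (w powr \<theta>) * g b"
  shows "(\<integral>\<^sup>+\<kappa>. ennreal (\<bar>psum H k \<kappa>\<bar> powr p) \<partial>Q) \<le> 4 * treesum \<theta> g"
proof -
  have "meas_fun (\<lambda>m b w. ennreal (\<bar>H m b w\<bar> powr p))"
    using H unfolding meas_fun_def case_prod_unfold by measurable
  from nn_integral_sum_ev_le_treesum[OF this _ le] nn_integral_psum_powr_le[OF p H centred, of k]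
  show ?thesis by (meson assms(4) mult_left_mono order_trans zero_le)
qed

lemma nn_integral_vsum_powr_le_treesum:
  assumes p: "0 < p" "p \<le> 2" and H: "meas_fun H" and g: "g \<in> borel_measurable borel"
    and centred: "p \<le> 1 \<or> (\<forall>b w. integrable L (\<lambda>m. H m b w) \<and> (LINT m|L. H m b w) = 0)"
    and le: "\<And>b w. 0 \<le> b \<Longrightarrow> 0 \<le> w \<Longrightarrow>
      (\<integral>\<^sup>+m. ennreal (\<bar>H m b w\<bar> powr p) \<partial>L) \<le> ennreal (w powr \<theta>) * g b"
  shows "(\<integral>\<^sup>+\<kappa>. ennreal (\<bar>vsum H \<kappa>\<bar> powr p) \<partial>Q) \<le> 4 * treesum \<theta> g"
proof -
  note [measurable] = measurable_psum[OF H]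
  have "(\<integral>\<^sup>+\<kappa>. ennreal (\<bar>vsum H \<kappa>\<bar> powr p) \<partial>Q)
      \<le> (\<integral>\<^sup>+\<kappa>. liminf (\<lambda>k. ennreal (\<bar>psum H k \<kappa>\<bar> powr p)) \<partial>Q)"
    by (intro nn_integral_mono ennreal_vsum_le_liminf p)
  also have "\<dots> \<le> liminf (\<lambda>k. \<integral>\<^sup>+\<kappa>. ennreal (\<bar>psum H k \<kappa>\<bar> powr p) \<partial>Q)"
    by (intro nn_integral_liminf) auto
  also have "\<dots> \<le> limsup (\<lambda>k. \<integral>\<^sup>+\<kappa>. ennreal (\<bar>psum H k \<kappa>\<bar> powr p) \<partial>Q)"
    by (intro Liminf_le_Limsup) auto
  also have "\<dots> \<le> 4 * treesum \<theta> g"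
    by (intro Limsup_bounded always_eventually allI nn_integral_psum_powr_le_treesum[OF p H g centred le])
  finally show ?thesis .
qed

end

section \<open>The additive supermartingale\<close>

lemma nn_integral_count_space_lists:
  fixes F :: "nat list \<Rightarrow> ennreal"
  shows "(\<integral>\<^sup>+y. F y \<partial>count_space UNIV)
    = F [] + (\<integral>\<^sup>+x. \<integral>\<^sup>+i. F (i # x) \<partial>count_space UNIV \<partial>count_space UNIV)"
proof -
  have bij: "bij_betw (\<lambda>(x, i). i # x) UNIV (- {[]} :: nat list set)"
  proof (rule bij_betwI')
    fix y :: "nat list" assume "y \<in> - {[]}"
    then show "\<exists>p\<in>UNIV. y = (case p of (x, i) \<Rightarrow> i # x)" by (cases y) auto
  qed auto
  have "(\<integral>\<^sup>+y. F y \<partial>count_space UNIV)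
      = (\<integral>\<^sup>+y. F y * indicator {[]} y + F y * indicator (- {[]}) y \<partial>count_space UNIV)"
    by (intro nn_integral_cong) (auto split: split_indicator)
  also have "\<dots> = (\<integral>\<^sup>+y. F y * indicator {[]} y \<partial>count_space UNIV)
      + (\<integral>\<^sup>+y. F y * indicator (- {[]}) y \<partial>count_space UNIV)"
    by (rule nn_integral_add) auto
  also have "(\<integral>\<^sup>+y. F y * indicator {[]} y \<partial>count_space UNIV) = F []"
    by (subst nn_integral_indicator_finite) auto
  also have "(\<integral>\<^sup>+y. F y * indicator (- {[]}) y \<partial>count_space UNIV) = (\<integral>\<^sup>+y. F y \<partial>count_space (- {[]}))"
    by (simp add: nn_integral_count_space_indicator)
  also have "\<dots> = (\<integral>\<^sup>+(x, i). F (i # x) \<partial>count_space UNIV)"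
    by (subst nn_integral_bij_count_space[OF bij, symmetric]) (simp add: case_prod_unfold)
  also have "\<dots> = (\<integral>\<^sup>+x. \<integral>\<^sup>+i. F (i # x) \<partial>count_space UNIV \<partial>count_space UNIV)"
    using nn_integral_fst_count_space[of "\<lambda>(x, i). F (i # x)"] by simp
  finally show ?thesis .
qed

lemma borel_measurable_nn_integral_countable:
  fixes f :: "'i::countable \<Rightarrow> 'a \<Rightarrow> ennreal"
  assumes [measurable]: "\<And>i. f i \<in> borel_measurable M"
  shows "(\<lambda>\<omega>. \<integral>\<^sup>+i. f i \<omega> \<partial>count_space UNIV) \<in> borel_measurable M"
proof -
  interpret sigma_finite_measure "count_space (UNIV :: 'i set)"
    by (intro sigma_finite_measure_count_space_countable) auto
  have "(\<lambda>(i, \<omega>). f i \<omega>) \<in> borel_measurable (count_space UNIV \<Otimes>\<^sub>M M)"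
    by (rule measurable_pair_measure_countable1) auto
  from measurable_compose[OF measurable_pair_swap' this]
  have "(\<lambda>(\<omega>, i). f i \<omega>) \<in> borel_measurable (M \<Otimes>\<^sub>M count_space UNIV)"
    by (simp add: case_prod_unfold)
  then show ?thesis by (rule borel_measurable_nn_integral)
qed

text \<open>Telescoping over the generations.  Subtraction is avoided because the sums may be infinite.\<close>

lemma tree_telescope:
  fixes A C D :: "nat list \<Rightarrow> ennreal"
  assumes step: "\<And>x. (\<integral>\<^sup>+i. A (i # x) \<partial>count_space UNIV) + D x \<le> A x + C x"
  shows "(\<integral>\<^sup>+x. D x \<partial>count_space UNIV) \<le> A [] + (\<integral>\<^sup>+x. C x \<partial>count_space UNIV)"
proof -
  define lev where "lev n F = (\<integral>\<^sup>+x. F x * indicator {x. length x = n} x \<partial>count_space UNIV)"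
    for n and F :: "nat list \<Rightarrow> ennreal"
  define low where "low n F = (\<integral>\<^sup>+x. F x * indicator {x. length x < n} x \<partial>count_space UNIV)"
    for n and F :: "nat list \<Rightarrow> ennreal"
  have low_Suc: "low (Suc n) F = low n F + lev n F" for n F
    unfolding low_def lev_def
    by (subst nn_integral_add[symmetric]) (auto intro!: nn_integral_cong split: split_indicator)
  have lev_Suc: "lev (Suc n) F = lev n (\<lambda>x. \<integral>\<^sup>+i. F (i # x) \<partial>count_space UNIV)" for n F
    unfolding lev_def
    by (subst nn_integral_count_space_lists) (auto intro!: nn_integral_cong split: split_indicator)
  have lev_add: "lev n (\<lambda>x. F x + G x) = lev n F + lev n G" for n F G
    unfolding lev_def by (subst nn_integral_add[symmetric]) (auto simp: distrib_right)
  have lev_mono: "(\<And>x. F x \<le> G x) \<Longrightarrow> lev n F \<le> lev n G" for n F G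
    unfolding lev_def by (intro nn_integral_mono mult_right_mono) auto
  have lev_0: "lev 0 F = F []" for F
  proof -
    have "lev 0 F = (\<integral>\<^sup>+x. F x * indicator {[]} x \<partial>count_space UNIV)"
      unfolding lev_def by (intro nn_integral_cong) (auto split: split_indicator)
    then show ?thesis by (subst (asm) nn_integral_indicator_finite) auto
  qed
  have le: "lev n A + low n D \<le> A [] + low n C" for n
  proof (induction n)
    case 0
    then show ?case by (simp add: lev_0) (simp add: low_def)
  next
    case (Suc n)
    have "lev (Suc n) A + low (Suc n) D
        = lev n (\<lambda>x. (\<integral>\<^sup>+i. A (i # x) \<partial>count_space UNIV) + D x) + low n D"
      by (simp add: lev_Suc low_Suc lev_add ac_simps)
    also have "\<dots> \<le> lev n (\<lambda>x. A x + C x) + low n D"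
      by (intro add_right_mono lev_mono step)
    also have "\<dots> = (lev n A + low n D) + lev n C" by (simp add: lev_add ac_simps)
    also have "\<dots> \<le> (A [] + low n C) + lev n C" by (intro add_right_mono Suc.IH)
    finally show ?case by (simp add: low_Suc ac_simps)
  qed
  have "(\<integral>\<^sup>+x. D x \<partial>count_space UNIV)
      = (\<integral>\<^sup>+x. (SUP n. D x * indicator {x. length x < n} x) \<partial>count_space UNIV)"
  proof (intro nn_integral_cong antisym)
    fix x :: "nat list"
    show "D x \<le> (SUP n. D x * indicator {x. length x < n} x)"
      by (intro SUP_upper2[of "Suc (length x)"]) auto
  qed (auto intro!: SUP_least split: split_indicator)
  also have "\<dots> = (SUP n. low n D)"
    unfolding low_def
    by (intro nn_integral_monotone_convergence_SUP)
      (auto simp: incseq_def le_fun_def split: split_indicator)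
  also have "\<dots> \<le> A [] + (\<integral>\<^sup>+x. C x \<partial>count_space UNIV)"
  proof (rule SUP_least)
    fix n
    have "low n D \<le> lev n A + low n D" by (rule add_increasing) auto
    also have "\<dots> \<le> A [] + low n C" by (rule le)
    also have "\<dots> \<le> A [] + (\<integral>\<^sup>+x. C x \<partial>count_space UNIV)"
      unfolding low_def by (intro add_left_mono nn_integral_mono) (auto split: split_indicator)
    finally show "low n D \<le> A [] + (\<integral>\<^sup>+x. C x \<partial>count_space UNIV)" .
  qed
  finally show ?thesis .
qed

lemma nn_integral_exp_Icc:
  fixes c k u v :: real
  assumes "0 \<le> c" "u \<le> v"
  shows "(\<integral>\<^sup>+e. ennreal (c * exp (k - c * e)) * indicator {u..v} e \<partial>lborel)
    = ennreal (exp (k - c * u) - exp (k - c * v))"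
proof -
  have "(\<integral>\<^sup>+e. ennreal (c * exp (k - c * e)) * indicator {u..v} e \<partial>lborel)
      = ennreal (- exp (k - c * v) - - exp (k - c * u))"
    using assms
    by (intro nn_integral_FTC_Icc) (auto intro!: derivative_eq_intros)
  then show ?thesis by simp
qed

context mark_law
begin

lemma nn_integral_mE_greater:
  assumes "0 \<le> a"
  shows "(\<integral>\<^sup>+m. of_bool (a < mE m) \<partial>L) = ennreal (exp (- a))"
proof -
  have "(\<integral>\<^sup>+m. of_bool (a < mE m) \<partial>L) = (\<integral>\<^sup>+m. indicator {a<..} (mE m) \<partial>L)"
    by (intro nn_integral_cong) (auto split: split_indicator)
  also have "\<dots> = (\<integral>\<^sup>+e. ennreal (exp (- e)) * indicator {0..} e * indicator {a<..} e \<partial>lborel)"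
    by (rule nn_integral_mE) auto
  also have "\<dots> = (\<integral>\<^sup>+e. ennreal (exp (- e)) * indicator {a..} e \<partial>lborel)"
    using AE_lborel_singleton[of a] assms
    by (intro nn_integral_cong_AE) (auto split: split_indicator elim!: eventually_mono)
  also have "\<dots> = ennreal (0 - (- exp (- a)))"
  proof (rule nn_integral_FTC_atLeast)
    have "((\<lambda>e. exp (- e)) \<longlongrightarrow> (0::real)) at_top"
      by (rule filterlim_compose[OF exp_at_bot filterlim_uminus_at_bot_at_top])
    then show "((\<lambda>e. - exp (- e)) \<longlongrightarrow> (0::real)) at_top"
      using tendsto_minus by fastforce
  qed (auto intro!: derivative_eq_intros)
  finally show ?thesis by simp
qed

definition wmom :: "real \<Rightarrow> ennreal" where
  "wmom \<theta> = (\<integral>\<^sup>+m. (\<Sum>i<mN m. ennreal (mA m i powr \<theta>)) \<partial>L)"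

definition alive_sum :: "real \<Rightarrow> real \<Rightarrow> configuration \<Rightarrow> ennreal" where
  "alive_sum \<theta> t \<kappa> = (\<integral>\<^sup>+x. ev (\<lambda>m b w. ennreal (w powr \<theta>) * of_bool (b \<le> t \<and> t < b + mE m)) \<kappa> x
      \<partial>count_space UNIV)"

text \<open>A functional of the past up to time \<open>s\<close>: on the event that \<open>x\<close> dies after \<open>s\<close>, it does not
  depend on the mark of \<open>x\<close>.  This replaces measurability with respect to a filtration.\<close>

definition past :: "real \<Rightarrow> (configuration \<Rightarrow> ennreal) \<Rightarrow> bool" where
  "past s Z \<longleftrightarrow> Z \<in> borel_measurable cfg_space \<and>
     (\<forall>\<kappa> x m m'. (\<forall>y. 0 < mE (\<kappa> y)) \<longrightarrow> 0 < mE m \<longrightarrow> 0 < mE m' \<longrightarrow>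
        s < bt \<kappa> x + mE m \<longrightarrow> s < bt \<kappa> x + mE m' \<longrightarrow> Z (\<kappa>(x := m)) = Z (\<kappa>(x := m')))"

text \<open>The mark \<open>frozen s\<close> keeps a vertex alive beyond time \<open>s\<close>.\<close>

definition frozen :: "real \<Rightarrow> mark" where
  "frozen s = (\<bar>s\<bar> + 1, 0, 0, 0, \<lambda>_. 1)"

lemma measurable_upd_frozen [measurable]:
  "(\<lambda>\<kappa>. \<kappa>(x := frozen s)) \<in> measurable cfg_space cfg_space"
proof -
  have "frozen s \<in> space mark_space" by (simp add: space_pair_measure space_PiM)
  then show ?thesis
    using measurable_fun_upd[of UNIV UNIV x "\<lambda>\<kappa>. \<kappa>" cfg_space "\<lambda>_. mark_space" "\<lambda>_. frozen s"] by simp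
qed

text \<open>When \<open>F\<close> charges only the event that \<open>x\<close> dies after \<open>s\<close>, the past \<open>Z\<close> may be evaluated as if \<open>x\<close> were
  frozen.  Then \<open>Z\<close> no longer depends on the mark of \<open>x\<close>, which can be integrated out.\<close>

lemma nn_integral_freeze:
  fixes F :: "mark \<Rightarrow> real \<Rightarrow> real \<Rightarrow> ennreal"
  assumes Z: "past s Z" and F: "meas_fun F"
    and F0: "\<And>m b w. 0 \<le> b \<Longrightarrow> F m b w \<noteq> 0 \<Longrightarrow> s < b + mE m"
  shows "(\<integral>\<^sup>+\<kappa>. Z \<kappa> * ev F \<kappa> x \<partial>Q)
    = (\<integral>\<^sup>+\<kappa>. Z (\<kappa>(x := frozen s)) * (\<integral>\<^sup>+m. F m (bt \<kappa> x) (wt \<kappa> x) \<partial>L) \<partial>Q)"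
proof -
  have [measurable]: "Z \<in> borel_measurable cfg_space" using Z by (simp add: past_def)
  note [measurable] = measurable_ev[OF F]
  have [measurable]: "(\<lambda>m. F m b w) \<in> borel_measurable mark_space" for b w
    by (rule meas_fun_compose[OF F]) auto
  have "(\<integral>\<^sup>+\<kappa>. Z \<kappa> * ev F \<kappa> x \<partial>Q) = (\<integral>\<^sup>+\<kappa>. \<integral>\<^sup>+m. Z (\<kappa>(x := m)) * F m (bt \<kappa> x) (wt \<kappa> x) \<partial>L \<partial>Q)"
    by (subst nn_integral_resample[where x = x]) (auto simp: ev_upd_same)
  also have "\<dots> = (\<integral>\<^sup>+\<kappa>. \<integral>\<^sup>+m. Z (\<kappa>(x := frozen s)) * F m (bt \<kappa> x) (wt \<kappa> x) \<partial>L \<partial>Q)"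
  proof (rule nn_integral_cong_AE, use AE_good in eventually_elim)
    case (elim \<kappa>)
    then have pos: "\<forall>y. 0 < mE (\<kappa> y)" by auto
    have b: "0 \<le> bt \<kappa> x" using pos by (rule bt_nonneg)
    \<comment> \<open>Birth times are nonnegative, so the lifetime \<open>\<bar>s\<bar> + 1\<close> outlives \<open>s\<close>.\<close>
    have fr: "s < bt \<kappa> x + mE (frozen s)" "0 < mE (frozen s)" using b by (auto simp: frozen_def)
    show ?case
    proof (rule nn_integral_cong_AE, use mE_pos in eventually_elim)
      case (elim m)
      show ?case
      proof (cases "F m (bt \<kappa> x) (wt \<kappa> x) = 0")
        case False
        then have "s < bt \<kappa> x + mE m" using F0 b by blast
        then have "Z (\<kappa>(x := m)) = Z (\<kappa>(x := frozen s))"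
          using Z pos elim fr unfolding past_def by blast
        then show ?thesis by simp
      qed simp
    qed
  qed
  also have "\<dots> = (\<integral>\<^sup>+\<kappa>. Z (\<kappa>(x := frozen s)) * (\<integral>\<^sup>+m. F m (bt \<kappa> x) (wt \<kappa> x) \<partial>L) \<partial>Q)"
    by (intro nn_integral_cong nn_integral_cmult measurable_L) measurable
  finally show ?thesis .
qed

text \<open>The identity behind the additive martingale: a vertex born at \<open>b \<le> t\<close> is alive at time \<open>t\<close> or
  has been replaced by its children, whose expected contribution \<open>e\<^bsup>\<phi>(t - b - e)\<^esup>\<close> is discounted by
  the time \<open>e\<close> at which they appear.\<close>

lemma offspring_balance:
  assumes "0 \<le> b" "s \<le> t" "-1 \<le> \<phi>"
  shows "ennreal (1 + \<phi>) *
      (\<integral>\<^sup>+m. ennreal (of_bool (s < b + mE m \<and> b + mE m \<le> t) * exp (\<phi> * (t - (b + mE m)))) \<partial>L)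
    + (\<integral>\<^sup>+m. of_bool (b \<le> t \<and> t < b + mE m) \<partial>L)
    \<le> ennreal (of_bool (s < b \<and> b \<le> t) * exp (\<phi> * (t - b)))
    + ennreal (exp (\<phi> * (t - s))) * (\<integral>\<^sup>+m. of_bool (b \<le> s \<and> s < b + mE m) \<partial>L)"
proof (cases "b \<le> t")
  case False
  have "AE m in L. ennreal (of_bool (s < b + mE m \<and> b + mE m \<le> t) * exp (\<phi> * (t - (b + mE m)))) = 0"
    using mE_pos by eventually_elim (use False in auto)
  then have "(\<integral>\<^sup>+m. ennreal (of_bool (s < b + mE m \<and> b + mE m \<le> t) * exp (\<phi> * (t - (b + mE m)))) \<partial>L)
      = (\<integral>\<^sup>+m. 0 \<partial>L)"
    by (intro nn_integral_cong_AE)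
  then show ?thesis using False by simp
next
  case True
  define a where "a = max s b"
  have a: "b \<le> a" "a \<le> t" using True assms by (auto simp: a_def)
  have "ennreal (1 + \<phi>) *
      (\<integral>\<^sup>+m. ennreal (of_bool (s < b + mE m \<and> b + mE m \<le> t) * exp (\<phi> * (t - (b + mE m)))) \<partial>L)
    = ennreal (1 + \<phi>) * (\<integral>\<^sup>+e. ennreal (exp (- e)) * indicator {0..} e *
        ennreal (of_bool (s < b + e \<and> b + e \<le> t) * exp (\<phi> * (t - (b + e)))) \<partial>lborel)"
    by (subst nn_integral_mE[of "\<lambda>e. ennreal (of_bool (s < b + e \<and> b + e \<le> t) * exp (\<phi> * (t - (b + e))))"]) auto
  also have "\<dots> = (\<integral>\<^sup>+e. ennreal (1 + \<phi>) * (ennreal (exp (- e)) * indicator {0..} e *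
        ennreal (of_bool (s < b + e \<and> b + e \<le> t) * exp (\<phi> * (t - (b + e))))) \<partial>lborel)"
    by (rule nn_integral_cmult[symmetric]) auto
  also have "\<dots> \<le> (\<integral>\<^sup>+e. ennreal ((1 + \<phi>) * exp (\<phi> * (t - b) - (1 + \<phi>) * e)) * indicator {a - b..t - b} e \<partial>lborel)"
  proof (rule nn_integral_mono)
    fix e :: real
    show "ennreal (1 + \<phi>) * (ennreal (exp (- e)) * indicator {0..} e *
        ennreal (of_bool (s < b + e \<and> b + e \<le> t) * exp (\<phi> * (t - (b + e)))))
      \<le> ennreal ((1 + \<phi>) * exp (\<phi> * (t - b) - (1 + \<phi>) * e)) * indicator {a - b..t - b} e"
    proof (cases "0 \<le> e \<and> s < b + e \<and> b + e \<le> t")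
      case True
      have "exp (- e) * exp (\<phi> * (t - (b + e))) = exp (\<phi> * (t - b) - (1 + \<phi>) * e)"
        by (simp add: exp_add[symmetric] algebra_simps)
      then show ?thesis using True assms
        by (auto simp: ennreal_mult'[symmetric] a_def max_def split: split_indicator)
    qed auto
  qed
  also have "\<dots> = ennreal (exp (\<phi> * (t - b) - (1 + \<phi>) * (a - b)) - exp (\<phi> * (t - b) - (1 + \<phi>) * (t - b)))"
    using a assms by (intro nn_integral_exp_Icc) auto
  also have "\<phi> * (t - b) - (1 + \<phi>) * (t - b) = - (t - b)" by (simp add: algebra_simps)
  finally have 1: "ennreal (1 + \<phi>) *
      (\<integral>\<^sup>+m. ennreal (of_bool (s < b + mE m \<and> b + mE m \<le> t) * exp (\<phi> * (t - (b + mE m)))) \<partial>L)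
    \<le> ennreal (exp (\<phi> * (t - b) - (1 + \<phi>) * (a - b)) - exp (- (t - b)))" .
  have alive: "(\<integral>\<^sup>+m. of_bool (b \<le> r \<and> r < b + mE m) \<partial>L) = ennreal (exp (- (r - b)))" if "b \<le> r" for r
  proof -
    have "(\<integral>\<^sup>+m. of_bool (b \<le> r \<and> r < b + mE m) \<partial>L) = (\<integral>\<^sup>+m. of_bool (r - b < mE m) \<partial>L)"
      using that by (intro nn_integral_cong) auto
    then show ?thesis using that by (simp add: nn_integral_mE_greater)
  qed
  have "exp (- (t - b)) \<le> exp (\<phi> * (t - b) - (1 + \<phi>) * (a - b))"
    using mult_left_mono[of "a - b" "t - b" "1 + \<phi>"] a assms by (simp add: algebra_simps)
  then have 2: "ennreal (exp (\<phi> * (t - b) - (1 + \<phi>) * (a - b)) - exp (- (t - b))) + ennreal (exp (- (t - b)))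
      = ennreal (exp (\<phi> * (t - b) - (1 + \<phi>) * (a - b)))"
    by (subst ennreal_plus[symmetric]) auto
  have 3: "ennreal (exp (\<phi> * (t - b) - (1 + \<phi>) * (a - b)))
      = ennreal (of_bool (s < b \<and> b \<le> t) * exp (\<phi> * (t - b)))
    + ennreal (exp (\<phi> * (t - s))) * (\<integral>\<^sup>+m. of_bool (b \<le> s \<and> s < b + mE m) \<partial>L)"
  proof (cases "s < b")
    case False
    have "exp (\<phi> * (t - b) - (1 + \<phi>) * (s - b)) = exp (\<phi> * (t - s)) * exp (- (s - b))"
      by (simp add: exp_add[symmetric] algebra_simps)
    then show ?thesis using False alive[of s] by (simp add: a_def ennreal_mult')
  qed (use True in \<open>simp add: a_def\<close>)
  have "ennreal (1 + \<phi>) *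
      (\<integral>\<^sup>+m. ennreal (of_bool (s < b + mE m \<and> b + mE m \<le> t) * exp (\<phi> * (t - (b + mE m)))) \<partial>L)
    + (\<integral>\<^sup>+m. of_bool (b \<le> t \<and> t < b + mE m) \<partial>L)
    \<le> ennreal (exp (\<phi> * (t - b) - (1 + \<phi>) * (a - b)) - exp (- (t - b))) + ennreal (exp (- (t - b)))"
    unfolding alive[OF True] by (rule add_right_mono[OF 1])
  also note 2
  also note 3
  finally show ?thesis .
qed

lemma measurable_alive_sum [measurable]: "alive_sum \<theta> t \<in> borel_measurable cfg_space"
proof -
  have [measurable]: "(\<lambda>\<kappa>. ev (\<lambda>m b w. ennreal (w powr \<theta>) * of_bool (b \<le> t \<and> t < b + mE m)) \<kappa> x)
      \<in> borel_measurable cfg_space" for x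
    by (rule measurable_ev) (unfold meas_fun_def case_prod_unfold, measurable)
  show ?thesis
    unfolding alive_sum_def[abs_def] by (rule borel_measurable_nn_integral_countable) measurable
qed

text \<open>Each vertex born at \<open>b \<in> (s, t]\<close> is credited with \<open>e\<^bsup>\<phi>(t - b)\<^esup>\<close>, its predicted contribution at time
  \<open>t\<close>, and each vertex alive at \<open>s\<close> with \<open>e\<^bsup>\<phi>(t - s)\<^esup>\<close>.  By \<open>offspring_balance\<close> the credits of a vertex pay
  for its own contribution at time \<open>t\<close> and for the credits of its children, so \<open>tree_telescope\<close>
  applies.  The extra term is the credit of the root, which is born after \<open>s\<close> only if \<open>s < 0\<close>.\<close>

lemma alive_sum_supermartingale:
  assumes Z: "past s Z" and st: "s \<le> t" and \<phi>: "wmom \<theta> = ennreal (1 + \<phi>)" "-1 \<le> \<phi>"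
  shows "(\<integral>\<^sup>+\<kappa>. Z \<kappa> * alive_sum \<theta> t \<kappa> \<partial>Q)
    \<le> ennreal (of_bool (s < 0 \<and> 0 \<le> t) * exp (\<phi> * t)) * (\<integral>\<^sup>+\<kappa>. Z \<kappa> \<partial>Q)
      + ennreal (exp (\<phi> * (t - s))) * (\<integral>\<^sup>+\<kappa>. Z \<kappa> * alive_sum \<theta> s \<kappa> \<partial>Q)"
proof -
  have [measurable]: "Z \<in> borel_measurable cfg_space" using Z by (simp add: past_def)
  define Fa where "Fa r m b w = ennreal (w powr \<theta>) * of_bool (b \<le> r \<and> r < b + mE m)"
    for r b w and m :: mark
  define G where "G b = ennreal (of_bool (s < b \<and> b \<le> t) * exp (\<phi> * (t - b)))" for b
  define FA where "FA m b w = ennreal (w powr \<theta>) * G b" for m :: mark and b w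
  \<comment> \<open>The factor is \<open>1\<close> almost surely wherever \<open>G\<close> is positive; it makes \<open>nn_integral_freeze\<close> applicable.\<close>
  define FA' where "FA' m b w = of_bool (s < b + mE m) * (ennreal (w powr \<theta>) * G b)" for m :: mark and b w
  define FS where "FS m b w = ennreal (w powr \<theta>) * ((\<Sum>i<mN m. ennreal (mA m i powr \<theta>)) * G (b + mE m))"
    for m :: mark and b w
  have Gm [measurable]: "G \<in> borel_measurable borel" unfolding G_def by measurable
  have mf: "meas_fun (Fa r)" "meas_fun FA" "meas_fun FA'" "meas_fun FS" for r
    unfolding meas_fun_def Fa_def FA_def FA'_def FS_def case_prod_unfold by measurable
  note [measurable] = mf[THEN measurable_ev]
  have [measurable]: "(\<lambda>m. \<Sum>i<mN m. ennreal (mA m i powr \<theta>)) \<in> borel_measurable mark_space"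
    by measurable
  define A where "A x = (\<integral>\<^sup>+\<kappa>. Z \<kappa> * ev FA \<kappa> x \<partial>Q)" for x
  define C where "C x = ennreal (exp (\<phi> * (t - s))) * (\<integral>\<^sup>+\<kappa>. Z \<kappa> * ev (Fa s) \<kappa> x \<partial>Q)" for x
  define D where "D x = (\<integral>\<^sup>+\<kappa>. Z \<kappa> * ev (Fa t) \<kappa> x \<partial>Q)" for x
  have step: "(\<integral>\<^sup>+i. A (i # x) \<partial>count_space UNIV) + D x \<le> A x + C x" for x
  proof -
    let ?Z = "\<lambda>\<kappa>. Z (\<kappa>(x := frozen s))"
    let ?b = "\<lambda>\<kappa>. bt \<kappa> x" and ?w = "\<lambda>\<kappa>. ennreal (wt \<kappa> x powr \<theta>)"
    have sumA: "(\<integral>\<^sup>+i. A (i # x) \<partial>count_space UNIV) = (\<integral>\<^sup>+\<kappa>. Z \<kappa> * ev FS \<kappa> x \<partial>Q)"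
    proof -
      have "(\<integral>\<^sup>+i. A (i # x) \<partial>count_space UNIV)
          = (\<integral>\<^sup>+\<kappa>. (\<integral>\<^sup>+i. Z \<kappa> * ev FA \<kappa> (i # x) \<partial>count_space UNIV) \<partial>Q)"
        unfolding A_def by (rule nn_integral_count_space_nn_integral[symmetric]) auto
      also have "\<dots> = (\<integral>\<^sup>+\<kappa>. Z \<kappa> * ev FS \<kappa> x \<partial>Q)"
      proof (rule nn_integral_cong_AE, use AE_good in eventually_elim)
        case (elim \<kappa>)
        then have pos: "\<And>i. 0 < mA (\<kappa> x) i" "0 \<le> wt \<kappa> x" using wt_nonneg by auto
        have summand: "ev FA \<kappa> (i # x) = ennreal (wt \<kappa> x powr \<theta>) * G (bt \<kappa> x + mE (\<kappa> x)) *
            (ennreal (mA (\<kappa> x) i powr \<theta>) * indicator {..<mN (\<kappa> x)} i)" for i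
          using pos less_imp_le[OF pos(1), of i]
          by (cases "i < mN (\<kappa> x)") (auto simp: ev_def FA_def powr_mult ennreal_mult' mult_ac)
        have S: "(\<integral>\<^sup>+i. ennreal (mA (\<kappa> x) i powr \<theta>) * indicator {..<mN (\<kappa> x)} i \<partial>count_space UNIV)
            = (\<Sum>i<mN (\<kappa> x). ennreal (mA (\<kappa> x) i powr \<theta>))"
          by (subst nn_integral_indicator_finite) auto
        have ac: "(z * (w * g)) * r = z * (w * (r * g))" for z w g r :: ennreal
          by (simp add: mult_ac)
        have "(\<integral>\<^sup>+i. Z \<kappa> * ev FA \<kappa> (i # x) \<partial>count_space UNIV)
            = (\<integral>\<^sup>+i. (Z \<kappa> * (ennreal (wt \<kappa> x powr \<theta>) * G (bt \<kappa> x + mE (\<kappa> x)))) *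
                (ennreal (mA (\<kappa> x) i powr \<theta>) * indicator {..<mN (\<kappa> x)} i) \<partial>count_space UNIV)"
          unfolding summand by (simp only: mult.assoc)
        also have "\<dots> = (Z \<kappa> * (ennreal (wt \<kappa> x powr \<theta>) * G (bt \<kappa> x + mE (\<kappa> x)))) *
            (\<integral>\<^sup>+i. ennreal (mA (\<kappa> x) i powr \<theta>) * indicator {..<mN (\<kappa> x)} i \<partial>count_space UNIV)"
          by (rule nn_integral_cmult) simp
        also have "\<dots> = Z \<kappa> * (ennreal (wt \<kappa> x powr \<theta>) *
            ((\<Sum>i<mN (\<kappa> x). ennreal (mA (\<kappa> x) i powr \<theta>)) * G (bt \<kappa> x + mE (\<kappa> x))))"
          unfolding S by (rule ac)
        finally show ?case by (simp only: ev_def FS_def)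
      qed
      finally show ?thesis .
    qed
    also have "\<dots> = (\<integral>\<^sup>+\<kappa>. ?Z \<kappa> * (\<integral>\<^sup>+m. FS m (bt \<kappa> x) (wt \<kappa> x) \<partial>L) \<partial>Q)"
      by (rule nn_integral_freeze[OF Z mf(4)]) (auto simp: FS_def G_def split: if_splits)
    also have "\<dots> = (\<integral>\<^sup>+\<kappa>. ?Z \<kappa> * (?w \<kappa> * (ennreal (1 + \<phi>) * (\<integral>\<^sup>+m. G (bt \<kappa> x + mE m) \<partial>L))) \<partial>Q)"
    proof (intro nn_integral_cong arg_cong2[where f = "(*)"] refl)
      fix \<kappa>
      have "(\<integral>\<^sup>+m. FS m (bt \<kappa> x) (wt \<kappa> x) \<partial>L)
          = ?w \<kappa> * (\<integral>\<^sup>+m. G (bt \<kappa> x + mE m) * (\<Sum>i<mN m. ennreal (mA m i powr \<theta>)) \<partial>L)"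
        unfolding FS_def by (subst nn_integral_cmult) (auto intro!: measurable_L simp: mult.commute)
      moreover have "(\<integral>\<^sup>+m. G (bt \<kappa> x + mE m) * (\<Sum>i<mN m. ennreal (mA m i powr \<theta>)) \<partial>L)
          = (\<integral>\<^sup>+m. G (bt \<kappa> x + mE m) \<partial>L) * wmom \<theta>"
        unfolding wmom_def
        using indep_vec[of "\<lambda>e. G (bt \<kappa> x + e)" "\<lambda>v. \<Sum>i<fst v. ennreal (snd (snd v) i powr \<theta>)"]
        by (simp add: mark_projections)
      ultimately show "(\<integral>\<^sup>+m. FS m (bt \<kappa> x) (wt \<kappa> x) \<partial>L)
          = ?w \<kappa> * (ennreal (1 + \<phi>) * (\<integral>\<^sup>+m. G (bt \<kappa> x + mE m) \<partial>L))"
        by (simp add: \<phi> mult.commute)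
    qed
    finally have 1: "(\<integral>\<^sup>+i. A (i # x) \<partial>count_space UNIV)
        = (\<integral>\<^sup>+\<kappa>. ?Z \<kappa> * (?w \<kappa> * (ennreal (1 + \<phi>) * (\<integral>\<^sup>+m. G (bt \<kappa> x + mE m) \<partial>L))) \<partial>Q)" .
    have frz: "(\<integral>\<^sup>+\<kappa>. Z \<kappa> * ev (Fa r) \<kappa> x \<partial>Q)
        = (\<integral>\<^sup>+\<kappa>. ?Z \<kappa> * (?w \<kappa> * (\<integral>\<^sup>+m. of_bool (bt \<kappa> x \<le> r \<and> r < bt \<kappa> x + mE m) \<partial>L)) \<partial>Q)"
      if "s \<le> r" for r
    proof -
      have "(\<integral>\<^sup>+\<kappa>. Z \<kappa> * ev (Fa r) \<kappa> x \<partial>Q) = (\<integral>\<^sup>+\<kappa>. ?Z \<kappa> * (\<integral>\<^sup>+m. Fa r m (bt \<kappa> x) (wt \<kappa> x) \<partial>L) \<partial>Q)"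
      proof (rule nn_integral_freeze[OF Z mf(1)])
        fix m :: mark and b w
        assume "Fa r m b w \<noteq> 0"
        then have "r < b + mE m" unfolding Fa_def by (cases "r < b + mE m") simp_all
        then show "s < b + mE m" using that by simp
      qed
      also have "\<dots> = (\<integral>\<^sup>+\<kappa>. ?Z \<kappa> * (?w \<kappa> * (\<integral>\<^sup>+m. of_bool (bt \<kappa> x \<le> r \<and> r < bt \<kappa> x + mE m) \<partial>L)) \<partial>Q)"
      proof (intro nn_integral_cong arg_cong2[where f = "(*)"] refl)
        fix \<kappa>
        show "(\<integral>\<^sup>+m. Fa r m (bt \<kappa> x) (wt \<kappa> x) \<partial>L)
            = ?w \<kappa> * (\<integral>\<^sup>+m. of_bool (bt \<kappa> x \<le> r \<and> r < bt \<kappa> x + mE m) \<partial>L)"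
          unfolding Fa_def by (rule nn_integral_cmult) (intro measurable_L, measurable)
      qed
      finally show ?thesis .
    qed
    have 2: "(\<integral>\<^sup>+\<kappa>. ?Z \<kappa> * (?w \<kappa> * G (bt \<kappa> x)) \<partial>Q) \<le> A x"
    proof -
      have "(\<integral>\<^sup>+\<kappa>. ?Z \<kappa> * (?w \<kappa> * G (bt \<kappa> x)) \<partial>Q)
          = (\<integral>\<^sup>+\<kappa>. ?Z \<kappa> * (\<integral>\<^sup>+m. FA' m (bt \<kappa> x) (wt \<kappa> x) \<partial>L) \<partial>Q)"
      proof (intro nn_integral_cong arg_cong2[where f = "(*)"] refl)
        fix \<kappa>
        have "AE m in L. FA' m (bt \<kappa> x) (wt \<kappa> x) = ?w \<kappa> * G (bt \<kappa> x)"
          using mE_pos by eventually_elim (auto simp: FA'_def G_def)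
        then have "(\<integral>\<^sup>+m. FA' m (bt \<kappa> x) (wt \<kappa> x) \<partial>L) = (\<integral>\<^sup>+m. ?w \<kappa> * G (bt \<kappa> x) \<partial>L)"
          by (intro nn_integral_cong_AE)
        then show "?w \<kappa> * G (bt \<kappa> x) = (\<integral>\<^sup>+m. FA' m (bt \<kappa> x) (wt \<kappa> x) \<partial>L)"
          by (simp add: emeasure_space_1)
      qed
      also have "\<dots> = (\<integral>\<^sup>+\<kappa>. Z \<kappa> * ev FA' \<kappa> x \<partial>Q)"
        by (rule nn_integral_freeze[OF Z mf(3), symmetric]) (auto simp: FA'_def split: if_splits)
      also have "\<dots> \<le> A x"
        unfolding A_def by (intro nn_integral_mono mult_left_mono) (auto simp: ev_def FA_def FA'_def)
      finally show ?thesis .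
    qed
    let ?B = "\<lambda>r \<kappa>. \<integral>\<^sup>+m. of_bool (bt \<kappa> x \<le> r \<and> r < bt \<kappa> x + mE m) \<partial>L :: ennreal"
    have [measurable]: "?B r \<in> borel_measurable cfg_space" for r
    proof -
      have "(\<lambda>z. of_bool (bt (fst z) x \<le> r \<and> r < bt (fst z) x + mE (snd z)) :: ennreal)
          \<in> borel_measurable (cfg_space \<Otimes>\<^sub>M mark_space)" by measurable
      then have "(\<lambda>z. of_bool (bt (fst z) x \<le> r \<and> r < bt (fst z) x + mE (snd z)) :: ennreal)
          \<in> borel_measurable (cfg_space \<Otimes>\<^sub>M L)"
        using measurable_cong_sets[OF sets_pair_measure_cong[OF refl sets_L] refl] by blast
      then show ?thesis
        using borel_measurable_nn_integral[of "\<lambda>\<kappa> m. of_bool (bt \<kappa> x \<le> r \<and> r < bt \<kappa> x + mE m)" cfg_space]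
        by (simp add: case_prod_unfold)
    qed
    have [measurable]: "(\<lambda>\<kappa>. \<integral>\<^sup>+m. G (bt \<kappa> x + mE m) \<partial>L) \<in> borel_measurable cfg_space"
    proof -
      have "(\<lambda>z. G (bt (fst z) x + mE (snd z))) \<in> borel_measurable (cfg_space \<Otimes>\<^sub>M mark_space)" by measurable
      then have "(\<lambda>z. G (bt (fst z) x + mE (snd z))) \<in> borel_measurable (cfg_space \<Otimes>\<^sub>M L)"
        using measurable_cong_sets[OF sets_pair_measure_cong[OF refl sets_L] refl] by blast
      then show ?thesis
        using borel_measurable_nn_integral[of "\<lambda>\<kappa> m. G (bt \<kappa> x + mE m)" cfg_space]
        by (simp add: case_prod_unfold)
    qed
    have "(\<integral>\<^sup>+i. A (i # x) \<partial>count_space UNIV) + D x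
        = (\<integral>\<^sup>+\<kappa>. ?Z \<kappa> * (?w \<kappa> * (ennreal (1 + \<phi>) * (\<integral>\<^sup>+m. G (bt \<kappa> x + mE m) \<partial>L) + ?B t \<kappa>)) \<partial>Q)"
      unfolding 1 D_def frz[OF st] by (subst nn_integral_add[symmetric]) (auto simp: distrib_left)
    also have "\<dots> \<le> (\<integral>\<^sup>+\<kappa>. ?Z \<kappa> * (?w \<kappa> * (G (bt \<kappa> x) + ennreal (exp (\<phi> * (t - s))) * ?B s \<kappa>)) \<partial>Q)"
    proof (rule nn_integral_mono_AE, use AE_good in eventually_elim)
      case (elim \<kappa>)
      then have "0 \<le> bt \<kappa> x" by (intro bt_nonneg) auto
      from offspring_balance[OF this st \<phi>(2)] show ?case
        unfolding G_def by (intro mult_left_mono) auto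
    qed
    also have "\<dots> = (\<integral>\<^sup>+\<kappa>. ?Z \<kappa> * (?w \<kappa> * G (bt \<kappa> x)) \<partial>Q)
        + ennreal (exp (\<phi> * (t - s))) * (\<integral>\<^sup>+\<kappa>. ?Z \<kappa> * (?w \<kappa> * ?B s \<kappa>) \<partial>Q)"
    proof -
      have ac: "z * (w * (g + r * b)) = z * (w * g) + r * (z * (w * b))" for z w g r b :: ennreal
        by (simp add: distrib_left mult_ac)
      show ?thesis
        unfolding ac by (subst nn_integral_add, measurable, subst nn_integral_cmult, measurable)
    qed
    also have "\<dots> \<le> A x + C x"
      unfolding C_def frz[OF order_refl] by (intro add_right_mono 2)
    finally show ?thesis .
  qed
  have swap: "(\<integral>\<^sup>+\<kappa>. Z \<kappa> * alive_sum \<theta> r \<kappa> \<partial>Q) = (\<integral>\<^sup>+x. \<integral>\<^sup>+\<kappa>. Z \<kappa> * ev (Fa r) \<kappa> x \<partial>Q \<partial>count_space UNIV)" for r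
    unfolding alive_sum_def Fa_def[symmetric, abs_def]
    by (subst nn_integral_count_space_nn_integral[symmetric]) (auto simp: nn_integral_cmult)
  have "(\<integral>\<^sup>+\<kappa>. Z \<kappa> * alive_sum \<theta> t \<kappa> \<partial>Q) = (\<integral>\<^sup>+x. D x \<partial>count_space UNIV)"
    unfolding swap D_def ..
  also have "\<dots> \<le> A [] + (\<integral>\<^sup>+x. C x \<partial>count_space UNIV)"
    by (rule tree_telescope) (rule step)
  also have "(\<integral>\<^sup>+x. C x \<partial>count_space UNIV)
      = ennreal (exp (\<phi> * (t - s))) * (\<integral>\<^sup>+\<kappa>. Z \<kappa> * alive_sum \<theta> s \<kappa> \<partial>Q)"
    unfolding swap C_def by (rule nn_integral_cmult) auto
  also have "A [] = ennreal (of_bool (s < 0 \<and> 0 \<le> t) * exp (\<phi> * t)) * (\<integral>\<^sup>+\<kappa>. Z \<kappa> \<partial>Q)"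
    unfolding A_def ev_def FA_def G_def
    by (simp add: nn_integral_multc mult.commute)
  finally show ?thesis .
qed

end

section \<open>Convergence in probability\<close>

context prob_space
begin

lemma conv_in_probI_AE:
  assumes [measurable]: "\<And>t. Y t \<in> borel_measurable M" "Z \<in> borel_measurable M"
    and lim: "AE \<omega> in M. ((\<lambda>t. Y t \<omega>) \<longlongrightarrow> Z \<omega>) at_top"
  shows "conv_in_prob M Y Z"
  unfolding conv_in_prob_def
proof (intro allI impI)
  fix \<epsilon> :: real assume "0 < \<epsilon>"
  have "((\<lambda>t. LINT \<omega>|M. indicator {\<omega> \<in> space M. \<epsilon> < \<bar>Y t \<omega> - Z \<omega>\<bar>} \<omega>)
      \<longlongrightarrow> (LINT \<omega>|M. (0::real))) at_top"
  proof (rule integral_dominated_convergence_at_top[where w = "\<lambda>_. 1"])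
    show "AE \<omega> in M. ((\<lambda>t. indicator {\<omega> \<in> space M. \<epsilon> < \<bar>Y t \<omega> - Z \<omega>\<bar>} \<omega>) \<longlongrightarrow> (0::real)) at_top"
      using lim
    proof eventually_elim
      case (elim \<omega>)
      then have "((\<lambda>t. \<bar>Y t \<omega> - Z \<omega>\<bar>) \<longlongrightarrow> \<bar>Z \<omega> - Z \<omega>\<bar>) at_top"
        by (intro tendsto_intros)
      then have "\<forall>\<^sub>F t in at_top. \<bar>Y t \<omega> - Z \<omega>\<bar> < \<epsilon>"
        using \<open>0 < \<epsilon>\<close> by (intro order_tendstoD(2)) auto
      then have "\<forall>\<^sub>F t in at_top. indicator {\<omega> \<in> space M. \<epsilon> < \<bar>Y t \<omega> - Z \<omega>\<bar>} \<omega> = (0::real)"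
        by eventually_elim (auto simp: indicator_def)
      then show ?case by (rule tendsto_eventually)
    qed
  qed (auto intro!: always_eventually AE_I2 simp: indicator_def)
  then show "((\<lambda>t. \<P>(\<omega> in M. \<epsilon> < \<bar>Y t \<omega> - Z \<omega>\<bar>)) \<longlongrightarrow> 0) at_top" by simp
qed

lemma conv_in_prob_add:
  assumes [measurable]: "\<And>t. Y t \<in> borel_measurable M" "Z \<in> borel_measurable M"
      "\<And>t. Y' t \<in> borel_measurable M" "Z' \<in> borel_measurable M"
    and lim: "conv_in_prob M Y Z" "conv_in_prob M Y' Z'"
  shows "conv_in_prob M (\<lambda>t \<omega>. Y t \<omega> + Y' t \<omega>) (\<lambda>\<omega>. Z \<omega> + Z' \<omega>)"
  unfolding conv_in_prob_def
proof (intro allI impI)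
  fix \<epsilon> :: real assume \<epsilon>: "0 < \<epsilon>"
  have le: "\<P>(\<omega> in M. \<epsilon> < \<bar>(Y t \<omega> + Y' t \<omega>) - (Z \<omega> + Z' \<omega>)\<bar>)
      \<le> \<P>(\<omega> in M. \<epsilon> / 2 < \<bar>Y t \<omega> - Z \<omega>\<bar>) + \<P>(\<omega> in M. \<epsilon> / 2 < \<bar>Y' t \<omega> - Z' \<omega>\<bar>)" for t
  proof -
    have "\<epsilon> / 2 < \<bar>Y t \<omega> - Z \<omega>\<bar> \<or> \<epsilon> / 2 < \<bar>Y' t \<omega> - Z' \<omega>\<bar>"
      if "\<epsilon> < \<bar>(Y t \<omega> + Y' t \<omega>) - (Z \<omega> + Z' \<omega>)\<bar>" for \<omega>
      using that by linarith
    then have "\<P>(\<omega> in M. \<epsilon> < \<bar>(Y t \<omega> + Y' t \<omega>) - (Z \<omega> + Z' \<omega>)\<bar>)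
        \<le> prob ({\<omega> \<in> space M. \<epsilon> / 2 < \<bar>Y t \<omega> - Z \<omega>\<bar>} \<union> {\<omega> \<in> space M. \<epsilon> / 2 < \<bar>Y' t \<omega> - Z' \<omega>\<bar>})"
      by (intro finite_measure_mono) (blast, measurable)
    also have "\<dots> \<le> \<P>(\<omega> in M. \<epsilon> / 2 < \<bar>Y t \<omega> - Z \<omega>\<bar>) + \<P>(\<omega> in M. \<epsilon> / 2 < \<bar>Y' t \<omega> - Z' \<omega>\<bar>)"
      by (intro measure_subadditive) auto
    finally show ?thesis .
  qed
  have sum: "((\<lambda>t. \<P>(\<omega> in M. \<epsilon> / 2 < \<bar>Y t \<omega> - Z \<omega>\<bar>) + \<P>(\<omega> in M. \<epsilon> / 2 < \<bar>Y' t \<omega> - Z' \<omega>\<bar>)) \<longlongrightarrow> 0 + 0) at_top"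
    using lim half_gt_zero[OF \<epsilon>] unfolding conv_in_prob_def by (intro tendsto_add) blast+
  show "((\<lambda>t. \<P>(\<omega> in M. \<epsilon> < \<bar>(Y t \<omega> + Y' t \<omega>) - (Z \<omega> + Z' \<omega>)\<bar>)) \<longlongrightarrow> 0) at_top"
    by (rule Lim_null_comparison[OF _ sum[simplified]]) (use le in simp)
qed

lemma prob_abs_greater_le_moment:
  assumes [measurable]: "X \<in> borel_measurable M" and "0 < p" "0 < \<epsilon>" "0 \<le> B"
    and le: "(\<integral>\<^sup>+\<omega>. ennreal (\<bar>X \<omega>\<bar> powr p) \<partial>M) \<le> ennreal B"
  shows "\<P>(\<omega> in M. \<epsilon> < \<bar>X \<omega>\<bar>) \<le> B / \<epsilon> powr p"
proof -
  have "ennreal (\<P>(\<omega> in M. \<epsilon> < \<bar>X \<omega>\<bar>)) = (\<integral>\<^sup>+\<omega>. indicator {\<omega> \<in> space M. \<epsilon> < \<bar>X \<omega>\<bar>} \<omega> \<partial>M)"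
    by (subst nn_integral_indicator) (auto simp: emeasure_eq_measure)
  also have "\<dots> \<le> (\<integral>\<^sup>+\<omega>. ennreal (1 / \<epsilon> powr p) * ennreal (\<bar>X \<omega>\<bar> powr p) \<partial>M)"
  proof (rule nn_integral_mono)
    fix \<omega>
    show "indicator {\<omega> \<in> space M. \<epsilon> < \<bar>X \<omega>\<bar>} \<omega> \<le> ennreal (1 / \<epsilon> powr p) * ennreal (\<bar>X \<omega>\<bar> powr p)"
    proof (cases "\<epsilon> < \<bar>X \<omega>\<bar>")
      case True
      then have "\<epsilon> powr p \<le> \<bar>X \<omega>\<bar> powr p" using assms by (intro powr_mono2) auto
      then have "ennreal 1 \<le> ennreal (1 / \<epsilon> powr p * \<bar>X \<omega>\<bar> powr p)"
        using assms by (intro ennreal_leI) (simp add: field_simps)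
      then have "1 \<le> ennreal (1 / \<epsilon> powr p) * ennreal (\<bar>X \<omega>\<bar> powr p)"
        by (subst ennreal_mult[symmetric]) (simp_all del: ennreal_le_1)
      then show ?thesis by (simp add: indicator_def)
    qed (simp add: indicator_def)
  qed
  also have "\<dots> = ennreal (1 / \<epsilon> powr p) * (\<integral>\<^sup>+\<omega>. ennreal (\<bar>X \<omega>\<bar> powr p) \<partial>M)"
    by (rule nn_integral_cmult) auto
  also have "\<dots> \<le> ennreal (1 / \<epsilon> powr p) * ennreal B" by (intro mult_left_mono le) auto
  also have "\<dots> = ennreal (B / \<epsilon> powr p)" using assms by (simp add: ennreal_mult'[symmetric])
  finally show ?thesis using assms by (subst (asm) ennreal_le_iff) auto
qed

lemma conv_in_probI_bound:
  assumes "\<And>\<epsilon>. 0 < \<epsilon> \<Longrightarrow> \<forall>\<^sub>F t in at_top. \<P>(\<omega> in M. \<epsilon> < \<bar>Y t \<omega> - Z \<omega>\<bar>) \<le> B \<epsilon> t"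
    and "\<And>\<epsilon>. 0 < \<epsilon> \<Longrightarrow> (B \<epsilon> \<longlongrightarrow> 0) at_top"
  shows "conv_in_prob M Y Z"
  unfolding conv_in_prob_def
proof (intro allI impI)
  fix \<epsilon> :: real assume "0 < \<epsilon>"
  then show "((\<lambda>t. \<P>(\<omega> in M. \<epsilon> < \<bar>Y t \<omega> - Z \<omega>\<bar>)) \<longlongrightarrow> 0) at_top"
    using assms(1)[of \<epsilon>] by (intro Lim_null_comparison[OF _ assms(2)[of \<epsilon>]]) auto
qed

lemma conv_in_probI_moment:
  assumes [measurable]: "\<And>t. Y t \<in> borel_measurable M" "Z \<in> borel_measurable M" and p: "0 < p"
    and le: "\<forall>\<^sub>F t in at_top. (\<integral>\<^sup>+\<omega>. ennreal (\<bar>Y t \<omega> - Z \<omega>\<bar> powr p) \<partial>M) \<le> ennreal (B t)"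
    and B: "\<And>t. 0 \<le> B t" "(B \<longlongrightarrow> 0) at_top"
  shows "conv_in_prob M Y Z"
proof (rule conv_in_probI_bound)
  fix \<epsilon> :: real assume \<epsilon>: "0 < \<epsilon>"
  show "\<forall>\<^sub>F t in at_top. \<P>(\<omega> in M. \<epsilon> < \<bar>Y t \<omega> - Z \<omega>\<bar>) \<le> B t / \<epsilon> powr p"
    using le by eventually_elim (rule prob_abs_greater_le_moment, use p \<epsilon> B in auto)
  show "((\<lambda>t. B t / \<epsilon> powr p) \<longlongrightarrow> 0) at_top"
    using tendsto_divide[OF B(2) tendsto_const[of "\<epsilon> powr p"]] \<epsilon> by simp
qed

lemma conv_in_prob_cong_AE:
  assumes [measurable]: "\<And>t. Y t \<in> borel_measurable M" "Z \<in> borel_measurable M"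
      "\<And>t. Y' t \<in> borel_measurable M" "Z' \<in> borel_measurable M"
    and eq: "\<And>t. AE \<omega> in M. Y t \<omega> = Y' t \<omega>" "AE \<omega> in M. Z \<omega> = Z' \<omega>"
    and lim: "conv_in_prob M Y Z"
  shows "conv_in_prob M Y' Z'"
proof -
  have "\<P>(\<omega> in M. \<epsilon> < \<bar>Y t \<omega> - Z \<omega>\<bar>) = \<P>(\<omega> in M. \<epsilon> < \<bar>Y' t \<omega> - Z' \<omega>\<bar>)" for \<epsilon> t
  proof (rule measure_eq_AE)
    show "AE \<omega> in M. \<omega> \<in> {\<omega> \<in> space M. \<epsilon> < \<bar>Y t \<omega> - Z \<omega>\<bar>} \<longleftrightarrow>
        \<omega> \<in> {\<omega> \<in> space M. \<epsilon> < \<bar>Y' t \<omega> - Z' \<omega>\<bar>}"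
      using eq(1)[of t] eq(2) by eventually_elim simp
  qed measurable
  then show ?thesis using lim by (simp add: conv_in_prob_def)
qed

lemma cmod_iexp_diff_le: "cmod (iexp x - iexp y) \<le> min 2 \<bar>x - y\<bar>"
proof -
  have "cmod (iexp x - iexp y) = cmod (iexp y * (iexp (x - y) - 1))"
    by (simp add: algebra_simps exp_add[symmetric])
  also have "\<dots> = cmod (iexp (x - y) - 1)" by (simp add: norm_mult)
  finally have "cmod (iexp x - iexp y) \<le> \<bar>x - y\<bar>"
    using iexp_approx1[of "x - y" 0] by simp
  moreover have "cmod (iexp x - iexp y) \<le> 2"
    using norm_triangle_ineq4[of "iexp x" "iexp y"] by simp
  ultimately show ?thesis by simp
qed

text \<open>The integrand changes by at most \<open>\<bar>\<xi>\<bar> \<epsilon>\<close> off the event that \<open>Y t\<close> and \<open>Z\<close> differ by more than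
  \<open>\<epsilon>\<close>, and by at most \<open>2\<close> on it.\<close>

lemma conv_in_prob_imp_char:
  assumes [measurable]: "\<And>t. Y t \<in> borel_measurable M" "Z \<in> borel_measurable M"
    and lim: "conv_in_prob M Y Z"
  shows "((\<lambda>t. CLINT \<omega>|M. iexp (\<xi> * Y t \<omega>)) \<longlongrightarrow> (CLINT \<omega>|M. iexp (\<xi> * Z \<omega>))) at_top"
proof (rule tendstoI)
  fix e :: real assume e: "0 < e"
  define \<delta> where "\<delta> = e / (2 * (\<bar>\<xi>\<bar> + 1))"
  have \<delta>: "0 < \<delta>" "\<bar>\<xi>\<bar> * \<delta> \<le> e / 2"
    using e by (auto simp: \<delta>_def field_simps)
  have int: "integrable M (\<lambda>\<omega>. iexp (\<xi> * U \<omega>))" if [measurable]: "U \<in> borel_measurable M" for U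
    by (rule integrable_const_bound[where B = 1]) auto
  have "\<forall>\<^sub>F t in at_top. \<P>(\<omega> in M. \<delta> < \<bar>Y t \<omega> - Z \<omega>\<bar>) < e / 4"
    using lim \<delta> e unfolding conv_in_prob_def by (intro order_tendstoD(2)[of _ 0]) auto
  then show "\<forall>\<^sub>F t in at_top. dist (CLINT \<omega>|M. iexp (\<xi> * Y t \<omega>)) (CLINT \<omega>|M. iexp (\<xi> * Z \<omega>)) < e"
  proof eventually_elim
    case (elim t)
    let ?A = "{\<omega> \<in> space M. \<delta> < \<bar>Y t \<omega> - Z \<omega>\<bar>}"
    have "dist (CLINT \<omega>|M. iexp (\<xi> * Y t \<omega>)) (CLINT \<omega>|M. iexp (\<xi> * Z \<omega>))
        = cmod (CLINT \<omega>|M. iexp (\<xi> * Y t \<omega>) - iexp (\<xi> * Z \<omega>))"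
      using int by (subst Bochner_Integration.integral_diff) (auto simp: dist_norm)
    also have "\<dots> \<le> (LINT \<omega>|M. cmod (iexp (\<xi> * Y t \<omega>) - iexp (\<xi> * Z \<omega>)))"
      by (rule integral_norm_bound)
    also have "\<dots> \<le> (LINT \<omega>|M. \<bar>\<xi>\<bar> * \<delta> + 2 * indicator ?A \<omega>)"
    proof (rule integral_mono)
      show "integrable M (\<lambda>\<omega>. cmod (iexp (\<xi> * Y t \<omega>) - iexp (\<xi> * Z \<omega>)))"
        using int by (intro integrable_norm Bochner_Integration.integrable_diff) auto
      show "integrable M (\<lambda>\<omega>. \<bar>\<xi>\<bar> * \<delta> + 2 * indicator ?A \<omega>)"
        by (intro Bochner_Integration.integrable_add integrable_mult_right integrable_real_indicator)
          (auto simp: emeasure_eq_measure)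
      fix \<omega> assume "\<omega> \<in> space M"
      show "cmod (iexp (\<xi> * Y t \<omega>) - iexp (\<xi> * Z \<omega>)) \<le> \<bar>\<xi>\<bar> * \<delta> + 2 * indicator ?A \<omega>"
      proof (cases "\<delta> < \<bar>Y t \<omega> - Z \<omega>\<bar>")
        case True
        have "0 \<le> \<bar>\<xi>\<bar> * \<delta>" using \<delta> by auto
        then show ?thesis
          using True cmod_iexp_diff_le[of "\<xi> * Y t \<omega>" "\<xi> * Z \<omega>"] \<open>\<omega> \<in> space M\<close> by simp
      next
        case False
        have "\<bar>\<xi> * Y t \<omega> - \<xi> * Z \<omega>\<bar> = \<bar>\<xi>\<bar> * \<bar>Y t \<omega> - Z \<omega>\<bar>"
          by (simp add: abs_mult[symmetric] right_diff_distrib)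
        also have "\<dots> \<le> \<bar>\<xi>\<bar> * \<delta>" using False by (intro mult_left_mono) auto
        finally show ?thesis
          using False cmod_iexp_diff_le[of "\<xi> * Y t \<omega>" "\<xi> * Z \<omega>"] by simp
      qed
    qed
    also have "\<dots> = \<bar>\<xi>\<bar> * \<delta> + 2 * prob ?A"
      by (subst Bochner_Integration.integral_add) (auto simp: prob_space emeasure_eq_measure)
    also have "\<dots> < e" using \<delta> elim by linarith
    finally show ?case .
  qed
qed

lemma indep_varI_nn_integral:
  fixes X Y :: "'a \<Rightarrow> real"
  assumes [measurable]: "X \<in> borel_measurable M" "Y \<in> borel_measurable M"
    and prod: "\<And>f g. f \<in> borel_measurable borel \<Longrightarrow> g \<in> borel_measurable borel \<Longrightarrow>
      (\<integral>\<^sup>+\<omega>. f (X \<omega>) * g (Y \<omega>) \<partial>M) = (\<integral>\<^sup>+\<omega>. f (X \<omega>) \<partial>M) * (\<integral>\<^sup>+\<omega>. g (Y \<omega>) \<partial>M)"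
  shows "indep_var borel X borel Y"
proof -
  have "distr M borel X \<Otimes>\<^sub>M distr M borel Y = distr M (borel \<Otimes>\<^sub>M borel) (\<lambda>\<omega>. (X \<omega>, Y \<omega>))"
  proof (rule pair_measure_eqI)
    fix A B assume "A \<in> sets (distr M borel X)" "B \<in> sets (distr M borel Y)"
    then have [measurable]: "A \<in> sets borel" "B \<in> sets borel" by auto
    have "emeasure (distr M (borel \<Otimes>\<^sub>M borel) (\<lambda>\<omega>. (X \<omega>, Y \<omega>))) (A \<times> B)
        = (\<integral>\<^sup>+z. indicator (A \<times> B) z \<partial>distr M (borel \<Otimes>\<^sub>M borel) (\<lambda>\<omega>. (X \<omega>, Y \<omega>)))"
      by (subst nn_integral_indicator) auto
    also have "\<dots> = (\<integral>\<^sup>+\<omega>. indicator A (X \<omega>) * indicator B (Y \<omega>) \<partial>M)"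
      by (subst nn_integral_distr) (auto simp: indicator_times)
    also have "\<dots> = (\<integral>\<^sup>+\<omega>. indicator A (X \<omega>) \<partial>M) * (\<integral>\<^sup>+\<omega>. indicator B (Y \<omega>) \<partial>M)"
      by (rule prod) auto
    also have "(\<integral>\<^sup>+\<omega>. indicator A (X \<omega>) \<partial>M) = emeasure (distr M borel X) A"
      by (subst nn_integral_distr[symmetric, of X M borel]) auto
    also have "(\<integral>\<^sup>+\<omega>. indicator B (Y \<omega>) \<partial>M) = emeasure (distr M borel Y) B"
      by (subst nn_integral_distr[symmetric, of Y M borel]) auto
    finally show "emeasure (distr M borel X) A * emeasure (distr M borel Y) B
        = emeasure (distr M (borel \<Otimes>\<^sub>M borel) (\<lambda>\<omega>. (X \<omega>, Y \<omega>))) (A \<times> B)" ..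
  qed (auto intro!: prob_space_imp_sigma_finite prob_space_distr)
  then show ?thesis by (simp add: indep_var_distribution_eq)
qed

end

section \<open>The branching random walk in terms of the coordinate process\<close>

abbreviation crd :: "nat list \<Rightarrow> configuration \<Rightarrow> mark" where
  "crd \<equiv> \<lambda>x \<kappa>. \<kappa> x"

lemma birth_crd: "birth crd \<kappa> x = bt \<kappa> x"
  by (induction x) auto

lemma death_crd: "death crd \<kappa> x = bt \<kappa> x + mE (\<kappa> x)"
  by (simp add: death_def birth_crd)

lemma Cons_mem_tree_iff: "i # x \<in> tree X \<omega> \<longleftrightarrow> x \<in> tree X \<omega> \<and> i < mN (X x \<omega>)"
  by (subst tree.simps) auto

lemma wt_eq_exp_pos:
  assumes "\<forall>x k. 0 < mA (\<kappa> x) k"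
  shows "wt \<kappa> x = (if x \<in> tree crd \<kappa> then exp (pos crd \<kappa> x) else 0)"
  using assms by (induction x) (auto simp: tree.root Cons_mem_tree_iff exp_add)

lemma infsum_subset_eq:
  fixes f :: "'i \<Rightarrow> real"
  shows "(\<Sum>\<^sub>\<infinity>x\<in>A. f x) = (\<Sum>\<^sub>\<infinity>x. of_bool (x \<in> A) * f x)"
  by (rule infsum_cong_neutral) auto

lemma infsum_alive_eq:
  assumes "\<forall>x k. 0 < mA (\<kappa> x) k"
  shows "(\<Sum>\<^sub>\<infinity>x\<in>alive crd \<kappa> t. exp (pos crd \<kappa> x) * f (\<kappa> x))
    = vsum (\<lambda>m b w. w * f m * of_bool (b \<le> t \<and> t < b + mE m)) \<kappa>"
  unfolding vsum_def infsum_subset_eq[of _ "alive crd \<kappa> t"]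
  by (intro infsum_cong) (auto simp: ev_def wt_eq_exp_pos[OF assms] alive_def birth_crd death_crd)

lemma infsum_dead_eq:
  assumes "\<forall>x k. 0 < mA (\<kappa> x) k"
  shows "(\<Sum>\<^sub>\<infinity>x\<in>dead crd \<kappa> t. exp (pos crd \<kappa> x) * f (\<kappa> x))
    = vsum (\<lambda>m b w. w * f m * of_bool (b + mE m \<le> t)) \<kappa>"
  unfolding vsum_def infsum_subset_eq[of _ "dead crd \<kappa> t"]
  by (intro infsum_cong) (auto simp: ev_def wt_eq_exp_pos[OF assms] dead_def death_crd)

lemma measurable_tree [measurable]: "Measurable.pred cfg_space (\<lambda>\<kappa>. x \<in> tree crd \<kappa>)"
  by (induction x) (auto simp: tree.root Cons_mem_tree_iff)

lemma measurable_pos [measurable]: "(\<lambda>\<kappa>. pos crd \<kappa> x) \<in> borel_measurable cfg_space"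
  by (induction x) auto

lemma measurable_Cproc [measurable]: "Cproc crd t \<in> borel_measurable cfg_space"
proof -
  have "(\<lambda>\<kappa>. \<Sum>\<^sub>\<infinity>x. of_bool (x \<in> dead crd \<kappa> t) * (exp (pos crd \<kappa> x) * mC (\<kappa> x))) \<in> borel_measurable cfg_space"
    unfolding dead_def death_crd mem_Collect_eq by (intro borel_measurable_infsum) measurable
  then show ?thesis unfolding Cproc_def[abs_def] by (subst infsum_subset_eq)
qed

lemma measurable_Wproc [measurable]: "Wproc crd t \<in> borel_measurable cfg_space"
proof -
  have "(\<lambda>\<kappa>. \<Sum>\<^sub>\<infinity>x. of_bool (x \<in> alive crd \<kappa> t) * (exp (pos crd \<kappa> x) * mR (\<kappa> x))) \<in> borel_measurable cfg_space"
    unfolding alive_def death_crd birth_crd mem_Collect_eq by (intro borel_measurable_infsum) measurable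
  then have [measurable]: "(\<lambda>\<kappa>. \<Sum>\<^sub>\<infinity>x\<in>alive crd \<kappa> t. exp (pos crd \<kappa> x) * mR (\<kappa> x)) \<in> borel_measurable cfg_space"
    by (subst infsum_subset_eq)
  show ?thesis unfolding Wproc_def[abs_def] by measurable
qed

context mark_law
begin

definition Rpart :: "real \<Rightarrow> mark \<Rightarrow> real \<Rightarrow> real \<Rightarrow> real" where
  "Rpart t m b w = w * mR m * of_bool (b \<le> t \<and> t < b + mE m)"

definition Cpart :: "real \<Rightarrow> mark \<Rightarrow> real \<Rightarrow> real \<Rightarrow> real" where
  "Cpart t m b w = w * mC m * of_bool (b + mE m \<le> t)"

lemma meas_fun_parts: "meas_fun (Rpart t)" "meas_fun (Cpart t)"
  unfolding meas_fun_def Rpart_def Cpart_def case_prod_unfold by measurable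

lemma AE_Cproc: "AE \<kappa> in Q. \<forall>t. Cproc crd t \<kappa> = vsum (Cpart t) \<kappa>"
  using AE_good
proof eventually_elim
  case (elim \<kappa>)
  then have "\<forall>x k. 0 < mA (\<kappa> x) k" by auto
  from infsum_dead_eq[OF this, where f = mC] show ?case
    by (simp add: Cproc_def Cpart_def[abs_def])
qed

lemma AE_Wproc: "AE \<kappa> in Q. \<forall>t. Wproc crd t \<kappa> = vsum (Rpart t) \<kappa> + vsum (Cpart t) \<kappa>"
  using AE_good AE_Cproc
proof eventually_elim
  case (elim \<kappa>)
  then have "\<forall>x k. 0 < mA (\<kappa> x) k" by auto
  from infsum_alive_eq[OF this, where f = mR] elim(2) show ?case
    by (simp add: Wproc_def Rpart_def[abs_def])
qed

lemma AE_Mart: "AE \<kappa> in Q. \<forall>t. Mart crd \<Phi> 1 t \<kappa> = exp (- \<Phi> * t) * enn2real (alive_sum 1 t \<kappa>)"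
  using AE_good
proof eventually_elim
  case (elim \<kappa>)
  then have A: "\<forall>x k. 0 < mA (\<kappa> x) k" by auto
  have "vsum (\<lambda>m b w. w * 1 * of_bool (b \<le> t \<and> t < b + mE m)) \<kappa> = enn2real (alive_sum 1 t \<kappa>)" for t
  proof -
    have "vsum (\<lambda>m b w. w * 1 * of_bool (b \<le> t \<and> t < b + mE m)) \<kappa>
        = enn2real (\<integral>\<^sup>+x. ennreal (ev (\<lambda>m b w. w * 1 * of_bool (b \<le> t \<and> t < b + mE m)) \<kappa> x) \<partial>count_space UNIV)"
      unfolding vsum_def infsum_eq_lebesgue_integral
      by (rule integral_eq_nn_integral) (auto simp: ev_def wt_nonneg[OF A])
    also have "(\<integral>\<^sup>+x. ennreal (ev (\<lambda>m b w. w * 1 * of_bool (b \<le> t \<and> t < b + mE m)) \<kappa> x) \<partial>count_space UNIV)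
        = alive_sum 1 t \<kappa>"
      unfolding alive_sum_def
      by (intro nn_integral_cong) (auto simp: ev_def wt_nonneg[OF A] powr_one)
    finally show ?thesis .
  qed
  then show ?case
    using infsum_alive_eq[OF A, where f = "\<lambda>_. 1"] by (simp add: Mart_def)
qed

section \<open>Independence of the lifetime\<close>

text \<open>The estimates below apply to \<open>f = mC\<close> and \<open>f = mR\<close> alike; this is what the two variables share.\<close>

definition indep_life :: "(mark \<Rightarrow> real) \<Rightarrow> bool" where
  "indep_life f \<longleftrightarrow> f \<in> borel_measurable mark_space \<and>
    (\<forall>g h. g \<in> borel_measurable borel \<longrightarrow> h \<in> borel_measurable borel \<longrightarrow>
      (\<integral>\<^sup>+m. g (mE m) * h (f m) \<partial>L) = (\<integral>\<^sup>+m. g (mE m) \<partial>L) * (\<integral>\<^sup>+m. h (f m) \<partial>L))"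

lemma indep_life_mC: "indep_life mC"
  unfolding indep_life_def mark_projections(4)[abs_def]
proof (intro conjI allI impI)
  fix g h :: "real \<Rightarrow> ennreal" assume [measurable]: "g \<in> borel_measurable borel" "h \<in> borel_measurable borel"
  show "(\<integral>\<^sup>+m. g (mE m) * h (fst (snd (vec_of m))) \<partial>L)
      = (\<integral>\<^sup>+m. g (mE m) \<partial>L) * (\<integral>\<^sup>+m. h (fst (snd (vec_of m))) \<partial>L)"
    by (rule indep_vec[of g "\<lambda>v. h (fst (snd v))"]) measurable
qed measurable

lemma indep_life_mR: "indep_life mR"
  unfolding indep_life_def using indep_R by auto

lemma indep_life_compose: "indep_life f \<Longrightarrow> k \<in> borel_measurable borel \<Longrightarrow> indep_life (\<lambda>m. k (f m))"
  unfolding indep_life_def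
proof (elim conjE, intro conjI allI impI)
  fix g h :: "real \<Rightarrow> ennreal"
  assume k: "k \<in> borel_measurable borel" and g: "g \<in> borel_measurable borel" and h: "h \<in> borel_measurable borel"
    and f: "\<forall>g h. g \<in> borel_measurable borel \<longrightarrow> h \<in> borel_measurable borel \<longrightarrow>
      (\<integral>\<^sup>+m. g (mE m) * h (f m) \<partial>L) = (\<integral>\<^sup>+m. g (mE m) \<partial>L) * (\<integral>\<^sup>+m. h (f m) \<partial>L)"
  show "(\<integral>\<^sup>+m. g (mE m) * h (k (f m)) \<partial>L) = (\<integral>\<^sup>+m. g (mE m) \<partial>L) * (\<integral>\<^sup>+m. h (k (f m)) \<partial>L)"
    by (rule f[rule_format, OF g, of "\<lambda>x. h (k x)"]) (rule measurable_compose[OF k h])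
qed (auto intro: measurable_compose)

lemma indep_life_nn_integral:
  assumes "indep_life f" "g \<in> borel_measurable borel" "h \<in> borel_measurable borel"
  shows "(\<integral>\<^sup>+m. g (mE m) * h (f m) \<partial>L) = (\<integral>\<^sup>+m. g (mE m) \<partial>L) * (\<integral>\<^sup>+m. h (f m) \<partial>L)"
  using assms by (simp add: indep_life_def)

lemma indep_life_integral:
  assumes f: "indep_life f" "integrable L f" and [measurable]: "h \<in> borel_measurable borel"
    and h: "integrable L (\<lambda>m. h (mE m))"
  shows "integrable L (\<lambda>m. h (mE m) * f m)"
    and "(LINT m|L. h (mE m) * f m) = (LINT m|L. h (mE m)) * (LINT m|L. f m)"
proof -
  have "indep_var borel mE borel f"
    using f by (intro indep_varI_nn_integral) (auto simp: indep_life_def intro!: measurable_L)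
  then have "indep_var borel (h \<circ> mE) borel (id \<circ> f)"
    by (rule indep_var_compose) auto
  then have ind: "indep_var borel (\<lambda>m. h (mE m)) borel f" by (simp add: comp_def)
  show "integrable L (\<lambda>m. h (mE m) * f m)"
    by (rule indep_var_integrable[OF ind h f(2)])
  show "(LINT m|L. h (mE m) * f m) = (LINT m|L. h (mE m)) * (LINT m|L. f m)"
    by (rule indep_var_lebesgue_integral[OF ind h f(2)])
qed

lemma integrable_of_bool_mE:
  assumes [measurable]: "Measurable.pred borel P"
  shows "integrable L (\<lambda>m. of_bool (P (mE m)) :: real)"
  by (rule integrable_const_bound[where B = 1]) (auto intro!: measurable_L)

section \<open>Bounds for sums over the tree\<close>

lemma emeasure_Q_UNIV [simp]: "emeasure Q UNIV = 1"
  using Q.emeasure_space_1 by simp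

lemma past_const: "past s (\<lambda>_. c)"
  by (simp add: past_def)

lemma nn_integral_alive:
  assumes "b \<le> r"
  shows "(\<integral>\<^sup>+m. of_bool (b \<le> r \<and> r < b + mE m) \<partial>L) = ennreal (exp (b - r))"
proof -
  have "(\<integral>\<^sup>+m. of_bool (b \<le> r \<and> r < b + mE m) \<partial>L) = (\<integral>\<^sup>+m. of_bool (r - b < mE m) \<partial>L)"
    using assms by (intro nn_integral_cong) auto
  then show ?thesis using nn_integral_mE_greater[of "r - b"] assms by simp
qed

lemma nn_integral_alive_sum_le:
  assumes "0 \<le> t" "wmom \<theta> = ennreal (1 + \<phi>)" "-1 \<le> \<phi>"
  shows "(\<integral>\<^sup>+\<kappa>. alive_sum \<theta> t \<kappa> \<partial>Q) \<le> ennreal (exp (\<phi> * t))"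
proof -
  have "AE \<kappa> in Q. alive_sum \<theta> (-1) \<kappa> = 0"
    using AE_good
  proof eventually_elim
    case (elim \<kappa>)
    then have b: "0 \<le> bt \<kappa> x" for x by (intro bt_nonneg) auto
    have "\<not> bt \<kappa> x \<le> -1" for x using b[of x] by linarith
    then show ?case by (simp add: alive_sum_def ev_def)
  qed
  then have "(\<integral>\<^sup>+\<kappa>. 1 * alive_sum \<theta> (-1) \<kappa> \<partial>Q) = (\<integral>\<^sup>+\<kappa>. 0 \<partial>Q)"
    by (intro nn_integral_cong_AE) auto
  then show ?thesis
    using alive_sum_supermartingale[OF past_const[of "-1" 1], of t \<theta> \<phi>] assms by simp
qed

text \<open>The probability that a vertex born at \<open>b\<close> is alive at time \<open>t\<close>, for \<open>b \<le> t\<close>.\<close>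

abbreviation recent :: "real \<Rightarrow> real \<Rightarrow> real" where
  "recent t b \<equiv> of_bool (b \<le> t) * exp (b - t)"

text \<open>The left side is the mean alive sum at time \<open>t\<close>, with the lifetimes integrated out.\<close>

lemma treesum_recent_le:
  assumes "0 \<le> t" "wmom \<theta> = ennreal (1 + \<phi>)" "-1 \<le> \<phi>"
  shows "treesum \<theta> (\<lambda>b. ennreal (recent t b)) \<le> ennreal (exp (\<phi> * t))"
proof -
  let ?F = "\<lambda>m b w. ennreal (w powr \<theta>) * of_bool (b \<le> t \<and> t < b + mE m) :: ennreal"
  have F: "meas_fun ?F" unfolding meas_fun_def case_prod_unfold by measurable
  note [measurable] = measurable_ev[OF F]
  have "treesum \<theta> (\<lambda>b. ennreal (recent t b))
      = (\<integral>\<^sup>+x. \<integral>\<^sup>+\<kappa>. ennreal (wt \<kappa> x powr \<theta>) * ennreal (recent t (bt \<kappa> x)) \<partial>Q \<partial>count_space UNIV)"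
    unfolding treesum_def by (subst nn_integral_count_space_nn_integral) auto
  also have "\<dots> = (\<integral>\<^sup>+x. \<integral>\<^sup>+\<kappa>. \<integral>\<^sup>+m. ?F m (bt \<kappa> x) (wt \<kappa> x) \<partial>L \<partial>Q \<partial>count_space UNIV)"
  proof (intro nn_integral_cong)
    fix x \<kappa>
    have "(\<integral>\<^sup>+m. ?F m (bt \<kappa> x) (wt \<kappa> x) \<partial>L)
        = ennreal (wt \<kappa> x powr \<theta>) * (\<integral>\<^sup>+m. of_bool (bt \<kappa> x \<le> t \<and> t < bt \<kappa> x + mE m) \<partial>L)"
      by (rule nn_integral_cmult) (intro measurable_L, measurable)
    also have "(\<integral>\<^sup>+m. of_bool (bt \<kappa> x \<le> t \<and> t < bt \<kappa> x + mE m) \<partial>L) = ennreal (recent t (bt \<kappa> x))"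
      using nn_integral_alive[of "bt \<kappa> x" t] by (cases "bt \<kappa> x \<le> t") auto
    finally show "ennreal (wt \<kappa> x powr \<theta>) * ennreal (recent t (bt \<kappa> x))
        = (\<integral>\<^sup>+m. ?F m (bt \<kappa> x) (wt \<kappa> x) \<partial>L)" ..
  qed
  also have "\<dots> = (\<integral>\<^sup>+x. \<integral>\<^sup>+\<kappa>. ev ?F \<kappa> x \<partial>Q \<partial>count_space UNIV)"
    by (simp only: nn_integral_ev[OF F])
  also have "\<dots> = (\<integral>\<^sup>+\<kappa>. alive_sum \<theta> t \<kappa> \<partial>Q)"
    unfolding alive_sum_def by (subst nn_integral_count_space_nn_integral) auto
  also have "\<dots> \<le> ennreal (exp (\<phi> * t))" by (rule nn_integral_alive_sum_le[OF assms])
  finally show ?thesis .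
qed

lemma treesum_mono:
  assumes "\<And>b. 0 \<le> b \<Longrightarrow> g b \<le> h b"
  shows "treesum \<theta> g \<le> treesum \<theta> h"
  unfolding treesum_def
proof (rule nn_integral_mono_AE, use AE_good in eventually_elim)
  case (elim \<kappa>)
  then show ?case by (intro nn_integral_mono mult_left_mono assms bt_nonneg) auto
qed

lemma treesum_cmult:
  assumes [measurable]: "g \<in> borel_measurable borel"
  shows "treesum \<theta> (\<lambda>b. c * g b) = c * treesum \<theta> g"
proof -
  have "treesum \<theta> (\<lambda>b. c * g b)
      = (\<integral>\<^sup>+\<kappa>. c * (\<integral>\<^sup>+x. ennreal (wt \<kappa> x powr \<theta>) * g (bt \<kappa> x) \<partial>count_space UNIV) \<partial>Q)"
    unfolding treesum_def by (simp add: nn_integral_cmult[symmetric] mult.left_commute)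
  also have "\<dots> = c * treesum \<theta> g"
    unfolding treesum_def
    by (intro nn_integral_cmult borel_measurable_nn_integral_countable) measurable
  finally show ?thesis .
qed

lemma treesum_sum:
  assumes [measurable]: "\<And>k. g k \<in> borel_measurable borel"
  shows "treesum \<theta> (\<lambda>b. \<Sum>k\<in>I. g k b) = (\<Sum>k\<in>I. treesum \<theta> (g k))"
proof -
  have "treesum \<theta> (\<lambda>b. \<Sum>k\<in>I. g k b)
      = (\<integral>\<^sup>+\<kappa>. (\<Sum>k\<in>I. \<integral>\<^sup>+x. ennreal (wt \<kappa> x powr \<theta>) * g k (bt \<kappa> x) \<partial>count_space UNIV) \<partial>Q)"
    unfolding treesum_def by (simp add: nn_integral_sum[symmetric] sum_distrib_left)
  also have "\<dots> = (\<Sum>k\<in>I. treesum \<theta> (g k))"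
    unfolding treesum_def
    by (intro nn_integral_sum borel_measurable_nn_integral_countable) measurable
  finally show ?thesis .
qed

text \<open>A vertex born at most one unit of time before \<open>k\<close> is still alive at \<open>k\<close> with probability at least \<open>e\<^sup>-\<^sup>1\<close>.
  Every vertex born before \<open>t\<close> was born within one unit of time before some integer
  \<open>k \<le> \<lceil>t\<rceil>\<close>, so the total weight up to time \<open>t\<close> is a geometric sum.\<close>

lemma treesum_born_le:
  fixes \<phi> :: real
  assumes "0 \<le> t" and \<phi>: "wmom \<theta> = ennreal (1 + \<phi>)" "-1 \<le> \<phi>"
  shows "treesum \<theta> (\<lambda>b. of_bool (b \<le> t)) \<le> ennreal (exp 1 * (\<Sum>k\<le>nat \<lceil>t\<rceil>. exp (\<phi> * k)))"
proof -
  have "treesum \<theta> (\<lambda>b. of_bool (b \<le> t))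
      \<le> treesum \<theta> (\<lambda>b. ennreal (exp 1) * (\<Sum>k\<le>nat \<lceil>t\<rceil>. ennreal (recent (real k) b)))"
  proof (rule treesum_mono)
    fix b :: real assume b: "0 \<le> b"
    show "of_bool (b \<le> t) \<le> ennreal (exp 1) * (\<Sum>k\<le>nat \<lceil>t\<rceil>. ennreal (recent (real k) b))"
    proof (cases "b \<le> t")
      case True
      let ?k = "nat \<lceil>b\<rceil>"
      have "b \<le> real (nat \<lceil>t\<rceil>)" using True real_nat_ceiling_ge[of t] by linarith
      then have kt: "?k \<in> {..nat \<lceil>t\<rceil>}" by simp
      have k: "b \<le> real ?k" "real ?k \<le> b + 1"
        using nat_ceiling_le_add_one[OF b] real_nat_ceiling_ge[of b] by auto
      have "exp (b - real ?k) \<ge> exp (- 1)" using k by simp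
      then have "exp 1 * exp (- 1) \<le> exp 1 * exp (b - real ?k)" by (intro mult_left_mono) auto
      then have "1 \<le> exp 1 * recent (real ?k) b" using k by (simp add: exp_add[symmetric])
      then have "1 \<le> ennreal (exp 1) * ennreal (recent (real ?k) b)"
        by (subst ennreal_mult[symmetric]) auto
      also have "\<dots> \<le> ennreal (exp 1) * (\<Sum>k\<le>nat \<lceil>t\<rceil>. ennreal (recent (real k) b))"
        using member_le_sum[OF kt, of "\<lambda>k. ennreal (recent (real k) b)"]
        by (intro mult_left_mono) auto
      finally show ?thesis using True by simp
    qed simp
  qed
  also have "\<dots> = ennreal (exp 1) * (\<Sum>k\<le>nat \<lceil>t\<rceil>. treesum \<theta> (\<lambda>b. ennreal (recent (real k) b)))"
    by (subst treesum_cmult, measurable) (subst treesum_sum, auto)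
  also have "\<dots> \<le> ennreal (exp 1) * (\<Sum>k\<le>nat \<lceil>t\<rceil>. ennreal (exp (\<phi> * k)))"
    by (intro mult_left_mono sum_mono treesum_recent_le \<phi>) auto
  also have "\<dots> = ennreal (exp 1 * (\<Sum>k\<le>nat \<lceil>t\<rceil>. exp (\<phi> * k)))"
    by (simp add: ennreal_mult' sum_nonneg)
  finally show ?thesis .
qed

lemma AE_summable_ev:
  assumes H: "meas_fun H" and [measurable]: "g \<in> borel_measurable borel"
    and le: "\<And>b w. 0 \<le> b \<Longrightarrow> 0 \<le> w \<Longrightarrow>
      (\<integral>\<^sup>+m. ennreal \<bar>H m b w\<bar> \<partial>L) \<le> ennreal (w powr \<theta>) * g b"
    and fin: "treesum \<theta> g < \<infinity>"
  shows "AE \<kappa> in Q. (\<lambda>x. ev H \<kappa> x) summable_on UNIV"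
proof -
  let ?A = "\<lambda>m b w. ennreal \<bar>H m b w\<bar>"
  have A: "meas_fun ?A" using H unfolding meas_fun_def case_prod_unfold by measurable
  note [measurable] = measurable_ev[OF A]
  have "(\<integral>\<^sup>+\<kappa>. (\<integral>\<^sup>+x. ev ?A \<kappa> x \<partial>count_space UNIV) \<partial>Q) \<le> treesum \<theta> g"
    by (rule nn_integral_sum_ev_le_treesum[OF A _ le]) auto
  then have "(\<integral>\<^sup>+\<kappa>. (\<integral>\<^sup>+x. ev ?A \<kappa> x \<partial>count_space UNIV) \<partial>Q) \<noteq> \<infinity>" using fin by auto
  then have "AE \<kappa> in Q. (\<integral>\<^sup>+x. ev ?A \<kappa> x \<partial>count_space UNIV) \<noteq> \<infinity>"
    by (intro nn_integral_PInf_AE borel_measurable_nn_integral_countable) measurable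
  then show ?thesis
  proof eventually_elim
    case (elim \<kappa>)
    then have "integrable (count_space UNIV) (\<lambda>x. ev H \<kappa> x)"
      by (intro integrableI_bounded) (auto simp: ev_def less_top)
    then have "Infinite_Sum.abs_summable_on (\<lambda>x. ev H \<kappa> x) UNIV"
      unfolding abs_summable_equivalent abs_summable_on_def .
    then show ?case by (rule abs_summable_summable)
  qed
qed

end

context mark_law
begin

section \<open>Centred sums over the vertices that are alive, or die in a short interval\<close>

lemma nn_integral_life_cmult:
  assumes f: "indep_life f" and [measurable]: "Measurable.pred borel P" and w: "0 \<le> w"
  shows "(\<integral>\<^sup>+m. ennreal (\<bar>w * f m * of_bool (P (mE m))\<bar> powr p) \<partial>L)
    = ennreal (w powr p) * ((\<integral>\<^sup>+m. ennreal (\<bar>f m\<bar> powr p) \<partial>L) * (\<integral>\<^sup>+m. of_bool (P (mE m)) \<partial>L))"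
proof -
  have [measurable]: "f \<in> borel_measurable mark_space" using f by (simp add: indep_life_def)
  have "(\<integral>\<^sup>+m. ennreal (\<bar>w * f m * of_bool (P (mE m))\<bar> powr p) \<partial>L)
      = (\<integral>\<^sup>+m. ennreal (w powr p) * (of_bool (P (mE m)) * ennreal (\<bar>f m\<bar> powr p)) \<partial>L)"
    using w by (intro nn_integral_cong) (auto simp: abs_mult powr_mult ennreal_mult')
  also have "\<dots> = ennreal (w powr p) * (\<integral>\<^sup>+m. of_bool (P (mE m)) * ennreal (\<bar>f m\<bar> powr p) \<partial>L)"
    by (rule nn_integral_cmult) (intro measurable_L, measurable)
  also have "(\<integral>\<^sup>+m. of_bool (P (mE m)) * ennreal (\<bar>f m\<bar> powr p) \<partial>L)
      = (\<integral>\<^sup>+m. of_bool (P (mE m)) \<partial>L) * (\<integral>\<^sup>+m. ennreal (\<bar>f m\<bar> powr p) \<partial>L)"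
    by (rule indep_life_nn_integral[OF f]) measurable
  finally show ?thesis by (simp add: mult.commute)
qed

lemma centred_life:
  fixes p :: real
  assumes f: "indep_life f" and centred: "p \<le> 1 \<or> integrable L f \<and> (LINT m|L. f m) = 0"
    and P: "\<And>b. Measurable.pred borel (P b)"
  shows "p \<le> 1 \<or> (\<forall>b w. integrable L (\<lambda>m. w * f m * of_bool (P b (mE m)))
    \<and> (LINT m|L. w * f m * of_bool (P b (mE m))) = 0)"
proof (cases "p \<le> 1")
  case False
  then have c: "integrable L f" "(LINT m|L. f m) = 0" using centred by auto
  have eq: "(\<lambda>m. w * f m * of_bool (P b (mE m))) = (\<lambda>m. w * (of_bool (P b (mE m)) * f m))" for b w
    by (auto simp: mult_ac)
  have "integrable L (\<lambda>m. of_bool (P b (mE m)) * f m)"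
    "(LINT m|L. of_bool (P b (mE m)) * f m) = 0" for b
    using indep_life_integral[OF f c(1) _ integrable_of_bool_mE[OF P], of b] c(2) P[of b] by auto
  then show ?thesis unfolding eq by simp
qed simp

text \<open>The \<open>p\<close>-th moments of the summands add up to the mean alive sum with exponent \<open>p\<close>.\<close>

lemma alive_moment:
  assumes f: "indep_life f" and p: "0 < p" "p \<le> 2"
    and centred: "p \<le> 1 \<or> integrable L f \<and> (LINT m|L. f m) = 0"
    and K: "(\<integral>\<^sup>+m. ennreal (\<bar>f m\<bar> powr p) \<partial>L) \<le> ennreal K" "0 \<le> K"
    and t: "0 \<le> t" and \<phi>: "wmom p = ennreal (1 + \<phi>)" "-1 \<le> \<phi>"
  shows "(\<integral>\<^sup>+\<kappa>. ennreal (\<bar>vsum (\<lambda>m b w. w * f m * of_bool (b \<le> t \<and> t < b + mE m)) \<kappa>\<bar> powr p) \<partial>Q)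
    \<le> ennreal (4 * K * exp (\<phi> * t))"
proof -
  have [measurable]: "f \<in> borel_measurable mark_space" using f by (simp add: indep_life_def)
  have "(\<integral>\<^sup>+\<kappa>. ennreal (\<bar>vsum (\<lambda>m b w. w * f m * of_bool (b \<le> t \<and> t < b + mE m)) \<kappa>\<bar> powr p) \<partial>Q)
      \<le> 4 * treesum p (\<lambda>b. ennreal K * ennreal (recent t b))"
  proof (rule nn_integral_vsum_powr_le_treesum[OF p])
    show "meas_fun (\<lambda>m b w. w * f m * of_bool (b \<le> t \<and> t < b + mE m))"
      unfolding meas_fun_def case_prod_unfold by measurable
    show "p \<le> 1 \<or> (\<forall>b w. integrable L (\<lambda>m. w * f m * of_bool (b \<le> t \<and> t < b + mE m))
        \<and> (LINT m|L. w * f m * of_bool (b \<le> t \<and> t < b + mE m)) = 0)"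
      by (rule centred_life[OF f centred, of "\<lambda>b e. b \<le> t \<and> t < b + e"]) measurable
    fix b w :: real assume bw: "0 \<le> b" "0 \<le> w"
    have "(\<integral>\<^sup>+m. of_bool (b \<le> t \<and> t < b + mE m) \<partial>L) = ennreal (recent t b)"
      using nn_integral_alive[of b t] by (cases "b \<le> t") auto
    then show "(\<integral>\<^sup>+m. ennreal (\<bar>w * f m * of_bool (b \<le> t \<and> t < b + mE m)\<bar> powr p) \<partial>L)
        \<le> ennreal (w powr p) * (ennreal K * ennreal (recent t b))"
      using K(1) bw
      by (subst nn_integral_life_cmult[OF f, of "\<lambda>e. b \<le> t \<and> t < b + e"])
        (auto intro!: mult_left_mono mult_right_mono)
  qed measurable
  also have "treesum p (\<lambda>b. ennreal K * ennreal (recent t b)) \<le> ennreal K * ennreal (exp (\<phi> * t))"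
    by (subst treesum_cmult) (auto intro!: mult_left_mono treesum_recent_le t \<phi>)
  then have "4 * treesum p (\<lambda>b. ennreal K * ennreal (recent t b)) \<le> ennreal 4 * (ennreal K * ennreal (exp (\<phi> * t)))"
    by (simp add: mult_left_mono)
  also have "\<dots> = ennreal (4 * K * exp (\<phi> * t))" using K(2) by (simp add: ennreal_mult mult.assoc)
  finally show ?thesis .
qed

lemma nn_integral_death_le:
  assumes st: "s \<le> t" "t \<le> s + 1"
  shows "(\<integral>\<^sup>+m. of_bool (s < b + mE m \<and> b + mE m \<le> t) \<partial>L) \<le> ennreal (exp 1) * ennreal (recent t b)"
proof (cases "b \<le> t")
  case False
  have "AE m in L. of_bool (s < b + mE m \<and> b + mE m \<le> t) = (0 :: ennreal)"
    using mE_pos by eventually_elim (use False in auto)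
  then have "(\<integral>\<^sup>+m. of_bool (s < b + mE m \<and> b + mE m \<le> t) \<partial>L) = (\<integral>\<^sup>+m. 0 \<partial>L :: ennreal)"
    by (intro nn_integral_cong_AE)
  then show ?thesis by simp
next
  case True
  define a where "a = max s b"
  have a: "b \<le> a" "a \<le> t" "t \<le> a + 1" using True st by (auto simp: a_def)
  have "(\<integral>\<^sup>+m. of_bool (s < b + mE m \<and> b + mE m \<le> t) \<partial>L)
      \<le> (\<integral>\<^sup>+m. of_bool (b \<le> a \<and> a < b + mE m) \<partial>L :: ennreal)"
    using mE_pos by (intro nn_integral_mono_AE, eventually_elim) (auto simp: a_def)
  also have "\<dots> = ennreal (exp (b - a))" by (rule nn_integral_alive[OF a(1)])
  also have "\<dots> \<le> ennreal (exp 1 * exp (b - t))"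
    using a by (intro ennreal_leI) (simp add: exp_add[symmetric])
  also have "\<dots> = ennreal (exp 1) * ennreal (recent t b)" using True by (simp add: ennreal_mult)
  finally show ?thesis .
qed

text \<open>Given the birth time \<open>b \<le> t\<close>, the probability of dying in \<open>(s, t]\<close> is at most \<open>e\<close> times that of being alive
  at time \<open>t\<close>, because at most one unit of time separates \<open>max b s\<close> from \<open>t\<close>.\<close>

lemma death_moment:
  assumes f: "indep_life f" and p: "0 < p" "p \<le> 2"
    and centred: "p \<le> 1 \<or> integrable L f \<and> (LINT m|L. f m) = 0"
    and K: "(\<integral>\<^sup>+m. ennreal (\<bar>f m\<bar> powr p) \<partial>L) \<le> ennreal K" "0 \<le> K"
    and st: "s \<le> t" "t \<le> s + 1" and t: "0 \<le> t" and \<phi>: "wmom p = ennreal (1 + \<phi>)" "-1 \<le> \<phi>"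
  shows "(\<integral>\<^sup>+\<kappa>. ennreal (\<bar>vsum (\<lambda>m b w. w * f m * of_bool (s < b + mE m \<and> b + mE m \<le> t)) \<kappa>\<bar> powr p) \<partial>Q)
    \<le> ennreal (4 * exp 1 * K * exp (\<phi> * t))"
proof -
  have [measurable]: "f \<in> borel_measurable mark_space" using f by (simp add: indep_life_def)
  have "(\<integral>\<^sup>+\<kappa>. ennreal (\<bar>vsum (\<lambda>m b w. w * f m * of_bool (s < b + mE m \<and> b + mE m \<le> t)) \<kappa>\<bar> powr p) \<partial>Q)
      \<le> 4 * treesum p (\<lambda>b. ennreal (exp 1 * K) * ennreal (recent t b))"
  proof (rule nn_integral_vsum_powr_le_treesum[OF p])
    show "meas_fun (\<lambda>m b w. w * f m * of_bool (s < b + mE m \<and> b + mE m \<le> t))"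
      unfolding meas_fun_def case_prod_unfold by measurable
    show "p \<le> 1 \<or> (\<forall>b w. integrable L (\<lambda>m. w * f m * of_bool (s < b + mE m \<and> b + mE m \<le> t))
        \<and> (LINT m|L. w * f m * of_bool (s < b + mE m \<and> b + mE m \<le> t)) = 0)"
      by (rule centred_life[OF f centred, of "\<lambda>b e. s < b + e \<and> b + e \<le> t"]) measurable
    fix b w :: real assume bw: "0 \<le> b" "0 \<le> w"
    have "(\<integral>\<^sup>+m. ennreal (\<bar>w * f m * of_bool (s < b + mE m \<and> b + mE m \<le> t)\<bar> powr p) \<partial>L)
        \<le> ennreal (w powr p) * (ennreal K * (ennreal (exp 1) * ennreal (recent t b)))"
      using K(1) bw nn_integral_death_le[OF st, of b]
      by (subst nn_integral_life_cmult[OF f, of "\<lambda>e. s < b + e \<and> b + e \<le> t"])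
        (auto intro!: mult_left_mono mult_mono)
    also have "ennreal K * (ennreal (exp 1) * ennreal (recent t b)) = ennreal (exp 1 * K) * ennreal (recent t b)"
      using K(2) by (simp add: ennreal_mult mult_ac)
    finally show "(\<integral>\<^sup>+m. ennreal (\<bar>w * f m * of_bool (s < b + mE m \<and> b + mE m \<le> t)\<bar> powr p) \<partial>L)
        \<le> ennreal (w powr p) * (ennreal (exp 1 * K) * ennreal (recent t b))" .
  qed measurable
  also have "treesum p (\<lambda>b. ennreal (exp 1 * K) * ennreal (recent t b)) \<le> ennreal (exp 1 * K) * ennreal (exp (\<phi> * t))"
    by (subst treesum_cmult) (auto intro!: mult_left_mono treesum_recent_le t \<phi>)
  then have "4 * treesum p (\<lambda>b. ennreal (exp 1 * K) * ennreal (recent t b))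
      \<le> ennreal 4 * (ennreal (exp 1 * K) * ennreal (exp (\<phi> * t)))"
    by (simp add: mult_left_mono)
  also have "\<dots> = ennreal (4 * exp 1 * K * exp (\<phi> * t))"
    using K(2) by (simp add: ennreal_mult[symmetric] mult.assoc del: ennreal_numeral)
  finally show ?thesis .
qed

text \<open>With exponent \<open>1\<close> the bound on the deaths before an integer time is one of absolute summability;
  the sums for smaller times are dominated by it.\<close>

lemma AE_summable_dead:
  assumes f: "indep_life f" "integrable L f" and \<phi>: "wmom 1 = ennreal (1 + \<phi>)" "-1 \<le> \<phi>"
  shows "AE \<kappa> in Q. \<forall>t. (\<lambda>x. ev (\<lambda>m b w. w * f m * of_bool (b + mE m \<le> t)) \<kappa> x) summable_on UNIV"
proof -
  have [measurable]: "f \<in> borel_measurable mark_space" using f by (simp add: indep_life_def)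
  let ?H = "\<lambda>t m b w. w * f m * of_bool (b + mE m \<le> t)"
  let ?K = "\<integral>\<^sup>+m. ennreal (\<bar>f m\<bar> powr 1) \<partial>L"
  have K: "?K < \<infinity>"
    using f(2) by (simp add: integrable_iff_bounded)
  have nat: "AE \<kappa> in Q. (\<lambda>x. ev (?H (real n)) \<kappa> x) summable_on UNIV" for n :: nat
  proof (rule AE_summable_ev)
    show "meas_fun (?H (real n))" unfolding meas_fun_def case_prod_unfold by measurable
    fix b w :: real assume bw: "0 \<le> b" "0 \<le> w"
    have "(\<integral>\<^sup>+m. of_bool (b + mE m \<le> real n) \<partial>L) \<le> (\<integral>\<^sup>+m. of_bool (b \<le> real n) \<partial>L :: ennreal)"
      using mE_pos by (intro nn_integral_mono_AE, eventually_elim) auto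
    then have "(\<integral>\<^sup>+m. of_bool (b + mE m \<le> real n) \<partial>L) \<le> (of_bool (b \<le> real n) :: ennreal)"
      by (simp add: emeasure_space_1)
    then have "ennreal (w powr 1) * (?K * (\<integral>\<^sup>+m. of_bool (b + mE m \<le> real n) \<partial>L))
        \<le> ennreal (w powr 1) * (?K * of_bool (b \<le> real n))"
      by (intro mult_left_mono) auto
    moreover have "(\<integral>\<^sup>+m. ennreal (\<bar>?H (real n) m b w\<bar> powr 1) \<partial>L)
        = ennreal (w powr 1) * (?K * (\<integral>\<^sup>+m. of_bool (b + mE m \<le> real n) \<partial>L))"
      by (rule nn_integral_life_cmult[OF f(1) _ bw(2)]) measurable
    ultimately show "(\<integral>\<^sup>+m. ennreal \<bar>?H (real n) m b w\<bar> \<partial>L) \<le> ennreal (w powr 1) * (?K * of_bool (b \<le> real n))"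
      by simp
  next
    have "treesum 1 (\<lambda>b. ?K * of_bool (b \<le> real n)) = ?K * treesum 1 (\<lambda>b. of_bool (b \<le> real n))"
      by (rule treesum_cmult) measurable
    also have "\<dots> < \<infinity>"
      using K le_less_trans[OF treesum_born_le[OF _ \<phi>, of "real n"] ennreal_less_top]
      by (simp add: ennreal_mult_less_top)
    finally show "treesum 1 (\<lambda>b. ?K * of_bool (b \<le> real n)) < \<infinity>" .
  qed measurable
  have "AE \<kappa> in Q. \<forall>n. (\<lambda>x. ev (?H (real n)) \<kappa> x) summable_on UNIV"
    using nat by (simp add: AE_all_countable)
  then show ?thesis
  proof eventually_elim
    case (elim \<kappa>)
    show ?case
    proof
      fix t :: real
      obtain n where n: "t \<le> real n" using real_arch_simple by blast
      have abs: "(\<lambda>x. norm (ev (?H (real n)) \<kappa> x)) summable_on UNIV"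
        by (rule iffD1[OF summable_on_iff_abs_summable_on_real]) (rule elim[rule_format])
      have "norm (ev (?H t) \<kappa> x) \<le> norm (ev (?H (real n)) \<kappa> x)" for x
        using n by (cases "bt \<kappa> x + mE (\<kappa> x) \<le> t") (simp_all add: ev_def)
      then have "(\<lambda>x. norm (ev (?H t) \<kappa> x)) summable_on UNIV"
        by (rule Infinite_Sum.abs_summable_on_comparison_test[OF abs])
      then show "(\<lambda>x. ev (?H t) \<kappa> x) summable_on UNIV"
        by (rule iffD2[OF summable_on_iff_abs_summable_on_real])
    qed
  qed
qed

lemma infsum_diff_eq:
  fixes f g :: "'i \<Rightarrow> real"
  assumes "f summable_on UNIV" "g summable_on UNIV"
  shows "(\<Sum>\<^sub>\<infinity>x. f x) - (\<Sum>\<^sub>\<infinity>x. g x) = (\<Sum>\<^sub>\<infinity>x. f x - g x)"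
proof -
  have "(\<lambda>x. - g x) summable_on UNIV" using assms(2) by (simp add: summable_on_uminus)
  from infsum_add[OF assms(1) this] show ?thesis by (simp add: infsum_uminus)
qed

section \<open>Convergence of the additive part\<close>

text \<open>The scaled inequality \<open>y \<le> \<eta> + \<eta> powr (1 - p) * y powr p\<close> with \<open>\<eta> = q\<close>.\<close>

lemma nn_integral_abs_le_of_powr:
  assumes p: "1 \<le> p" and K: "0 \<le> K" and q: "0 < q" and [measurable]: "X \<in> borel_measurable cfg_space"
    and le: "(\<integral>\<^sup>+\<kappa>. ennreal (\<bar>X \<kappa>\<bar> powr p) \<partial>Q) \<le> ennreal (K * q powr p)"
  shows "(\<integral>\<^sup>+\<kappa>. ennreal \<bar>X \<kappa>\<bar> \<partial>Q) \<le> ennreal ((1 + K) * q)"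
proof -
  have "(\<integral>\<^sup>+\<kappa>. ennreal \<bar>X \<kappa>\<bar> \<partial>Q)
      \<le> (\<integral>\<^sup>+\<kappa>. ennreal q + ennreal (q powr (1 - p)) * ennreal (\<bar>X \<kappa>\<bar> powr p) \<partial>Q)"
  proof (rule nn_integral_mono)
    fix \<kappa>
    have "ennreal \<bar>X \<kappa>\<bar> \<le> ennreal (q + q powr (1 - p) * \<bar>X \<kappa>\<bar> powr p)"
      using le_add_scaled_powr[OF q p] by (intro ennreal_leI) auto
    then show "ennreal \<bar>X \<kappa>\<bar> \<le> ennreal q + ennreal (q powr (1 - p)) * ennreal (\<bar>X \<kappa>\<bar> powr p)"
      using q by (simp add: ennreal_plus ennreal_mult)
  qed
  also have "\<dots> = ennreal q + ennreal (q powr (1 - p)) * (\<integral>\<^sup>+\<kappa>. ennreal (\<bar>X \<kappa>\<bar> powr p) \<partial>Q)"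
    by (subst nn_integral_add) (auto simp: nn_integral_cmult)
  also have "\<dots> \<le> ennreal q + ennreal (q powr (1 - p)) * ennreal (K * q powr p)"
    by (intro add_left_mono mult_left_mono le) auto
  also have "\<dots> = ennreal (q + q powr (1 - p) * (K * q powr p))"
    using q K by (simp add: ennreal_plus ennreal_mult)
  also have "q powr (1 - p) * (K * q powr p) = K * q"
    using q powr_add[of q "1 - p" p] by (simp add: mult_ac)
  finally show ?thesis by (simp add: algebra_simps)
qed

text \<open>The increments of \<open>C\<^sub>t\<close> over unit intervals decay like \<open>q powr t\<close> in mean, where \<open>q = e\<^bsup>\<phi>/p\<^esup>\<close>: for \<open>p = 1\<close> by
  absolute values, for \<open>p > 1\<close> because the summands are centred, so that their \<open>p\<close>-th moments add up.
  The values at the integers therefore form almost surely a Cauchy sequence, and the limit is close in mean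
  to \<open>C\<^sub>t\<close> for every large \<open>t\<close>.\<close>

lemma additive_part_converges:
  assumes p: "1 \<le> p" "p \<le> 2" and C: "integrable L mC"
    and centred: "p \<le> 1 \<or> (LINT m|L. mC m) = 0"
    and Cp: "(\<integral>\<^sup>+m. ennreal (\<bar>mC m\<bar> powr p) \<partial>L) < \<infinity>"
    and \<phi>1: "wmom 1 = ennreal (1 + \<phi>1)" "-1 \<le> \<phi>1"
    and \<phi>: "wmom p = ennreal (1 + \<phi>)" "-1 \<le> \<phi>" "\<phi> < 0"
  shows "\<exists>Z. is_C_inf Q crd Z"
proof -
  obtain K where K: "(\<integral>\<^sup>+m. ennreal (\<bar>mC m\<bar> powr p) \<partial>L) = ennreal K" "0 \<le> K"
    using Cp by (cases "\<integral>\<^sup>+m. ennreal (\<bar>mC m\<bar> powr p) \<partial>L") auto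
  let ?D = "\<lambda>s t. vsum (\<lambda>m b w. w * mC m * of_bool (s < b + mE m \<and> b + mE m \<le> t))"
  have mf [measurable]: "?D s t \<in> borel_measurable cfg_space" for s t
    by (rule measurable_vsum) (unfold meas_fun_def case_prod_unfold, measurable)
  define q where "q = exp (\<phi> / p)"
  have q: "0 < q" "q < 1" using \<phi> p by (auto simp: q_def divide_neg_pos)
  define B where "B = 1 + 4 * exp 1 * K"
  have B: "0 \<le> B" using K by (simp add: B_def)
  have diff: "(\<integral>\<^sup>+\<kappa>. ennreal \<bar>?D s t \<kappa>\<bar> \<partial>Q) \<le> ennreal (B * q powr t)"
    if "s \<le> t" "t \<le> s + 1" "0 \<le> t" for s t
  proof -
    have "(\<integral>\<^sup>+\<kappa>. ennreal (\<bar>?D s t \<kappa>\<bar> powr p) \<partial>Q) \<le> ennreal (4 * exp 1 * K * exp (\<phi> * t))"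
      using p that C centred
      by (intro death_moment[OF indep_life_mC]) (auto simp: K \<phi>)
    also have "exp (\<phi> * t) = (q powr t) powr p"
      using p by (simp add: q_def powr_def field_simps)
    finally show ?thesis
      using nn_integral_abs_le_of_powr[OF p(1) _ _ mf, of "4 * exp 1 * K" "q powr t" s t] q K
      by (simp add: B_def)
  qed
  have C_diff: "AE \<kappa> in Q. \<forall>s t. s \<le> t \<longrightarrow> Cproc crd t \<kappa> - Cproc crd s \<kappa> = ?D s t \<kappa>"
    using AE_Cproc AE_summable_dead[OF indep_life_mC C \<phi>1]
  proof eventually_elim
    case (elim \<kappa>)
    show ?case
    proof (intro allI impI)
      fix s t :: real assume "s \<le> t"
      have "vsum (Cpart t) \<kappa> - vsum (Cpart s) \<kappa> = (\<Sum>\<^sub>\<infinity>x. ev (Cpart t) \<kappa> x - ev (Cpart s) \<kappa> x)"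
        unfolding vsum_def Cpart_def[abs_def]
        by (rule infsum_diff_eq) (use elim(2) in blast)+
      also have "\<dots> = ?D s t \<kappa>"
        unfolding vsum_def using \<open>s \<le> t\<close>
        by (intro infsum_cong) (auto simp: ev_def Cpart_def)
      finally show "Cproc crd t \<kappa> - Cproc crd s \<kappa> = ?D s t \<kappa>" using elim(1) by simp
    qed
  qed
  have diffC: "(\<integral>\<^sup>+\<kappa>. ennreal \<bar>Cproc crd t \<kappa> - Cproc crd s \<kappa>\<bar> \<partial>Q) \<le> ennreal (B * q powr t)"
    if "s \<le> t" "t \<le> s + 1" "0 \<le> t" for s t
  proof -
    have "(\<integral>\<^sup>+\<kappa>. ennreal \<bar>Cproc crd t \<kappa> - Cproc crd s \<kappa>\<bar> \<partial>Q) = (\<integral>\<^sup>+\<kappa>. ennreal \<bar>?D s t \<kappa>\<bar> \<partial>Q)"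
      using C_diff by (intro nn_integral_cong_AE, eventually_elim) (use that in auto)
    then show ?thesis using diff[OF that] by simp
  qed
  let ?C = "\<lambda>n \<kappa>. Cproc crd (real n) \<kappa>"
  have qpow: "q powr real n = q ^ n" for n by (rule powr_realpow[OF q(1)])
  have summ: "summable (\<lambda>k. B * q powr real (k + Suc n))" for n
  proof -
    have eq: "B * q powr real (k + Suc n) = (B * q ^ Suc n) * q ^ k" for k
      unfolding qpow by (simp add: power_add mult_ac)
    show ?thesis unfolding eq using q by (intro summable_mult summable_geometric) auto
  qed
  define S where "S n = (\<Sum>k. B * q powr real (k + Suc n))" for n
  have S_eq: "S n = B * q ^ Suc n / (1 - q)" for n
  proof -
    have eq: "B * q powr real (k + Suc n) = (B * q ^ Suc n) * q ^ k" for k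
      unfolding qpow by (simp add: power_add mult_ac)
    show ?thesis unfolding S_def eq using q
      by (subst suminf_mult) (auto simp: suminf_geometric summable_geometric)
  qed
  define T where "T n \<kappa> = (\<Sum>k. ennreal \<bar>?C (Suc (k + n)) \<kappa> - ?C (k + n) \<kappa>\<bar>)" for n \<kappa>
  have [measurable]: "T n \<in> borel_measurable cfg_space" for n unfolding T_def[abs_def] by measurable
  have T: "(\<integral>\<^sup>+\<kappa>. T n \<kappa> \<partial>Q) \<le> ennreal (S n)" for n
  proof -
    have "(\<integral>\<^sup>+\<kappa>. T n \<kappa> \<partial>Q) = (\<Sum>k. \<integral>\<^sup>+\<kappa>. ennreal \<bar>?C (Suc (k + n)) \<kappa> - ?C (k + n) \<kappa>\<bar> \<partial>Q)"
      unfolding T_def by (rule nn_integral_suminf) measurable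
    also have "\<dots> \<le> (\<Sum>k. ennreal (B * q powr real (k + Suc n)))"
      using diffC by (intro suminf_le) (auto simp: add.commute)
    also have "\<dots> = ennreal (S n)" unfolding S_def
      using B summ by (intro suminf_ennreal2) auto
    finally show ?thesis .
  qed
  have T0: "AE \<kappa> in Q. T 0 \<kappa> \<noteq> \<infinity>"
    using T[of 0] by (intro nn_integral_PInf_AE) (auto simp: top_unique)
  have conv: "?C n \<kappa> - ?C m \<kappa> = (\<Sum>k<n - m. ?C (Suc (k + m)) \<kappa> - ?C (k + m) \<kappa>)" if "m \<le> n" for n m \<kappa>
    using sum_lessThan_telescope[of "\<lambda>k. ?C (k + m) \<kappa>" "n - m"] that by simp
  have lim: "AE \<kappa> in Q. convergent (\<lambda>n. ?C n \<kappa>)"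
    using T0
  proof eventually_elim
    case (elim \<kappa>)
    have "summable (\<lambda>k. \<bar>?C (Suc k) \<kappa> - ?C k \<kappa>\<bar>)"
      using elim by (intro summable_suminf_not_top) (auto simp: T_def)
    then have "summable (\<lambda>k. ?C (Suc k) \<kappa> - ?C k \<kappa>)" by (rule summable_rabs_cancel)
    then have "convergent (\<lambda>n. \<Sum>k<n. ?C (Suc k) \<kappa> - ?C k \<kappa>)" by (rule summable_iff_convergent[THEN iffD1])
    then have "convergent (\<lambda>n. ?C n \<kappa> - ?C 0 \<kappa>)"
      unfolding sum_lessThan_telescope[of "\<lambda>k. ?C k \<kappa>"] .
    then show ?case by (simp add: convergent_diff_const_right_iff)
  qed
  define Z where "Z \<kappa> = lim (\<lambda>n. ?C n \<kappa>)" for \<kappa>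
  have Z [measurable]: "Z \<in> borel_measurable cfg_space"
    unfolding Z_def[abs_def] by measurable
  have limZ: "AE \<kappa> in Q. (\<lambda>n. ?C n \<kappa>) \<longlonglongrightarrow> Z \<kappa>"
    using lim unfolding Z_def by eventually_elim (rule convergent_LIMSEQ_iff[THEN iffD1])
  have ZC: "(\<integral>\<^sup>+\<kappa>. ennreal \<bar>Z \<kappa> - ?C n \<kappa>\<bar> \<partial>Q) \<le> ennreal (S n)" for n
  proof -
    have "(\<integral>\<^sup>+\<kappa>. ennreal \<bar>Z \<kappa> - ?C n \<kappa>\<bar> \<partial>Q) \<le> (\<integral>\<^sup>+\<kappa>. T n \<kappa> \<partial>Q)"
      using limZ
    proof (intro nn_integral_mono_AE, eventually_elim)
      case (elim \<kappa>)
      have "(\<lambda>l. ennreal \<bar>?C l \<kappa> - ?C n \<kappa>\<bar>) \<longlonglongrightarrow> ennreal \<bar>Z \<kappa> - ?C n \<kappa>\<bar>"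
        using elim by (intro tendsto_ennrealI tendsto_intros)
      moreover have "\<forall>\<^sub>F l in sequentially. ennreal \<bar>?C l \<kappa> - ?C n \<kappa>\<bar> \<le> T n \<kappa>"
        using eventually_ge_at_top[of n]
      proof eventually_elim
        case (elim l)
        have "ennreal \<bar>?C l \<kappa> - ?C n \<kappa>\<bar> \<le> ennreal (\<Sum>k<l - n. \<bar>?C (Suc (k + n)) \<kappa> - ?C (k + n) \<kappa>\<bar>)"
          unfolding conv[OF elim] by (intro ennreal_leI sum_abs)
        also have "\<dots> = (\<Sum>k<l - n. ennreal \<bar>?C (Suc (k + n)) \<kappa> - ?C (k + n) \<kappa>\<bar>)" by simp
        also have "\<dots> \<le> T n \<kappa>" unfolding T_def by (intro sum_le_suminf) auto
        finally show ?case .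
      qed
      ultimately show ?case by (rule tendsto_upperbound) simp
    qed
    also have "\<dots> \<le> ennreal (S n)" by (rule T)
    finally show ?thesis .
  qed
  have "conv_in_prob Q (Cproc crd) Z"
  proof (rule Q.conv_in_probI_moment[where p = 1 and B = "\<lambda>t. B * q ^ nat \<lceil>t\<rceil> + S (nat \<lceil>t\<rceil>)"])
    show "\<forall>\<^sub>F t in at_top. (\<integral>\<^sup>+\<kappa>. ennreal (\<bar>Cproc crd t \<kappa> - Z \<kappa>\<bar> powr 1) \<partial>Q)
        \<le> ennreal (B * q ^ nat \<lceil>t\<rceil> + S (nat \<lceil>t\<rceil>))"
      using eventually_ge_at_top[of 0]
    proof eventually_elim
      case (elim t)
      let ?n = "nat \<lceil>t\<rceil>"
      have n: "t \<le> real ?n" "real ?n \<le> t + 1"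
        using nat_ceiling_le_add_one[OF elim] real_nat_ceiling_ge[of t] by auto
      have "(\<integral>\<^sup>+\<kappa>. ennreal (\<bar>Cproc crd t \<kappa> - Z \<kappa>\<bar> powr 1) \<partial>Q)
          \<le> (\<integral>\<^sup>+\<kappa>. ennreal \<bar>?C ?n \<kappa> - Cproc crd t \<kappa>\<bar> + ennreal \<bar>Z \<kappa> - ?C ?n \<kappa>\<bar> \<partial>Q)"
        by (intro nn_integral_mono) (auto simp: ennreal_plus[symmetric] simp del: ennreal_plus intro!: ennreal_leI)
      also have "\<dots> = (\<integral>\<^sup>+\<kappa>. ennreal \<bar>?C ?n \<kappa> - Cproc crd t \<kappa>\<bar> \<partial>Q) + (\<integral>\<^sup>+\<kappa>. ennreal \<bar>Z \<kappa> - ?C ?n \<kappa>\<bar> \<partial>Q)"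
        by (rule nn_integral_add) measurable
      also have "\<dots> \<le> ennreal (B * q powr real ?n) + ennreal (S ?n)"
        using n by (intro add_mono diffC ZC) auto
      also have "\<dots> = ennreal (B * q ^ ?n + S ?n)"
        using B q S_eq by (simp add: qpow ennreal_plus)
      finally show ?case .
    qed
    have lim: "filterlim (\<lambda>t::real. nat \<lceil>t\<rceil>) sequentially at_top"
      unfolding filterlim_at_top
    proof
      fix n :: nat
      show "\<forall>\<^sub>F t::real in at_top. n \<le> nat \<lceil>t\<rceil>"
        using eventually_ge_at_top[of "real n"]
      proof eventually_elim
        case (elim t)
        then have "real n \<le> real (nat \<lceil>t\<rceil>)" using real_nat_ceiling_ge[of t] by linarith
        then show ?case by simp
      qed
    qed
    have q0: "(\<lambda>n. q ^ n) \<longlonglongrightarrow> 0" using q by (intro LIMSEQ_power_zero) auto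
    have "(\<lambda>n. B * q ^ n + B * q ^ Suc n / (1 - q)) \<longlonglongrightarrow> B * 0 + B * 0 / (1 - q)"
      using q by (intro tendsto_intros q0 LIMSEQ_Suc[OF q0]) auto
    from filterlim_compose[OF this lim]
    show "((\<lambda>t::real. B * q ^ nat \<lceil>t\<rceil> + S (nat \<lceil>t\<rceil>)) \<longlongrightarrow> 0) at_top"
      by (simp add: S_eq)
  qed (use B q S_eq in auto)
  moreover have "AE \<kappa> in Q. (\<lambda>x. \<bar>exp (pos crd \<kappa> x) * mC (\<kappa> x)\<bar>) summable_on tree crd \<kappa> \<longrightarrow>
        Z \<kappa> = (\<Sum>\<^sub>\<infinity>x\<in>tree crd \<kappa>. exp (pos crd \<kappa> x) * mC (\<kappa> x))"
    using limZ
  proof eventually_elim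
    case (elim \<kappa>)
    let ?f = "\<lambda>x. exp (pos crd \<kappa> x) * mC (\<kappa> x)"
    show ?case
    proof
      assume "(\<lambda>x. \<bar>?f x\<bar>) summable_on tree crd \<kappa>"
      moreover have "(\<lambda>x. \<bar>?f x\<bar>) summable_on tree crd \<kappa> \<longleftrightarrow>
          (\<lambda>x. norm (of_bool (x \<in> tree crd \<kappa>) * ?f x)) summable_on UNIV"
        by (rule summable_on_cong_neutral) auto
      ultimately have "(\<lambda>x. norm (of_bool (x \<in> tree crd \<kappa>) * ?f x)) summable_on UNIV"
        by simp
      then have int: "integrable (count_space UNIV) (\<lambda>x. of_bool (x \<in> tree crd \<kappa>) * ?f x)"
        unfolding abs_summable_equivalent abs_summable_on_def .
      have "(\<lambda>n. LINT x|count_space UNIV. of_bool (x \<in> dead crd \<kappa> (real n)) * ?f x)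
          \<longlonglongrightarrow> (LINT x|count_space UNIV. of_bool (x \<in> tree crd \<kappa>) * ?f x)"
      proof (rule integral_dominated_convergence[where w = "\<lambda>x. \<bar>of_bool (x \<in> tree crd \<kappa>) * ?f x\<bar>"])
        show "AE x in count_space UNIV. (\<lambda>n. of_bool (x \<in> dead crd \<kappa> (real n)) * ?f x)
            \<longlonglongrightarrow> of_bool (x \<in> tree crd \<kappa>) * ?f x"
        proof (rule AE_I2)
          fix x
          obtain N where "death crd \<kappa> x \<le> real N" using real_arch_simple by blast
          then have "x \<in> dead crd \<kappa> (real n) \<longleftrightarrow> x \<in> tree crd \<kappa>" if "N \<le> n" for n
            using that by (auto simp: dead_def)
          then have "\<forall>\<^sub>F n in sequentially.
              of_bool (x \<in> dead crd \<kappa> (real n)) * ?f x = of_bool (x \<in> tree crd \<kappa>) * ?f x"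
            by (intro eventually_sequentiallyI[of N]) simp
          then show "(\<lambda>n. of_bool (x \<in> dead crd \<kappa> (real n)) * ?f x) \<longlonglongrightarrow> of_bool (x \<in> tree crd \<kappa>) * ?f x"
            by (rule tendsto_eventually)
        qed
      qed (use int in \<open>auto simp: dead_def\<close>)
      then have "(\<lambda>n. ?C n \<kappa>) \<longlonglongrightarrow> (\<Sum>\<^sub>\<infinity>x\<in>tree crd \<kappa>. ?f x)"
        unfolding Cproc_def infsum_subset_eq[of _ "dead crd \<kappa> _"] infsum_subset_eq[of _ "tree crd \<kappa>"]
          infsum_eq_lebesgue_integral .
      then show "Z \<kappa> = (\<Sum>\<^sub>\<infinity>x\<in>tree crd \<kappa>. ?f x)" using elim LIMSEQ_unique by blast
    qed
  qed
  moreover have "Z \<in> borel_measurable Q"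
    by measurable
  ultimately have "is_C_inf Q crd Z" unfolding is_C_inf_def by (intro conjI)
  then show ?thesis by (intro exI[of _ Z])
qed

end

section \<open>Almost sure convergence of the additive martingale\<close>

lemma measurable_hold:
  assumes [measurable]: "\<And>k. f k \<in> borel_measurable M"
  shows "Measurable.pred M (\<lambda>\<omega>. hold a b (\<lambda>i. f i \<omega>) k)"
  by (induction k) auto

lemma measurable_ups:
  assumes [measurable]: "\<And>k. f k \<in> borel_measurable M"
  shows "(\<lambda>\<omega>. ups a b (\<lambda>i. f i \<omega>) k) \<in> measurable M (count_space UNIV)"
proof (induction k)
  case (Suc k)
  note [measurable] = Suc measurable_hold[of f M a b k, OF assms]
  show ?case by simp
qed simp

lemma ennreal_eq_infinityI:
  assumes "\<And>m::nat. of_nat m \<le> (x :: ennreal)"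
  shows "x = \<infinity>"
proof (rule ccontr)
  assume "x \<noteq> \<infinity>"
  then obtain r where r: "x = ennreal r" "0 \<le> r" by (cases x) auto
  obtain m :: nat where "r < real m" using reals_Archimedean2 by blast
  then have "x < of_nat m" using r by (simp add: ennreal_of_nat_eq_real_of_nat ennreal_less_iff)
  then show False using assms[of m] by simp
qed

context mark_law
begin

text \<open>Changing the mark of a vertex that dies after \<open>s\<close> affects only its descendants, and these are born
  after \<open>s\<close>.\<close>

lemma swap_marks:
  assumes pos: "\<forall>y. 0 < mE (\<kappa> y)" "0 < mE m" "0 < mE m'"
    and late: "s < bt \<kappa> x + mE m" "s < bt \<kappa> x + mE m'"
  shows "bt (\<kappa>(x := m)) y = bt (\<kappa>(x := m')) y \<and> wt (\<kappa>(x := m)) y = wt (\<kappa>(x := m')) y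
    \<or> s < bt (\<kappa>(x := m)) y \<and> s < bt (\<kappa>(x := m')) y"
proof (induction y)
  case (Cons i y)
  have p: "0 < mE ((\<kappa>(x := m)) y)" "0 < mE ((\<kappa>(x := m')) y)" using pos by auto
  show ?case
  proof (cases "y = x")
    case True
    have e: "bt (\<kappa>(x := m)) (i # x) = bt \<kappa> x + mE m" for m
      using bt_upd[of x x \<kappa> m] by simp
    show ?thesis unfolding True e by (intro disjI2 conjI late)
  next
    case False
    then show ?thesis using Cons.IH p by auto
  qed
qed simp

lemma alive_sum_swap:
  assumes pos: "\<forall>y. 0 < mE (\<kappa> y)" "0 < mE m" "0 < mE m'"
    and late: "s < bt \<kappa> x + mE m" "s < bt \<kappa> x + mE m'" and r: "r \<le> s"
  shows "alive_sum \<theta> r (\<kappa>(x := m)) = alive_sum \<theta> r (\<kappa>(x := m'))"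
  unfolding alive_sum_def
proof (rule nn_integral_cong)
  fix y
  let ?F = "\<lambda>m b w. ennreal (w powr \<theta>) * of_bool (b \<le> r \<and> r < b + mE m) :: ennreal"
  consider "bt (\<kappa>(x := m)) y = bt (\<kappa>(x := m')) y \<and> wt (\<kappa>(x := m)) y = wt (\<kappa>(x := m')) y"
    | "s < bt (\<kappa>(x := m)) y \<and> s < bt (\<kappa>(x := m')) y"
    using swap_marks[OF pos late] by blast
  then show "ev ?F (\<kappa>(x := m)) y = ev ?F (\<kappa>(x := m')) y"
  proof cases
    case 1
    show ?thesis
    proof (cases "y = x")
      case True
      then show ?thesis using late r by (simp add: ev_def bt_upd wt_upd)
    next
      case False
      then show ?thesis using 1 by (simp add: ev_def)
    qed
  next
    case 2
    then show ?thesis using r by (simp add: ev_def)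
  qed
qed

lemma AE_born_finite: 
  assumes \<phi>: "wmom 1 = ennreal (1 + \<phi>)" "-1 \<le> \<phi>"
  shows "AE \<kappa> in Q. \<forall>n::nat. (\<integral>\<^sup>+x. ennreal (wt \<kappa> x) * of_bool (bt \<kappa> x \<le> real n) \<partial>count_space UNIV) < \<infinity>"
proof -
  have "AE \<kappa> in Q. (\<integral>\<^sup>+x. ennreal (wt \<kappa> x) * of_bool (bt \<kappa> x \<le> real n) \<partial>count_space UNIV) < \<infinity>" for n :: nat
  proof -
    have "treesum 1 (\<lambda>b. of_bool (b \<le> real n)) < \<infinity>"
      using le_less_trans[OF treesum_born_le[OF _ \<phi>, of "real n"] ennreal_less_top] by simp
    then have "AE \<kappa> in Q. (\<integral>\<^sup>+x. ennreal (wt \<kappa> x powr 1) * of_bool (bt \<kappa> x \<le> real n) \<partial>count_space UNIV) \<noteq> \<infinity>"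
      unfolding treesum_def by (intro nn_integral_PInf_AE borel_measurable_nn_integral_countable) auto
    then show ?thesis using AE_good
    proof eventually_elim
      case (elim \<kappa>)
      then have w: "0 \<le> wt \<kappa> x" for x by (intro wt_nonneg) auto
      have "(\<integral>\<^sup>+x. ennreal (wt \<kappa> x powr 1) * of_bool (bt \<kappa> x \<le> real n) \<partial>count_space UNIV)
          = (\<integral>\<^sup>+x. ennreal (wt \<kappa> x) * of_bool (bt \<kappa> x \<le> real n) \<partial>count_space UNIV)"
        by (intro nn_integral_cong) (simp add: w)
      then show ?case using elim(1) by (simp add: less_top)
    qed
  qed
  then show ?thesis by (simp add: AE_all_countable)
qed

definition mart :: "real \<Rightarrow> real \<Rightarrow> configuration \<Rightarrow> real" where
  "mart \<phi> t \<kappa> = exp (- \<phi> * t) * enn2real (alive_sum 1 t \<kappa>)"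

lemma measurable_mart [measurable]: "mart \<phi> t \<in> borel_measurable cfg_space"
  unfolding mart_def[abs_def] by measurable

lemma mart_nonneg [simp]: "0 \<le> mart \<phi> t \<kappa>"
  by (simp add: mart_def)

lemma alive_sum_1_eq:
  assumes "\<forall>x k. 0 < mA (\<kappa> x) k"
  shows "alive_sum 1 t \<kappa>
    = (\<integral>\<^sup>+x. ennreal (wt \<kappa> x * of_bool (bt \<kappa> x \<le> t \<and> t < bt \<kappa> x + mE (\<kappa> x))) \<partial>count_space UNIV)"
  unfolding alive_sum_def
  by (intro nn_integral_cong) (simp add: ev_def wt_nonneg[OF assms] of_bool_def)

lemma alive_sum_finite:
  assumes A: "\<forall>x k. 0 < mA (\<kappa> x) k"
    and fin: "\<forall>n::nat. (\<integral>\<^sup>+x. ennreal (wt \<kappa> x) * of_bool (bt \<kappa> x \<le> real n) \<partial>count_space UNIV) < \<infinity>"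
  shows "alive_sum 1 t \<kappa> < \<infinity>"
proof -
  obtain n where n: "t \<le> real n" using real_arch_simple by blast
  have "alive_sum 1 t \<kappa> \<le> (\<integral>\<^sup>+x. ennreal (wt \<kappa> x) * of_bool (bt \<kappa> x \<le> real n) \<partial>count_space UNIV)"
    unfolding alive_sum_1_eq[OF A] by (intro nn_integral_mono) (use n in \<open>simp add: of_bool_def\<close>)
  then show ?thesis using fin le_less_trans by blast
qed

text \<open>Dominated convergence: each summand is right-continuous in time, and the weights of the vertices
  born by a given time have a finite sum.\<close>

lemma alive_sum_right_continuous:
  assumes A: "\<forall>x k. 0 < mA (\<kappa> x) k"
    and fin: "\<forall>n::nat. (\<integral>\<^sup>+x. ennreal (wt \<kappa> x) * of_bool (bt \<kappa> x \<le> real n) \<partial>count_space UNIV) < \<infinity>"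
  shows "continuous (at_right s) (\<lambda>t. enn2real (alive_sum 1 t \<kappa>))"
proof -
  let ?w = "wt \<kappa>"
  let ?h = "\<lambda>t x. ?w x * of_bool (bt \<kappa> x \<le> t \<and> t < bt \<kappa> x + mE (\<kappa> x))"
  have Y: "enn2real (alive_sum 1 t \<kappa>) = (LINT x|count_space UNIV. ?h t x)" for t
    unfolding alive_sum_1_eq[OF A]
    by (rule integral_eq_nn_integral[symmetric]) (auto simp: wt_nonneg[OF A])
  obtain n where n: "s + 1 \<le> real n" using real_arch_simple by blast
  have int: "integrable (count_space UNIV) (\<lambda>x. ?w x * of_bool (bt \<kappa> x \<le> real n))"
  proof (rule integrableI_nonneg)
    have "(\<integral>\<^sup>+x. ennreal (?w x * of_bool (bt \<kappa> x \<le> real n)) \<partial>count_space UNIV)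
        = (\<integral>\<^sup>+x. ennreal (?w x) * of_bool (bt \<kappa> x \<le> real n) \<partial>count_space UNIV)"
      by (intro nn_integral_cong) (simp add: of_bool_def)
    then show "(\<integral>\<^sup>+x. ennreal (?w x * of_bool (bt \<kappa> x \<le> real n)) \<partial>count_space UNIV) < \<infinity>"
      using fin by simp
  qed (auto simp: wt_nonneg[OF A])
  have "((\<lambda>t. LINT x|count_space UNIV. ?h t x) \<longlongrightarrow> (LINT x|count_space UNIV. ?h s x)) (at_right s)"
  proof (rule tendsto_at_right_sequentially[of s "s + 1"])
    fix S :: "nat \<Rightarrow> real"
    assume S: "\<And>n. s < S n" "\<And>n. S n < s + 1" "S \<longlonglongrightarrow> s"
    show "(\<lambda>k. LINT x|count_space UNIV. ?h (S k) x) \<longlonglongrightarrow> (LINT x|count_space UNIV. ?h s x)"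
    proof (rule integral_dominated_convergence[where w = "\<lambda>x. ?w x * of_bool (bt \<kappa> x \<le> real n)"])
      show "AE x in count_space UNIV. (\<lambda>k. ?h (S k) x) \<longlonglongrightarrow> ?h s x"
      proof (rule AE_I2)
        fix x
        have 1: "\<forall>\<^sub>F k in sequentially. bt \<kappa> x \<le> S k \<longleftrightarrow> bt \<kappa> x \<le> s"
        proof (cases "bt \<kappa> x \<le> s")
          case True
          have "bt \<kappa> x \<le> S k" for k using S(1)[of k] True by linarith
          then show ?thesis using True by simp
        next
          case False
          then have "\<forall>\<^sub>F k in sequentially. S k < bt \<kappa> x" using S(3) by (intro order_tendstoD(2)) auto
          then show ?thesis by eventually_elim (use False in auto)
        qed
        have 2: "\<forall>\<^sub>F k in sequentially. S k < bt \<kappa> x + mE (\<kappa> x) \<longleftrightarrow> s < bt \<kappa> x + mE (\<kappa> x)"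
        proof (cases "s < bt \<kappa> x + mE (\<kappa> x)")
          case True
          then have "\<forall>\<^sub>F k in sequentially. S k < bt \<kappa> x + mE (\<kappa> x)"
            using S(3) by (intro order_tendstoD(2)) auto
          then show ?thesis by eventually_elim (use True in auto)
        next
          case False
          have "\<not> S k < bt \<kappa> x + mE (\<kappa> x)" for k using S(1)[of k] False by linarith
          then show ?thesis using False by simp
        qed
        show "(\<lambda>k. ?h (S k) x) \<longlonglongrightarrow> ?h s x"
          by (rule tendsto_eventually, use 1 2 in eventually_elim) simp
      qed
      show "AE x in count_space UNIV. norm (?h (S k) x) \<le> ?w x * of_bool (bt \<kappa> x \<le> real n)" for k
      proof (rule AE_I2)
        fix x
        have "S k \<le> real n" using S(2)[of k] n by linarith
        then show "norm (?h (S k) x) \<le> ?w x * of_bool (bt \<kappa> x \<le> real n)"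
          using wt_nonneg[OF A, of x] by (auto simp: of_bool_def)
      qed
    qed (use int in auto)
  qed simp
  then show ?thesis unfolding continuous_within Y .
qed

lemma mart_nn_integral_le:
  assumes "0 \<le> t" and \<phi>: "wmom 1 = ennreal (1 + \<phi>)" "-1 \<le> \<phi>"
  shows "(\<integral>\<^sup>+\<kappa>. ennreal (mart \<phi> t \<kappa>) \<partial>Q) \<le> 1"
proof -
  have "(\<integral>\<^sup>+\<kappa>. ennreal (mart \<phi> t \<kappa>) \<partial>Q) \<le> (\<integral>\<^sup>+\<kappa>. ennreal (exp (- \<phi> * t)) * alive_sum 1 t \<kappa> \<partial>Q)"
    unfolding mart_def by (intro nn_integral_mono) (simp add: ennreal_mult' mult_left_mono ennreal_enn2real_if)
  also have "\<dots> = ennreal (exp (- \<phi> * t)) * (\<integral>\<^sup>+\<kappa>. alive_sum 1 t \<kappa> \<partial>Q)"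
    by (rule nn_integral_cmult) measurable
  also have "\<dots> \<le> ennreal (exp (- \<phi> * t)) * ennreal (exp (\<phi> * t))"
    by (intro mult_left_mono nn_integral_alive_sum_le assms) auto
  also have "\<dots> = 1" by (simp add: ennreal_mult[symmetric] exp_add[symmetric])
  finally show ?thesis .
qed

lemma alive_sum_supermartingale_nonneg:
  assumes "past s Z" "s \<le> t" "0 \<le> s" "wmom \<theta> = ennreal (1 + \<phi>)" "-1 \<le> \<phi>"
  shows "(\<integral>\<^sup>+\<kappa>. Z \<kappa> * alive_sum \<theta> t \<kappa> \<partial>Q)
    \<le> ennreal (exp (\<phi> * (t - s))) * (\<integral>\<^sup>+\<kappa>. Z \<kappa> * alive_sum \<theta> s \<kappa> \<partial>Q)"
  using alive_sum_supermartingale[OF assms(1,2,4,5)] assms(3) by (simp add: not_less[symmetric])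

text \<open>The strategy up to time \<open>k/(j+1)\<close> is a functional of the past by \<open>alive_sum_swap\<close>, so the supermartingale
  bound applies to it.\<close>

lemma mart_upcrossings:
  assumes \<phi>: "wmom 1 = ennreal (1 + \<phi>)" "-1 \<le> \<phi>" and ab: "0 \<le> a" "a < b"
  shows "(\<integral>\<^sup>+\<kappa>. ups a b (\<lambda>k. mart \<phi> (real k / real (Suc j)) \<kappa>) n \<partial>Q) \<le> ennreal (a / (b - a))"
proof (rule Q.upcrossing_inequality[OF ab])
  let ?t = "\<lambda>k. real k / real (Suc j)"
  fix k
  show "(\<integral>\<^sup>+\<kappa>. ennreal (mart \<phi> (?t k) \<kappa>) \<partial>Q) < \<infinity>"
    using mart_nn_integral_le[OF _ \<phi>, of "?t k"] by (auto intro: le_less_trans)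
  let ?Z = "\<lambda>\<kappa>. of_bool (hold a b (\<lambda>i. mart \<phi> (?t i) \<kappa>) k) :: ennreal"
  have [measurable]: "Measurable.pred cfg_space (\<lambda>\<kappa>. hold a b (\<lambda>i. mart \<phi> (?t i) \<kappa>) k)"
    by (rule measurable_hold) measurable
  have past: "past (?t k) ?Z"
    unfolding past_def
  proof (intro conjI allI impI)
    fix \<kappa> x m m'
    assume h: "\<forall>y. 0 < mE (\<kappa> y)" "0 < mE m" "0 < mE m'" "?t k < bt \<kappa> x + mE m" "?t k < bt \<kappa> x + mE m'"
    have "mart \<phi> (?t i) (\<kappa>(x := m)) = mart \<phi> (?t i) (\<kappa>(x := m'))" if "i \<le> k" for i
    proof -
      have "?t i \<le> ?t k" using that by (intro divide_right_mono) auto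
      then show ?thesis unfolding mart_def using alive_sum_swap[OF h] by simp
    qed
    then show "?Z (\<kappa>(x := m)) = ?Z (\<kappa>(x := m'))"
      by (simp cong: hold_cong)
  qed measurable
  have fin: "AE \<kappa> in Q. \<forall>t. alive_sum 1 t \<kappa> < \<infinity>"
    using AE_good AE_born_finite[OF \<phi>]
  proof eventually_elim
    case (elim \<kappa>)
    then have "\<forall>x k. 0 < mA (\<kappa> x) k" by auto
    from alive_sum_finite[OF this elim(2)] show ?case by blast
  qed
  have eq: "(\<integral>\<^sup>+\<kappa>. ?Z \<kappa> * ennreal (mart \<phi> t \<kappa>) \<partial>Q)
      = ennreal (exp (- \<phi> * t)) * (\<integral>\<^sup>+\<kappa>. ?Z \<kappa> * alive_sum 1 t \<kappa> \<partial>Q)" for t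
  proof -
    have "(\<integral>\<^sup>+\<kappa>. ?Z \<kappa> * ennreal (mart \<phi> t \<kappa>) \<partial>Q)
        = (\<integral>\<^sup>+\<kappa>. ennreal (exp (- \<phi> * t)) * (?Z \<kappa> * alive_sum 1 t \<kappa>) \<partial>Q)"
    proof (rule nn_integral_cong_AE, use fin in eventually_elim)
      case (elim \<kappa>)
      then have "ennreal (mart \<phi> t \<kappa>) = ennreal (exp (- \<phi> * t)) * alive_sum 1 t \<kappa>"
        by (simp add: mart_def ennreal_mult' ennreal_enn2real)
      then show ?case by (simp add: mult.left_commute)
    qed
    also have "\<dots> = ennreal (exp (- \<phi> * t)) * (\<integral>\<^sup>+\<kappa>. ?Z \<kappa> * alive_sum 1 t \<kappa> \<partial>Q)"
      by (rule nn_integral_cmult) measurable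
    finally show ?thesis .
  qed
  have "?t k \<le> ?t (Suc k)" "0 \<le> ?t k" by (intro divide_right_mono) auto
  from alive_sum_supermartingale_nonneg[OF past this \<phi>]
  have "(\<integral>\<^sup>+\<kappa>. ?Z \<kappa> * alive_sum 1 (?t (Suc k)) \<kappa> \<partial>Q)
      \<le> ennreal (exp (\<phi> * (?t (Suc k) - ?t k))) * (\<integral>\<^sup>+\<kappa>. ?Z \<kappa> * alive_sum 1 (?t k) \<kappa> \<partial>Q)" .
  then have "ennreal (exp (- \<phi> * ?t (Suc k))) * (\<integral>\<^sup>+\<kappa>. ?Z \<kappa> * alive_sum 1 (?t (Suc k)) \<kappa> \<partial>Q)
      \<le> ennreal (exp (- \<phi> * ?t (Suc k))) * (ennreal (exp (\<phi> * (?t (Suc k) - ?t k)))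
          * (\<integral>\<^sup>+\<kappa>. ?Z \<kappa> * alive_sum 1 (?t k) \<kappa> \<partial>Q))"
    by (rule mult_left_mono) simp
  also have "\<dots> = ennreal (exp (- \<phi> * ?t (Suc k)) * exp (\<phi> * (?t (Suc k) - ?t k)))
          * (\<integral>\<^sup>+\<kappa>. ?Z \<kappa> * alive_sum 1 (?t k) \<kappa> \<partial>Q)"
    by (simp only: ennreal_mult[OF exp_ge_zero exp_ge_zero] mult.assoc)
  also have "exp (- \<phi> * ?t (Suc k)) * exp (\<phi> * (?t (Suc k) - ?t k)) = exp (- \<phi> * ?t k)"
  proof -
    have "- \<phi> * u + \<phi> * (u - v) = - \<phi> * v" for u v by (simp add: algebra_simps)
    then show ?thesis unfolding exp_add[symmetric] by (rule arg_cong)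
  qed
  finally show "(\<integral>\<^sup>+\<kappa>. ?Z \<kappa> * ennreal (mart \<phi> (?t (Suc k)) \<kappa>) \<partial>Q)
      \<le> (\<integral>\<^sup>+\<kappa>. ?Z \<kappa> * ennreal (mart \<phi> (?t k) \<kappa>) \<partial>Q)"
    unfolding eq .
qed auto

text \<open>By Fatou's lemma a path has, almost surely, boundedly many upcrossings along infinitely many
  grids, so it does not oscillate.\<close>

lemma mart_converges:
  assumes \<phi>: "wmom 1 = ennreal (1 + \<phi>)" "-1 \<le> \<phi>"
  obtains Z where "Z \<in> borel_measurable cfg_space" "AE \<kappa> in Q. ((\<lambda>t. mart \<phi> t \<kappa>) \<longlongrightarrow> Z \<kappa>) at_top"
proof -
  have rc: "AE \<kappa> in Q. \<forall>s. continuous (at_right s) (\<lambda>t. mart \<phi> t \<kappa>)"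
    using AE_good AE_born_finite[OF \<phi>]
  proof eventually_elim
    case (elim \<kappa>)
    then have "continuous (at_right s) (\<lambda>t. enn2real (alive_sum 1 t \<kappa>))" for s
      by (intro alive_sum_right_continuous) auto
    then show ?case unfolding mart_def by (intro allI continuous_intros)
  qed
  have osc: "AE \<kappa> in Q. \<not> ((\<forall>T. \<exists>s\<ge>T. mart \<phi> s \<kappa> < a) \<and> (\<forall>T. \<exists>s\<ge>T. b < mart \<phi> s \<kappa>))"
    if ab: "0 \<le> a" "a < b" for a b
  proof -
    \<comment> \<open>The grid of mesh \<open>1/(j+1)\<close> is followed up to time \<open>j+1\<close>, so that both mesh and horizon improve.\<close>
    let ?U = "\<lambda>j \<kappa>. of_nat (ups a b (\<lambda>k. mart \<phi> (real k / real (Suc j)) \<kappa>) (Suc j * Suc j)) :: ennreal"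
    have [measurable]: "(\<lambda>\<kappa>. ups a b (\<lambda>i. mart \<phi> (real i / real (Suc j)) \<kappa>) k) \<in> measurable cfg_space (count_space UNIV)" for j k
      by (rule measurable_ups) measurable
    have mU [measurable]: "?U j \<in> borel_measurable cfg_space" for j
      by measurable
    have "(\<integral>\<^sup>+\<kappa>. liminf (\<lambda>j. ?U j \<kappa>) \<partial>Q) \<le> liminf (\<lambda>j. \<integral>\<^sup>+\<kappa>. ?U j \<kappa> \<partial>Q)"
      by (rule nn_integral_liminf) measurable
    also have "\<dots> \<le> limsup (\<lambda>j. \<integral>\<^sup>+\<kappa>. ?U j \<kappa> \<partial>Q)" by (rule Liminf_le_Limsup) simp
    also have "\<dots> \<le> ennreal (a / (b - a))"
      by (intro Limsup_bounded always_eventually allI mart_upcrossings[OF \<phi> ab])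
    finally have "(\<integral>\<^sup>+\<kappa>. liminf (\<lambda>j. ?U j \<kappa>) \<partial>Q) \<noteq> \<infinity>" by (auto simp: top_unique)
    then have "AE \<kappa> in Q. liminf (\<lambda>j. ?U j \<kappa>) \<noteq> \<infinity>"
      by (intro nn_integral_PInf_AE) measurable
    then show ?thesis using rc
    proof eventually_elim
      case (elim \<kappa>)
      show ?case
      proof
        assume h: "(\<forall>T. \<exists>s\<ge>T. mart \<phi> s \<kappa> < a) \<and> (\<forall>T. \<exists>s\<ge>T. b < mart \<phi> s \<kappa>)"
        have "of_nat m \<le> liminf (\<lambda>j. ?U j \<kappa>)" for m
        proof (rule Liminf_bounded)
          have "\<forall>\<^sub>F j in sequentially. m \<le> ups a b (\<lambda>k. mart \<phi> (real k / real (Suc j)) \<kappa>) (Suc j * Suc j)"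
            by (rule oscillation_imp_many_upcrossings) (use h elim(2) ab in auto)
          then show "\<forall>\<^sub>F j in sequentially. of_nat m \<le> ?U j \<kappa>"
            by eventually_elim (rule of_nat_mono)
        qed
        then have "liminf (\<lambda>j. ?U j \<kappa>) = \<infinity>"
          by (rule ennreal_eq_infinityI)
        then show False using elim(1) by simp
      qed
    qed
  qed
  have bdd: "AE \<kappa> in Q. \<exists>K. \<forall>T. \<exists>s\<ge>T. mart \<phi> s \<kappa> \<le> K"
  proof -
    have "(\<integral>\<^sup>+\<kappa>. liminf (\<lambda>n. ennreal (mart \<phi> (real n) \<kappa>)) \<partial>Q) \<le> liminf (\<lambda>n. \<integral>\<^sup>+\<kappa>. ennreal (mart \<phi> (real n) \<kappa>) \<partial>Q)"
      by (rule nn_integral_liminf) measurable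
    also have "\<dots> \<le> limsup (\<lambda>n. \<integral>\<^sup>+\<kappa>. ennreal (mart \<phi> (real n) \<kappa>) \<partial>Q)" by (rule Liminf_le_Limsup) simp
    also have "\<dots> \<le> 1"
      by (intro Limsup_bounded always_eventually allI mart_nn_integral_le \<phi>) auto
    finally have "(\<integral>\<^sup>+\<kappa>. liminf (\<lambda>n. ennreal (mart \<phi> (real n) \<kappa>)) \<partial>Q) \<noteq> \<infinity>" by (auto simp: top_unique)
    then have "AE \<kappa> in Q. liminf (\<lambda>n. ennreal (mart \<phi> (real n) \<kappa>)) \<noteq> \<infinity>"
      by (intro nn_integral_PInf_AE) measurable
    then show ?thesis
    proof eventually_elim
      case (elim \<kappa>)
      show ?case
      proof (rule ccontr)
        assume "\<not> ?case"
        then have "\<exists>T. \<forall>s\<ge>T. \<not> mart \<phi> s \<kappa> \<le> K" for K by blast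
        then have n: "\<exists>T. \<forall>s\<ge>T. K < mart \<phi> s \<kappa>" for K by (simp only: not_le)
        have "of_nat m \<le> liminf (\<lambda>n. ennreal (mart \<phi> (real n) \<kappa>))" for m
        proof (rule Liminf_bounded)
          obtain T where T: "\<And>s. T \<le> s \<Longrightarrow> real m < mart \<phi> s \<kappa>" using n by blast
          have "\<forall>\<^sub>F n in sequentially. T \<le> real n"
            using filterlim_real_sequentially by (auto simp: filterlim_at_top)
          then show "\<forall>\<^sub>F n in sequentially. of_nat m \<le> ennreal (mart \<phi> (real n) \<kappa>)"
            by eventually_elim (use T in \<open>simp add: ennreal_of_nat_eq_real_of_nat less_imp_le ennreal_leI\<close>)
        qed
        then have "liminf (\<lambda>n. ennreal (mart \<phi> (real n) \<kappa>)) = \<infinity>"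
          by (rule ennreal_eq_infinityI)
        then show False using elim by simp
      qed
    qed
  qed
  have "AE \<kappa> in Q. \<forall>z\<in>\<rat> \<times> \<rat>. 0 \<le> fst z \<longrightarrow> fst z < snd z \<longrightarrow>
      \<not> ((\<forall>T. \<exists>s\<ge>T. mart \<phi> s \<kappa> < fst z) \<and> (\<forall>T. \<exists>s\<ge>T. snd z < mart \<phi> s \<kappa>))"
  proof (subst AE_ball_countable)
    show "countable (\<rat> \<times> \<rat> :: (real \<times> real) set)" using countable_rat by auto
    show "\<forall>z\<in>\<rat> \<times> \<rat>. AE \<kappa> in Q. 0 \<le> fst z \<longrightarrow> fst z < snd z \<longrightarrow>
      \<not> ((\<forall>T. \<exists>s\<ge>T. mart \<phi> s \<kappa> < fst z) \<and> (\<forall>T. \<exists>s\<ge>T. snd z < mart \<phi> s \<kappa>))"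
    proof
      fix z :: "real \<times> real"
      show "AE \<kappa> in Q. 0 \<le> fst z \<longrightarrow> fst z < snd z \<longrightarrow>
        \<not> ((\<forall>T. \<exists>s\<ge>T. mart \<phi> s \<kappa> < fst z) \<and> (\<forall>T. \<exists>s\<ge>T. snd z < mart \<phi> s \<kappa>))"
      proof (cases "0 \<le> fst z \<and> fst z < snd z")
        case True
        then have "AE \<kappa> in Q. \<not> ((\<forall>T. \<exists>s\<ge>T. mart \<phi> s \<kappa> < fst z) \<and> (\<forall>T. \<exists>s\<ge>T. snd z < mart \<phi> s \<kappa>))"
          by (intro osc) auto
        then show ?thesis by eventually_elim blast
      qed (auto intro: AE_I2)
    qed
  qed
  then have conv: "AE \<kappa> in Q. \<exists>l. ((\<lambda>t. mart \<phi> t \<kappa>) \<longlongrightarrow> l) at_top"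
    using bdd
  proof eventually_elim
    case (elim \<kappa>)
    show ?case
      by (rule convergent_if_no_oscillation[OF mart_nonneg _ elim(2)]) (use elim(1) in force)
  qed
  define Z where "Z \<kappa> = lim (\<lambda>n. mart \<phi> (real n) \<kappa>)" for \<kappa>
  have Zm: "Z \<in> borel_measurable cfg_space" unfolding Z_def[abs_def] by measurable
  have "AE \<kappa> in Q. ((\<lambda>t. mart \<phi> t \<kappa>) \<longlongrightarrow> Z \<kappa>) at_top"
    using conv
  proof eventually_elim
    case (elim \<kappa>)
    then obtain l where l: "((\<lambda>t. mart \<phi> t \<kappa>) \<longlongrightarrow> l) at_top" by blast
    then have "(\<lambda>n. mart \<phi> (real n) \<kappa>) \<longlonglongrightarrow> l"
      by (rule filterlim_compose[OF _ filterlim_real_sequentially])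
    then have "Z \<kappa> = l" unfolding Z_def by (rule limI)
    then show ?case using l by simp
  qed
  with Zm show ?thesis by (rule that)
qed

end

context mark_law
begin

section \<open>The contribution of the alive vertices\<close>

lemma measurable_Rsum [measurable]: "vsum (Rpart t) \<in> borel_measurable cfg_space"
  by (rule measurable_vsum[OF meas_fun_parts(1)])

text \<open>Markov's inequality for the moment of order \<open>p\<close>.\<close>

lemma Rsum_converges:
  assumes p: "0 < p" "p \<le> 2" and centred: "p \<le> 1 \<or> integrable L mR \<and> (LINT m|L. mR m) = 0"
    and Rp: "(\<integral>\<^sup>+m. ennreal (\<bar>mR m\<bar> powr p) \<partial>L) < \<infinity>"
    and \<phi>: "wmom p = ennreal (1 + \<phi>)" "-1 \<le> \<phi>"
    and c: "((\<lambda>t. \<bar>c t\<bar> powr p * exp (\<phi> * t)) \<longlongrightarrow> 0) at_top"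
  shows "conv_in_prob Q (\<lambda>t \<kappa>. c t * vsum (Rpart t) \<kappa>) (\<lambda>_. 0)"
proof -
  obtain K where K: "(\<integral>\<^sup>+m. ennreal (\<bar>mR m\<bar> powr p) \<partial>L) = ennreal K" "0 \<le> K"
    using Rp by (cases "\<integral>\<^sup>+m. ennreal (\<bar>mR m\<bar> powr p) \<partial>L") auto
  show ?thesis
  proof (rule Q.conv_in_probI_moment[OF _ _ p(1), where B = "\<lambda>t. (4 * K) * (\<bar>c t\<bar> powr p * exp (\<phi> * t))"])
    show "\<forall>\<^sub>F t in at_top. (\<integral>\<^sup>+\<kappa>. ennreal (\<bar>c t * vsum (Rpart t) \<kappa> - 0\<bar> powr p) \<partial>Q)
        \<le> ennreal ((4 * K) * (\<bar>c t\<bar> powr p * exp (\<phi> * t)))"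
      using eventually_ge_at_top[of 0]
    proof eventually_elim
      case (elim t)
      have "(\<integral>\<^sup>+\<kappa>. ennreal (\<bar>c t * vsum (Rpart t) \<kappa> - 0\<bar> powr p) \<partial>Q)
          = (\<integral>\<^sup>+\<kappa>. ennreal (\<bar>c t\<bar> powr p) * ennreal (\<bar>vsum (Rpart t) \<kappa>\<bar> powr p) \<partial>Q)"
        by (intro nn_integral_cong) (simp add: abs_mult powr_mult ennreal_mult)
      also have "\<dots> = ennreal (\<bar>c t\<bar> powr p) * (\<integral>\<^sup>+\<kappa>. ennreal (\<bar>vsum (Rpart t) \<kappa>\<bar> powr p) \<partial>Q)"
        by (rule nn_integral_cmult) measurable
      also have "\<dots> \<le> ennreal (\<bar>c t\<bar> powr p) * ennreal (4 * K * exp (\<phi> * t))"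
        using alive_moment[OF indep_life_mR p centred _ K(2) elim \<phi>] K(1)
        by (intro mult_left_mono) (auto simp: Rpart_def[abs_def])
      also have "\<dots> = ennreal ((4 * K) * (\<bar>c t\<bar> powr p * exp (\<phi> * t)))"
        using K by (subst ennreal_mult[symmetric]) (auto simp: mult_ac)
      finally show ?case .
    qed
    show "((\<lambda>t. (4 * K) * (\<bar>c t\<bar> powr p * exp (\<phi> * t))) \<longlongrightarrow> 0) at_top"
      using tendsto_mult_left[OF c, of "4 * K"] by simp
  qed (use K in auto)
qed

text \<open>Layer-cake formula: \<open>R\<^sup>2 1{\<bar>R\<bar> \<le> y}\<close> is at most the integral of \<open>2 u 1{u < \<bar>R\<bar>}\<close> over \<open>0 \<le> u \<le> y\<close>, and
  the tail bound makes the mean of the integrand at most \<open>2 K\<close>.\<close>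

lemma truncated_second_moment:
  assumes K: "0 \<le> K" and tail: "\<And>y. 0 < y \<Longrightarrow> (\<integral>\<^sup>+m. of_bool (y < \<bar>mR m\<bar>) \<partial>L) \<le> ennreal (K / y)"
    and y: "0 \<le> y"
  shows "(\<integral>\<^sup>+m. ennreal ((mR m)\<^sup>2 * of_bool (\<bar>mR m\<bar> \<le> y)) \<partial>L) \<le> ennreal (2 * K * y)"
proof -
  interpret pair_sigma_finite L "lborel :: real measure" ..
  let ?f = "\<lambda>m u. ennreal (2 * u) * indicator {0..y} u * of_bool (u < \<bar>mR m\<bar>) :: ennreal"
  have f: "case_prod ?f \<in> borel_measurable (L \<Otimes>\<^sub>M lborel)"
  proof -
    have "case_prod ?f \<in> borel_measurable (mark_space \<Otimes>\<^sub>M lborel)"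
      unfolding case_prod_unfold by measurable
    then show ?thesis
      using measurable_cong_sets[OF sets_pair_measure_cong[OF sets_L refl] refl] by blast
  qed
  have "(\<integral>\<^sup>+m. ennreal ((mR m)\<^sup>2 * of_bool (\<bar>mR m\<bar> \<le> y)) \<partial>L) \<le> (\<integral>\<^sup>+m. \<integral>\<^sup>+u. ?f m u \<partial>lborel \<partial>L)"
  proof (rule nn_integral_mono)
    fix m
    show "ennreal ((mR m)\<^sup>2 * of_bool (\<bar>mR m\<bar> \<le> y)) \<le> (\<integral>\<^sup>+u. ?f m u \<partial>lborel)"
    proof (cases "\<bar>mR m\<bar> \<le> y")
      case True
      have "(\<integral>\<^sup>+u. ennreal (2 * u) * indicator {0..\<bar>mR m\<bar>} u \<partial>lborel) = ennreal (\<bar>mR m\<bar>\<^sup>2 - 0\<^sup>2)"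
        by (rule nn_integral_FTC_Icc) (auto intro!: derivative_eq_intros)
      moreover have "(\<integral>\<^sup>+u. ennreal (2 * u) * indicator {0..\<bar>mR m\<bar>} u \<partial>lborel) \<le> (\<integral>\<^sup>+u. ?f m u \<partial>lborel)"
        using AE_lborel_singleton[of "\<bar>mR m\<bar>"]
        by (intro nn_integral_mono_AE, eventually_elim) (use True in \<open>auto split: split_indicator\<close>)
      ultimately show ?thesis using True by simp
    qed simp
  qed
  also have "\<dots> = (\<integral>\<^sup>+u. \<integral>\<^sup>+m. ?f m u \<partial>L \<partial>lborel)"
    by (rule Fubini'[OF f, symmetric])
  also have "\<dots> \<le> (\<integral>\<^sup>+u. ennreal (2 * K) * indicator {0..y} u \<partial>lborel)"
  proof (rule nn_integral_mono)
    fix u :: real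
    have "(\<integral>\<^sup>+m. ?f m u \<partial>L) = ennreal (2 * u) * indicator {0..y} u * (\<integral>\<^sup>+m. of_bool (u < \<bar>mR m\<bar>) \<partial>L)"
      by (rule nn_integral_cmult) (intro measurable_L, measurable)
    also have "\<dots> \<le> ennreal (2 * K) * indicator {0..y} u"
    proof (cases "0 < u \<and> u \<le> y")
      case True
      then have "ennreal (2 * u) * (\<integral>\<^sup>+m. of_bool (u < \<bar>mR m\<bar>) \<partial>L) \<le> ennreal (2 * u) * ennreal (K / u)"
        by (intro mult_left_mono tail) auto
      also have "\<dots> = ennreal (2 * K)" using True K by (subst ennreal_mult[symmetric]) auto
      finally show ?thesis using True by simp
    next
      case False
      then show ?thesis by (cases "u = 0") (auto split: split_indicator)
    qed
    finally show "(\<integral>\<^sup>+m. ?f m u \<partial>L) \<le> ennreal (2 * K) * indicator {0..y} u" .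
  qed
  also have "\<dots> = ennreal (2 * K) * ennreal y" using y by (simp add: nn_integral_cmult)
  also have "\<dots> = ennreal (2 * K * y)" using K y by (simp add: ennreal_mult)
  finally show ?thesis .
qed

lemma sets_abs_greater:
  fixes f :: "configuration \<Rightarrow> real"
  assumes [measurable]: "f \<in> borel_measurable cfg_space"
  shows "{\<kappa>. c < \<bar>f \<kappa>\<bar>} \<in> sets Q"
proof -
  have "{\<kappa> \<in> space Q. c < \<bar>f \<kappa>\<bar>} \<in> sets Q" by measurable
  then show ?thesis by simp
qed

text \<open>The condition \<open>c < \<bar>y\<bar>\<close> is open, so it is inherited by the limit of the partial sums; the default
  value \<open>0\<close> of \<open>vsum\<close> satisfies it for no \<open>c \<ge> 0\<close>.\<close>

lemma prob_vsum_le: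
  assumes H: "meas_fun H" and le: "\<And>k. Q.prob {\<kappa>. c < \<bar>psum H k \<kappa>\<bar>} \<le> B" and c: "0 \<le> c"
  shows "Q.prob {\<kappa>. c < \<bar>vsum H \<kappa>\<bar>} \<le> B"
proof -
  note [measurable] = measurable_psum[OF H] measurable_vsum[OF H]
    sets_abs_greater[OF measurable_psum[OF H]] sets_abs_greater[OF measurable_vsum[OF H]]
  have B: "0 \<le> B" using le[of 0] measure_nonneg order_trans by blast
  have "emeasure Q {\<kappa>. c < \<bar>vsum H \<kappa>\<bar>} = (\<integral>\<^sup>+\<kappa>. indicator {\<kappa>. c < \<bar>vsum H \<kappa>\<bar>} \<kappa> \<partial>Q)"
    by (rule nn_integral_indicator[symmetric]) (rule sets_abs_greater[OF measurable_vsum[OF H]])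
  also have "\<dots> \<le> (\<integral>\<^sup>+\<kappa>. liminf (\<lambda>k. indicator {\<kappa>. c < \<bar>psum H k \<kappa>\<bar>} \<kappa>) \<partial>Q)"
  proof (rule nn_integral_mono)
    fix \<kappa>
    show "indicator {\<kappa>. c < \<bar>vsum H \<kappa>\<bar>} \<kappa> \<le> liminf (\<lambda>k. indicator {\<kappa>. c < \<bar>psum H k \<kappa>\<bar>} \<kappa> :: ennreal)"
    proof (cases "c < \<bar>vsum H \<kappa>\<bar>")
      case True
      then have "vsum H \<kappa> \<noteq> 0" using c by auto
      then have "(\<lambda>k. psum H k \<kappa>) \<longlonglongrightarrow> vsum H \<kappa>"
        by (cases rule: vsum_cases[of H \<kappa>]) auto
      then have "\<forall>\<^sub>F k in sequentially. c < \<bar>psum H k \<kappa>\<bar>"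
        using True by (intro order_tendstoD(1)[OF tendsto_rabs]) auto
      then have "\<forall>\<^sub>F k in sequentially. 1 \<le> (indicator {\<kappa>. c < \<bar>psum H k \<kappa>\<bar>} \<kappa> :: ennreal)"
        by eventually_elim simp
      then have "1 \<le> liminf (\<lambda>k. indicator {\<kappa>. c < \<bar>psum H k \<kappa>\<bar>} \<kappa> :: ennreal)"
        by (rule Liminf_bounded)
      then show ?thesis using True by simp
    qed simp
  qed
  also have "\<dots> \<le> liminf (\<lambda>k. \<integral>\<^sup>+\<kappa>. indicator {\<kappa>. c < \<bar>psum H k \<kappa>\<bar>} \<kappa> \<partial>Q)"
    by (rule nn_integral_liminf) measurable
  also have "\<dots> \<le> limsup (\<lambda>k. \<integral>\<^sup>+\<kappa>. indicator {\<kappa>. c < \<bar>psum H k \<kappa>\<bar>} \<kappa> \<partial>Q)"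
    by (rule Liminf_le_Limsup) simp
  also have "\<dots> \<le> ennreal B"
  proof (intro Limsup_bounded always_eventually allI)
    fix k
    have "(\<integral>\<^sup>+\<kappa>. indicator {\<kappa>. c < \<bar>psum H k \<kappa>\<bar>} \<kappa> \<partial>Q) = emeasure Q {\<kappa>. c < \<bar>psum H k \<kappa>\<bar>}"
      by (rule nn_integral_indicator) (rule sets_abs_greater[OF measurable_psum[OF H]])
    also have "\<dots> \<le> ennreal B" using le[of k] by (simp add: Q.emeasure_eq_measure ennreal_leI)
    finally show "(\<integral>\<^sup>+\<kappa>. indicator {\<kappa>. c < \<bar>psum H k \<kappa>\<bar>} \<kappa> \<partial>Q) \<le> ennreal B" .
  qed
  finally show ?thesis using B by (simp add: Q.emeasure_eq_measure)
qed

text \<open>Markov's inequality in the critical case, where the mean of the alive weights stays bounded.\<close>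

lemma prob_psum_le:
  assumes p: "0 < p" "p \<le> 2" and H: "meas_fun H"
    and centred: "p \<le> 1 \<or> (\<forall>b w. integrable L (\<lambda>m. H m b w) \<and> (LINT m|L. H m b w) = 0)"
    and le: "\<And>b w. 0 \<le> b \<Longrightarrow> 0 \<le> w \<Longrightarrow>
      (\<integral>\<^sup>+m. ennreal (\<bar>H m b w\<bar> powr p) \<partial>L) \<le> ennreal (w powr 1) * (ennreal K * ennreal (recent t b))"
    and K: "0 \<le> K" and t: "0 \<le> t" and \<phi>: "wmom 1 = ennreal 1" and c: "0 < c"
  shows "Q.prob {\<kappa>. c < \<bar>psum H k \<kappa>\<bar>} \<le> 4 * K / c powr p"
proof -
  note [measurable] = measurable_psum[OF H]
  have "(\<integral>\<^sup>+\<kappa>. ennreal (\<bar>psum H k \<kappa>\<bar> powr p) \<partial>Q) \<le> 4 * treesum 1 (\<lambda>b. ennreal K * ennreal (recent t b))"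
    by (rule nn_integral_psum_powr_le_treesum[OF p H _ centred le]) measurable
  also have rec: "4 * treesum 1 (\<lambda>b. ennreal K * ennreal (recent t b)) \<le> ennreal (4 * K)"
  proof -
    have "treesum 1 (\<lambda>b. ennreal (recent t b)) \<le> ennreal (exp (0 * t))"
      by (rule treesum_recent_le[OF t]) (use \<phi> in auto)
    then have "treesum 1 (\<lambda>b. ennreal K * ennreal (recent t b)) \<le> ennreal K"
      by (subst treesum_cmult) (auto dest: mult_left_mono[of _ 1 "ennreal K"])
    then have "4 * treesum 1 (\<lambda>b. ennreal K * ennreal (recent t b)) \<le> ennreal 4 * ennreal K"
      by (simp add: mult_left_mono)
    then show ?thesis using K by (simp add: ennreal_mult)
  qed
  finally show ?thesis
    using Q.prob_abs_greater_le_moment[of "psum H k" p c "4 * K"] p c K by simp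
qed

text \<open>For \<open>\<Phi>(1) = 0\<close> and tails of order \<open>1/y\<close>, truncate each summand \<open>e\<^bsup>V(x)\<^esup>R(x)\<close> at \<open>t\<close>: some summand
  exceeds \<open>t\<close> with probability \<open>O(1/t)\<close>, the centred truncated sum has variance \<open>O(t)\<close>, and the means
  add up to \<open>O(1)\<close>; all of this is negligible on the scale \<open>t\<close>.\<close>

lemma Rsum_heavy_tails:
  assumes K: "0 \<le> K" and tail: "\<And>y. 0 < y \<Longrightarrow> (\<integral>\<^sup>+m. of_bool (y < \<bar>mR m\<bar>) \<partial>L) \<le> ennreal (K / y)"
    and mean: "\<And>y. 0 < y \<Longrightarrow> \<bar>LINT m|L. mR m * of_bool (\<bar>mR m\<bar> \<le> y)\<bar> \<le> K"
    and \<phi>: "wmom 1 = ennreal 1"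
  shows "conv_in_prob Q (\<lambda>t \<kappa>. 1 / t * vsum (Rpart t) \<kappa>) (\<lambda>_. 0)"
proof (rule Q.conv_in_probI_bound)
  fix \<epsilon> :: real assume \<epsilon>: "0 < \<epsilon>"
  define B where "B t = 8 * K / t + 32 * K / (\<epsilon>\<^sup>2 * t) + 8 * K / (\<epsilon> * t)" for t
  have bound: "Q.prob {\<kappa>. \<epsilon> * t < \<bar>vsum (Rpart t) \<kappa>\<bar>} \<le> B t" if t: "0 < t" for t
  proof (rule prob_vsum_le[OF meas_fun_parts(1)])
    define al where "al m b = (of_bool (b \<le> t \<and> t < b + mE m) :: real)" for m b
    \<comment> \<open>The summands above the level \<open>t\<close>, their number, the truncated summands, the means and the
      centred versions of the latter.\<close>
    define big where "big m b w = w * mR m * of_bool (t < \<bar>w * mR m\<bar>) * al m b" for m b w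
    define ind where "ind m b w = of_bool (t < \<bar>w * mR m\<bar>) * al m b" for m b w
    define sml where "sml m b w = w * mR m * of_bool (\<bar>w * mR m\<bar> \<le> t) * al m b" for m b w
    define mn where "mn m b w = (LINT m|L. sml m b w)" for m :: mark and b w
    define cen where "cen m b w = sml m b w - mn m b w" for m b w
    have mf: "meas_fun big" "meas_fun ind" "meas_fun sml"
      unfolding meas_fun_def big_def ind_def sml_def al_def case_prod_unfold by measurable
    have mf_mn: "meas_fun mn"
    proof -
      have "(\<lambda>z. sml (snd z) (fst (fst z)) (snd (fst z))) \<in> borel_measurable ((borel \<Otimes>\<^sub>M borel) \<Otimes>\<^sub>M mark_space)"
        by (rule meas_fun_compose[OF mf(3)]) measurable
      then have "(\<lambda>z. sml (snd z) (fst (fst z)) (snd (fst z))) \<in> borel_measurable ((borel \<Otimes>\<^sub>M borel) \<Otimes>\<^sub>M L)"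
        using measurable_cong_sets[OF sets_pair_measure_cong[OF refl sets_L] refl] by blast
      then have "(\<lambda>u. LINT m|L. sml m (fst u) (snd u)) \<in> borel_measurable (borel \<Otimes>\<^sub>M borel)"
        using borel_measurable_lebesgue_integral[of "\<lambda>u m. sml m (fst u) (snd u)" "borel \<Otimes>\<^sub>M borel"]
        by (simp add: case_prod_unfold)
      from measurable_compose[OF _ this, of "\<lambda>z. snd z" "mark_space \<Otimes>\<^sub>M borel \<Otimes>\<^sub>M borel"]
      show ?thesis unfolding meas_fun_def mn_def case_prod_unfold by simp
    qed
    have mf_cen: "meas_fun cen"
      using mf(3) mf_mn unfolding meas_fun_def cen_def case_prod_unfold by (rule borel_measurable_diff)
    have [measurable]: "(\<lambda>m. sml m b w) \<in> borel_measurable mark_space" for b w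
      by (rule meas_fun_compose[OF mf(3)]) auto
    have sml_le: "\<bar>sml m b w\<bar> \<le> t" for m b w
      using t by (auto simp: sml_def al_def)
    have sml_int: "integrable L (\<lambda>m. sml m b w)" for b w
      by (rule integrable_const_bound[where B = t]) (auto simp: sml_le intro!: measurable_L)
    have alive: "(\<integral>\<^sup>+m. of_bool (b \<le> t \<and> t < b + mE m) \<partial>L) = ennreal (recent t b)" for b
      using nn_integral_alive[of b t] by (cases "b \<le> t") auto
    have recent_nonneg: "0 \<le> recent t b" for b by simp
    have LINT_al: "(LINT m|L. al m b) = recent t b" for b
    proof -
      have "(\<lambda>m. al m b) \<in> borel_measurable mark_space" unfolding al_def by measurable
      then have "(LINT m|L. al m b) = enn2real (\<integral>\<^sup>+m. ennreal (al m b) \<partial>L)"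
        by (intro integral_eq_nn_integral measurable_L AE_I2) (simp_all add: al_def)
      also have "(\<integral>\<^sup>+m. ennreal (al m b) \<partial>L) = (\<integral>\<^sup>+m. of_bool (b \<le> t \<and> t < b + mE m) \<partial>L)"
        by (intro nn_integral_cong) (simp add: al_def)
      also have "\<dots> = ennreal (recent t b)" by (rule alive)
      finally show ?thesis by (simp only: enn2real_ennreal[OF recent_nonneg])
    qed
    have mn_le: "\<bar>mn m b w\<bar> \<le> w * K * recent t b" if w: "0 \<le> w" for m b w
    proof (cases "w = 0")
      case False
      then have w: "0 < w" using that by simp
      define tr where "tr r = r * of_bool (\<bar>r\<bar> \<le> t / w)" for r :: real
      have [measurable]: "tr \<in> borel_measurable borel" unfolding tr_def[abs_def] by measurable
      have tr: "sml m b w = w * (al m b * tr (mR m))" for m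
        using w by (simp add: sml_def tr_def abs_mult pos_le_divide_eq mult_ac)
      have itr: "integrable L (\<lambda>m. tr (mR m))"
        by (rule integrable_const_bound[where B = "t / w"]) (use t w in \<open>auto simp: tr_def intro!: measurable_L\<close>)
      have "(LINT m|L. al m b * tr (mR m)) = (LINT m|L. al m b) * (LINT m|L. tr (mR m))"
        unfolding al_def
        by (rule indep_life_integral(2)[OF indep_life_compose[OF indep_life_mR] itr,
              of "\<lambda>e. of_bool (b \<le> t \<and> t < b + e)"]) (auto intro!: integrable_of_bool_mE)
      then have "mn m b w = w * (recent t b * (LINT m|L. tr (mR m)))"
        unfolding mn_def tr LINT_al[symmetric] by simp
      then have "\<bar>mn m b w\<bar> = w * recent t b * \<bar>LINT m|L. tr (mR m)\<bar>"
        using w by (simp add: abs_mult)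
      also have "\<dots> \<le> w * recent t b * K"
        using mean[of "t / w"] w t by (intro mult_left_mono) (auto simp: tr_def)
      finally show ?thesis by (simp add: mult_ac)
    qed (simp add: mn_def sml_def)
    have ind_le: "(\<integral>\<^sup>+m. ennreal (\<bar>ind m b w\<bar> powr 1) \<partial>L) \<le> ennreal (w powr 1) * (ennreal (K / t) * ennreal (recent t b))"
      if w: "0 \<le> w" for b w
    proof (cases "w = 0")
      case False
      then have w: "0 < w" using that by simp
      have "(\<integral>\<^sup>+m. ennreal (\<bar>ind m b w\<bar> powr 1) \<partial>L)
          = (\<integral>\<^sup>+m. of_bool (b \<le> t \<and> t < b + mE m) * of_bool (t / w < \<bar>mR m\<bar>) \<partial>L)"
        using w by (intro nn_integral_cong) (auto simp: ind_def al_def of_bool_def abs_mult pos_divide_less_eq mult_ac)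
      also have "\<dots> = (\<integral>\<^sup>+m. of_bool (b \<le> t \<and> t < b + mE m) \<partial>L) * (\<integral>\<^sup>+m. of_bool (t / w < \<bar>mR m\<bar>) \<partial>L)"
        by (rule indep_life_nn_integral[OF indep_life_mR]) measurable
      also have "\<dots> \<le> ennreal (recent t b) * ennreal (K / (t / w))"
        unfolding alive using t w by (intro mult_left_mono tail) auto
      also have "\<dots> = ennreal (w powr 1) * (ennreal (K / t) * ennreal (recent t b))"
        using w t K by (simp add: ennreal_mult[symmetric] mult_ac)
      finally show ?thesis .
    qed (use t in \<open>simp add: ind_def\<close>)
    have cen_le: "(\<integral>\<^sup>+m. ennreal (\<bar>cen m b w\<bar> powr 2) \<partial>L) \<le> ennreal (w powr 1) * (ennreal (2 * K * t) * ennreal (recent t b))"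
      if w: "0 \<le> w" for b w
    proof (cases "w = 0")
      case True
      then show ?thesis by (simp add: cen_def mn_def sml_def)
    next
      case False
      then have w: "0 < w" using that by simp
      have int2: "integrable L (\<lambda>m. (sml m b w)\<^sup>2)"
        by (rule integrable_const_bound[where B = "t\<^sup>2"])
          (use sml_le in \<open>auto intro!: measurable_L AE_I2 simp: abs_le_square_iff[symmetric] abs_of_nonneg[OF less_imp_le[OF t]]\<close>)
      have intc: "integrable L (\<lambda>m. (cen m b w)\<^sup>2)"
        using int2 sml_int by (simp add: cen_def mn_def power2_diff)
      have "(\<integral>\<^sup>+m. ennreal (\<bar>cen m b w\<bar> powr 2) \<partial>L) = (\<integral>\<^sup>+m. ennreal ((cen m b w)\<^sup>2) \<partial>L)"
        by (intro nn_integral_cong) simp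
      also have "\<dots> = ennreal (LINT m|L. (cen m b w)\<^sup>2)"
        using intc by (intro nn_integral_eq_integral) auto
      also have "(LINT m|L. (cen m b w)\<^sup>2) = (LINT m|L. (sml m b w)\<^sup>2) - (LINT m|L. sml m b w)\<^sup>2"
        using variance_eq[OF sml_int int2] by (simp add: cen_def mn_def)
      also have "ennreal \<dots> \<le> ennreal (LINT m|L. (sml m b w)\<^sup>2)" by (intro ennreal_leI) simp
      also have "\<dots> = (\<integral>\<^sup>+m. ennreal ((sml m b w)\<^sup>2) \<partial>L)"
        using int2 by (intro nn_integral_eq_integral[symmetric]) auto
      also have "\<dots> = (\<integral>\<^sup>+m. ennreal (w\<^sup>2) * (of_bool (b \<le> t \<and> t < b + mE m)
          * ennreal ((mR m)\<^sup>2 * of_bool (\<bar>mR m\<bar> \<le> t / w))) \<partial>L)"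
        using w by (intro nn_integral_cong)
          (auto simp: sml_def al_def of_bool_def abs_mult pos_le_divide_eq power_mult_distrib ennreal_mult mult_ac)
      also have "\<dots> = ennreal (w\<^sup>2) * (\<integral>\<^sup>+m. of_bool (b \<le> t \<and> t < b + mE m)
          * ennreal ((mR m)\<^sup>2 * of_bool (\<bar>mR m\<bar> \<le> t / w)) \<partial>L)"
        by (rule nn_integral_cmult) (intro measurable_L, measurable)
      also have "(\<integral>\<^sup>+m. of_bool (b \<le> t \<and> t < b + mE m) * ennreal ((mR m)\<^sup>2 * of_bool (\<bar>mR m\<bar> \<le> t / w)) \<partial>L)
          = (\<integral>\<^sup>+m. of_bool (b \<le> t \<and> t < b + mE m) \<partial>L) * (\<integral>\<^sup>+m. ennreal ((mR m)\<^sup>2 * of_bool (\<bar>mR m\<bar> \<le> t / w)) \<partial>L)"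
        by (rule indep_life_nn_integral[OF indep_life_mR]) measurable
      also have "ennreal (w\<^sup>2) * ((\<integral>\<^sup>+m. of_bool (b \<le> t \<and> t < b + mE m) \<partial>L)
            * (\<integral>\<^sup>+m. ennreal ((mR m)\<^sup>2 * of_bool (\<bar>mR m\<bar> \<le> t / w)) \<partial>L))
          \<le> ennreal (w\<^sup>2) * (ennreal (recent t b) * ennreal (2 * K * (t / w)))"
        unfolding alive using t w by (intro mult_left_mono truncated_second_moment K tail) auto
      also have "\<dots> = ennreal (w powr 1) * (ennreal (2 * K * t) * ennreal (recent t b))"
        using w t K by (simp add: ennreal_mult[symmetric] power2_eq_square mult_ac)
      finally show ?thesis .
    qed
    fix k
    have split: "psum (Rpart t) k \<kappa> = psum big k \<kappa> + psum cen k \<kappa> + psum mn k \<kappa>" for \<kappa>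
    proof -
      have "Rpart t m b w = big m b w + cen m b w + mn m b w" for m b w
        by (auto simp: Rpart_def big_def cen_def sml_def al_def of_bool_def not_le)
      then show ?thesis by (simp add: psum_def ev_def sum.distrib)
    qed
    \<comment> \<open>The number of large summands is an integer, so it vanishes as soon as it is at most \<open>1/2\<close>.\<close>
    have big0: "psum big k \<kappa> = 0" if "\<not> 1 / 2 < \<bar>psum ind k \<kappa>\<bar>" for \<kappa>
    proof -
      have nn: "0 \<le> ev ind \<kappa> x" for x by (simp add: ev_def ind_def al_def)
      have "ev ind \<kappa> (list_decode j) = 0" if j: "j < k" for j
      proof (rule ccontr)
        assume "ev ind \<kappa> (list_decode j) \<noteq> 0"
        then have "1 = ev ind \<kappa> (list_decode j)" by (auto simp: ev_def ind_def al_def of_bool_def split: if_splits)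
        also have "\<dots> \<le> psum ind k \<kappa>" unfolding psum_def using j nn by (intro member_le_sum) auto
        finally show False using \<open>\<not> 1 / 2 < \<bar>psum ind k \<kappa>\<bar>\<close> by simp
      qed
      then have "ev big \<kappa> (list_decode j) = 0" if "j < k" for j
        using that by (fastforce simp: ev_def ind_def big_def)
      then show ?thesis by (simp add: psum_def)
    qed
    note sets_gr = mf(2)[THEN measurable_psum, THEN sets_abs_greater]
      mf_mn[THEN measurable_psum, THEN sets_abs_greater] mf_cen[THEN measurable_psum, THEN sets_abs_greater]
    have p_ind: "Q.prob {\<kappa>. 1 / 2 < \<bar>psum ind k \<kappa>\<bar>} \<le> 4 * (K / t) / (1 / 2) powr 1"
      by (rule prob_psum_le[OF _ _ mf(2) _ ind_le]) (use K t \<phi> in auto)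
    have p_mn: "Q.prob {\<kappa>. \<epsilon> * t / 2 < \<bar>psum mn k \<kappa>\<bar>} \<le> 4 * K / (\<epsilon> * t / 2) powr 1"
    proof (rule prob_psum_le[OF _ _ mf_mn, where t = t])
      fix b w :: real assume "0 \<le> w"
      have "(\<integral>\<^sup>+m. ennreal (\<bar>mn m b w\<bar> powr 1) \<partial>L) \<le> (\<integral>\<^sup>+m. ennreal (w * K * recent t b) \<partial>L)"
        using mn_le[OF \<open>0 \<le> w\<close>] by (intro nn_integral_mono ennreal_leI) simp
      also have "\<dots> = ennreal (w powr 1) * (ennreal K * ennreal (recent t b))"
        using \<open>0 \<le> w\<close> K by (simp add: emeasure_space_1 ennreal_mult mult.assoc)
      finally show "(\<integral>\<^sup>+m. ennreal (\<bar>mn m b w\<bar> powr 1) \<partial>L) \<le> ennreal (w powr 1) * (ennreal K * ennreal (recent t b))" .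
    qed (use K t \<phi> \<epsilon> in auto)
    have p_cen: "Q.prob {\<kappa>. \<epsilon> * t / 2 < \<bar>psum cen k \<kappa>\<bar>} \<le> 4 * (2 * K * t) / (\<epsilon> * t / 2) powr 2"
    proof (rule prob_psum_le[OF _ _ mf_cen _ cen_le])
      show "2 \<le> (1::real) \<or> (\<forall>b w. integrable L (\<lambda>m. cen m b w) \<and> (LINT m|L. cen m b w) = 0)"
        using sml_int by (simp add: cen_def mn_def prob_space)
    qed (use K t \<phi> \<epsilon> in auto)
    have "Q.prob {\<kappa>. \<epsilon> * t < \<bar>psum (Rpart t) k \<kappa>\<bar>}
        \<le> Q.prob ({\<kappa>. 1 / 2 < \<bar>psum ind k \<kappa>\<bar>} \<union> ({\<kappa>. \<epsilon> * t / 2 < \<bar>psum cen k \<kappa>\<bar>} \<union> {\<kappa>. \<epsilon> * t / 2 < \<bar>psum mn k \<kappa>\<bar>}))"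
    proof (rule Q.finite_measure_mono)
      show "{\<kappa>. \<epsilon> * t < \<bar>psum (Rpart t) k \<kappa>\<bar>} \<subseteq> {\<kappa>. 1 / 2 < \<bar>psum ind k \<kappa>\<bar>} \<union>
          ({\<kappa>. \<epsilon> * t / 2 < \<bar>psum cen k \<kappa>\<bar>} \<union> {\<kappa>. \<epsilon> * t / 2 < \<bar>psum mn k \<kappa>\<bar>})"
      proof
        fix \<kappa> assume "\<kappa> \<in> {\<kappa>. \<epsilon> * t < \<bar>psum (Rpart t) k \<kappa>\<bar>}"
        then have h: "\<epsilon> * t < \<bar>psum big k \<kappa> + psum cen k \<kappa> + psum mn k \<kappa>\<bar>" unfolding split by simp
        have "1 / 2 < \<bar>psum ind k \<kappa>\<bar> \<or> \<epsilon> * t / 2 < \<bar>psum cen k \<kappa>\<bar> \<or> \<epsilon> * t / 2 < \<bar>psum mn k \<kappa>\<bar>"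
        proof (rule ccontr)
          assume n: "\<not> ?thesis"
          then have "psum big k \<kappa> = 0" by (intro big0) blast
          then show False using h n by linarith
        qed
        then show "\<kappa> \<in> {\<kappa>. 1 / 2 < \<bar>psum ind k \<kappa>\<bar>} \<union>
          ({\<kappa>. \<epsilon> * t / 2 < \<bar>psum cen k \<kappa>\<bar>} \<union> {\<kappa>. \<epsilon> * t / 2 < \<bar>psum mn k \<kappa>\<bar>})" by blast
      qed
    qed (intro sets.Un sets_gr)
    also have "\<dots> \<le> Q.prob {\<kappa>. 1 / 2 < \<bar>psum ind k \<kappa>\<bar>} + Q.prob ({\<kappa>. \<epsilon> * t / 2 < \<bar>psum cen k \<kappa>\<bar>} \<union> {\<kappa>. \<epsilon> * t / 2 < \<bar>psum mn k \<kappa>\<bar>})"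
      by (rule measure_Un_le) (intro sets.Un sets_gr)+
    also have "\<dots> \<le> Q.prob {\<kappa>. 1 / 2 < \<bar>psum ind k \<kappa>\<bar>} + (Q.prob {\<kappa>. \<epsilon> * t / 2 < \<bar>psum cen k \<kappa>\<bar>}
        + Q.prob {\<kappa>. \<epsilon> * t / 2 < \<bar>psum mn k \<kappa>\<bar>})"
      by (intro add_left_mono measure_Un_le sets_gr)
    also have "\<dots> \<le> 4 * (K / t) / (1 / 2) powr 1 + (4 * (2 * K * t) / (\<epsilon> * t / 2) powr 2 + 4 * K / (\<epsilon> * t / 2) powr 1)"
      by (intro add_mono p_ind p_mn p_cen)
    also have "\<dots> = B t"
      using t \<epsilon> by (simp add: B_def power2_eq_square field_simps)
    finally show "Q.prob {\<kappa>. \<epsilon> * t < \<bar>psum (Rpart t) k \<kappa>\<bar>} \<le> B t" .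
  qed (use \<epsilon> t in auto)
  show "\<forall>\<^sub>F t in at_top. \<P>(\<kappa> in Q. \<epsilon> < \<bar>1 / t * vsum (Rpart t) \<kappa> - 0\<bar>) \<le> B t"
    using eventually_gt_at_top[of 0]
  proof eventually_elim
    case (elim t)
    have "{\<kappa> \<in> space Q. \<epsilon> < \<bar>1 / t * vsum (Rpart t) \<kappa> - 0\<bar>} = {\<kappa>. \<epsilon> * t < \<bar>vsum (Rpart t) \<kappa>\<bar>}"
      using elim by (auto simp: abs_mult pos_less_divide_eq)
    then show ?case using bound[OF elim] by simp
  qed
  have "((\<lambda>t::real. (8 * K + 32 * K / \<epsilon>\<^sup>2 + 8 * K / \<epsilon>) * inverse t) \<longlongrightarrow> (8 * K + 32 * K / \<epsilon>\<^sup>2 + 8 * K / \<epsilon>) * 0) at_top"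
    by (intro tendsto_intros tendsto_inverse_0_at_top filterlim_ident)
  moreover have "B = (\<lambda>t. (8 * K + 32 * K / \<epsilon>\<^sup>2 + 8 * K / \<epsilon>) * inverse t)"
    by (rule ext) (simp add: B_def divide_inverse algebra_simps)
  ultimately show "(B \<longlongrightarrow> 0) at_top" by simp
qed

end

section \<open>Weighted averages\<close>

text \<open>The part of the integral before a fixed time is negligible against \<open>\<beta> t\<close>, and afterwards \<open>f\<close> is close to \<open>m\<close>.\<close>

lemma weighted_average_tendsto:
  fixes f w J \<beta> :: "real \<Rightarrow> real"
  assumes [measurable]: "f \<in> borel_measurable borel" "w \<in> borel_measurable borel"
    and nn: "\<And>s. 0 \<le> f s" "\<And>s. 0 \<le> w s" "\<And>t. 0 \<le> J t" "\<And>t. 0 \<le> t \<Longrightarrow> 0 \<le> \<beta> t"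
    and w: "\<And>u v. 0 \<le> u \<Longrightarrow> u \<le> v \<Longrightarrow>
      (\<integral>\<^sup>+s. ennreal (w s) * indicator {u..v} s \<partial>lborel) = ennreal (\<beta> v - \<beta> u)"
    and mono: "\<And>u v. 0 \<le> u \<Longrightarrow> u \<le> v \<Longrightarrow> \<beta> u \<le> \<beta> v"
    and lim: "filterlim \<beta> at_top at_top"
    and J: "\<And>t. 0 \<le> t \<Longrightarrow> ennreal (J t) = (\<integral>\<^sup>+s. ennreal (w s * f s) * indicator {0..t} s \<partial>lborel)"
    and f: "(f \<longlongrightarrow> m) at_top"
  shows "((\<lambda>t. J t / \<beta> t) \<longlongrightarrow> m) at_top"
proof (rule tendstoI)
  fix e :: real assume e: "0 < e"
  define \<epsilon> where "\<epsilon> = e / 3"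
  have \<epsilon>: "0 < \<epsilon>" using e by (simp add: \<epsilon>_def)
  have m: "0 \<le> m" by (rule tendsto_lowerbound[OF f]) (auto simp: nn)
  have "\<forall>\<^sub>F s in at_top. dist (f s) m < \<epsilon>" using f \<epsilon> by (rule tendstoD)
  then obtain s1 where s1: "\<And>s. s1 \<le> s \<Longrightarrow> \<bar>f s - m\<bar> < \<epsilon>"
    by (auto simp: eventually_at_top_linorder dist_real_def)
  define s0 where "s0 = max 0 s1"
  have s0: "0 \<le> s0" "\<And>s. s0 \<le> s \<Longrightarrow> \<bar>f s - m\<bar> < \<epsilon>" using s1 by (auto simp: s0_def)
  have upper: "J t \<le> J s0 + (m + \<epsilon>) * (\<beta> t - \<beta> s0)" if t: "s0 \<le> t" for t
  proof -
    have "ennreal (J t) \<le> (\<integral>\<^sup>+s. ennreal (w s * f s) * indicator {0..s0} s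
        + ennreal (m + \<epsilon>) * (ennreal (w s) * indicator {s0..t} s) \<partial>lborel)"
      unfolding J[OF order_trans[OF s0(1) t]]
    proof (rule nn_integral_mono)
      fix s
      show "ennreal (w s * f s) * indicator {0..t} s \<le> ennreal (w s * f s) * indicator {0..s0} s
        + ennreal (m + \<epsilon>) * (ennreal (w s) * indicator {s0..t} s)"
      proof (cases "s0 \<le> s \<and> s \<le> t")
        case True
        then have "w s * f s \<le> (m + \<epsilon>) * w s"
          using s0(2)[of s] nn(2)[of s] by (subst mult.commute) (intro mult_right_mono, auto)
        then have "ennreal (w s * f s) \<le> ennreal (m + \<epsilon>) * ennreal (w s)"
          using m \<epsilon> nn by (subst ennreal_mult[symmetric]) (auto intro!: ennreal_leI)
        then show ?thesis using True s0(1) by (auto intro: add_increasing split: split_indicator)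
      qed (auto split: split_indicator)
    qed
    also have "\<dots> = ennreal (J s0) + ennreal (m + \<epsilon>) * ennreal (\<beta> t - \<beta> s0)"
      using J[OF s0(1)] w[OF s0(1) t] by (subst nn_integral_add) (auto simp: nn_integral_cmult)
    also have "\<dots> = ennreal (J s0 + (m + \<epsilon>) * (\<beta> t - \<beta> s0))"
      using mono[OF s0(1) t] m \<epsilon> nn by (simp add: ennreal_plus ennreal_mult)
    finally show ?thesis
      using mono[OF s0(1) t] m \<epsilon> nn by (subst (asm) ennreal_le_iff) auto
  qed
  have lower: "m * (\<beta> t - \<beta> s0) \<le> J t + \<epsilon> * (\<beta> t - \<beta> s0)" if t: "s0 \<le> t" for t
  proof -
    have "ennreal m * ennreal (\<beta> t - \<beta> s0) = (\<integral>\<^sup>+s. ennreal m * (ennreal (w s) * indicator {s0..t} s) \<partial>lborel)"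
      using w[OF s0(1) t] by (subst nn_integral_cmult) auto
    also have "\<dots> \<le> (\<integral>\<^sup>+s. ennreal (w s * f s) * indicator {0..t} s
        + ennreal \<epsilon> * (ennreal (w s) * indicator {s0..t} s) \<partial>lborel)"
    proof (rule nn_integral_mono)
      fix s
      show "ennreal m * (ennreal (w s) * indicator {s0..t} s) \<le> ennreal (w s * f s) * indicator {0..t} s
        + ennreal \<epsilon> * (ennreal (w s) * indicator {s0..t} s)"
      proof (cases "s0 \<le> s \<and> s \<le> t")
        case True
        then have "m * w s \<le> (f s + \<epsilon>) * w s"
          using s0(2)[of s] nn(2)[of s] by (intro mult_right_mono) auto
        then have "ennreal (m * w s) \<le> ennreal (w s * f s + \<epsilon> * w s)"
          by (intro ennreal_leI) (simp add: algebra_simps)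
        then have "ennreal m * ennreal (w s) \<le> ennreal (w s * f s) + ennreal \<epsilon> * ennreal (w s)"
          using m \<epsilon> nn by (simp add: ennreal_mult ennreal_plus)
        then show ?thesis using True s0(1) by (auto split: split_indicator)
      qed (auto split: split_indicator)
    qed
    also have "\<dots> = ennreal (J t) + ennreal \<epsilon> * ennreal (\<beta> t - \<beta> s0)"
      using J[OF order_trans[OF s0(1) t]] w[OF s0(1) t] by (subst nn_integral_add) (auto simp: nn_integral_cmult)
    also have "\<dots> = ennreal (J t + \<epsilon> * (\<beta> t - \<beta> s0))"
      using mono[OF s0(1) t] \<epsilon> nn by (simp add: ennreal_plus ennreal_mult)
    finally have "ennreal (m * (\<beta> t - \<beta> s0)) \<le> ennreal (J t + \<epsilon> * (\<beta> t - \<beta> s0))"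
      using m mono[OF s0(1) t] by (simp add: ennreal_mult)
    then show ?thesis
      using mono[OF s0(1) t] \<epsilon> nn by (subst (asm) ennreal_le_iff) auto
  qed
  define K where "K = J s0 + m * \<beta> s0 + 1"
  have m\<beta>: "0 \<le> m * \<beta> s0" by (intro mult_nonneg_nonneg m nn(4) s0(1))
  have K: "0 < K" "m * \<beta> s0 \<le> K" "J s0 \<le> K"
    using m\<beta> nn(3)[of s0] unfolding K_def by linarith+
  have "\<forall>\<^sub>F t in at_top. K / \<epsilon> \<le> \<beta> t" using lim by (auto simp: filterlim_at_top)
  then show "\<forall>\<^sub>F t in at_top. dist (J t / \<beta> t) m < e"
    using eventually_ge_at_top[of s0]
  proof eventually_elim
    case (elim t)
    have \<beta>: "0 < \<beta> t" using elim(1) K \<epsilon> by (meson divide_pos_pos less_le_trans)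
    have K\<beta>: "K \<le> \<epsilon> * \<beta> t" using elim(1) \<epsilon> by (simp add: pos_divide_le_eq mult.commute)
    have b0: "0 \<le> \<epsilon> * \<beta> s0" using \<epsilon> nn(4)[OF s0(1)] by simp
    have "J t \<le> m * \<beta> t + 2 * (\<epsilon> * \<beta> t)"
      using upper[OF elim(2)] K K\<beta> b0 m\<beta> by (simp add: algebra_simps)
    moreover have "m * \<beta> t - 2 * (\<epsilon> * \<beta> t) \<le> J t"
      using lower[OF elim(2)] K K\<beta> b0 by (simp add: algebra_simps)
    ultimately have "\<bar>J t - m * \<beta> t\<bar> \<le> 2 * \<epsilon> * \<beta> t" by (simp add: abs_le_iff)
    moreover have "\<bar>J t / \<beta> t - m\<bar> = \<bar>J t - m * \<beta> t\<bar> / \<beta> t"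
    proof -
      have "J t / \<beta> t - m = (J t - m * \<beta> t) / \<beta> t" using \<beta> by (simp add: diff_divide_distrib)
      then show ?thesis using \<beta> by (simp add: abs_divide)
    qed
    ultimately have "\<bar>J t / \<beta> t - m\<bar> \<le> 2 * \<epsilon>" using \<beta> by (simp add: pos_divide_le_eq)
    then show ?case using e by (simp add: dist_real_def \<epsilon>_def)
  qed
qed

text \<open>The integral of \<open>e\<^bsup>\<rho> s\<^esup>\<close> over \<open>0 \<le> s \<le> t\<close>.\<close>

definition exp_int :: "real \<Rightarrow> real \<Rightarrow> real" where
  "exp_int \<rho> t = (if \<rho> = 0 then t else (exp (\<rho> * t) - 1) / \<rho>)"

lemma exp_int_deriv: "(exp_int \<rho> has_real_derivative exp (\<rho> * t)) (at t)"
proof (cases "\<rho> = 0")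
  case True
  then have "exp_int \<rho> = (\<lambda>t. t)" by (auto simp: exp_int_def)
  then show ?thesis using True by simp
next
  case False
  then have "exp_int \<rho> = (\<lambda>t. (exp (\<rho> * t) - 1) / \<rho>)" by (auto simp: exp_int_def)
  then show ?thesis using False by (auto intro!: derivative_eq_intros)
qed

lemma exp_int_mono: "u \<le> v \<Longrightarrow> exp_int \<rho> u \<le> exp_int \<rho> v"
  by (rule DERIV_nonneg_imp_nondecreasing) (auto intro!: exp_int_deriv exI)

lemma exp_int_at_top:
  assumes "0 \<le> \<rho>"
  shows "filterlim (exp_int \<rho>) at_top at_top"
proof (rule filterlim_at_top_mono[OF filterlim_ident])
  show "\<forall>\<^sub>F t in at_top. t \<le> exp_int \<rho> t"
    using eventually_ge_at_top[of 0]
  proof eventually_elim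
    case (elim t)
    have "1 + \<rho> * t \<le> exp (\<rho> * t)" by (rule exp_ge_add_one_self)
    then have "t * \<rho> \<le> exp (\<rho> * t) - 1" by (subst mult.commute) linarith
    then show ?case using assms by (simp add: exp_int_def pos_le_divide_eq)
  qed
qed

context mark_law
begin

section \<open>The total lifetime weighted by \<open>e\<^bsup>V\<^esup>\<close>\<close>

text \<open>The weight times the part of the lifetime that lies before \<open>t\<close>.\<close>

definition Jpart :: "real \<Rightarrow> mark \<Rightarrow> real \<Rightarrow> real \<Rightarrow> real" where
  "Jpart t m b w = w * (of_bool (b \<le> t) * min (mE m) (t - b))"

lemma meas_fun_Jpart: "meas_fun (Jpart t)"
  unfolding meas_fun_def Jpart_def case_prod_unfold by measurable

lemma measurable_Jsum [measurable]: "vsum (Jpart t) \<in> borel_measurable cfg_space"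
  by (rule measurable_vsum[OF meas_fun_Jpart])

lemma nn_integral_lifetime:
  assumes "0 \<le> b" "0 < e" "0 \<le> t"
  shows "(\<integral>\<^sup>+s. of_bool (b \<le> s \<and> s < b + e) * indicator {0..t} s \<partial>lborel)
    = ennreal (of_bool (b \<le> t) * min e (t - b))"
proof -
  define A where "A = (if b + e \<le> t then {b..<b + e} else {b..t})"
  have "(\<integral>\<^sup>+s. of_bool (b \<le> s \<and> s < b + e) * indicator {0..t} s \<partial>lborel) = (\<integral>\<^sup>+s. indicator A s \<partial>lborel)"
    using assms by (intro nn_integral_cong) (auto simp: A_def split: split_indicator)
  also have "\<dots> = emeasure lborel A" by (rule nn_integral_indicator) (simp add: A_def)
  also have "\<dots> = ennreal (of_bool (b \<le> t) * min e (t - b))"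
    using assms by (auto simp: A_def min_def not_le)
  finally show ?thesis .
qed

text \<open>Tonelli's theorem: a lifetime is the time integral of the indicator of being alive.\<close>

lemma Jsum_eq:
  assumes good: "\<forall>x. 0 < mE (\<kappa> x) \<and> (\<forall>k. 0 < mA (\<kappa> x) k)" and t: "0 \<le> t"
    and fin: "\<forall>n::nat. (\<integral>\<^sup>+x. ennreal (wt \<kappa> x) * of_bool (bt \<kappa> x \<le> real n) \<partial>count_space UNIV) < \<infinity>"
  shows "(\<lambda>x. ev (Jpart t) \<kappa> x) summable_on UNIV"
    and "0 \<le> vsum (Jpart t) \<kappa>"
    and "ennreal (vsum (Jpart t) \<kappa>) = (\<integral>\<^sup>+s. alive_sum 1 s \<kappa> * indicator {0..t} s \<partial>lborel)"
proof -
  have A: "\<forall>x k. 0 < mA (\<kappa> x) k" using good by auto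
  have b: "0 \<le> bt \<kappa> x" for x using good by (intro bt_nonneg) auto
  have nn: "0 \<le> ev (Jpart t) \<kappa> x" for x
    using good wt_nonneg[OF A, of x] by (cases "bt \<kappa> x \<le> t") (auto simp: ev_def Jpart_def less_imp_le)
  obtain n where n: "t \<le> real n" using real_arch_simple by blast
  have int: "integrable (count_space UNIV) (\<lambda>x. ev (Jpart t) \<kappa> x)"
  proof (rule integrableI_nonneg)
    have "(\<integral>\<^sup>+x. ennreal (ev (Jpart t) \<kappa> x) \<partial>count_space UNIV)
        \<le> (\<integral>\<^sup>+x. ennreal t * (ennreal (wt \<kappa> x) * of_bool (bt \<kappa> x \<le> real n)) \<partial>count_space UNIV)"
    proof (rule nn_integral_mono)
      fix x
      have "ev (Jpart t) \<kappa> x \<le> t * (wt \<kappa> x * of_bool (bt \<kappa> x \<le> real n))"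
      proof (cases "bt \<kappa> x \<le> t")
        case True
        have "min (mE (\<kappa> x)) (t - bt \<kappa> x) \<le> t" using b[of x] by linarith
        then have "wt \<kappa> x * min (mE (\<kappa> x)) (t - bt \<kappa> x) \<le> wt \<kappa> x * t"
          by (intro mult_left_mono wt_nonneg[OF A])
        then show ?thesis using True n by (simp add: ev_def Jpart_def mult.commute)
      qed (use t wt_nonneg[OF A, of x] in \<open>simp add: ev_def Jpart_def\<close>)
      then show "ennreal (ev (Jpart t) \<kappa> x) \<le> ennreal t * (ennreal (wt \<kappa> x) * of_bool (bt \<kappa> x \<le> real n))"
        using t wt_nonneg[OF A, of x]
        by (cases "bt \<kappa> x \<le> real n") (auto simp: ennreal_mult[symmetric] ennreal_neg intro: ennreal_leI)
    qed
    also have "\<dots> = ennreal t * (\<integral>\<^sup>+x. ennreal (wt \<kappa> x) * of_bool (bt \<kappa> x \<le> real n) \<partial>count_space UNIV)"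
      by (rule nn_integral_cmult) simp
    also have "\<dots> < \<infinity>" using fin by (simp add: ennreal_mult_less_top)
    finally show "(\<integral>\<^sup>+x. ennreal (ev (Jpart t) \<kappa> x) \<partial>count_space UNIV) < \<infinity>" .
  qed (use nn in auto)
  then have "Infinite_Sum.abs_summable_on (\<lambda>x. ev (Jpart t) \<kappa> x) UNIV"
    unfolding abs_summable_equivalent abs_summable_on_def .
  then show "(\<lambda>x. ev (Jpart t) \<kappa> x) summable_on UNIV" by (rule abs_summable_summable)
  show "0 \<le> vsum (Jpart t) \<kappa>" unfolding vsum_def by (intro infsum_nonneg nn)
  have "ennreal (vsum (Jpart t) \<kappa>) = (\<integral>\<^sup>+x. ennreal (ev (Jpart t) \<kappa> x) \<partial>count_space UNIV)"
    unfolding vsum_def infsum_eq_lebesgue_integral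
    using int nn by (intro nn_integral_eq_integral[symmetric]) auto
  also have "\<dots> = (\<integral>\<^sup>+x. \<integral>\<^sup>+s. ennreal (wt \<kappa> x) *
      (of_bool (bt \<kappa> x \<le> s \<and> s < bt \<kappa> x + mE (\<kappa> x)) * indicator {0..t} s) \<partial>lborel \<partial>count_space UNIV)"
  proof (rule nn_integral_cong)
    fix x
    have "(\<integral>\<^sup>+s. ennreal (wt \<kappa> x) * (of_bool (bt \<kappa> x \<le> s \<and> s < bt \<kappa> x + mE (\<kappa> x)) * indicator {0..t} s) \<partial>lborel)
        = ennreal (wt \<kappa> x) * (\<integral>\<^sup>+s. of_bool (bt \<kappa> x \<le> s \<and> s < bt \<kappa> x + mE (\<kappa> x)) * indicator {0..t} s \<partial>lborel)"
      by (rule nn_integral_cmult) measurable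
    also have "\<dots> = ennreal (wt \<kappa> x) * ennreal (of_bool (bt \<kappa> x \<le> t) * min (mE (\<kappa> x)) (t - bt \<kappa> x))"
      using good by (subst nn_integral_lifetime) (auto simp: b t)
    also have "\<dots> = ennreal (ev (Jpart t) \<kappa> x)"
      unfolding ev_def Jpart_def using wt_nonneg[OF A, of x] by (rule ennreal_mult'[symmetric])
    finally show "ennreal (ev (Jpart t) \<kappa> x) = (\<integral>\<^sup>+s. ennreal (wt \<kappa> x) *
      (of_bool (bt \<kappa> x \<le> s \<and> s < bt \<kappa> x + mE (\<kappa> x)) * indicator {0..t} s) \<partial>lborel)" ..
  qed
  also have "\<dots> = (\<integral>\<^sup>+s. \<integral>\<^sup>+x. ennreal (wt \<kappa> x) *
      (of_bool (bt \<kappa> x \<le> s \<and> s < bt \<kappa> x + mE (\<kappa> x)) * indicator {0..t} s) \<partial>count_space UNIV \<partial>lborel)"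
    by (rule nn_integral_count_space_nn_integral[symmetric]) measurable
  also have "\<dots> = (\<integral>\<^sup>+s. alive_sum 1 s \<kappa> * indicator {0..t} s \<partial>lborel)"
  proof (rule nn_integral_cong)
    fix s
    show "(\<integral>\<^sup>+x. ennreal (wt \<kappa> x) * (of_bool (bt \<kappa> x \<le> s \<and> s < bt \<kappa> x + mE (\<kappa> x)) * indicator {0..t} s) \<partial>count_space UNIV)
        = alive_sum 1 s \<kappa> * indicator {0..t} s"
      unfolding alive_sum_1_eq[OF A]
      by (subst nn_integral_multc[symmetric]) (auto intro!: nn_integral_cong simp: of_bool_def split: split_indicator)
  qed
  finally show "ennreal (vsum (Jpart t) \<kappa>) = (\<integral>\<^sup>+s. alive_sum 1 s \<kappa> * indicator {0..t} s \<partial>lborel)" .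
qed

lemma Jsum_asymptotics:
  assumes \<phi>: "wmom 1 = ennreal (1 + \<rho>)" "0 \<le> \<rho>"
    and Z: "AE \<kappa> in Q. ((\<lambda>t. mart \<rho> t \<kappa>) \<longlongrightarrow> Z \<kappa>) at_top"
  shows "AE \<kappa> in Q. ((\<lambda>t. vsum (Jpart t) \<kappa> / exp_int \<rho> t) \<longlongrightarrow> Z \<kappa>) at_top"
proof -
  have \<phi>': "-1 \<le> \<rho>" using \<phi> by simp
  show ?thesis
    using Z AE_good AE_born_finite[OF \<phi>(1) \<phi>']
  proof eventually_elim
    case (elim \<kappa>)
    then have A: "\<forall>x k. 0 < mA (\<kappa> x) k" by auto
    have [measurable]: "(\<lambda>s. alive_sum 1 s \<kappa>) \<in> borel_measurable borel"
      unfolding alive_sum_1_eq[OF A] by (rule borel_measurable_nn_integral_countable) measurable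
    have fin: "alive_sum 1 s \<kappa> < \<infinity>" for s by (rule alive_sum_finite[OF A elim(3)])
    have eq: "ennreal (exp (\<rho> * s) * mart \<rho> s \<kappa>) = alive_sum 1 s \<kappa>" for s
    proof -
      have "exp (\<rho> * s) * mart \<rho> s \<kappa> = enn2real (alive_sum 1 s \<kappa>)"
        by (simp add: mart_def mult.assoc[symmetric] exp_add[symmetric])
      then show ?thesis using fin by simp
    qed
    let ?J = "\<lambda>t. if 0 \<le> t then vsum (Jpart t) \<kappa> else 0"
    have "((\<lambda>t. ?J t / exp_int \<rho> t) \<longlongrightarrow> Z \<kappa>) at_top"
    proof (rule weighted_average_tendsto[where f = "\<lambda>s. mart \<rho> s \<kappa>" and w = "\<lambda>s. exp (\<rho> * s)"])
      show "(\<lambda>s. mart \<rho> s \<kappa>) \<in> borel_measurable borel" unfolding mart_def by measurable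
      show "0 \<le> ?J t" for t using Jsum_eq(2)[OF elim(2) _ elim(3)] by auto
      show "0 \<le> exp_int \<rho> t" if "0 \<le> t" for t
        using exp_int_mono[OF that, of \<rho>] by (simp add: exp_int_def split: if_splits)
      show "(\<integral>\<^sup>+s. ennreal (exp (\<rho> * s)) * indicator {u..v} s \<partial>lborel) = ennreal (exp_int \<rho> v - exp_int \<rho> u)"
        if "u \<le> v" for u v
        using that by (intro nn_integral_FTC_Icc exp_int_deriv) auto
      show "filterlim (exp_int \<rho>) at_top at_top" by (rule exp_int_at_top[OF \<phi>(2)])
      show "ennreal (?J t) = (\<integral>\<^sup>+s. ennreal (exp (\<rho> * s) * mart \<rho> s \<kappa>) * indicator {0..t} s \<partial>lborel)"
        if "0 \<le> t" for t
        unfolding eq using Jsum_eq(3)[OF elim(2) that elim(3)] that by simp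
    qed (use elim(1) in \<open>auto intro: exp_int_mono\<close>)
    moreover have "\<forall>\<^sub>F t in at_top. ?J t / exp_int \<rho> t = vsum (Jpart t) \<kappa> / exp_int \<rho> t"
      using eventually_ge_at_top[of 0] by eventually_elim simp
    ultimately show ?case by (rule Lim_transform_eventually)
  qed
qed

lemma nn_integral_min_mE:
  assumes a: "0 \<le> a"
  shows "(\<integral>\<^sup>+m. ennreal (min (mE m) a) \<partial>L) = ennreal (1 - exp (- a))"
proof -
  interpret pair_sigma_finite L "lborel :: real measure" ..
  let ?f = "\<lambda>m s. indicator {0..a} s * of_bool (s < mE m) :: ennreal"
  have f: "case_prod ?f \<in> borel_measurable (L \<Otimes>\<^sub>M lborel)"
  proof -
    have "case_prod ?f \<in> borel_measurable (mark_space \<Otimes>\<^sub>M lborel)"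
      unfolding case_prod_unfold by measurable
    then show ?thesis
      using measurable_cong_sets[OF sets_pair_measure_cong[OF sets_L refl] refl] by blast
  qed
  have "(\<integral>\<^sup>+m. ennreal (min (mE m) a) \<partial>L) = (\<integral>\<^sup>+m. \<integral>\<^sup>+s. ?f m s \<partial>lborel \<partial>L)"
  proof (rule nn_integral_cong_AE, use mE_pos in eventually_elim)
    case (elim m)
    have "(\<integral>\<^sup>+s. ?f m s \<partial>lborel) = (\<integral>\<^sup>+s. of_bool (0 \<le> s \<and> s < 0 + mE m) * indicator {0..a} s \<partial>lborel)"
      by (intro nn_integral_cong) (auto split: split_indicator)
    also have "\<dots> = ennreal (of_bool (0 \<le> a) * min (mE m) (a - 0))"
      by (rule nn_integral_lifetime) (use elim a in auto)
    finally show ?case using a by simp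
  qed
  also have "\<dots> = (\<integral>\<^sup>+s. \<integral>\<^sup>+m. ?f m s \<partial>L \<partial>lborel)" by (rule Fubini'[OF f, symmetric])
  also have "\<dots> = (\<integral>\<^sup>+s. ennreal (1 * exp (0 - 1 * s)) * indicator {0..a} s \<partial>lborel)"
  proof (rule nn_integral_cong)
    fix s :: real
    have "(\<integral>\<^sup>+m. ?f m s \<partial>L) = indicator {0..a} s * (\<integral>\<^sup>+m. of_bool (s < mE m) \<partial>L)"
      by (rule nn_integral_cmult) (intro measurable_L, measurable)
    also have "\<dots> = ennreal (1 * exp (0 - 1 * s)) * indicator {0..a} s"
      using nn_integral_mE_greater[of s] by (auto split: split_indicator)
    finally show "(\<integral>\<^sup>+m. ?f m s \<partial>L) = ennreal (1 * exp (0 - 1 * s)) * indicator {0..a} s" .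
  qed
  also have "\<dots> = ennreal (exp (0 - 1 * 0) - exp (0 - 1 * a))" by (rule nn_integral_exp_Icc) (use a in auto)
  finally show ?thesis by simp
qed

text \<open>A unit exponential lifetime has hazard rate \<open>1\<close>, so the time at risk \<open>min E a\<close> compensates the indicator of
  death before age \<open>a\<close>.\<close>

lemma lifetime_compensator:
  assumes a: "0 \<le> a"
  shows "integrable L (\<lambda>m. min (mE m) a)"
    and "(LINT m|L. min (mE m) a) = (LINT m|L. of_bool (mE m \<le> a))"
proof -
  have nn: "AE m in L. 0 \<le> min (mE m) a" using mE_pos by eventually_elim (use a in auto)
  have me: "(\<lambda>m. min (mE m) a) \<in> borel_measurable mark_space" by measurable
  have e: "0 \<le> 1 - exp (- a)" using a by simp
  show int: "integrable L (\<lambda>m. min (mE m) a)"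
    by (rule integrableI_nonneg[OF measurable_L[OF me] nn]) (simp add: nn_integral_min_mE[OF a])
  have 1: "(LINT m|L. min (mE m) a) = 1 - exp (- a)"
    using nn_integral_eq_integral[OF int nn] nn_integral_min_mE[OF a] e integral_nonneg_AE[OF nn]
    by simp
  have intb: "integrable L (\<lambda>m. of_bool (a < mE m) :: real)" by (rule integrable_of_bool_mE) measurable
  have "ennreal (LINT m|L. of_bool (a < mE m)) = (\<integral>\<^sup>+m. of_bool (a < mE m) \<partial>L)"
  proof -
    have "(\<integral>\<^sup>+m. of_bool (a < mE m) \<partial>L) = (\<integral>\<^sup>+m. ennreal (of_bool (a < mE m)) \<partial>L)"
      by (intro nn_integral_cong) simp
    then show ?thesis using nn_integral_eq_integral[OF intb] by simp
  qed
  then have 2: "(LINT m|L. of_bool (a < mE m)) = exp (- a)"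
    using nn_integral_mE_greater[OF a] by (simp add: ennreal_inj)
  have "(LINT m|L. of_bool (mE m \<le> a)) = (LINT m|L. 1 - of_bool (a < mE m))"
    by (intro Bochner_Integration.integral_cong) auto
  also have "\<dots> = 1 - exp (- a)"
    using intb 2 by (simp add: prob_space)
  finally show "(LINT m|L. min (mE m) a) = (LINT m|L. of_bool (mE m \<le> a))" using 1 by simp
qed

lemma lifetime_powr_moment:
  assumes p: "0 < p" "p \<le> 2" and fm: "f \<in> borel_measurable mark_space"
    and f: "(\<integral>\<^sup>+m. ennreal (\<bar>f m\<bar> powr p) \<partial>L) < \<infinity>" and c: "0 \<le> c"
  shows "(\<integral>\<^sup>+m. ennreal ((\<bar>f m\<bar> + c * \<bar>mE m\<bar>) powr p) \<partial>L) < \<infinity>"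
proof -
  note [measurable] = fm
  have "(\<integral>\<^sup>+m. ennreal (exp (mE m / 2)) \<partial>L) = (\<integral>\<^sup>+e. ennreal (exp (- e)) * indicator {0..} e * ennreal (exp (e / 2)) \<partial>lborel)"
    by (rule nn_integral_mE) measurable
  also have "\<dots> = (\<integral>\<^sup>+e. ennreal (exp (- (e / 2))) * indicator {0..} e \<partial>lborel)"
    by (intro nn_integral_cong) (auto simp: ennreal_mult[symmetric] exp_add[symmetric] split: split_indicator)
  also have "\<dots> = ennreal (0 - (- 2 * exp (- (0 / 2))))"
  proof (rule nn_integral_FTC_atLeast)
    show "((\<lambda>e::real. - 2 * exp (- (e / 2))) \<longlongrightarrow> 0) at_top" by real_asymp
  qed (auto intro!: derivative_eq_intros)
  finally have E: "(\<integral>\<^sup>+m. ennreal (exp (mE m / 2)) \<partial>L) < \<infinity>" by simp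
  have bound: "(\<bar>f m\<bar> + c * \<bar>mE m\<bar>) powr p \<le> 4 * \<bar>f m\<bar> powr p + (64 * c powr p) * exp (mE m / 2)"
    if "0 < mE m" for m
  proof -
    let ?x = "\<bar>f m\<bar>" and ?y = "c * \<bar>mE m\<bar>" and ?e = "mE m"
    have "(?x + ?y) powr p \<le> (2 * max ?x ?y) powr p"
      using p c by (intro powr_mono2) auto
    also have "\<dots> = 2 powr p * max ?x ?y powr p" using c by (subst powr_mult) auto
    also have "\<dots> \<le> 4 * (?x powr p + ?y powr p)"
    proof (intro mult_mono)
      show "2 powr p \<le> (4::real)" using powr_mono[OF p(2), of 2] by simp
      show "max ?x ?y powr p \<le> ?x powr p + ?y powr p"
        by (cases "?x \<le> ?y") (simp_all add: max_def)
    qed auto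
    finally have 1: "(?x + ?y) powr p \<le> 4 * ?x powr p + 4 * ?y powr p" by simp
    have "?e \<le> 4 * exp (?e / 4)" using exp_ge_add_one_self[of "?e / 4"] by linarith
    then have "?e powr p \<le> (4 * exp (?e / 4)) powr p" using p that by (intro powr_mono2) auto
    also have "\<dots> \<le> (4 * exp (?e / 4)) powr 2"
    proof (rule powr_mono)
      have "1 \<le> exp (?e / 4)" using that by simp
      then show "1 \<le> 4 * exp (?e / 4)" by linarith
    qed (use p in auto)
    also have "\<dots> = 16 * exp (?e / 2)"
      by (simp add: power_mult_distrib power2_eq_square exp_add[symmetric])
    finally have "c powr p * ?e powr p \<le> c powr p * (16 * exp (?e / 2))" by (intro mult_left_mono) auto
    moreover have "?y powr p = c powr p * ?e powr p" using c that by (simp add: powr_mult)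
    ultimately show ?thesis using 1 by simp
  qed
  have "(\<integral>\<^sup>+m. ennreal ((\<bar>f m\<bar> + c * \<bar>mE m\<bar>) powr p) \<partial>L)
      \<le> (\<integral>\<^sup>+m. ennreal 4 * ennreal (\<bar>f m\<bar> powr p) + ennreal (64 * c powr p) * ennreal (exp (mE m / 2)) \<partial>L)"
  proof (rule nn_integral_mono_AE, use mE_pos in eventually_elim)
    case (elim m)
    have "ennreal ((\<bar>f m\<bar> + c * \<bar>mE m\<bar>) powr p) \<le> ennreal (4 * \<bar>f m\<bar> powr p + (64 * c powr p) * exp (mE m / 2))"
      by (intro ennreal_leI bound elim)
    also have "\<dots> = ennreal 4 * ennreal (\<bar>f m\<bar> powr p) + ennreal (64 * c powr p) * ennreal (exp (mE m / 2))"
      by (simp add: ennreal_plus ennreal_mult)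
    finally show ?case .
  qed
  also have "\<dots> = ennreal 4 * (\<integral>\<^sup>+m. ennreal (\<bar>f m\<bar> powr p) \<partial>L)
      + ennreal (64 * c powr p) * (\<integral>\<^sup>+m. ennreal (exp (mE m / 2)) \<partial>L)"
  proof -
    have m1: "(\<lambda>m. ennreal (\<bar>f m\<bar> powr p)) \<in> borel_measurable L" by (intro measurable_L) measurable
    have m2: "(\<lambda>m. ennreal (exp (mE m / 2))) \<in> borel_measurable L" by (intro measurable_L) measurable
    show ?thesis
      using m1 m2 by (subst nn_integral_add) (auto simp: nn_integral_cmult)
  qed
  also have "\<dots> < \<infinity>" using f E by (simp add: ennreal_mult_less_top)
  finally show ?thesis .
qed

text \<open>By \<open>lifetime_compensator\<close> and the independence of \<open>C\<close> and \<open>E\<close>, the difference \<open>C\<^sub>t - E[C] J\<^sub>t\<close> is a sum of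
  centred vertex functionals.  Its \<open>p\<close>-th moment is of the order of the total weight \<open>e\<^bsup>p V\<^esup>\<close> born up to time
  \<open>t\<close>, which the hypothesis \<open>small\<close> makes negligible against \<open>r t\<close>; so \<open>E[C] J\<^sub>t\<close> determines the limit.\<close>

lemma additive_part_law:
  assumes p: "1 < p" "p \<le> 2" and C: "integrable L mC" and Cp: "(\<integral>\<^sup>+m. ennreal (\<bar>mC m\<bar> powr p) \<partial>L) < \<infinity>"
    and \<rho>: "wmom 1 = ennreal (1 + \<rho>)" "0 \<le> \<rho>" and \<phi>: "wmom p = ennreal (1 + \<phi>)" "-1 \<le> \<phi>"
    and r: "\<And>t. 0 < t \<Longrightarrow> 0 < r t"
    and small: "((\<lambda>t. (t + 2) * exp (max 0 \<phi> * (t + 1)) / r t powr p) \<longlongrightarrow> 0) at_top"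
    and Zm: "Z \<in> borel_measurable cfg_space"
    and J: "AE \<kappa> in Q. ((\<lambda>t. vsum (Jpart t) \<kappa> / r t) \<longlongrightarrow> \<zeta> * Z \<kappa>) at_top"
  shows "conv_in_prob Q (\<lambda>t \<kappa>. Cproc crd t \<kappa> / r t) (\<lambda>\<kappa>. (LINT m|L. mC m) * (\<zeta> * Z \<kappa>))"
proof -
  note [measurable] = Zm
  define c where "c = (LINT m|L. mC m)"
  \<comment> \<open>\<open>H t\<close> is \<open>Cpart t - c Jpart t\<close>.\<close>
  define H where "H t m b w = w * (of_bool (b \<le> t) * (of_bool (mE m \<le> t - b) * mC m - c * min (mE m) (t - b)))"
    for t m b w
  have mfH: "meas_fun (H t)" for t
    unfolding meas_fun_def H_def case_prod_unfold by measurable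
  note [measurable] = measurable_vsum[OF mfH]
  have \<rho>': "-1 \<le> \<rho>" using \<rho> by simp
  have centred: "integrable L (\<lambda>m. H t m b w) \<and> (LINT m|L. H t m b w) = 0" for t b w
  proof (cases "b \<le> t")
    case True
    then have a: "0 \<le> t - b" by simp
    have i1: "integrable L (\<lambda>m. of_bool (mE m \<le> t - b) * mC m)"
      and e1: "(LINT m|L. of_bool (mE m \<le> t - b) * mC m) = (LINT m|L. of_bool (mE m \<le> t - b)) * c"
    proof -
      have ib: "integrable L (\<lambda>m. of_bool (mE m \<le> t - b) :: real)" by (rule integrable_of_bool_mE) measurable
      have bm: "(\<lambda>e. of_bool (e \<le> t - b) :: real) \<in> borel_measurable borel" by measurable
      show "integrable L (\<lambda>m. of_bool (mE m \<le> t - b) * mC m)"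
        "(LINT m|L. of_bool (mE m \<le> t - b) * mC m) = (LINT m|L. of_bool (mE m \<le> t - b)) * c"
        unfolding c_def by (rule indep_life_integral[OF indep_life_mC C bm ib])+
    qed
    have "integrable L (\<lambda>m. of_bool (mE m \<le> t - b) * mC m - c * min (mE m) (t - b))"
      using i1 lifetime_compensator(1)[OF a] by simp
    moreover have "(LINT m|L. of_bool (mE m \<le> t - b) * mC m - c * min (mE m) (t - b)) = 0"
      using i1 lifetime_compensator[OF a] e1 by simp
    ultimately show ?thesis using True by (simp add: H_def)
  qed (simp add: H_def)
  obtain K where K: "(\<integral>\<^sup>+m. ennreal ((\<bar>mC m\<bar> + \<bar>c\<bar> * \<bar>mE m\<bar>) powr p) \<partial>L) = ennreal K" "0 \<le> K"
    using lifetime_powr_moment[OF _ p(2) _ Cp, of "\<bar>c\<bar>"] p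
    by (cases "\<integral>\<^sup>+m. ennreal ((\<bar>mC m\<bar> + \<bar>c\<bar> * \<bar>mE m\<bar>) powr p) \<partial>L") auto
  have H_le: "(\<integral>\<^sup>+m. ennreal (\<bar>H t m b w\<bar> powr p) \<partial>L) \<le> ennreal (w powr p) * (ennreal K * of_bool (b \<le> t))"
    if w: "0 \<le> w" for t b w
  proof (cases "b \<le> t")
    case True
    have "(\<integral>\<^sup>+m. ennreal (\<bar>H t m b w\<bar> powr p) \<partial>L)
        \<le> (\<integral>\<^sup>+m. ennreal (w powr p) * ennreal ((\<bar>mC m\<bar> + \<bar>c\<bar> * \<bar>mE m\<bar>) powr p) \<partial>L)"
    proof (rule nn_integral_mono_AE, use mE_pos in eventually_elim)
      case (elim m)
      have "\<bar>of_bool (mE m \<le> t - b) * mC m - c * min (mE m) (t - b)\<bar>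
          \<le> \<bar>of_bool (mE m \<le> t - b) * mC m\<bar> + \<bar>c * min (mE m) (t - b)\<bar>" by (rule abs_triangle_ineq4)
      also have "\<dots> \<le> \<bar>mC m\<bar> + \<bar>c\<bar> * \<bar>mE m\<bar>"
      proof (rule add_mono)
        have "\<bar>min (mE m) (t - b)\<bar> \<le> \<bar>mE m\<bar>" using elim True by (simp add: min_def)
        then show "\<bar>c * min (mE m) (t - b)\<bar> \<le> \<bar>c\<bar> * \<bar>mE m\<bar>" unfolding abs_mult by (rule mult_left_mono) simp
      qed simp
      finally have "\<bar>H t m b w\<bar> \<le> w * (\<bar>mC m\<bar> + \<bar>c\<bar> * \<bar>mE m\<bar>)"
        using w True by (simp add: H_def abs_mult mult_left_mono)
      then have "\<bar>H t m b w\<bar> powr p \<le> (w * (\<bar>mC m\<bar> + \<bar>c\<bar> * \<bar>mE m\<bar>)) powr p"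
        using p by (intro powr_mono2) auto
      also have "\<dots> = w powr p * (\<bar>mC m\<bar> + \<bar>c\<bar> * \<bar>mE m\<bar>) powr p" using w by (simp add: powr_mult)
      finally show ?case by (subst ennreal_mult[symmetric]) (auto intro: ennreal_leI)
    qed
    also have "\<dots> = ennreal (w powr p) * (\<integral>\<^sup>+m. ennreal ((\<bar>mC m\<bar> + \<bar>c\<bar> * \<bar>mE m\<bar>) powr p) \<partial>L)"
      by (rule nn_integral_cmult) (intro measurable_L, measurable)
    finally show ?thesis using K True by simp
  qed (use p in \<open>simp add: H_def\<close>)
  have H_moment: "(\<integral>\<^sup>+\<kappa>. ennreal (\<bar>vsum (H t) \<kappa>\<bar> powr p) \<partial>Q) \<le> ennreal (12 * K * ((t + 2) * exp (max 0 \<phi> * (t + 1))))"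
    if t: "0 \<le> t" for t
  proof -
    have "(\<integral>\<^sup>+\<kappa>. ennreal (\<bar>vsum (H t) \<kappa>\<bar> powr p) \<partial>Q) \<le> 4 * treesum p (\<lambda>b. ennreal K * of_bool (b \<le> t))"
      using p centred by (intro nn_integral_vsum_powr_le_treesum[OF _ p(2) mfH _ _ H_le]) auto
    also have "treesum p (\<lambda>b. ennreal K * of_bool (b \<le> t)) = ennreal K * treesum p (\<lambda>b. of_bool (b \<le> t))"
      by (rule treesum_cmult) measurable
    also have "4 * (ennreal K * treesum p (\<lambda>b. of_bool (b \<le> t)))
        \<le> 4 * (ennreal K * ennreal (3 * ((t + 2) * exp (max 0 \<phi> * (t + 1)))))"
    proof (intro mult_left_mono)
      have "(\<Sum>k\<le>nat \<lceil>t\<rceil>. exp (\<phi> * real k)) \<le> (\<Sum>k\<le>nat \<lceil>t\<rceil>. exp (max 0 \<phi> * (t + 1)))"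
      proof (rule sum_mono)
        fix k assume "k \<in> {..nat \<lceil>t\<rceil>}"
        then have "real k \<le> real (nat \<lceil>t\<rceil>)" by simp
        also have "\<dots> \<le> t + 1" by (rule nat_ceiling_le_add_one[OF t])
        finally have k: "real k \<le> t + 1" .
        have "\<phi> * real k \<le> max 0 \<phi> * real k" by (intro mult_right_mono) auto
        also have "\<dots> \<le> max 0 \<phi> * (t + 1)" using k by (intro mult_left_mono) auto
        finally show "exp (\<phi> * real k) \<le> exp (max 0 \<phi> * (t + 1))" by simp
      qed
      also have "\<dots> = (real (nat \<lceil>t\<rceil>) + 1) * exp (max 0 \<phi> * (t + 1))" by simp
      also have "\<dots> \<le> (t + 2) * exp (max 0 \<phi> * (t + 1))"
        using nat_ceiling_le_add_one[OF t] by (intro mult_right_mono) auto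
      finally have "exp 1 * (\<Sum>k\<le>nat \<lceil>t\<rceil>. exp (\<phi> * real k)) \<le> 3 * ((t + 2) * exp (max 0 \<phi> * (t + 1)))"
        using exp_le t by (intro mult_mono) (auto intro: sum_nonneg)
      then show "treesum p (\<lambda>b. of_bool (b \<le> t)) \<le> ennreal (3 * ((t + 2) * exp (max 0 \<phi> * (t + 1))))"
        by (intro order_trans[OF treesum_born_le[OF t \<phi>]] ennreal_leI)
    qed auto
    also have "\<dots> = ennreal 4 * (ennreal K * ennreal (3 * ((t + 2) * exp (max 0 \<phi> * (t + 1)))))" by simp
    also have "\<dots> = ennreal (12 * K * ((t + 2) * exp (max 0 \<phi> * (t + 1))))"
      using K t by (simp add: ennreal_mult[symmetric] mult_ac del: ennreal_numeral)
    finally show ?thesis .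
  qed
  have 1: "conv_in_prob Q (\<lambda>t \<kappa>. vsum (H t) \<kappa> / r t) (\<lambda>_. 0)"
  proof (rule Q.conv_in_probI_moment[where p = p and B = "\<lambda>t. \<bar>12 * K * ((t + 2) * exp (max 0 \<phi> * (t + 1)) / r t powr p)\<bar>"])
    show "\<forall>\<^sub>F t in at_top. (\<integral>\<^sup>+\<kappa>. ennreal (\<bar>vsum (H t) \<kappa> / r t - 0\<bar> powr p) \<partial>Q)
        \<le> ennreal \<bar>12 * K * ((t + 2) * exp (max 0 \<phi> * (t + 1)) / r t powr p)\<bar>"
      using eventually_gt_at_top[of 0]
    proof eventually_elim
      case (elim t)
      have "(\<integral>\<^sup>+\<kappa>. ennreal (\<bar>vsum (H t) \<kappa> / r t - 0\<bar> powr p) \<partial>Q)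
          = (\<integral>\<^sup>+\<kappa>. ennreal (1 / r t powr p) * ennreal (\<bar>vsum (H t) \<kappa>\<bar> powr p) \<partial>Q)"
        using r[OF elim] by (intro nn_integral_cong) (simp add: abs_divide powr_divide ennreal_mult[symmetric])
      also have "\<dots> = ennreal (1 / r t powr p) * (\<integral>\<^sup>+\<kappa>. ennreal (\<bar>vsum (H t) \<kappa>\<bar> powr p) \<partial>Q)"
        by (rule nn_integral_cmult) measurable
      also have "\<dots> \<le> ennreal (1 / r t powr p) * ennreal (12 * K * ((t + 2) * exp (max 0 \<phi> * (t + 1))))"
        using elim by (intro mult_left_mono H_moment) auto
      also have "\<dots> = ennreal (12 * K * ((t + 2) * exp (max 0 \<phi> * (t + 1)) / r t powr p))"
        using elim K by (simp add: ennreal_mult[symmetric])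
      also have "\<dots> \<le> ennreal \<bar>12 * K * ((t + 2) * exp (max 0 \<phi> * (t + 1)) / r t powr p)\<bar>"
        by (rule ennreal_leI[OF abs_ge_self])
      finally show ?case .
    qed
    have "((\<lambda>t. 12 * K * ((t + 2) * exp (max 0 \<phi> * (t + 1)) / r t powr p)) \<longlongrightarrow> 12 * K * 0) at_top"
      by (intro tendsto_mult tendsto_const small)
    then have "((\<lambda>t. 12 * K * ((t + 2) * exp (max 0 \<phi> * (t + 1)) / r t powr p)) \<longlongrightarrow> 0) at_top"
      by (simp only: mult_zero_right)
    then show "((\<lambda>t. \<bar>12 * K * ((t + 2) * exp (max 0 \<phi> * (t + 1)) / r t powr p)\<bar>) \<longlongrightarrow> 0) at_top"
      by (rule tendsto_rabs_zero)
  qed (use p in auto)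
  have 2: "conv_in_prob Q (\<lambda>t \<kappa>. c * (vsum (Jpart t) \<kappa> / r t)) (\<lambda>\<kappa>. c * (\<zeta> * Z \<kappa>))"
  proof (rule Q.conv_in_probI_AE)
    show "AE \<kappa> in Q. ((\<lambda>t. c * (vsum (Jpart t) \<kappa> / r t)) \<longlongrightarrow> c * (\<zeta> * Z \<kappa>)) at_top"
      using J by eventually_elim (rule tendsto_mult_left)
  qed measurable
  have sum: "conv_in_prob Q (\<lambda>t \<kappa>. vsum (H t) \<kappa> / r t + c * (vsum (Jpart t) \<kappa> / r t)) (\<lambda>\<kappa>. 0 + c * (\<zeta> * Z \<kappa>))"
    by (rule Q.conv_in_prob_add[OF _ _ _ _ 1 2]) measurable
  have split: "AE \<kappa> in Q. \<forall>t\<ge>0. Cproc crd t \<kappa> = vsum (H t) \<kappa> + c * vsum (Jpart t) \<kappa>"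
    using AE_Cproc AE_summable_dead[OF indep_life_mC C \<rho>(1) \<rho>'] AE_good AE_born_finite[OF \<rho>(1) \<rho>']
  proof eventually_elim
    case (elim \<kappa>)
    show ?case
    proof (intro allI impI)
      fix t :: real assume t: "0 \<le> t"
      have sC: "(\<lambda>x. ev (Cpart t) \<kappa> x) summable_on UNIV"
        using elim(2) by (simp add: Cpart_def[abs_def])
      have sJ: "(\<lambda>x. c * ev (Jpart t) \<kappa> x) summable_on UNIV"
        by (intro summable_on_cmult_right Jsum_eq(1)[OF elim(3) t elim(4)])
      have "vsum (Cpart t) \<kappa> - c * vsum (Jpart t) \<kappa> = (\<Sum>\<^sub>\<infinity>x. ev (Cpart t) \<kappa> x) - (\<Sum>\<^sub>\<infinity>x. c * ev (Jpart t) \<kappa> x)"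
        unfolding vsum_def by (simp add: infsum_cmult_right')
      also have "\<dots> = (\<Sum>\<^sub>\<infinity>x. ev (Cpart t) \<kappa> x - c * ev (Jpart t) \<kappa> x)"
        by (rule infsum_diff_eq[OF sC sJ])
      also have "\<dots> = vsum (H t) \<kappa>"
        unfolding vsum_def
      proof (rule infsum_cong)
        fix x
        have "0 < mE (\<kappa> x)" using elim(3) by auto
        then show "ev (Cpart t) \<kappa> x - c * ev (Jpart t) \<kappa> x = ev (H t) \<kappa> x"
          by (cases "bt \<kappa> x \<le> t"; cases "mE (\<kappa> x) \<le> t - bt \<kappa> x")
            (auto simp: ev_def Cpart_def Jpart_def H_def algebra_simps)
      qed
      finally show "Cproc crd t \<kappa> = vsum (H t) \<kappa> + c * vsum (Jpart t) \<kappa>" using elim(1) by simp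
    qed
  qed
  have ev: "\<P>(\<kappa> in Q. \<epsilon> < \<bar>Cproc crd t \<kappa> / r t - c * (\<zeta> * Z \<kappa>)\<bar>)
      = \<P>(\<kappa> in Q. \<epsilon> < \<bar>vsum (H t) \<kappa> / r t + c * (vsum (Jpart t) \<kappa> / r t) - (0 + c * (\<zeta> * Z \<kappa>))\<bar>)"
    if "0 \<le> t" for \<epsilon> t
  proof (rule measure_eq_AE)
    show "AE \<kappa> in Q. \<kappa> \<in> {\<kappa> \<in> space Q. \<epsilon> < \<bar>Cproc crd t \<kappa> / r t - c * (\<zeta> * Z \<kappa>)\<bar>} \<longleftrightarrow>
        \<kappa> \<in> {\<kappa> \<in> space Q. \<epsilon> < \<bar>vsum (H t) \<kappa> / r t + c * (vsum (Jpart t) \<kappa> / r t) - (0 + c * (\<zeta> * Z \<kappa>))\<bar>}"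
      using split by eventually_elim (use that in \<open>simp add: add_divide_distrib\<close>)
  qed measurable
  have "conv_in_prob Q (\<lambda>t \<kappa>. Cproc crd t \<kappa> / r t) (\<lambda>\<kappa>. c * (\<zeta> * Z \<kappa>))"
  proof (rule Q.conv_in_probI_bound)
    fix \<epsilon> :: real assume "0 < \<epsilon>"
    then show "((\<lambda>t. \<P>(\<kappa> in Q. \<epsilon> < \<bar>vsum (H t) \<kappa> / r t + c * (vsum (Jpart t) \<kappa> / r t) - (0 + c * (\<zeta> * Z \<kappa>))\<bar>)) \<longlongrightarrow> 0) at_top"
      using sum by (simp add: conv_in_prob_def)
    show "\<forall>\<^sub>F t in at_top. \<P>(\<kappa> in Q. \<epsilon> < \<bar>Cproc crd t \<kappa> / r t - c * (\<zeta> * Z \<kappa>)\<bar>)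
        \<le> \<P>(\<kappa> in Q. \<epsilon> < \<bar>vsum (H t) \<kappa> / r t + c * (vsum (Jpart t) \<kappa> / r t) - (0 + c * (\<zeta> * Z \<kappa>))\<bar>)"
      using eventually_ge_at_top[of 0] by eventually_elim (simp only: ev order_refl)
  qed
  then show ?thesis by (simp add: c_def)
qed

end

section \<open>The three regimes for the coordinate process\<close>

context mark_law
begin

lemma Wproc_converges:
  assumes [measurable]: "Z \<in> borel_measurable cfg_space"
    and R: "conv_in_prob Q (\<lambda>t \<kappa>. c t * vsum (Rpart t) \<kappa>) (\<lambda>_. 0)"
    and C: "conv_in_prob Q (\<lambda>t \<kappa>. c t * Cproc crd t \<kappa>) Z"
  shows "conv_in_prob Q (\<lambda>t \<kappa>. c t * Wproc crd t \<kappa>) Z"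
proof (rule Q.conv_in_prob_cong_AE)
  show "conv_in_prob Q (\<lambda>t \<kappa>. c t * vsum (Rpart t) \<kappa> + c t * Cproc crd t \<kappa>) (\<lambda>\<kappa>. 0 + Z \<kappa>)"
    by (rule Q.conv_in_prob_add[OF _ _ _ _ R C]) measurable
  show "AE \<kappa> in Q. c t * vsum (Rpart t) \<kappa> + c t * Cproc crd t \<kappa> = c t * Wproc crd t \<kappa>" for t
    using AE_Wproc AE_Cproc by eventually_elim (simp add: distrib_left)
qed auto

lemma is_M_inf_mart:
  assumes "Z \<in> borel_measurable cfg_space" "AE \<kappa> in Q. ((\<lambda>t. mart \<rho> t \<kappa>) \<longlongrightarrow> Z \<kappa>) at_top"
  shows "is_M_inf Q crd \<rho> 1 Z"
  unfolding is_M_inf_def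
proof
  show "Z \<in> borel_measurable Q" using assms(1) by simp
  show "AE \<kappa> in Q. ((\<lambda>t. Mart crd \<rho> 1 t \<kappa>) \<longlongrightarrow> Z \<kappa>) at_top"
    using assms(2) AE_Mart[of \<rho>] by eventually_elim (simp add: mart_def)
qed

text \<open>The exponents \<open>p\<close> for \<open>C\<close> and \<open>\<gamma>\<close> for \<open>R\<close> are independent of each other; \<open>p = 1\<close> and \<open>\<gamma> \<le> 1\<close> need no
  centring.\<close>

theorem subcritical_convergence:
  assumes p: "1 \<le> p" "p \<le> 2" and C: "integrable L mC"
    and centredC: "p \<le> 1 \<or> (LINT m|L. mC m) = 0"
    and Cp: "(\<integral>\<^sup>+m. ennreal (\<bar>mC m\<bar> powr p) \<partial>L) < \<infinity>"
    and \<phi>1: "wmom 1 = ennreal (1 + \<phi>1)" "-1 \<le> \<phi>1"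
    and \<phi>: "wmom p = ennreal (1 + \<phi>)" "-1 \<le> \<phi>" "\<phi> < 0"
    and \<gamma>: "0 < \<gamma>" "\<gamma> \<le> 2" and centredR: "\<gamma> \<le> 1 \<or> integrable L mR \<and> (LINT m|L. mR m) = 0"
    and Rp: "(\<integral>\<^sup>+m. ennreal (\<bar>mR m\<bar> powr \<gamma>) \<partial>L) < \<infinity>"
    and \<psi>: "wmom \<gamma> = ennreal (1 + \<psi>)" "-1 \<le> \<psi>" "\<psi> < 0"
  shows "\<exists>Z. is_C_inf Q crd Z \<and> conv_in_prob Q (Wproc crd) Z"
proof -
  obtain Z where Z: "is_C_inf Q crd Z"
    using additive_part_converges[OF p C centredC Cp \<phi>1 \<phi>] by auto
  have Zm: "Z \<in> borel_measurable cfg_space"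
    using Z measurable_cong_sets[OF sets_Q refl] by (auto simp: is_C_inf_def)
  have "((\<lambda>t. exp (\<psi> * t)) \<longlongrightarrow> 0) at_top" using \<psi>(3) by real_asymp
  then have R: "conv_in_prob Q (\<lambda>t \<kappa>. 1 * vsum (Rpart t) \<kappa>) (\<lambda>_. 0)"
    by (intro Rsum_converges[OF \<gamma> centredR Rp \<psi>(1,2)]) simp
  have "conv_in_prob Q (\<lambda>t \<kappa>. 1 * Cproc crd t \<kappa>) Z"
    using Z by (simp add: is_C_inf_def)
  from Wproc_converges[OF Zm R this] have "conv_in_prob Q (Wproc crd) Z" by simp
  with Z show ?thesis by (intro exI[of _ Z] conjI)
qed

text \<open>Here \<open>J\<^sub>t\<close> is asymptotic to \<open>M\<^sub>\<infinity>(1) e\<^bsup>\<rho> t\<^esup> / \<rho>\<close>, and \<open>\<phi> < p \<rho>\<close> makes both the fluctuations of \<open>C\<^sub>t\<close> and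
  the contribution of \<open>R\<close> small on the scale \<open>e\<^bsup>\<rho> t\<^esup>\<close>.\<close>

theorem supercritical_convergence:
  assumes p: "1 < p" "p \<le> 2" and C: "integrable L mC" and Cp: "(\<integral>\<^sup>+m. ennreal (\<bar>mC m\<bar> powr p) \<partial>L) < \<infinity>"
    and R: "integrable L mR" "(LINT m|L. mR m) = 0" and Rp: "(\<integral>\<^sup>+m. ennreal (\<bar>mR m\<bar> powr p) \<partial>L) < \<infinity>"
    and \<rho>: "wmom 1 = ennreal (1 + \<rho>)" "0 < \<rho>"
    and \<phi>: "wmom p = ennreal (1 + \<phi>)" "-1 \<le> \<phi>" "\<phi> < p * \<rho>"
  shows "\<exists>Z. Z \<in> borel_measurable cfg_space \<and> is_M_inf Q crd \<rho> 1 Z \<and>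
    conv_in_prob Q (\<lambda>t \<kappa>. exp (- \<rho> * t) * Wproc crd t \<kappa>) (\<lambda>\<kappa>. (LINT m|L. mC m) / \<rho> * Z \<kappa>)"
proof -
  have \<rho>': "-1 \<le> \<rho>" "0 \<le> \<rho>" using \<rho> by auto
  obtain Z where Z: "Z \<in> borel_measurable cfg_space" "AE \<kappa> in Q. ((\<lambda>t. mart \<rho> t \<kappa>) \<longlongrightarrow> Z \<kappa>) at_top"
    using mart_converges[OF \<rho>(1) \<rho>'(1)] .
  note [measurable] = Z(1)
  have J: "AE \<kappa> in Q. ((\<lambda>t. vsum (Jpart t) \<kappa> / exp (\<rho> * t)) \<longlongrightarrow> 1 / \<rho> * Z \<kappa>) at_top"
    using Jsum_asymptotics[OF \<rho>(1) \<rho>'(2) Z(2)]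
  proof eventually_elim
    case (elim \<kappa>)
    have "((\<lambda>t. exp_int \<rho> t / exp (\<rho> * t)) \<longlongrightarrow> 1 / \<rho>) at_top"
    proof -
      have "((\<lambda>t. exp (- \<rho> * t)) \<longlongrightarrow> 0) at_top" using \<rho>(2) by real_asymp
      then have "((\<lambda>t. (1 - exp (- \<rho> * t)) / \<rho>) \<longlongrightarrow> (1 - 0) / \<rho>) at_top"
        using \<rho>(2) by (intro tendsto_divide tendsto_diff tendsto_const) auto
      then have "((\<lambda>t. (1 - exp (- \<rho> * t)) / \<rho>) \<longlongrightarrow> 1 / \<rho>) at_top" by simp
      moreover have "exp_int \<rho> t / exp (\<rho> * t) = (1 - exp (- \<rho> * t)) / \<rho>" for t
        using \<rho>(2) by (simp add: exp_int_def exp_minus divide_inverse algebra_simps)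
      ultimately show ?thesis by simp
    qed
    from tendsto_mult[OF elim this]
    have "((\<lambda>t. vsum (Jpart t) \<kappa> / exp_int \<rho> t * (exp_int \<rho> t / exp (\<rho> * t))) \<longlongrightarrow> Z \<kappa> * (1 / \<rho>)) at_top" .
    moreover have "\<forall>\<^sub>F t in at_top. vsum (Jpart t) \<kappa> / exp_int \<rho> t * (exp_int \<rho> t / exp (\<rho> * t))
        = vsum (Jpart t) \<kappa> / exp (\<rho> * t)"
      using eventually_gt_at_top[of 0]
    proof eventually_elim
      case (elim t)
      then have "exp_int \<rho> t \<noteq> 0" using \<rho>(2) by (simp add: exp_int_def)
      then show ?case by simp
    qed
    ultimately have "((\<lambda>t. vsum (Jpart t) \<kappa> / exp (\<rho> * t)) \<longlongrightarrow> Z \<kappa> * (1 / \<rho>)) at_top"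
      by (rule Lim_transform_eventually)
    then show ?case by (simp only: mult.commute)
  qed
  have small: "((\<lambda>t. (t + 2) * exp (max 0 \<phi> * (t + 1)) / exp (\<rho> * t) powr p) \<longlongrightarrow> 0) at_top"
  proof -
    define a where "a = max 0 \<phi>"
    define d where "d = p * \<rho> - a"
    have d: "0 < d" using \<phi>(3) p \<rho>(2) by (simp add: d_def a_def)
    have "((\<lambda>t. exp a * ((t + 2) * exp (- d * t))) \<longlongrightarrow> 0) at_top" using d by real_asymp
    moreover have "exp a * ((t + 2) * exp (- d * t)) = (t + 2) * exp (a * (t + 1)) / exp (\<rho> * t) powr p" for t
    proof -
      have "exp (\<rho> * t) powr p = exp (p * \<rho> * t)" by (simp add: powr_def mult.assoc)
      then have "exp a * exp (- d * t) = exp (a * (t + 1)) / exp (\<rho> * t) powr p"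
        by (simp add: exp_add[symmetric] exp_diff[symmetric] d_def algebra_simps)
      then show ?thesis by (simp only: mult.left_commute[of "exp a"] times_divide_eq_right)
    qed
    ultimately show ?thesis by (simp add: a_def)
  qed
  have "conv_in_prob Q (\<lambda>t \<kappa>. Cproc crd t \<kappa> / exp (\<rho> * t)) (\<lambda>\<kappa>. (LINT m|L. mC m) * (1 / \<rho> * Z \<kappa>))"
    by (rule additive_part_law[OF p C Cp \<rho>(1) \<rho>'(2) \<phi>(1,2) _ small Z(1) J]) simp
  then have C': "conv_in_prob Q (\<lambda>t \<kappa>. exp (- \<rho> * t) * Cproc crd t \<kappa>) (\<lambda>\<kappa>. (LINT m|L. mC m) / \<rho> * Z \<kappa>)"
    by (simp add: exp_minus divide_inverse mult_ac)
  have "((\<lambda>t. \<bar>exp (- \<rho> * t)\<bar> powr p * exp (\<phi> * t)) \<longlongrightarrow> 0) at_top"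
  proof -
    define d where "d = p * \<rho> - \<phi>"
    have d: "0 < d" using \<phi>(3) by (simp add: d_def)
    have "((\<lambda>t. exp (- d * t)) \<longlongrightarrow> 0) at_top" using d by real_asymp
    moreover have "exp (- d * t) = \<bar>exp (- \<rho> * t)\<bar> powr p * exp (\<phi> * t)" for t
      by (simp add: powr_def exp_add[symmetric] d_def algebra_simps)
    ultimately show ?thesis by simp
  qed
  then have R': "conv_in_prob Q (\<lambda>t \<kappa>. exp (- \<rho> * t) * vsum (Rpart t) \<kappa>) (\<lambda>_. 0)"
    using p R by (intro Rsum_converges[OF _ _ _ Rp \<phi>(1,2)]) auto
  have "conv_in_prob Q (\<lambda>t \<kappa>. exp (- \<rho> * t) * Wproc crd t \<kappa>) (\<lambda>\<kappa>. (LINT m|L. mC m) / \<rho> * Z \<kappa>)"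
    by (rule Wproc_converges[OF _ R' C']) measurable
  then show ?thesis using Z(1) is_M_inf_mart[OF Z] by (intro exI[of _ Z] conjI)
qed

text \<open>Without exponential growth \<open>J\<^sub>t / t\<close> is the average of \<open>M\<^sub>s(1)\<close> over \<open>0 \<le> s \<le> t\<close>.\<close>

theorem critical_convergence:
  assumes p: "1 < p" "p \<le> 2" and C: "integrable L mC" and Cp: "(\<integral>\<^sup>+m. ennreal (\<bar>mC m\<bar> powr p) \<partial>L) < \<infinity>"
    and K: "0 \<le> K" and tail: "\<And>y. 0 < y \<Longrightarrow> (\<integral>\<^sup>+m. of_bool (y < \<bar>mR m\<bar>) \<partial>L) \<le> ennreal (K / y)"
    and mean: "\<And>y. 0 < y \<Longrightarrow> \<bar>LINT m|L. mR m * of_bool (\<bar>mR m\<bar> \<le> y)\<bar> \<le> K"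
    and one: "wmom 1 = ennreal 1"
    and \<phi>: "wmom p = ennreal (1 + \<phi>)" "-1 \<le> \<phi>" "\<phi> < 0"
  shows "\<exists>Z. Z \<in> borel_measurable cfg_space \<and> is_M_inf Q crd 0 1 Z \<and>
    conv_in_prob Q (\<lambda>t \<kappa>. 1 / t * Wproc crd t \<kappa>) (\<lambda>\<kappa>. (LINT m|L. mC m) * Z \<kappa>)"
proof -
  have one': "wmom 1 = ennreal (1 + 0)" using one by simp
  obtain Z where Z: "Z \<in> borel_measurable cfg_space" "AE \<kappa> in Q. ((\<lambda>t. mart 0 t \<kappa>) \<longlongrightarrow> Z \<kappa>) at_top"
    using mart_converges[OF one'] by auto
  note [measurable] = Z(1)
  have "exp_int 0 = (\<lambda>t. t)" by (auto simp: exp_int_def)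
  then have J: "AE \<kappa> in Q. ((\<lambda>t. vsum (Jpart t) \<kappa> / t) \<longlongrightarrow> 1 * Z \<kappa>) at_top"
    using Jsum_asymptotics[OF one' order_refl Z(2)] by simp
  have "((\<lambda>t::real. (t + 2) / t powr p) \<longlongrightarrow> 0) at_top" using p(1) by real_asymp
  then have small: "((\<lambda>t. (t + 2) * exp (max 0 \<phi> * (t + 1)) / t powr p) \<longlongrightarrow> 0) at_top"
    using \<phi>(3) by simp
  have "conv_in_prob Q (\<lambda>t \<kappa>. Cproc crd t \<kappa> / t) (\<lambda>\<kappa>. (LINT m|L. mC m) * (1 * Z \<kappa>))"
    by (rule additive_part_law[OF p C Cp one' order_refl \<phi>(1,2) _ small Z(1) J]) simp
  then have C': "conv_in_prob Q (\<lambda>t \<kappa>. 1 / t * Cproc crd t \<kappa>) (\<lambda>\<kappa>. (LINT m|L. mC m) * Z \<kappa>)"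
    by simp
  have "conv_in_prob Q (\<lambda>t \<kappa>. 1 / t * Wproc crd t \<kappa>) (\<lambda>\<kappa>. (LINT m|L. mC m) * Z \<kappa>)"
    by (rule Wproc_converges[OF _ Rsum_heavy_tails[OF K tail mean one] C']) measurable
  then show ?thesis using Z(1) is_M_inf_mart[OF Z] by (intro exI[of _ Z] conjI)
qed

section \<open>Transfer to an arbitrary family of independent marks\<close>

lemma birth_eq: "birth X \<omega> x = birth crd (\<lambda>y. X y \<omega>) x"
  by (induction x) auto

lemma pos_eq: "pos X \<omega> x = pos crd (\<lambda>y. X y \<omega>) x"
  by (induction x) auto

lemma tree_eq: "tree X \<omega> = tree crd (\<lambda>y. X y \<omega>)"
proof -
  have "x \<in> tree X \<omega> \<longleftrightarrow> x \<in> tree crd (\<lambda>y. X y \<omega>)" for x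
    by (induction x) (auto simp: tree.root Cons_mem_tree_iff)
  then show ?thesis by blast
qed

text \<open>The processes depend on the marks and on the sample point only through the configuration.\<close>

lemma process_eqs:
  "Cproc X t \<omega> = Cproc crd t (\<lambda>y. X y \<omega>)" "Wproc X t \<omega> = Wproc crd t (\<lambda>y. X y \<omega>)"
  "Mart X \<rho> \<theta> t \<omega> = Mart crd \<rho> \<theta> t (\<lambda>y. X y \<omega>)"
  by (simp_all only: Cproc_def Wproc_def Mart_def alive_def dead_def death_def
      birth_eq[of X] tree_eq[of X] pos_eq[of X])

context
  fixes M :: "'a measure" and X :: "nat list \<Rightarrow> 'a \<Rightarrow> mark"
  assumes M: "prob_space M" and X: "iid_marks M X L"
begin

lemma measurable_configuration [measurable]: "(\<lambda>\<omega> y. X y \<omega>) \<in> measurable M cfg_space"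
proof -
  interpret M: prob_space M by (rule M)
  have "X y \<in> measurable M mark_space" for y
    using X by (auto simp: iid_marks_def M.indep_vars_def)
  then show ?thesis by (intro measurable_PiM_single') (auto intro: measurable_space)
qed

lemma distr_configuration: "distr M cfg_space (\<lambda>\<omega> y. X y \<omega>) = Q"
proof -
  interpret M: prob_space M by (rule M)
  have "X y \<in> measurable M mark_space" for y
    using X by (auto simp: iid_marks_def M.indep_vars_def)
  then have "distr M cfg_space (\<lambda>\<omega>. \<lambda>y\<in>UNIV. X y \<omega>) = (\<Pi>\<^sub>M y\<in>UNIV. distr M mark_space (X y))"
    using X by (subst M.indep_vars_iff_distr_eq_PiM[symmetric]) (auto simp: iid_marks_def)
  then show ?thesis using X by (simp add: iid_marks_def restrict_def)
qed

lemma AE_transfer: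
  assumes "AE \<kappa> in Q. P \<kappa>"
  shows "AE \<omega> in M. P (\<lambda>y. X y \<omega>)"
proof (rule AE_distrD[OF measurable_configuration])
  show "AE \<kappa> in distr M cfg_space (\<lambda>\<omega> y. X y \<omega>). P \<kappa>"
    unfolding distr_configuration by (rule assms)
qed

lemma conv_in_prob_transfer:
  assumes [measurable]: "\<And>t. Y t \<in> borel_measurable cfg_space" "Z \<in> borel_measurable cfg_space"
    and lim: "conv_in_prob Q Y Z"
  shows "conv_in_prob M (\<lambda>t \<omega>. Y t (\<lambda>y. X y \<omega>)) (\<lambda>\<omega>. Z (\<lambda>y. X y \<omega>))"
proof -
  have "\<P>(\<omega> in M. \<epsilon> < \<bar>Y t (\<lambda>y. X y \<omega>) - Z (\<lambda>y. X y \<omega>)\<bar>) = \<P>(\<kappa> in Q. \<epsilon> < \<bar>Y t \<kappa> - Z \<kappa>\<bar>)" for t \<epsilon>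
  proof -
    have s: "{\<kappa> \<in> space cfg_space. \<epsilon> < \<bar>Y t \<kappa> - Z \<kappa>\<bar>} \<in> sets cfg_space" by measurable
    have "\<P>(\<kappa> in Q. \<epsilon> < \<bar>Y t \<kappa> - Z \<kappa>\<bar>)
        = measure (distr M cfg_space (\<lambda>\<omega> y. X y \<omega>)) {\<kappa> \<in> space cfg_space. \<epsilon> < \<bar>Y t \<kappa> - Z \<kappa>\<bar>}"
      unfolding distr_configuration using sets_eq_imp_space_eq[OF sets_Q] by simp
    also have "\<dots> = measure M ((\<lambda>\<omega> y. X y \<omega>) -` {\<kappa> \<in> space cfg_space. \<epsilon> < \<bar>Y t \<kappa> - Z \<kappa>\<bar>} \<inter> space M)"
      by (rule measure_distr[OF measurable_configuration s])
    also have "(\<lambda>\<omega> y. X y \<omega>) -` {\<kappa> \<in> space cfg_space. \<epsilon> < \<bar>Y t \<kappa> - Z \<kappa>\<bar>} \<inter> space M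
        = {\<omega> \<in> space M. \<epsilon> < \<bar>Y t (\<lambda>y. X y \<omega>) - Z (\<lambda>y. X y \<omega>)\<bar>}"
      using measurable_space[OF measurable_configuration] by auto
    finally show ?thesis ..
  qed
  then show ?thesis using lim by (simp add: conv_in_prob_def)
qed

lemma is_M_inf_transfer:
  assumes Z: "Z \<in> borel_measurable cfg_space" "is_M_inf Q crd \<rho> 1 Z"
  shows "is_M_inf M X \<rho> 1 (\<lambda>\<omega>. Z (\<lambda>y. X y \<omega>))"
  unfolding is_M_inf_def process_eqs(3)[of X]
  using AE_transfer[of "\<lambda>\<kappa>. ((\<lambda>t. Mart crd \<rho> 1 t \<kappa>) \<longlongrightarrow> Z \<kappa>) at_top"] Z
    measurable_compose[OF measurable_configuration Z(1)]
  by (simp add: is_M_inf_def)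

lemma is_C_inf_transfer:
  assumes "is_C_inf Q crd Z"
  shows "is_C_inf M X (\<lambda>\<omega>. Z (\<lambda>y. X y \<omega>))"
proof -
  have Z: "Z \<in> borel_measurable cfg_space"
    using assms measurable_cong_sets[OF sets_Q refl] by (auto simp: is_C_inf_def)
  have "conv_in_prob M (\<lambda>t \<omega>. Cproc crd t (\<lambda>y. X y \<omega>)) (\<lambda>\<omega>. Z (\<lambda>y. X y \<omega>))"
    using assms by (intro conv_in_prob_transfer Z measurable_Cproc) (simp add: is_C_inf_def)
  moreover have "Cproc X = (\<lambda>t \<omega>. Cproc crd t (\<lambda>y. X y \<omega>))"
    by (intro ext process_eqs)
  moreover have "AE \<omega> in M. (\<lambda>x. \<bar>exp (pos X \<omega> x) * mC (X x \<omega>)\<bar>) summable_on tree X \<omega> \<longrightarrow>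
        Z (\<lambda>y. X y \<omega>) = (\<Sum>\<^sub>\<infinity>x\<in>tree X \<omega>. exp (pos X \<omega> x) * mC (X x \<omega>))"
    unfolding pos_eq[of X] tree_eq[of X]
    using assms by (intro AE_transfer[of "\<lambda>\<kappa>. (\<lambda>x. \<bar>exp (pos crd \<kappa> x) * mC (\<kappa> x)\<bar>) summable_on tree crd \<kappa> \<longrightarrow>
        Z \<kappa> = (\<Sum>\<^sub>\<infinity>x\<in>tree crd \<kappa>. exp (pos crd \<kappa> x) * mC (\<kappa> x))"]) (simp add: is_C_inf_def)
  ultimately show ?thesis
    unfolding is_C_inf_def using measurable_compose[OF measurable_configuration Z] by simp
qed

lemma Wproc_transfer:
  assumes Z: "Z \<in> borel_measurable cfg_space"
    and lim: "conv_in_prob Q (\<lambda>t \<kappa>. c t * Wproc crd t \<kappa>) Z"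
  shows "conv_in_prob M (\<lambda>t \<omega>. c t * Wproc X t \<omega>) (\<lambda>\<omega>. Z (\<lambda>y. X y \<omega>))"
    and "((\<lambda>t. char_fun M (Wproc X t) (c t * \<xi>)) \<longlongrightarrow> (CLINT \<omega>|M. iexp (\<xi> * Z (\<lambda>y. X y \<omega>)))) at_top"
proof -
  interpret M: prob_space M by (rule M)
  have W: "Wproc X = (\<lambda>t \<omega>. Wproc crd t (\<lambda>y. X y \<omega>))" by (intro ext process_eqs)
  have Wm: "Wproc X t \<in> borel_measurable M" for t
    unfolding W by (rule measurable_compose[OF measurable_configuration measurable_Wproc])
  have cWm: "(\<lambda>\<kappa>. c t * Wproc crd t \<kappa>) \<in> borel_measurable cfg_space" for t by measurable
  show conv: "conv_in_prob M (\<lambda>t \<omega>. c t * Wproc X t \<omega>) (\<lambda>\<omega>. Z (\<lambda>y. X y \<omega>))"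
    unfolding W by (rule conv_in_prob_transfer[OF cWm Z lim])
  have "((\<lambda>t. CLINT \<omega>|M. iexp (\<xi> * (c t * Wproc X t \<omega>))) \<longlongrightarrow> (CLINT \<omega>|M. iexp (\<xi> * Z (\<lambda>y. X y \<omega>)))) at_top"
    using Wm by (intro M.conv_in_prob_imp_char[OF _ _ conv] measurable_compose[OF measurable_configuration Z]) auto
  then show "((\<lambda>t. char_fun M (Wproc X t) (c t * \<xi>)) \<longlongrightarrow> (CLINT \<omega>|M. iexp (\<xi> * Z (\<lambda>y. X y \<omega>)))) at_top"
    unfolding char_fun_def by (simp add: mult_ac)
qed

end

end

section \<open>The law of a mark\<close>

text \<open>Independence of two variables with different codomains passes to real functions of them.\<close>

lemma (in prob_space) nn_integral_indep_mult:
  assumes X: "X \<in> measurable M S" and Y: "Y \<in> measurable M T"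
    and ind: "\<And>a b. a \<in> sets (vimage_algebra (space M) X S) \<Longrightarrow> b \<in> sets (vimage_algebra (space M) Y T) \<Longrightarrow>
      prob (a \<inter> b) = prob a * prob b"
    and f: "f \<in> borel_measurable S" and g: "g \<in> borel_measurable T"
  shows "(\<integral>\<^sup>+\<omega>. f (X \<omega>) * g (Y \<omega>) \<partial>M) = (\<integral>\<^sup>+\<omega>. f (X \<omega>) \<partial>M) * (\<integral>\<^sup>+\<omega>. g (Y \<omega>) \<partial>M :: ennreal)"
proof -
  let ?F = "\<lambda>\<omega>. f (X \<omega>)" and ?G = "\<lambda>\<omega>. g (Y \<omega>)"
  have Fm: "?F \<in> borel_measurable M" and Gm: "?G \<in> borel_measurable M"
    using measurable_compose[OF X f] measurable_compose[OF Y g] by auto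
  have sub: "sigma_sets (space M) {(\<lambda>\<omega>. h (Z \<omega>)) -` A \<inter> space M |A. A \<in> sets borel}
      \<subseteq> sets (vimage_algebra (space M) Z U)"
    if Z: "Z \<in> measurable M U" and h: "h \<in> borel_measurable U"
    for Z :: "'a \<Rightarrow> 'z" and U and h :: "'z \<Rightarrow> ennreal"
  proof -
    have "(\<lambda>\<omega>. h (Z \<omega>)) -` A \<inter> space M \<in> sets (vimage_algebra (space M) Z U)" if "A \<in> sets borel" for A
    proof -
      have "(\<lambda>\<omega>. h (Z \<omega>)) -` A \<inter> space M = Z -` (h -` A \<inter> space U) \<inter> space M"
        using measurable_space[OF Z] by auto
      then show ?thesis using in_vimage_algebra[OF measurable_sets[OF h that]] by simp
    qed
    then show ?thesis
      using sets.sigma_sets_subset[of "{(\<lambda>\<omega>. h (Z \<omega>)) -` A \<inter> space M |A. A \<in> sets borel}"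
          "vimage_algebra (space M) Z U"] by (simp add: subset_iff) blast
  qed
  have ev: "sigma_sets (space M) {Z -` A \<inter> space M |A. A \<in> sets borel} \<subseteq> events"
    if "Z \<in> borel_measurable M" for Z :: "'a \<Rightarrow> ennreal"
    using measurable_sets[OF that] by (intro sets.sigma_sets_subset) blast
  have "indep_set (sigma_sets (space M) {?F -` A \<inter> space M |A. A \<in> sets borel})
      (sigma_sets (space M) {?G -` A \<inter> space M |A. A \<in> sets borel})"
    unfolding indep_sets2_eq
  proof (intro conjI ballI)
    fix a b
    assume "a \<in> sigma_sets (space M) {?F -` A \<inter> space M |A. A \<in> sets borel}"
      and "b \<in> sigma_sets (space M) {?G -` A \<inter> space M |A. A \<in> sets borel}"
    then show "prob (a \<inter> b) = prob a * prob b"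
      using ind[OF subsetD[OF sub[OF X f]] subsetD[OF sub[OF Y g]]] by simp
  qed (rule ev[OF Fm] ev[OF Gm])+
  then have "indep_var borel ?F borel ?G"
    unfolding indep_var_eq using Fm Gm by simp
  moreover have "case_bool borel borel = (\<lambda>_. borel :: ennreal measure)"
    by (rule ext) (simp split: bool.split)
  ultimately have "indep_vars (\<lambda>_. borel) (case_bool ?F ?G) UNIV"
    unfolding indep_var_def by simp
  then have "(\<integral>\<^sup>+\<omega>. (\<Prod>i\<in>UNIV. case_bool ?F ?G i \<omega>) \<partial>M) = (\<Prod>i\<in>UNIV. \<integral>\<^sup>+\<omega>. case_bool ?F ?G i \<omega> \<partial>M)"
    by (intro indep_vars_nn_integral) simp_all
  then show ?thesis by (simp add: UNIV_bool mult.commute)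
qed

lemma mark_law_distr:
  fixes P :: "'b measure" and E R C :: "'b \<Rightarrow> real" and N :: "'b \<Rightarrow> nat" and A :: "nat \<Rightarrow> 'b \<Rightarrow> real"
  defines "mk \<equiv> \<lambda>\<omega>. (E \<omega>, R \<omega>, N \<omega>, C \<omega>, \<lambda>k. A k \<omega>)"
  assumes P: "prob_space P"
    and indep: "indep3 P borel E borel R vec_space (\<lambda>\<omega>. (N \<omega>, C \<omega>, \<lambda>k. A k \<omega>))"
    and E_exp: "distributed P lborel E (exponential_density 1)"
    and A_pos: "\<And>k \<omega>. \<omega> \<in> space P \<Longrightarrow> 0 < A k \<omega>"
  shows "mk \<in> measurable P mark_space" and "mark_law (distr P mark_space mk)"
proof -
  interpret P: prob_space P by (rule P)
  let ?V = "\<lambda>\<omega>. (N \<omega>, C \<omega>, \<lambda>k. A k \<omega>)"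
  have Em: "E \<in> borel_measurable P" and Rm: "R \<in> borel_measurable P" and Vm: "?V \<in> measurable P vec_space"
    and ind: "P.indep_sets (\<lambda>i. [sets (vimage_algebra (space P) E borel),
             sets (vimage_algebra (space P) R borel),
             sets (vimage_algebra (space P) ?V vec_space)] ! i) {..<3}"
    using indep by (auto simp: indep3_def)
  show mk: "mk \<in> measurable P mark_space"
    unfolding mk_def by (intro measurable_Pair Em Rm Vm)
  have ind_V: "P.prob (a \<inter> b) = P.prob a * P.prob b"
    if "a \<in> sets (vimage_algebra (space P) E borel)" "b \<in> sets (vimage_algebra (space P) ?V vec_space)" for a b
    using P.indep_setsD[OF ind, of "{0, 2}" "\<lambda>i. if i = 0 then a else b"] that by (simp add: Int_commute)
  have ind_R: "P.prob (a \<inter> b) = P.prob a * P.prob b"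
    if "a \<in> sets (vimage_algebra (space P) E borel)" "b \<in> sets (vimage_algebra (space P) R borel)" for a b
    using P.indep_setsD[OF ind, of "{0, 1}" "\<lambda>i. if i = 0 then a else b"] that by (simp add: Int_commute)
  let ?L = "distr P mark_space mk"
  have push: "(\<integral>\<^sup>+m. h m \<partial>?L) = (\<integral>\<^sup>+\<omega>. h (E \<omega>, R \<omega>, N \<omega>, C \<omega>, \<lambda>k. A k \<omega>) \<partial>P)"
    if "h \<in> borel_measurable mark_space" for h :: "mark \<Rightarrow> ennreal"
    using nn_integral_distr[OF mk, of h] that by (simp add: mk_def)
  show "mark_law ?L"
  proof (rule mark_law.intro)
    show "prob_space ?L" by (rule P.prob_space_distr[OF mk])
    show "mark_law_axioms ?L"
    proof
      show "sets ?L = sets mark_space" by simp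
      show "AE m in ?L. \<forall>k. 0 < mA m k"
        by (subst AE_distr_iff[OF mk]) (auto intro!: AE_I2 A_pos simp: mk_def)
      have "distr ?L borel mE = distr P borel (mE \<circ> mk)"
        by (rule distr_distr[OF measurable_mark_projections(1) mk])
      also have "\<dots> = distr P lborel E" by (rule distr_cong) (auto simp: mk_def)
      also have "\<dots> = density lborel (exponential_density 1)"
        using distributed_distr_eq_density[OF E_exp] .
      finally show "distr ?L borel mE = density lborel (exponential_density 1)" .
    next
      fix f :: "real \<Rightarrow> ennreal" and g :: "offspring \<Rightarrow> ennreal"
      assume fm[measurable]: "f \<in> borel_measurable borel" and gm[measurable]: "g \<in> borel_measurable vec_space"
      have "(\<integral>\<^sup>+m. f (mE m) * g (vec_of m) \<partial>?L) = (\<integral>\<^sup>+\<omega>. f (E \<omega>) * g (?V \<omega>) \<partial>P)"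
        by (subst push[of "\<lambda>m. f (mE m) * g (vec_of m)"]) simp_all
      also have "\<dots> = (\<integral>\<^sup>+\<omega>. f (E \<omega>) \<partial>P) * (\<integral>\<^sup>+\<omega>. g (?V \<omega>) \<partial>P)"
        by (rule P.nn_integral_indep_mult[OF Em Vm ind_V fm gm])
      also have "(\<integral>\<^sup>+\<omega>. f (E \<omega>) \<partial>P) = (\<integral>\<^sup>+m. f (mE m) \<partial>?L)"
        by (subst push[of "\<lambda>m. f (mE m)"]) simp_all
      also have "(\<integral>\<^sup>+\<omega>. g (?V \<omega>) \<partial>P) = (\<integral>\<^sup>+m. g (vec_of m) \<partial>?L)"
        by (subst push[of "\<lambda>m. g (vec_of m)"]) simp_all
      finally show "(\<integral>\<^sup>+m. f (mE m) * g (vec_of m) \<partial>?L) = (\<integral>\<^sup>+m. f (mE m) \<partial>?L) * (\<integral>\<^sup>+m. g (vec_of m) \<partial>?L)" .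
    next
      fix f g :: "real \<Rightarrow> ennreal"
      assume fm[measurable]: "f \<in> borel_measurable borel" and gm[measurable]: "g \<in> borel_measurable borel"
      have "(\<integral>\<^sup>+m. f (mE m) * g (mR m) \<partial>?L) = (\<integral>\<^sup>+\<omega>. f (E \<omega>) * g (R \<omega>) \<partial>P)"
        by (subst push[of "\<lambda>m. f (mE m) * g (mR m)"]) simp_all
      also have "\<dots> = (\<integral>\<^sup>+\<omega>. f (E \<omega>) \<partial>P) * (\<integral>\<^sup>+\<omega>. g (R \<omega>) \<partial>P)"
        by (rule P.nn_integral_indep_mult[OF Em Rm ind_R fm gm])
      also have "(\<integral>\<^sup>+\<omega>. f (E \<omega>) \<partial>P) = (\<integral>\<^sup>+m. f (mE m) \<partial>?L)"
        by (subst push[of "\<lambda>m. f (mE m)"]) simp_all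
      also have "(\<integral>\<^sup>+\<omega>. g (R \<omega>) \<partial>P) = (\<integral>\<^sup>+m. g (mR m) \<partial>?L)"
        by (subst push[of "\<lambda>m. g (mR m)"]) simp_all
      finally show "(\<integral>\<^sup>+m. f (mE m) * g (mR m) \<partial>?L) = (\<integral>\<^sup>+m. f (mE m) \<partial>?L) * (\<integral>\<^sup>+m. g (mR m) \<partial>?L)" .
    qed
  qed
qed

section \<open>The exponents\<close>

lemma Phi_finite:
  assumes "weight_moment P N A s < \<infinity>"
  shows "weight_moment P N A s = ennreal (1 + real_of_ereal (Phi P N A s))"
    and "-1 \<le> real_of_ereal (Phi P N A s)"
    and "Phi P N A s = ereal (real_of_ereal (Phi P N A s))"
proof -
  obtain r where r: "weight_moment P N A s = ennreal r" "0 \<le> r"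
    using assms by (cases "weight_moment P N A s") auto
  then have "Phi P N A s = ereal (r - 1)" by (simp add: Phi_def one_ereal_def)
  then show "weight_moment P N A s = ennreal (1 + real_of_ereal (Phi P N A s))"
    "-1 \<le> real_of_ereal (Phi P N A s)" "Phi P N A s = ereal (real_of_ereal (Phi P N A s))"
    using r by auto
qed

lemma Phi_sign:
  assumes "weight_moment P N A s < \<infinity>"
  shows "Phi P N A s < 0 \<Longrightarrow> real_of_ereal (Phi P N A s) < 0"
    and "0 < Phi P N A s \<Longrightarrow> 0 < real_of_ereal (Phi P N A s)"
  using Phi_finite(3)[OF assms] by (cases "Phi P N A s"; simp)+

lemma weight_moment_finite_if_Phi_neg: "Phi P N A s < 0 \<Longrightarrow> weight_moment P N A s < \<infinity>"
  by (cases "weight_moment P N A s") (auto simp: Phi_def)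

text \<open>A negative derivative of \<open>\<mu>\<close> at \<open>1\<close> leaves room for an exponent \<open>p > 1\<close> whose additive functional
  grows more slowly than the \<open>p\<close>-th power of the leading one.\<close>

lemma exponent_above_one:
  assumes int: "1 \<in> interior (Dom P N A)" and neg: "mu_deriv_neg P N A 1" and q: "1 < q"
  shows "\<exists>p. 1 < p \<and> p \<le> 2 \<and> p \<le> q \<and> weight_moment P N A p < \<infinity> \<and>
    real_of_ereal (Phi P N A p) < p * real_of_ereal (Phi P N A 1)"
proof -
  obtain d where d: "d < 0" "(mu P N A has_real_derivative d) (at 1 within Dom P N A)"
    using neg by (auto simp: mu_deriv_neg_def)
  then have "(mu P N A has_real_derivative d) (at 1)" using at_within_interior[OF int] by simp
  from DERIV_neg_dec_right[OF this d(1)]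
  obtain r where r: "0 < r" "\<And>h. 0 < h \<Longrightarrow> h < r \<Longrightarrow> mu P N A (1 + h) < mu P N A 1" by blast
  obtain e where e: "0 < e" "ball 1 e \<subseteq> Dom P N A" using int by (auto simp: mem_interior)
  define h where "h = min (min r e) (min 1 (q - 1)) / 2"
  have h: "0 < h" "h < r" "h < e" "h \<le> 1" "h \<le> q - 1" using r e q by (auto simp: h_def)
  have "1 + h \<in> Dom P N A" using e(2) h by (auto simp: dist_real_def)
  moreover have "mu P N A (1 + h) < mu P N A 1" using r(2) h by blast
  ultimately show ?thesis
    using h by (intro exI[of _ "1 + h"]) (auto simp: Dom_def mu_def pos_divide_less_eq mult.commute)
qed

lemma powr_le_one_add_powr:
  fixes x :: real
  assumes "0 \<le> q" "q \<le> p"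
  shows "\<bar>x\<bar> powr q \<le> 1 + \<bar>x\<bar> powr p"
proof (cases "\<bar>x\<bar> \<le> 1")
  case True
  then have "\<bar>x\<bar> powr q \<le> 1" using assms by (intro powr_le1) auto
  then show ?thesis using powr_ge_zero[of "\<bar>x\<bar>" p] by linarith
next
  case False
  then have "\<bar>x\<bar> powr q \<le> \<bar>x\<bar> powr p" using assms by (intro powr_mono) auto
  then show ?thesis by simp
qed

lemma (in prob_space) powr_moments:
  assumes f[measurable]: "f \<in> borel_measurable M" and int: "integrable M (\<lambda>x. \<bar>f x\<bar> powr p)"
  shows "0 \<le> q \<Longrightarrow> q \<le> p \<Longrightarrow> (\<integral>\<^sup>+x. ennreal (\<bar>f x\<bar> powr q) \<partial>M) < \<infinity>"
    and "1 \<le> p \<Longrightarrow> integrable M f"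
proof -
  have bnd: "integrable M (\<lambda>x. \<bar>f x\<bar> powr q)" if "0 \<le> q" "q \<le> p" for q
  proof (rule Bochner_Integration.integrable_bound)
    show "integrable M (\<lambda>x. 1 + \<bar>f x\<bar> powr p)" using int by simp
    show "AE x in M. norm (\<bar>f x\<bar> powr q) \<le> norm (1 + \<bar>f x\<bar> powr p)"
      using powr_le_one_add_powr[OF that] by (intro AE_I2) simp
  qed measurable
  show "(\<integral>\<^sup>+x. ennreal (\<bar>f x\<bar> powr q) \<partial>M) < \<infinity>" if "0 \<le> q" "q \<le> p" for q
    using bnd[OF that] by (simp add: integrable_iff_bounded)
  show "integrable M f" if "1 \<le> p"
    using bnd[of 1] that by (simp add: integrable_abs_iff)
qed

text \<open>Convergence bounds \<open>f x\<close> for large \<open>x\<close>, and \<open>f x \<le> x\<close> for the others.\<close>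

lemma bounded_if_convergent_at_top:
  fixes f :: "real \<Rightarrow> real"
  assumes lim: "(f \<longlongrightarrow> c) at_top" and le: "\<And>x. 0 < x \<Longrightarrow> f x \<le> x"
  shows "\<exists>K\<ge>0. \<forall>x>0. f x \<le> K"
proof -
  have "\<forall>\<^sub>F x in at_top. f x < c + 1" using lim by (rule order_tendstoD(2)) simp
  then obtain x0 where x0: "\<And>x. x0 \<le> x \<Longrightarrow> f x < c + 1" by (auto simp: eventually_at_top_linorder)
  have "f x \<le> max 0 (max (c + 1) x0)" if "0 < x" for x
    using x0[of x] le[OF that] by (cases "x0 \<le> x") auto
  then show ?thesis by (intro exI[of _ "max 0 (max (c + 1) x0)"]) auto
qed

lemma (in prob_space) abs_integral_le:
  fixes f :: "'a \<Rightarrow> real"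
  assumes [measurable]: "f \<in> borel_measurable M" and le: "\<And>x. \<bar>f x\<bar> \<le> B"
  shows "\<bar>LINT x|M. f x\<bar> \<le> B"
proof -
  have int: "integrable M f" by (rule integrable_const_bound[where B = B]) (auto simp: le)
  have "\<bar>LINT x|M. f x\<bar> \<le> (LINT x|M. \<bar>f x\<bar>)" by (rule integral_abs_bound)
  also have "\<dots> \<le> (LINT x|M. B)" using int le by (intro integral_mono) auto
  finally show ?thesis by (simp add: prob_space)
qed

section \<open>Convergence of the solutions\<close>

theorem theorem2p9:
  fixes \<nu>0 :: "real measure"
    and P :: "'b measure"
    and E R C :: "'b \<Rightarrow> real" and N :: "'b \<Rightarrow> nat" and A :: "nat \<Rightarrow> 'b \<Rightarrow> real"
    and M :: "'a measure"
    and X :: "nat list \<Rightarrow> 'a \<Rightarrow> mark"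
  assumes "prob_space \<nu>0" and "sets \<nu>0 = sets borel"
    and "prob_space P"
    and indep: "indep3 P borel E borel R vec_space (\<lambda>\<omega>. (N \<omega>, C \<omega>, \<lambda>k. A k \<omega>))"
    and E_exp: "distributed P lborel E (exponential_density 1)"
    and R_law: "distr P borel R = \<nu>0"
    and A_pos: "\<And>k \<omega>. \<omega> \<in> space P \<Longrightarrow> 0 < A k \<omega>"
    and i: "\<forall>\<^sub>F \<epsilon> in at_right (0::real).
          (\<integral>\<^sup>+s\<in>{1 - \<epsilon>..1}. ennreal (1 / (s - (LINT \<omega>|P. s ^ N \<omega>))) \<partial>lborel) = \<infinity>"
    and ii: "\<And>m. \<P>(\<omega> in P. N \<omega> = m) > 0 \<Longrightarrow>
          \<P>(\<omega> in P. (\<forall>k<m. A k \<omega> > 0) \<bar> N \<omega> = m) = 1"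
    and iii: "\<exists>m. \<P>(\<omega> in P. N \<omega> = m) > 0 \<and>
          \<P>(\<omega> in P. (\<forall>k<m. A k \<omega> = 1) \<bar> N \<omega> = m) < 1"
    and iv: "1 < (\<integral>\<^sup>+\<omega>. of_nat (N \<omega>) \<partial>P)"
    and "prob_space M"
    and marks: "iid_marks M X (distr P mark_space (\<lambda>\<omega>. (E \<omega>, R \<omega>, N \<omega>, C \<omega>, \<lambda>k. A k \<omega>)))"
  shows
    "((LINT \<omega>|P. C \<omega>) \<noteq> 0 \<and> (\<exists>p>1. integrable P (\<lambda>\<omega>. \<bar>C \<omega>\<bar> powr p)) \<and>
      1 \<in> interior (Dom P N A) \<and> mu_deriv_neg P N A 1 \<and> Phi P N A 1 > 0 \<and>
      (LINT \<omega>|P. R \<omega>) = 0 \<and> (\<exists>\<delta>>0. integrable P (\<lambda>\<omega>. \<bar>R \<omega>\<bar> powr (1 + \<delta>)))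
      \<longrightarrow> (\<exists>Minf. is_M_inf M X (real_of_ereal (Phi P N A 1)) 1 Minf \<and>
            conv_in_prob M (\<lambda>t \<omega>. exp (- mu P N A 1 * t) * Wproc X t \<omega>)
              (\<lambda>\<omega>. (LINT \<omega>|P. C \<omega>) / real_of_ereal (Phi P N A 1) * Minf \<omega>) \<and>
            (\<forall>\<xi>. ((\<lambda>t. char_fun M (Wproc X t) (exp (- mu P N A 1 * t) * \<xi>)) \<longlongrightarrow>
               (CLINT \<omega>|M. iexp (\<xi> * (LINT \<omega>|P. C \<omega>) * Minf \<omega> / real_of_ereal (Phi P N A 1))))
               at_top)))
     \<and>
     ((LINT \<omega>|P. C \<omega>) \<noteq> 0 \<and> (\<exists>p>1. integrable P (\<lambda>\<omega>. \<bar>C \<omega>\<bar> powr p)) \<and>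
      1 \<in> interior (Dom P N A) \<and> mu_deriv_neg P N A 1 \<and> Phi P N A 1 = 0 \<and>
      ((\<exists>c0>0. ((\<lambda>x. x * measure \<nu>0 {x<..}) \<longlongrightarrow> c0) at_top \<and>
               ((\<lambda>x. \<bar>x\<bar> * measure \<nu>0 {..<x}) \<longlongrightarrow> c0) at_bot) \<and>
       (\<exists>m0. ((\<lambda>T. LINT x:{-T..T}|\<nu>0. x) \<longlongrightarrow> m0) at_top)
       \<or>
       (LINT \<omega>|P. R \<omega>) = 0 \<and> (\<exists>\<delta>>0. integrable P (\<lambda>\<omega>. \<bar>R \<omega>\<bar> powr (1 + \<delta>))))
      \<longrightarrow> (\<exists>Minf. is_M_inf M X (real_of_ereal (Phi P N A 1)) 1 Minf \<and>
            conv_in_prob M (\<lambda>t \<omega>. 1 / t * Wproc X t \<omega>)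
              (\<lambda>\<omega>. (LINT \<omega>|P. C \<omega>) * Minf \<omega>) \<and>
            (\<forall>\<xi>. ((\<lambda>t. char_fun M (Wproc X t) (1 / t * \<xi>)) \<longlongrightarrow>
               (CLINT \<omega>|M. iexp (\<xi> * (LINT \<omega>|P. C \<omega>) * Minf \<omega>))) at_top)))
     \<and>
     ((LINT \<omega>|P. C \<omega>) \<noteq> 0 \<and> (\<exists>p>1. integrable P (\<lambda>\<omega>. \<bar>C \<omega>\<bar> powr p)) \<and>
      1 \<in> interior (Dom P N A) \<and> mu_deriv_neg P N A 1 \<and> Phi P N A 1 < 0 \<and>
      (\<exists>\<gamma>. 0 < \<gamma> \<and> \<gamma> < 1 \<and> Phi P N A \<gamma> < 0 \<and> integrable P (\<lambda>\<omega>. \<bar>R \<omega>\<bar> powr \<gamma>))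
      \<longrightarrow> (\<exists>Cinf. is_C_inf M X Cinf \<and>
            conv_in_prob M (Wproc X) Cinf \<and>
            (\<forall>\<xi>. ((\<lambda>t. char_fun M (Wproc X t) \<xi>) \<longlongrightarrow> (CLINT \<omega>|M. iexp (\<xi> * Cinf \<omega>))) at_top)))
     \<and>
     ((LINT \<omega>|P. C \<omega>) = 0 \<and> mu_deriv_neg P N A 1 \<and>
      (\<exists>p. 1 < p \<and> p \<le> 2 \<and> integrable P (\<lambda>\<omega>. \<bar>C \<omega>\<bar> powr p) \<and> Phi P N A p < 0 \<and>
        (\<exists>\<gamma>. 0 < \<gamma> \<and> \<gamma> < p \<and> Phi P N A \<gamma> < 0 \<and> integrable P (\<lambda>\<omega>. \<bar>R \<omega>\<bar> powr \<gamma>) \<and>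
          (\<gamma> > 1 \<longrightarrow> (LINT \<omega>|P. R \<omega>) = 0)))
      \<longrightarrow> (\<exists>Cinf. is_C_inf M X Cinf \<and>
            conv_in_prob M (Wproc X) Cinf \<and>
            (\<forall>\<xi>. ((\<lambda>t. char_fun M (Wproc X t) \<xi>) \<longlongrightarrow> (CLINT \<omega>|M. iexp (\<xi> * Cinf \<omega>))) at_top)))"
proof -
  interpret P: prob_space P by fact
  let ?mk = "\<lambda>\<omega>. (E \<omega>, R \<omega>, N \<omega>, C \<omega>, \<lambda>k. A k \<omega>)"
  define L where "L = distr P mark_space ?mk"
  have mk [measurable]: "?mk \<in> measurable P mark_space"
    and law: "mark_law L"
    unfolding L_def using mark_law_distr[OF \<open>prob_space P\<close> indep E_exp A_pos] by auto
  interpret mark_law L by (rule law)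
  have X: "iid_marks M X L" using marks by (simp add: L_def)
  note M = \<open>prob_space M\<close>
  have wm: "wmom \<theta> = weight_moment P N A \<theta>" for \<theta>
  proof -
    have "(\<lambda>m. \<Sum>i<mN m. ennreal (mA m i powr \<theta>)) \<in> borel_measurable L"
      by (rule measurable_L) measurable
    then show ?thesis
      unfolding wmom_def weight_moment_def
      using nn_integral_distr[OF mk, of "\<lambda>m. \<Sum>i<mN m. ennreal (mA m i powr \<theta>)", folded L_def]
      by simp
  qed
  have int: "integrable L f \<longleftrightarrow> integrable P (\<lambda>\<omega>. f (?mk \<omega>))"
    and LINT: "(LINT m|L. f m) = (LINT \<omega>|P. f (?mk \<omega>))"
    if "f \<in> borel_measurable mark_space" for f :: "mark \<Rightarrow> real"
    unfolding L_def using that by (auto simp: integrable_distr_eq[OF mk] integral_distr[OF mk])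
  have LC: "(LINT m|L. mC m) = (LINT \<omega>|P. C \<omega>)" and LR: "(LINT m|L. mR m) = (LINT \<omega>|P. R \<omega>)"
    by (subst LINT; simp)+
  have Cpow: "integrable L (\<lambda>m. \<bar>mC m\<bar> powr p)" if "integrable P (\<lambda>\<omega>. \<bar>C \<omega>\<bar> powr p)" for p
    using that by (subst int) simp_all
  have Rpow: "integrable L (\<lambda>m. \<bar>mR m\<bar> powr p)" if "integrable P (\<lambda>\<omega>. \<bar>R \<omega>\<bar> powr p)" for p
    using that by (subst int) simp_all
  note C_moments = powr_moments[OF measurable_L[OF measurable_mark_projections(4)] Cpow]
  note R_moments = powr_moments[OF measurable_L[OF measurable_mark_projections(2)] Rpow]
  let ?\<Phi> = "\<lambda>s. real_of_ereal (Phi P N A s)"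
  note \<Phi> = Phi_finite[of P N A, folded wm]
  note sign = Phi_sign[of P N A, folded wm]
  note \<Phi>_neg = weight_moment_finite_if_Phi_neg[of P N A, folded wm]
  have Dom1: "wmom 1 < \<infinity>" if "mu_deriv_neg P N A 1"
    using that by (simp add: mu_deriv_neg_def Dom_def wm)
  have mu1: "mu P N A 1 = ?\<Phi> 1" by (simp add: mu_def)
  have sub: "\<exists>Cinf. is_C_inf M X Cinf \<and> conv_in_prob M (Wproc X) Cinf \<and>
      (\<forall>\<xi>. ((\<lambda>t. char_fun M (Wproc X t) \<xi>) \<longlongrightarrow> (CLINT \<omega>|M. iexp (\<xi> * Cinf \<omega>))) at_top)"
    if Z: "\<exists>Z. is_C_inf Q crd Z \<and> conv_in_prob Q (Wproc crd) Z"
  proof -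
    obtain Z where Z: "is_C_inf Q crd Z" "conv_in_prob Q (Wproc crd) Z" using Z by auto
    have Zm: "Z \<in> borel_measurable cfg_space"
      using Z measurable_cong_sets[OF sets_Q refl] by (auto simp: is_C_inf_def)
    have lim: "conv_in_prob Q (\<lambda>t \<kappa>. 1 * Wproc crd t \<kappa>) Z" using Z(2) by simp
    show ?thesis
      using is_C_inf_transfer[OF M X Z(1)] Wproc_transfer[OF M X Zm lim]
      by (intro exI[of _ "\<lambda>\<omega>. Z (\<lambda>y. X y \<omega>)"]) simp
  qed
  show ?thesis
  proof (intro conjI impI, goal_cases)
    case 1
    then obtain p0 \<delta> where h: "(1::real) < p0" "integrable P (\<lambda>\<omega>. \<bar>C \<omega>\<bar> powr p0)" "1 \<in> interior (Dom P N A)"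
      "mu_deriv_neg P N A 1" "Phi P N A 1 > 0" "(LINT \<omega>|P. R \<omega>) = 0" "(0::real) < \<delta>"
      "integrable P (\<lambda>\<omega>. \<bar>R \<omega>\<bar> powr (1 + \<delta>))" by - (elim conjE exE, rule that, assumption+)
    obtain p where p: "1 < p" "p \<le> 2" "p \<le> min p0 (1 + \<delta>)" "weight_moment P N A p < \<infinity>" "?\<Phi> p < p * ?\<Phi> 1"
      using exponent_above_one[OF h(3,4), of "min p0 (1 + \<delta>)"] h by auto
    have \<Phi>1: "0 < ?\<Phi> 1" by (rule sign(2)[OF Dom1[OF h(4)] h(5)])
    have fp: "wmom p < \<infinity>" using p(4) by (simp only: wm)
    have Cp: "(\<integral>\<^sup>+m. ennreal (\<bar>mC m\<bar> powr p) \<partial>L) < \<infinity>"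
      by (rule C_moments(1)[OF h(2)]) (use p in auto)
    have Rp: "(\<integral>\<^sup>+m. ennreal (\<bar>mR m\<bar> powr p) \<partial>L) < \<infinity>"
      by (rule R_moments(1)[OF h(8)]) (use p in auto)
    have intC: "integrable L mC" by (rule C_moments(2)[OF h(2)]) (use h(1) in simp)
    have intR: "integrable L mR" by (rule R_moments(2)[OF h(8)]) (use h(7) in simp)
    have meanR: "(LINT m|L. mR m) = 0" using LR h(6) by (rule trans)
    obtain Z where Z: "Z \<in> borel_measurable cfg_space" "is_M_inf Q crd (?\<Phi> 1) 1 Z"
      "conv_in_prob Q (\<lambda>t \<kappa>. exp (- ?\<Phi> 1 * t) * Wproc crd t \<kappa>) (\<lambda>\<kappa>. (LINT m|L. mC m) / ?\<Phi> 1 * Z \<kappa>)"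
      using supercritical_convergence[OF p(1,2) intC Cp intR meanR Rp \<Phi>(1)[OF Dom1[OF h(4)]] \<Phi>1
          \<Phi>(1,2)[OF fp] p(5)] by - (elim exE conjE, rule that)
    have cZ: "(\<lambda>\<kappa>. (LINT m|L. mC m) / ?\<Phi> 1 * Z \<kappa>) \<in> borel_measurable cfg_space" using Z(1) by measurable
    have eq: "\<xi> * ((LINT \<omega>|P. C \<omega>) / ?\<Phi> 1 * z) = \<xi> * (LINT \<omega>|P. C \<omega>) * z / ?\<Phi> 1" for \<xi> z by simp
    show ?case
    proof (intro exI conjI allI)
      show "is_M_inf M X (?\<Phi> 1) 1 (\<lambda>\<omega>. Z (\<lambda>y. X y \<omega>))" by (rule is_M_inf_transfer[OF M X Z(1,2)])
      show "conv_in_prob M (\<lambda>t \<omega>. exp (- mu P N A 1 * t) * Wproc X t \<omega>)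
          (\<lambda>\<omega>. (LINT \<omega>|P. C \<omega>) / ?\<Phi> 1 * Z (\<lambda>y. X y \<omega>))"
        using Wproc_transfer(1)[OF M X cZ Z(3)] by (simp only: mu1 LC)
      show "((\<lambda>t. char_fun M (Wproc X t) (exp (- mu P N A 1 * t) * \<xi>)) \<longlongrightarrow>
          (CLINT \<omega>|M. iexp (\<xi> * (LINT \<omega>|P. C \<omega>) * Z (\<lambda>y. X y \<omega>) / ?\<Phi> 1))) at_top" for \<xi>
        using Wproc_transfer(2)[OF M X cZ Z(3), of \<xi>] by (simp only: mu1 LC eq)
    qed
  next
    case 2
    then obtain p0 where h: "(1::real) < p0" "integrable P (\<lambda>\<omega>. \<bar>C \<omega>\<bar> powr p0)" "1 \<in> interior (Dom P N A)"
      "mu_deriv_neg P N A 1" "Phi P N A 1 = 0"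
      by - (elim conjE exE, rule that, assumption+)
    obtain p where p: "1 < p" "p \<le> 2" "p \<le> p0" "weight_moment P N A p < \<infinity>" "?\<Phi> p < p * ?\<Phi> 1"
      using exponent_above_one[OF h(3,4,1)] by auto
    have fp: "wmom p < \<infinity>" using p(4) by (simp only: wm)
    have \<Phi>p: "?\<Phi> p < 0" using p(5) h(5) by simp
    have Cp: "(\<integral>\<^sup>+m. ennreal (\<bar>mC m\<bar> powr p) \<partial>L) < \<infinity>"
      by (rule C_moments(1)[OF h(2)]) (use p in auto)
    have intC: "integrable L mC" by (rule C_moments(2)[OF h(2)]) (use h(1) in simp)
    have one: "wmom 1 = ennreal 1" using \<Phi>(1)[OF Dom1[OF h(4)]] h(5) by simp
    have \<nu>: "distr L borel mR = \<nu>0"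
    proof -
      have "distr L borel mR = distr P borel (mR \<circ> ?mk)"
        unfolding L_def by (rule distr_distr[OF measurable_mark_projections(2) mk])
      then show ?thesis using R_law by (simp add: comp_def)
    qed
    interpret \<nu>: prob_space \<nu>0 by fact
    have mRL: "mR \<in> borel_measurable L" by (rule measurable_L) measurable
    \<comment> \<open>Both alternatives for \<open>R\<close> yield tails of order \<open>1/y\<close> and bounded truncated means; for a centred
      \<open>R\<close> with a finite first moment, Markov's inequality suffices.\<close>
    have "\<exists>K\<ge>0. (\<forall>y>0. (\<integral>\<^sup>+m. of_bool (y < \<bar>mR m\<bar>) \<partial>L) \<le> ennreal (K / y)) \<and>
      (\<forall>y>0. \<bar>LINT m|L. mR m * of_bool (\<bar>mR m\<bar> \<le> y)\<bar> \<le> K)"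
    proof (cases "(LINT \<omega>|P. R \<omega>) = 0 \<and> (\<exists>\<delta>>0. integrable P (\<lambda>\<omega>. \<bar>R \<omega>\<bar> powr (1 + \<delta>)))")
      case True
      then obtain \<delta> where \<delta>: "(0::real) < \<delta>" "integrable P (\<lambda>\<omega>. \<bar>R \<omega>\<bar> powr (1 + \<delta>))" by auto
      have iR: "integrable L mR" using R_moments(2)[OF \<delta>(2)] \<delta>(1) by simp
      define K where "K = (LINT m|L. \<bar>mR m\<bar>)"
      have K: "0 \<le> K" by (simp add: K_def)
      have t: "(\<integral>\<^sup>+m. of_bool (y < \<bar>mR m\<bar>) \<partial>L) \<le> ennreal (K / y)" if y: "0 < y" for y
      proof -
        have "(\<integral>\<^sup>+m. of_bool (y < \<bar>mR m\<bar>) \<partial>L) \<le> (\<integral>\<^sup>+m. ennreal (\<bar>mR m\<bar> / y) \<partial>L)"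
        proof (rule nn_integral_mono)
          fix m
          show "of_bool (y < \<bar>mR m\<bar>) \<le> ennreal (\<bar>mR m\<bar> / y)"
          proof (cases "y < \<bar>mR m\<bar>")
            case True
            then have "1 \<le> \<bar>mR m\<bar> / y" using y by simp
            then show ?thesis using True ennreal_leI[of 1 "\<bar>mR m\<bar> / y"] by simp
          qed simp
        qed
        also have "\<dots> = ennreal (LINT m|L. \<bar>mR m\<bar> / y)"
          using iR y by (intro nn_integral_eq_integral) auto
        finally show ?thesis by (simp add: K_def)
      qed
      have m: "\<bar>LINT m|L. mR m * of_bool (\<bar>mR m\<bar> \<le> y)\<bar> \<le> K" for y
      proof -
        have "\<bar>LINT m|L. mR m * of_bool (\<bar>mR m\<bar> \<le> y)\<bar> \<le> (LINT m|L. \<bar>mR m * of_bool (\<bar>mR m\<bar> \<le> y)\<bar>)"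
          by (rule integral_abs_bound)
        also have "\<dots> \<le> K" unfolding K_def
        proof (rule integral_mono)
          have "(\<lambda>m. \<bar>mR m * of_bool (\<bar>mR m\<bar> \<le> y)\<bar>) \<in> borel_measurable mark_space" by measurable
          then show "integrable L (\<lambda>m. \<bar>mR m * of_bool (\<bar>mR m\<bar> \<le> y)\<bar>)"
            by (intro Bochner_Integration.integrable_bound[OF iR] measurable_L AE_I2) auto
        qed (use iR in auto)
        finally show ?thesis .
      qed
      show ?thesis by (intro exI[of _ K] conjI allI impI K t m)
    next
      case False
      with 2 obtain c0 m0 where b: "((\<lambda>x. x * measure \<nu>0 {x<..}) \<longlongrightarrow> c0) at_top"
        "((\<lambda>x. \<bar>x\<bar> * measure \<nu>0 {..<x}) \<longlongrightarrow> c0) at_bot"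
        "((\<lambda>T. LINT x:{-T..T}|\<nu>0. x) \<longlongrightarrow> m0) at_top" by blast
      have mean_eq: "(LINT x:{-T..T}|\<nu>0. x) = (LINT m|L. mR m * of_bool (\<bar>mR m\<bar> \<le> T))" for T
        unfolding \<nu>[symmetric] set_lebesgue_integral_def using mRL
        by (subst integral_distr) (auto intro!: Bochner_Integration.integral_cong split: split_indicator)
      have b3: "\<bar>LINT m|L. mR m * of_bool (\<bar>mR m\<bar> \<le> T)\<bar> \<le> T" if "0 < T" for T
      proof (rule abs_integral_le)
        show "(\<lambda>m. mR m * of_bool (\<bar>mR m\<bar> \<le> T)) \<in> borel_measurable L" by (rule measurable_L) measurable
        show "\<bar>mR m * of_bool (\<bar>mR m\<bar> \<le> T)\<bar> \<le> T" for m using that by (simp add: of_bool_def)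
      qed
      have "\<exists>K\<ge>0. \<forall>T>0. \<bar>LINT m|L. mR m * of_bool (\<bar>mR m\<bar> \<le> T)\<bar> \<le> K"
        by (rule bounded_if_convergent_at_top[OF tendsto_rabs[OF b(3), unfolded mean_eq]]) (rule b3)
      then obtain K3 where K3: "0 \<le> K3" "\<And>T. 0 < T \<Longrightarrow> \<bar>LINT m|L. mR m * of_bool (\<bar>mR m\<bar> \<le> T)\<bar> \<le> K3"
        by - (elim exE conjE, rule that, assumption, erule allE, erule mp, assumption)
      have b1: "x * measure \<nu>0 {x<..} \<le> x" if "0 < x" for x
        using that by (simp add: mult_left_le)
      have "\<exists>K\<ge>0. \<forall>T>0. T * measure \<nu>0 {T<..} \<le> K"
        by (rule bounded_if_convergent_at_top[OF b(1)]) (rule b1)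
      then obtain K1 where K1: "0 \<le> K1" "\<And>x. 0 < x \<Longrightarrow> x * measure \<nu>0 {x<..} \<le> K1"
        by - (elim exE conjE, rule that, assumption, erule allE, erule mp, assumption)
      have lim2: "((\<lambda>x. \<bar>- x\<bar> * measure \<nu>0 {..<- x}) \<longlongrightarrow> c0) at_top"
        using b(2) by (simp add: filterlim_at_bot_mirror)
      have b2: "\<bar>- x\<bar> * measure \<nu>0 {..<- x} \<le> x" if "0 < x" for x
        using that by (simp add: mult_left_le)
      have "\<exists>K\<ge>0. \<forall>T>0. \<bar>- T\<bar> * measure \<nu>0 {..<- T} \<le> K"
        by (rule bounded_if_convergent_at_top[OF lim2]) (rule b2)
      then obtain K2 where K2: "0 \<le> K2" "\<And>x. 0 < x \<Longrightarrow> \<bar>- x\<bar> * measure \<nu>0 {..<- x} \<le> K2"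
        by - (elim exE conjE, rule that, assumption, erule allE, erule mp, assumption)
      have t: "(\<integral>\<^sup>+m. of_bool (y < \<bar>mR m\<bar>) \<partial>L) \<le> ennreal ((K1 + K2 + K3) / y)" if y: "0 < y" for y
      proof -
        have s: "{y<..} \<in> sets \<nu>0" "{..<- y} \<in> sets \<nu>0" using \<open>sets \<nu>0 = sets borel\<close> by auto
        have "(\<integral>\<^sup>+m. of_bool (y < \<bar>mR m\<bar>) \<partial>L) = (\<integral>\<^sup>+m. indicator ({y<..} \<union> {..<- y}) (mR m) \<partial>L)"
          by (intro nn_integral_cong) (auto split: split_indicator)
        also have "\<dots> = (\<integral>\<^sup>+x. indicator ({y<..} \<union> {..<- y}) x \<partial>\<nu>0)"
          unfolding \<nu>[symmetric] using mRL by (subst nn_integral_distr) auto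
        also have "\<dots> = emeasure \<nu>0 ({y<..} \<union> {..<- y})" using s by (intro nn_integral_indicator) auto
        also have "\<dots> \<le> emeasure \<nu>0 {y<..} + emeasure \<nu>0 {..<- y}" by (rule emeasure_subadditive) (use s in auto)
        also have "\<dots> = ennreal (measure \<nu>0 {y<..} + measure \<nu>0 {..<- y})"
          by (simp add: \<nu>.emeasure_eq_measure)
        also have "\<dots> \<le> ennreal ((K1 + K2 + K3) / y)"
          using K1(2)[OF y] K2(2)[OF y] K3(1) y by (intro ennreal_leI) (simp add: pos_le_divide_eq algebra_simps)
        finally show ?thesis .
      qed
      have m: "\<bar>LINT m|L. mR m * of_bool (\<bar>mR m\<bar> \<le> y)\<bar> \<le> K1 + K2 + K3" if "0 < y" for y
        using K3(2)[OF that] K1(1) K2(1) by linarith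
      have "0 \<le> K1 + K2 + K3" using K1(1) K2(1) K3(1) by simp
      then show ?thesis by (intro exI[of _ "K1 + K2 + K3"] conjI allI impI t m)
    qed
    then obtain K where K: "0 \<le> K" "\<And>y. 0 < y \<Longrightarrow> (\<integral>\<^sup>+m. of_bool (y < \<bar>mR m\<bar>) \<partial>L) \<le> ennreal (K / y)"
      "\<And>y. 0 < y \<Longrightarrow> \<bar>LINT m|L. mR m * of_bool (\<bar>mR m\<bar> \<le> y)\<bar> \<le> K"
      by - (elim exE conjE, rule that, assumption, erule allE, erule mp, assumption, erule allE, erule mp, assumption)
    have "\<exists>Z. Z \<in> borel_measurable cfg_space \<and> is_M_inf Q crd 0 1 Z \<and>
        conv_in_prob Q (\<lambda>t \<kappa>. 1 / t * Wproc crd t \<kappa>) (\<lambda>\<kappa>. (LINT m|L. mC m) * Z \<kappa>)"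
      by (rule critical_convergence[OF p(1,2) intC Cp K(1) _ _ one \<Phi>(1,2)[OF fp] \<Phi>p]) (rule K(2) K(3), assumption)+
    then obtain Z where Z: "Z \<in> borel_measurable cfg_space" "is_M_inf Q crd 0 1 Z"
      "conv_in_prob Q (\<lambda>t \<kappa>. 1 / t * Wproc crd t \<kappa>) (\<lambda>\<kappa>. (LINT m|L. mC m) * Z \<kappa>)"
      by - (elim exE conjE, rule that)
    have cZ: "(\<lambda>\<kappa>. (LINT m|L. mC m) * Z \<kappa>) \<in> borel_measurable cfg_space" using Z(1) by measurable
    have \<Phi>0: "?\<Phi> 1 = 0" using h(5) by simp
    have eq: "\<xi> * ((LINT \<omega>|P. C \<omega>) * z) = \<xi> * (LINT \<omega>|P. C \<omega>) * z" for \<xi> z by simp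
    show ?case
    proof (intro exI conjI allI)
      show "is_M_inf M X (?\<Phi> 1) 1 (\<lambda>\<omega>. Z (\<lambda>y. X y \<omega>))"
        unfolding \<Phi>0 by (rule is_M_inf_transfer[OF M X Z(1,2)])
      show "conv_in_prob M (\<lambda>t \<omega>. 1 / t * Wproc X t \<omega>) (\<lambda>\<omega>. (LINT \<omega>|P. C \<omega>) * Z (\<lambda>y. X y \<omega>))"
        using Wproc_transfer(1)[OF M X cZ Z(3)] by (simp only: LC)
      show "((\<lambda>t. char_fun M (Wproc X t) (1 / t * \<xi>)) \<longlongrightarrow>
          (CLINT \<omega>|M. iexp (\<xi> * (LINT \<omega>|P. C \<omega>) * Z (\<lambda>y. X y \<omega>)))) at_top" for \<xi>
        using Wproc_transfer(2)[OF M X cZ Z(3), of \<xi>] by (simp only: LC eq)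
    qed
  next
    case 3
    then obtain p0 \<gamma> where h: "(1::real) < p0" "integrable P (\<lambda>\<omega>. \<bar>C \<omega>\<bar> powr p0)"
      "mu_deriv_neg P N A 1" "Phi P N A 1 < 0" "0 < \<gamma>" "\<gamma> < 1" "Phi P N A \<gamma> < 0"
      "integrable P (\<lambda>\<omega>. \<bar>R \<omega>\<bar> powr \<gamma>)"
      by - (elim conjE exE, rule that, assumption+)
    note f1 = Dom1[OF h(3)] and f\<gamma> = \<Phi>_neg[OF h(7)]
    have neg: "?\<Phi> 1 < 0" "?\<Phi> \<gamma> < 0"
      using sign(1)[OF f1 h(4)] sign(1)[OF f\<gamma> h(7)] by simp_all
    have Cp: "(\<integral>\<^sup>+m. ennreal (\<bar>mC m\<bar> powr 1) \<partial>L) < \<infinity>"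
      by (rule C_moments(1)[OF h(2)]) (use h(1) in auto)
    have Rp: "(\<integral>\<^sup>+m. ennreal (\<bar>mR m\<bar> powr \<gamma>) \<partial>L) < \<infinity>"
      by (rule R_moments(1)[OF h(8)]) (use h(5) in auto)
    have intC: "integrable L mC" by (rule C_moments(2)[OF h(2)]) (use h(1) in simp)
    have \<gamma>: "\<gamma> \<le> 2" "\<gamma> \<le> 1 \<or> integrable L mR \<and> (LINT m|L. mR m) = 0" using h(6) by auto
    \<comment> \<open>Since \<open>\<Phi>(1) < 0\<close>, the exponent \<open>p = 1\<close> serves for \<open>C\<close>, whose mean need not vanish.\<close>
    have p1: "(1::real) \<le> 1" "(1::real) \<le> 2" "(1::real) \<le> 1 \<or> (LINT m|L. mC m) = 0" by auto
    show ?case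
      by (rule sub, rule subcritical_convergence[OF p1(1,2) intC p1(3) Cp \<Phi>(1,2)[OF f1] \<Phi>(1,2)[OF f1] neg(1)
          h(5) \<gamma> Rp \<Phi>(1,2)[OF f\<gamma>] neg(2)])
  next
    case 4
    then obtain p \<gamma> where h: "(LINT \<omega>|P. C \<omega>) = 0" "mu_deriv_neg P N A 1" "1 < p" "p \<le> 2"
      "integrable P (\<lambda>\<omega>. \<bar>C \<omega>\<bar> powr p)" "Phi P N A p < 0" "0 < \<gamma>" "\<gamma> < p" "Phi P N A \<gamma> < 0"
      "integrable P (\<lambda>\<omega>. \<bar>R \<omega>\<bar> powr \<gamma>)" "\<gamma> > 1 \<longrightarrow> (LINT \<omega>|P. R \<omega>) = 0"
      by - (elim conjE exE, rule that, assumption+)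
    note f1 = Dom1[OF h(2)] and fp = \<Phi>_neg[OF h(6)] and f\<gamma> = \<Phi>_neg[OF h(9)]
    have neg: "?\<Phi> p < 0" "?\<Phi> \<gamma> < 0"
      using sign(1)[OF fp h(6)] sign(1)[OF f\<gamma> h(9)] by simp_all
    have Cp: "(\<integral>\<^sup>+m. ennreal (\<bar>mC m\<bar> powr p) \<partial>L) < \<infinity>"
      by (rule C_moments(1)[OF h(5)]) (use h(3) in auto)
    have Rp: "(\<integral>\<^sup>+m. ennreal (\<bar>mR m\<bar> powr \<gamma>) \<partial>L) < \<infinity>"
      by (rule R_moments(1)[OF h(10)]) (use h(7) in auto)
    have intC: "integrable L mC" by (rule C_moments(2)[OF h(5)]) (use h(3) in simp)
    have p1: "1 \<le> p" "p \<le> 1 \<or> (LINT m|L. mC m) = 0" and \<gamma>2: "\<gamma> \<le> 2" using h(1,3,4,8) LC by auto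
    have cR: "\<gamma> \<le> 1 \<or> integrable L mR \<and> (LINT m|L. mR m) = 0"
      using R_moments(2)[OF h(10)] h(11) LR by (cases "\<gamma> \<le> 1") auto
    show ?case
      by (rule sub, rule subcritical_convergence[OF p1(1) h(4) intC p1(2) Cp \<Phi>(1,2)[OF f1] \<Phi>(1,2)[OF fp] neg(1)
          h(7) \<gamma>2 cR Rp \<Phi>(1,2)[OF f\<gamma>] neg(2)])
  qed
qed

end
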